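(* Let $f$ be the restriction to a compact invariant set $X$ of a $C^1$ random map of an $m$-dimensional Riemannian manifold satisfying $\int(\log^+\|Df_\omega\|_\infty+\log^+\|(Df_\omega)^{-1}\|_\infty)\,d\mathbb P<\infty$. If $\mu_0\in\mathcal I(f)$ is coquasi-irreducible, then the map $\mu\in\mathcal I(f)\mapsto\lambda_m(\mu)$ is continuous at $\mu_0$ with respect to the weak$^*$ topology. In particular, if $f$ is coquasi-irreducible, then $\mu\in\mathcal I(f)\mapsto\lambda_m(\mu)$ is continuous.
   Context: Setting. $M$ is a Riemannian manifold of dimension $m$. $(T,\mathscr A,p)$ is a probability space and $(\Omega,\mathscr F,\mathbb P)=(T^{\mathbb N},\mathscr A^{\mathbb N},p^{\mathbb N})$. A $C^1$ random map is a measurable map $f:\Omega\times M\to M$ such that $f_\omega:=f(\omega,\cdot)=f_{\omega_0}$ depends only on the coordinate $\omega_0$ of $\omega$ and is a $C^1$ local diffeomorphism for $\mathbb P$-a.e. $\omega$. Put $f^0_\omega=\mathrm{id}$, $f^n_\omega=f_{\omega_{n-1}}\circ\dots\circ f_{\omega_0}$. $X\subset M$ is compact with $f_\omega(X)\subset X$ for $\mathbb P$-a.e. $\omega$; $f$ also denotes the restriction to $\Omega\times X$. $\|Df_\omega\|_\infty=\sup_{x\in X}\|Df_\omega(x)\|$, $\|(Df_\omega)^{-1}\|_\infty=\sup_{x\in X}\|Df_\omega(x)^{-1}\|$. $\mathcal I(f)$ is the set of $f$-stationary Borel probability measures on $X$ ($\mu=\int (f_\omega)_*\mu\,d\mathbb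 P$). $\lambda_m(\mu)=\lim_n\frac1n\int\log\mathfrak m(Df^n_\omega(x))\,d\mathbb P\,d\mu$ with $\mathfrak m(B)=\|B^{-1}\|^{-1}$. Cotangent dynamics: $(Df_\omega(x)^{-1})^*\xi=\xi\circ Df_\omega(x)^{-1}$; $\tilde X=P(T_X^*M)$ is the projectivized cotangent bundle over $X$; $\tilde f_\omega(x,[\xi])=(f_\omega(x),[(Df_\omega(x)^{-1})^*\xi])$; $\mathcal I_\mu(\tilde f)$ is the set of $\tilde f$-stationary probability measures on $\tilde X$ projecting to $\mu$; $\tilde\phi_f(x,[\xi])=\int\log\|(Df_\omega(x)^{-1})^*\xi\|\,d\mathbb P$ ($\xi$ unit). $\mu$ is coquasi-irreducible if $\int\tilde\phi_f\,d\tilde\mu=-\lambda_m(\mu)$ for every $\tilde\mu\in\mathcal I_\mu(\tilde f)$; $f$ is coquasi-irreducible if every $\mu\in\mathcal I(f)$ is. *)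

theory Defs
  imports "HOL-Probability.Probability"
begin

section \<open>Smooth manifolds\<close>

text \<open>Functions of class \<open>C\<^sup>k\<close> on an open subset of a Euclidean space.\<close>

primrec Ck_on :: "nat \<Rightarrow> 'e::euclidean_space set \<Rightarrow> ('e \<Rightarrow> 'b::real_normed_vector) \<Rightarrow> bool" where
  "Ck_on 0 S f \<longleftrightarrow> continuous_on S f"
| "Ck_on (Suc k) S f \<longleftrightarrow>
     (\<forall>u\<in>S. f differentiable (at u)) \<and> (\<forall>e. Ck_on k S (\<lambda>u. frechet_derivative f (at u) e))"

text \<open>
  A chart is a pair of a domain and a coordinate map; only the values of the coordinate map on
  the domain matter.
\<close>

type_synonym ('a, 'e) chart = "'a set \<times> ('a \<Rightarrow> 'e)"

definition chart_inv :: "('a, 'e) chart \<Rightarrow> 'e \<Rightarrow> 'a" where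
  "chart_inv c = inv_into (fst c) (snd c)"

definition is_chart :: "('a::topological_space, 'e::euclidean_space) chart \<Rightarrow> bool" where
  "is_chart c \<longleftrightarrow> open (fst c) \<and> open (snd c ` fst c) \<and>
     homeomorphism (fst c) (snd c ` fst c) (snd c) (chart_inv c)"

definition smooth_atlas :: "('a::topological_space, 'e::euclidean_space) chart set \<Rightarrow> bool" where
  "smooth_atlas A \<longleftrightarrow> (\<forall>c\<in>A. is_chart c) \<and> (\<Union>c\<in>A. fst c) = UNIV \<and>
     (\<forall>c\<in>A. \<forall>c'\<in>A. \<forall>k. Ck_on k (snd c ` (fst c \<inter> fst c')) (snd c' \<circ> chart_inv c))"

text \<open>
  A tangent vector at \<open>x\<close> is the family of its coordinate vectors in all the charts around \<open>x\<close>
  (and \<open>0\<close> in the other charts), which transform by the derivatives of the transition maps.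
  The vector space operations are the pointwise ones.
\<close>

type_synonym ('a, 'e) tvec = "('a, 'e) chart \<Rightarrow> 'e"

text \<open>The underlying set of the manifold is the whole type \<open>'a\<close>; its dimension is \<open>DIM('e)\<close>.\<close>

record ('a, 'e) riemannian =
  atlas :: "('a, 'e) chart set"
  metric :: "'a \<Rightarrow> ('a, 'e) tvec \<Rightarrow> ('a, 'e) tvec \<Rightarrow> real"

definition charts_at :: "('a, 'e) riemannian \<Rightarrow> 'a \<Rightarrow> ('a, 'e) chart set" where
  "charts_at M x = {c \<in> atlas M. x \<in> fst c}"

definition tangent_space :: "('a, 'e::euclidean_space) riemannian \<Rightarrow> 'a \<Rightarrow> ('a, 'e) tvec set" where
  "tangent_space M x = {v.
     (\<forall>c. c \<notin> charts_at M x \<longrightarrow> v c = 0) \<and>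
     (\<forall>c\<in>charts_at M x. \<forall>c'\<in>charts_at M x.
        v c' = frechet_derivative (snd c' \<circ> chart_inv c) (at (snd c x)) (v c))}"

text \<open>The tangent vector at \<open>x\<close> whose coordinate vector in the chart \<open>c\<close> around \<open>x\<close> is \<open>e\<close>.\<close>

definition coord_vector ::
  "('a, 'e::euclidean_space) riemannian \<Rightarrow> ('a, 'e) chart \<Rightarrow> 'a \<Rightarrow> 'e \<Rightarrow> ('a, 'e) tvec" where
  "coord_vector M c x e = (\<lambda>c'. if c' \<in> charts_at M x
     then frechet_derivative (snd c' \<circ> chart_inv c) (at (snd c x)) e else 0)"

definition riemannian_manifold ::
  "('a::{t2_space, second_countable_topology}, 'e::euclidean_space) riemannian \<Rightarrow> bool" where
  "riemannian_manifold M \<longleftrightarrow> smooth_atlas (atlas M) \<and>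
     (\<forall>x. \<forall>v\<in>tangent_space M x. \<forall>w\<in>tangent_space M x.
        metric M x v w = metric M x w v \<and>
        (\<forall>u\<in>tangent_space M x. \<forall>a b. metric M x (\<lambda>c. a *\<^sub>R v c + b *\<^sub>R w c) u =
           a * metric M x v u + b * metric M x w u)) \<and>
     (\<forall>x. \<forall>v\<in>tangent_space M x. v \<noteq> (\<lambda>_. 0) \<longrightarrow> metric M x v v > 0) \<and>
     (\<forall>c\<in>atlas M. \<forall>e e' k. Ck_on k (snd c ` fst c)
        (\<lambda>u. metric M (chart_inv c u) (coord_vector M c (chart_inv c u) e)
               (coord_vector M c (chart_inv c u) e')))"

definition tnorm :: "('a, 'e) riemannian \<Rightarrow> 'a \<Rightarrow> ('a, 'e) tvec \<Rightarrow> real" where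
  "tnorm M x v = sqrt (metric M x v v)"

text \<open>Operator norm of a linear map from the tangent space at \<open>x\<close> to the tangent space at \<open>y\<close>.\<close>

definition op_norm :: "('a, 'e::euclidean_space) riemannian \<Rightarrow> 'a \<Rightarrow> 'a \<Rightarrow>
    (('a, 'e) tvec \<Rightarrow> ('a, 'e) tvec) \<Rightarrow> real" where
  "op_norm M x y L = Sup {tnorm M y (L v) | v. v \<in> tangent_space M x \<and> tnorm M x v = 1}"

section \<open>Differentiable maps\<close>

definition C1_map_on ::
  "('a::topological_space, 'e::euclidean_space) riemannian \<Rightarrow> 'a set \<Rightarrow> ('a \<Rightarrow> 'a) \<Rightarrow> bool" where
  "C1_map_on M U h \<longleftrightarrow> continuous_on U h \<and>
     (\<forall>c\<in>atlas M. \<forall>c'\<in>atlas M.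
        Ck_on 1 (snd c ` (fst c \<inter> U \<inter> h -` fst c')) (snd c' \<circ> h \<circ> chart_inv c))"

definition C1_local_diffeo ::
  "('a::topological_space, 'e::euclidean_space) riemannian \<Rightarrow> ('a \<Rightarrow> 'a) \<Rightarrow> bool" where
  "C1_local_diffeo M h \<longleftrightarrow> (\<forall>x. \<exists>U. open U \<and> x \<in> U \<and> open (h ` U) \<and> inj_on h U \<and>
     C1_map_on M U h \<and> C1_map_on M (h ` U) (inv_into U h))"

text \<open>
  The derivative \<open>Dh(x)\<close>, computed in some chart around \<open>x\<close>; it does not depend on that chart.
\<close>

definition D_map :: "('a, 'e::euclidean_space) riemannian \<Rightarrow> ('a \<Rightarrow> 'a) \<Rightarrow> 'a \<Rightarrow>
    ('a, 'e) tvec \<Rightarrow> ('a, 'e) tvec" where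
  "D_map M h x v = (let c = (SOME c. c \<in> charts_at M x) in
     (\<lambda>c'. if c' \<in> charts_at M (h x)
        then frechet_derivative (snd c' \<circ> h \<circ> chart_inv c) (at (snd c x)) (v c) else 0))"

definition D_inv :: "('a, 'e::euclidean_space) riemannian \<Rightarrow> ('a \<Rightarrow> 'a) \<Rightarrow> 'a \<Rightarrow>
    ('a, 'e) tvec \<Rightarrow> ('a, 'e) tvec" where
  "D_inv M h x = inv_into (tangent_space M x) (D_map M h x)"

definition D_sup :: "('a, 'e::euclidean_space) riemannian \<Rightarrow> 'a set \<Rightarrow> ('a \<Rightarrow> 'a) \<Rightarrow> real" where
  "D_sup M X h = (SUP x\<in>X. op_norm M x (h x) (D_map M h x))"

definition D_inv_sup :: "('a, 'e::euclidean_space) riemannian \<Rightarrow> 'a set \<Rightarrow> ('a \<Rightarrow> 'a) \<Rightarrow> real" where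
  "D_inv_sup M X h = (SUP x\<in>X. op_norm M (h x) x (D_inv M h x))"

definition D_conorm :: "('a, 'e::euclidean_space) riemannian \<Rightarrow> ('a \<Rightarrow> 'a) \<Rightarrow> 'a \<Rightarrow> real" where
  "D_conorm M h x = inverse (op_norm M (h x) x (D_inv M h x))"

definition log_plus :: "real \<Rightarrow> real" where
  "log_plus t = max 0 (ln t)"

section \<open>Random maps and stationary measures\<close>

definition seq_space :: "'t measure \<Rightarrow> (nat \<Rightarrow> 't) measure" where
  "seq_space p = (\<Pi>\<^sub>M i\<in>UNIV. p)"

definition C1_random_map ::
  "('a::{t2_space, second_countable_topology}, 'e::euclidean_space) riemannian \<Rightarrow> 't measure \<Rightarrow>
    ((nat \<Rightarrow> 't) \<Rightarrow> 'a \<Rightarrow> 'a) \<Rightarrow> bool" where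
  "C1_random_map M p f \<longleftrightarrow>
     (\<lambda>(\<omega>, x). f \<omega> x) \<in> measurable (seq_space p \<Otimes>\<^sub>M borel) borel \<and>
     (\<forall>\<omega>\<in>space (seq_space p). \<forall>\<omega>'\<in>space (seq_space p). \<omega> 0 = \<omega>' 0 \<longrightarrow> f \<omega> = f \<omega>') \<and>
     (AE \<omega> in seq_space p. C1_local_diffeo M (f \<omega>))"

text \<open>
  Since \<open>f \<omega>\<close> depends only on \<open>\<omega> 0\<close>, the map written \<open>f\<close> with index \<open>\<omega>\<^sub>n\<close> is \<open>f\<close> at the sequence
  \<open>\<omega>\<close> shifted \<open>n\<close> times.
\<close>

primrec random_iterate :: "((nat \<Rightarrow> 't) \<Rightarrow> 'a \<Rightarrow> 'a) \<Rightarrow> nat \<Rightarrow> (nat \<Rightarrow> 't) \<Rightarrow> 'a \<Rightarrow> 'a" where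
  "random_iterate f 0 \<omega> = id"
| "random_iterate f (Suc n) \<omega> = f (\<lambda>i. \<omega> (i + n)) \<circ> random_iterate f n \<omega>"

definition stationary_measures ::
  "'t measure \<Rightarrow> ((nat \<Rightarrow> 't) \<Rightarrow> 'y \<Rightarrow> 'y) \<Rightarrow> 'y measure \<Rightarrow> 'y measure set" where
  "stationary_measures p F Y = {\<mu>. prob_space \<mu> \<and> sets \<mu> = sets Y \<and>
     (\<forall>B\<in>sets Y. emeasure \<mu> B =
        (\<integral>\<^sup>+ \<omega>. emeasure \<mu> (F \<omega> -` B \<inter> space Y) \<partial>seq_space p))}"

definition stationary_on ::
  "'t measure \<Rightarrow> ((nat \<Rightarrow> 't) \<Rightarrow> 'a::topological_space \<Rightarrow> 'a) \<Rightarrow> 'a set \<Rightarrow> 'a measure set" where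
  "stationary_on p f X = stationary_measures p f (restrict_space borel X)"

text \<open>
  Quantities involving the derivative of \<open>f \<omega>\<close> are meaningful only for almost every \<open>\<omega>\<close>.  Bochner
  integrals of them with respect to \<open>\<omega>\<close> are therefore taken for the completed measure: it
  agrees with the original one on measurable functions, and its integral is insensitive to the
  arbitrary, possibly non-measurable, values taken on a null set.
\<close>

definition lyap_min :: "('a::topological_space, 'e::euclidean_space) riemannian \<Rightarrow> 't measure \<Rightarrow>
    ((nat \<Rightarrow> 't) \<Rightarrow> 'a \<Rightarrow> 'a) \<Rightarrow> 'a measure \<Rightarrow> real" where
  "lyap_min M p f \<mu> = lim (\<lambda>n. 1 / real n *
     (\<integral>x. (\<integral>\<omega>. ln (D_conorm M (random_iterate f n \<omega>) x) \<partial>completion (seq_space p)) \<partial>\<mu>))"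

section \<open>Projectivized cotangent dynamics\<close>

text \<open>
  Covectors at \<open>x\<close> are linear functionals on the tangent space, extended by \<open>0\<close> outside of it.
\<close>

type_synonym ('a, 'e) covec = "('a, 'e) tvec \<Rightarrow> real"

definition cotangent_space :: "('a, 'e::euclidean_space) riemannian \<Rightarrow> 'a \<Rightarrow> ('a, 'e) covec set" where
  "cotangent_space M x = {\<xi>. (\<forall>v. v \<notin> tangent_space M x \<longrightarrow> \<xi> v = 0) \<and>
     (\<forall>v\<in>tangent_space M x. \<forall>w\<in>tangent_space M x. \<forall>a b.
        \<xi> (\<lambda>c. a *\<^sub>R v c + b *\<^sub>R w c) = a * \<xi> v + b * \<xi> w)}"

definition covec_norm :: "('a, 'e::euclidean_space) riemannian \<Rightarrow> 'a \<Rightarrow> ('a, 'e) covec \<Rightarrow> real" where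
  "covec_norm M x \<xi> = Sup {\<bar>\<xi> v\<bar> | v. v \<in> tangent_space M x \<and> tnorm M x v = 1}"

text \<open>\<open>(Dh(x)\<^sup>-\<^sup>1)\<^sup>* \<xi> = \<xi> \<circ> Dh(x)\<^sup>-\<^sup>1\<close>, a covector at \<open>h x\<close>.\<close>

definition D_costar :: "('a, 'e::euclidean_space) riemannian \<Rightarrow> ('a \<Rightarrow> 'a) \<Rightarrow> 'a \<Rightarrow>
    ('a, 'e) covec \<Rightarrow> ('a, 'e) covec" where
  "D_costar M h x \<xi> = (\<lambda>v. if v \<in> tangent_space M (h x) then \<xi> (D_inv M h x v) else 0)"

definition proj_class :: "('a, 'e) covec \<Rightarrow> ('a, 'e) covec set" where
  "proj_class \<xi> = {(\<lambda>v. a * \<xi> v) | a. a \<noteq> 0}"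

definition proj_cotangent :: "('a, 'e::euclidean_space) riemannian \<Rightarrow> 'a set \<Rightarrow>
    ('a \<times> ('a, 'e) covec set) set" where
  "proj_cotangent M X =
     {(x, proj_class \<xi>) | x \<xi>. x \<in> X \<and> \<xi> \<in> cotangent_space M x \<and> \<xi> \<noteq> (\<lambda>_. 0)}"

definition coord_covector ::
  "('a, 'e::euclidean_space) riemannian \<Rightarrow> ('a, 'e) chart \<Rightarrow> 'a \<Rightarrow> 'e \<Rightarrow> ('a, 'e) covec" where
  "coord_covector M c x e = (\<lambda>v. if v \<in> tangent_space M x then e \<bullet> v c else 0)"

text \<open>
  The topology of the projectivized cotangent bundle: the quotient, by \<open>\<xi> \<mapsto> [\<xi>]\<close>, of the nonzero
  part of the cotangent bundle, whose topology is given by the coordinates \<open>(u, e)\<close> of the point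
  and of the covector in the charts.
\<close>

definition proj_cotangent_open ::
  "('a, 'e::euclidean_space) riemannian \<Rightarrow> ('a \<times> ('a, 'e) covec set) set \<Rightarrow> bool" where
  "proj_cotangent_open M W \<longleftrightarrow> W \<subseteq> proj_cotangent M UNIV \<and>
     (\<forall>c\<in>atlas M. open {(u, e). u \<in> snd c ` fst c \<and> e \<noteq> 0 \<and>
        (chart_inv c u, proj_class (coord_covector M c (chart_inv c u) e)) \<in> W})"

definition proj_cotangent_topology :: "('a, 'e::euclidean_space) riemannian \<Rightarrow>
    ('a \<times> ('a, 'e) covec set) topology" where
  "proj_cotangent_topology M = topology (proj_cotangent_open M)"

lemma istopology_proj_cotangent_open: "istopology (proj_cotangent_open M)"
  unfolding istopology_def
proof (intro conjI allI impI)
  fix S T assume S: "proj_cotangent_open M S" and T: "proj_cotangent_open M T"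
  show "proj_cotangent_open M (S \<inter> T)"
    unfolding proj_cotangent_open_def
  proof (intro conjI ballI)
    show "S \<inter> T \<subseteq> proj_cotangent M UNIV"
      using S by (auto simp: proj_cotangent_open_def)
    fix c assume c: "c \<in> atlas M"
    let ?P = "\<lambda>W. {(u, e). u \<in> snd c ` fst c \<and> e \<noteq> 0 \<and>
        (chart_inv c u, proj_class (coord_covector M c (chart_inv c u) e)) \<in> W}"
    have "?P (S \<inter> T) = ?P S \<inter> ?P T" by auto
    moreover have "open (?P S)" "open (?P T)"
      using S T c unfolding proj_cotangent_open_def by blast+
    ultimately show "open (?P (S \<inter> T))" by (simp only: open_Int)
  qed
next
  fix \<K> assume K: "\<forall>K\<in>\<K>. proj_cotangent_open M K"
  show "proj_cotangent_open M (\<Union>\<K>)"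
    unfolding proj_cotangent_open_def
  proof (intro conjI ballI)
    show "\<Union>\<K> \<subseteq> proj_cotangent M UNIV"
      using K unfolding proj_cotangent_open_def by blast
    fix c assume c: "c \<in> atlas M"
    let ?P = "\<lambda>W. {(u, e). u \<in> snd c ` fst c \<and> e \<noteq> 0 \<and>
        (chart_inv c u, proj_class (coord_covector M c (chart_inv c u) e)) \<in> W}"
    have "?P (\<Union>\<K>) = (\<Union>K\<in>\<K>. ?P K)" by auto
    moreover have "\<forall>K\<in>\<K>. open (?P K)"
      using K c unfolding proj_cotangent_open_def by blast
    ultimately show "open (?P (\<Union>\<K>))" by (simp only: open_UN)
  qed
qed

lemma openin_proj_cotangent_topology:
  "openin (proj_cotangent_topology M) W \<longleftrightarrow> proj_cotangent_open M W"
  by (simp add: proj_cotangent_topology_def istopology_proj_cotangent_open)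

definition proj_cotangent_borel :: "('a, 'e::euclidean_space) riemannian \<Rightarrow> 'a set \<Rightarrow>
    ('a \<times> ('a, 'e) covec set) measure" where
  "proj_cotangent_borel M X = sigma (proj_cotangent M X)
     {W. openin (subtopology (proj_cotangent_topology M) (proj_cotangent M X)) W}"

text \<open>The image of the class \<open>[\<xi>]\<close> under a linear isomorphism is the class of the image of \<open>\<xi>\<close>.\<close>

definition proj_map :: "('a, 'e::euclidean_space) riemannian \<Rightarrow> ((nat \<Rightarrow> 't) \<Rightarrow> 'a \<Rightarrow> 'a) \<Rightarrow>
    (nat \<Rightarrow> 't) \<Rightarrow> 'a \<times> ('a, 'e) covec set \<Rightarrow> 'a \<times> ('a, 'e) covec set" where
  "proj_map M f \<omega> = (\<lambda>(x, L). (f \<omega> x, D_costar M (f \<omega>) x ` L))"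

definition proj_stationary :: "('a::topological_space, 'e::euclidean_space) riemannian \<Rightarrow>
    't measure \<Rightarrow> ((nat \<Rightarrow> 't) \<Rightarrow> 'a \<Rightarrow> 'a) \<Rightarrow> 'a set \<Rightarrow> 'a measure \<Rightarrow>
    ('a \<times> ('a, 'e) covec set) measure set" where
  "proj_stationary M p f X \<mu> =
     {\<nu> \<in> stationary_measures p (proj_map M f) (proj_cotangent_borel M X).
        distr \<nu> (restrict_space borel X) fst = \<mu>}"

definition proj_potential :: "('a, 'e::euclidean_space) riemannian \<Rightarrow> 't measure \<Rightarrow>
    ((nat \<Rightarrow> 't) \<Rightarrow> 'a \<Rightarrow> 'a) \<Rightarrow> 'a \<times> ('a, 'e) covec set \<Rightarrow> real" where
  "proj_potential M p f = (\<lambda>(x, L). let \<xi> = (SOME \<xi>. \<xi> \<in> L \<and> covec_norm M x \<xi> = 1) in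
     (\<integral>\<omega>. ln (covec_norm M (f \<omega> x) (D_costar M (f \<omega>) x \<xi>)) \<partial>completion (seq_space p)))"

definition coquasi_irreducible_measure :: "('a::topological_space, 'e::euclidean_space) riemannian \<Rightarrow>
    't measure \<Rightarrow> ((nat \<Rightarrow> 't) \<Rightarrow> 'a \<Rightarrow> 'a) \<Rightarrow> 'a set \<Rightarrow> 'a measure \<Rightarrow> bool" where
  "coquasi_irreducible_measure M p f X \<mu> \<longleftrightarrow>
     (\<forall>\<nu>\<in>proj_stationary M p f X \<mu>. (\<integral>z. proj_potential M p f z \<partial>\<nu>) = - lyap_min M p f \<mu>)"

definition coquasi_irreducible_map :: "('a::topological_space, 'e::euclidean_space) riemannian \<Rightarrow>
    't measure \<Rightarrow> ((nat \<Rightarrow> 't) \<Rightarrow> 'a \<Rightarrow> 'a) \<Rightarrow> 'a set \<Rightarrow> bool" where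
  "coquasi_irreducible_map M p f X \<longleftrightarrow>
     (\<forall>\<mu>\<in>stationary_on p f X. coquasi_irreducible_measure M p f X \<mu>)"

section \<open>The weak-star topology\<close>

text \<open>
  The coarsest topology on a set \<open>I\<close> of finite Borel measures on a compact set \<open>X\<close> for which
  integration of every continuous function on \<open>X\<close> is continuous.
\<close>

definition weak_star :: "'a::topological_space set \<Rightarrow> 'a measure set \<Rightarrow> 'a measure topology" where
  "weak_star X I = pullback_topology I
     (\<lambda>\<mu>. \<lambda>\<phi>\<in>{\<phi>. continuous_on X \<phi>}. \<integral>x. \<phi> x \<partial>\<mu>)
     (product_topology (\<lambda>_. euclideanreal) {\<phi>. continuous_on X \<phi>})"

end

theory Submission
  imports Defs
begin

text \<open>
  Only upper semicontinuity uses coquasi-irreducibility: \<open>- \<lambda>\<^sub>m\<close> is the limit of the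
  subadditive sequence of the integrals of \<open>log \<parallel>Df\<^sup>n(x)\<^sup>-\<^sup>1\<parallel>\<close>, hence an infimum of
  weak-star continuous functions.  For the other inequality, let \<open>\<mu>\<^sub>0\<close> be coquasi-irreducible, so
  that no stationary lift of \<open>\<mu>\<^sub>0\<close> to the projectivized cotangent bundle gives the potential
  \<open>\<phi>\<close> an integral below \<open>- \<lambda>\<^sub>m(\<mu>\<^sub>0)\<close>.  The Hahn-Banach and Riesz theorems turn
  this into functions \<open>u\<close> on the bundle and \<open>g\<close> on \<open>X\<close>, both continuous, such that \<open>g\<close> bounds
  from below the sum of \<open>\<phi>\<close> and the coboundary of \<open>u\<close>, while the \<open>\<mu>\<^sub>0\<close>-integral of
  \<open>g\<close> is almost \<open>- \<lambda>\<^sub>m(\<mu>\<^sub>0)\<close>.  Since \<open>\<parallel>Df\<^sup>n(x)\<^sup>-\<^sup>1\<parallel>\<close> dominates the growth of every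
  covector, the integral of \<open>g\<close> bounds \<open>- \<lambda>\<^sub>m(\<mu>)\<close> from below for every stationary \<open>\<mu>\<close>.
\<close>

subsection \<open>Positive functionals on spaces of functions\<close>

text \<open>A direct argument would lift each stationary measure near \<open>\<mu>\<^sub>0\<close>
  to a stationary measure realizing its exponent, and pass to a limit of the lifts. Duality replaces
  this: no lift of a nearby measure is constructed, since one inequality between functions, produced
  at \<open>\<mu>\<^sub>0\<close> alone, is integrated against every stationary measure. The
  functional to be extended sends \<open>g \<circ> pr\<close> plus the coboundary
  \<open>transfer u - u\<close> to the integral of \<open>g\<close>; the measure of a positive
  extension is then automatically stationary (vary \<open>u\<close>) and a lift of
  \<open>\<mu>\<^sub>0\<close> (vary \<open>g\<close>). Positivity on this subspace, which makes an
  extension possible, again needs no lift: summed coboundaries stay bounded while the integrals of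
  the sums of \<open>g\<close> grow linearly. The bundle carries no metric here, so the representing
  measure is found on a compact set of chart coordinates mapped onto it, and the topology of the
  bundle enters only through a lattice of functions. Derivatives are meaningful for almost every
  noise only; the map is replaced by the identity on an exceptional set of first letters.\<close>

definition function_space :: "('y \<Rightarrow> real) set \<Rightarrow> bool" where
  "function_space V \<longleftrightarrow> (\<lambda>_. 0) \<in> V \<and> (\<forall>f\<in>V. \<forall>g\<in>V. \<forall>a b. (\<lambda>x. a * f x + b * g x) \<in> V)"

definition sublinear_on :: "('y \<Rightarrow> real) set \<Rightarrow> (('y \<Rightarrow> real) \<Rightarrow> real) \<Rightarrow> bool" where
  "sublinear_on V q \<longleftrightarrow> (\<forall>f\<in>V. \<forall>g\<in>V. q (\<lambda>x. f x + g x) \<le> q f + q g) \<and>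
     (\<forall>f\<in>V. \<forall>a\<ge>0. q (\<lambda>x. a * f x) = a * q f)"

definition linear_functional_on :: "('y \<Rightarrow> real) set \<Rightarrow> (('y \<Rightarrow> real) \<Rightarrow> real) \<Rightarrow> bool" where
  "linear_functional_on V L \<longleftrightarrow>
     (\<forall>f\<in>V. \<forall>g\<in>V. \<forall>a b. L (\<lambda>x. a * f x + b * g x) = a * L f + b * L g)"

lemma function_space_combination:
  "function_space V \<Longrightarrow> f \<in> V \<Longrightarrow> g \<in> V \<Longrightarrow> (\<lambda>x. a * f x + b * g x) \<in> V"
  by (simp add: function_space_def)

lemma function_space_add:
  "function_space V \<Longrightarrow> f \<in> V \<Longrightarrow> g \<in> V \<Longrightarrow> (\<lambda>x. f x + g x) \<in> V"
  using function_space_combination[of V f g 1 1] by simp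

lemma function_space_scale: "function_space V \<Longrightarrow> f \<in> V \<Longrightarrow> (\<lambda>x. a * f x) \<in> V"
  using function_space_combination[of V f f a 0] by simp

lemma sublinear_on_add:
  "sublinear_on V q \<Longrightarrow> f \<in> V \<Longrightarrow> g \<in> V \<Longrightarrow> q (\<lambda>x. f x + g x) \<le> q f + q g"
  by (simp add: sublinear_on_def)

lemma sublinear_on_scale:
  "sublinear_on V q \<Longrightarrow> f \<in> V \<Longrightarrow> a \<ge> 0 \<Longrightarrow> q (\<lambda>x. a * f x) = a * q f"
  by (simp add: sublinear_on_def)

lemma sublinear_on_zero: "function_space V \<Longrightarrow> sublinear_on V q \<Longrightarrow> q (\<lambda>_. 0) = 0"
  using sublinear_on_scale[of V q "\<lambda>_. 0" 0] by (simp add: function_space_def)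

lemma sublinear_on_lower:
  assumes V: "function_space V" and q: "sublinear_on V q" and f: "f \<in> V"
  shows "- q (\<lambda>x. - f x) \<le> q f"
proof -
  have mf: "(\<lambda>x. - f x) \<in> V" using function_space_scale[OF V f, of "-1"] by simp
  show ?thesis using sublinear_on_add[OF q f mf] sublinear_on_zero[OF V q] by simp
qed

text \<open>Lowering a sublinear functional in the direction \<open>h\<close>: a minimal one is fixed by this
  operation for every \<open>h\<close>, and is therefore additive.\<close>

definition lowered :: "(('y \<Rightarrow> real) \<Rightarrow> real) \<Rightarrow> ('y \<Rightarrow> real) \<Rightarrow> ('y \<Rightarrow> real) \<Rightarrow> real" where
  "lowered q h f = (INF t\<in>{0..}. q (\<lambda>x. f x + t * h x) - t * q h)"

text \<open>The infimum is finite because \<open>q\<close> at \<open>t h\<close> is at most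
  \<open>q\<close> at \<open>f + t h\<close> plus \<open>q\<close> at \<open>- f\<close>. It is
  subadditive because a shift \<open>s\<close> for \<open>f\<close> and a shift \<open>t\<close> for
  \<open>g\<close> add up to the shift \<open>s + t\<close> for the sum. The value
  \<open>t = 0\<close> shows that lowering decreases \<open>q\<close>; \<open>t = 1\<close> turns
  invariance under lowering into superadditivity.\<close>

lemma
  assumes V: "function_space V" and q: "sublinear_on V q" and h: "h \<in> V"
  shows sublinear_on_lowered: "sublinear_on V (lowered q h)"
    and lowered_le: "f \<in> V \<Longrightarrow> t \<ge> 0 \<Longrightarrow> lowered q h f \<le> q (\<lambda>x. f x + t * h x) - t * q h"
proof -
  have add: "q (\<lambda>x. f x + g x) \<le> q f + q g" if "f \<in> V" "g \<in> V" for f g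
    using q that unfolding sublinear_on_def by blast
  have scale: "q (\<lambda>x. a * f x) = a * q f" if "f \<in> V" "a \<ge> 0" for f a
    using q that unfolding sublinear_on_def by blast
  have inV: "(\<lambda>x. f x + t * h x) \<in> V" if "f \<in> V" for f t
    using function_space_combination[OF V that h, of 1 t] by simp
  have low: "- q (\<lambda>x. - f x) \<le> q (\<lambda>x. f x + t * h x) - t * q h" if f: "f \<in> V" and "t \<ge> 0" for f t
  proof -
    have "(\<lambda>x. - f x) \<in> V" using function_space_scale[OF V f, of "-1"] by simp
    from add[OF inV[OF f, of t] this] have "q (\<lambda>x. t * h x) \<le> q (\<lambda>x. f x + t * h x) + q (\<lambda>x. - f x)"
      by simp
    then show ?thesis using scale[OF h \<open>t \<ge> 0\<close>] by simp
  qed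
  have bdd: "bdd_below ((\<lambda>t. q (\<lambda>x. f x + t * h x) - t * q h) ` {0..})" if "f \<in> V" for f
    using low[OF that] by (intro bdd_belowI[of _ "- q (\<lambda>x. - f x)"]) auto
  show le: "lowered q h f \<le> q (\<lambda>x. f x + t * h x) - t * q h" if "f \<in> V" "t \<ge> 0" for f t
    unfolding lowered_def using that by (intro cINF_lower bdd) auto
  have ge: "z \<le> lowered q h f" if "\<And>t. t \<ge> 0 \<Longrightarrow> z \<le> q (\<lambda>x. f x + t * h x) - t * q h" for f z
    unfolding lowered_def using that by (intro cINF_greatest) auto
  have sc_le: "lowered q h (\<lambda>x. a * f x) \<le> a * lowered q h f" if f: "f \<in> V" and a: "a > 0" for f a
  proof -
    have "lowered q h (\<lambda>x. a * f x) / a \<le> lowered q h f"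
    proof (rule ge)
      fix t :: real assume t: "t \<ge> 0"
      have "lowered q h (\<lambda>x. a * f x) \<le> q (\<lambda>x. a * f x + (a * t) * h x) - (a * t) * q h"
        using a t f by (intro le function_space_scale[OF V]) auto
      also have "(\<lambda>x. a * f x + (a * t) * h x) = (\<lambda>x. a * (f x + t * h x))"
        by (simp add: algebra_simps)
      also have "q \<dots> = a * q (\<lambda>x. f x + t * h x)"
        using a by (intro scale inV f) auto
      finally show "lowered q h (\<lambda>x. a * f x) / a \<le> q (\<lambda>x. f x + t * h x) - t * q h"
        using a by (simp add: field_simps)
    qed
    then show ?thesis using a by (simp add: field_simps)
  qed
  show "sublinear_on V (lowered q h)"
    unfolding sublinear_on_def
  proof (intro conjI ballI allI impI)
    fix f g assume f: "f \<in> V" and g: "g \<in> V"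
    have fg: "(\<lambda>x. f x + g x) \<in> V" by (rule function_space_add[OF V f g])
    have "lowered q h (\<lambda>x. f x + g x) - lowered q h g \<le> lowered q h f"
    proof (rule ge)
      fix s :: real assume s: "s \<ge> 0"
      have "lowered q h (\<lambda>x. f x + g x) - (q (\<lambda>x. f x + s * h x) - s * q h) \<le> lowered q h g"
      proof (rule ge)
        fix t :: real assume t: "t \<ge> 0"
        have "lowered q h (\<lambda>x. f x + g x) \<le> q (\<lambda>x. f x + g x + (s + t) * h x) - (s + t) * q h"
          using s t by (intro le fg) auto
        also have "(\<lambda>x. f x + g x + (s + t) * h x) = (\<lambda>x. (f x + s * h x) + (g x + t * h x))"
          by (simp add: algebra_simps)
        also have "q \<dots> \<le> q (\<lambda>x. f x + s * h x) + q (\<lambda>x. g x + t * h x)"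
          by (intro add inV f g)
        finally show "lowered q h (\<lambda>x. f x + g x) - (q (\<lambda>x. f x + s * h x) - s * q h) \<le>
            q (\<lambda>x. g x + t * h x) - t * q h" by (simp add: algebra_simps)
      qed
      then show "lowered q h (\<lambda>x. f x + g x) - lowered q h g \<le> q (\<lambda>x. f x + s * h x) - s * q h"
        by simp
    qed
    then show "lowered q h (\<lambda>x. f x + g x) \<le> lowered q h f + lowered q h g" by simp
  next
    fix f and a :: real assume f: "f \<in> V" and a: "a \<ge> 0"
    show "lowered q h (\<lambda>x. a * f x) = a * lowered q h f"
    proof (cases "a = 0")
      case True
      have "lowered q h (\<lambda>x. 0) = 0"
        unfolding lowered_def using scale[OF h] by (simp add: cong: INF_cong_simp)
      with True show ?thesis by simp
    next
      case False
      with a have a: "a > 0" by simp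
      have "lowered q h (\<lambda>x. inverse a * (a * f x)) \<le> inverse a * lowered q h (\<lambda>x. a * f x)"
        using a by (intro sc_le function_space_scale[OF V f]) auto
      then have "a * lowered q h f \<le> lowered q h (\<lambda>x. a * f x)"
        using a by (simp add: field_simps)
      with sc_le[OF f a] show ?thesis by simp
    qed
  qed
qed

text \<open>Zorn's lemma for the reversed pointwise order: the infimum over a chain is finite since
  every member lies above \<open>- S (\<lambda>x. - f x)\<close>.\<close>

lemma ex_minimal_sublinear:
  assumes V: "function_space V" and S: "sublinear_on V S"
  obtains q where "sublinear_on V q" "\<forall>f\<in>V. q f \<le> S f"
    "\<forall>q'. sublinear_on V q' \<longrightarrow> (\<forall>f\<in>V. q' f \<le> q f) \<longrightarrow> (\<forall>f\<in>V. q' f = q f)"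
proof -
  \<comment> \<open>Setting the functionals to 0 outside \<open>V\<close> makes them determined by
    their values on \<open>V\<close>; otherwise the pointwise order on \<open>V\<close> would not be
    antisymmetric.\<close>
  define A where "A = {q. sublinear_on V q \<and> (\<forall>f\<in>V. q f \<le> S f) \<and> (\<forall>f. f \<notin> V \<longrightarrow> q f = 0)}"
  define P where "P = (\<lambda>q q'. \<forall>f\<in>V. q' f \<le> (q f :: real))"
  define cut where "cut = (\<lambda>q f. if f \<in> V then q f else (0 :: real))"
  have cut: "sublinear_on V (cut q)" if "sublinear_on V q" for q
    using that function_space_add[OF V] function_space_scale[OF V]
    unfolding sublinear_on_def cut_def by auto
  have "\<exists>m\<in>A. \<forall>a\<in>A. P m a \<longrightarrow> a = m"
  proof (rule predicate_Zorn)
    have "q = q'" if "q \<in> A" "q' \<in> A" "P q q'" "P q' q" for q q'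
      using that unfolding A_def P_def by (auto simp: fun_eq_iff) (metis order.antisym)
    then show "partial_order_on A (relation_of P A)"
      unfolding partial_order_on_def preorder_on_def relation_of_def refl_on_def trans_def antisym_def
      by (auto simp: P_def) (meson order.trans)
  next
    fix C assume C: "C \<in> Chains (relation_of P A)"
    have CA: "C \<subseteq> A" using C unfolding Chains_def relation_of_def by auto
    have lin: "P q q' \<or> P q' q" if "q \<in> C" "q' \<in> C" for q q'
      using C that unfolding Chains_def relation_of_def by auto
    show "\<exists>u\<in>A. \<forall>a\<in>C. P a u"
    proof (cases "C = {}")
      case True
      have "cut S \<in> A" using cut[OF S] by (auto simp: A_def cut_def)
      with True show ?thesis by auto
    next
      case False
      have sub: "sublinear_on V q" if "q \<in> C" for q using CA that by (auto simp: A_def)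
      have le_S: "q f \<le> S f" if "q \<in> C" "f \<in> V" for q f using CA that by (auto simp: A_def)
      define u where "u = (\<lambda>f. INF q\<in>C. q f)"
      have bdd: "bdd_below ((\<lambda>q. q f) ` C)" if f: "f \<in> V" for f
      proof (rule bdd_belowI2[of _ "- S (\<lambda>x. - f x)"])
        fix q assume q: "q \<in> C"
        have "(\<lambda>x. - f x) \<in> V" using function_space_scale[OF V f, of "-1"] by simp
        then show "- S (\<lambda>x. - f x) \<le> q f"
          using sublinear_on_lower[OF V sub[OF q] f] le_S[OF q] by force
      qed
      have le: "u f \<le> q f" if "f \<in> V" "q \<in> C" for f q
        unfolding u_def using that by (intro cINF_lower bdd)
      have ge: "z \<le> u f" if "\<And>q. q \<in> C \<Longrightarrow> z \<le> q f" for f z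
        unfolding u_def using False that by (intro cINF_greatest)
      have "sublinear_on V u"
        unfolding sublinear_on_def
      proof (intro conjI ballI allI impI)
        fix f g assume f: "f \<in> V" and g: "g \<in> V"
        have fg: "(\<lambda>x. f x + g x) \<in> V" by (rule function_space_add[OF V f g])
        have "u (\<lambda>x. f x + g x) - u g \<le> u f"
        proof (rule ge)
          fix q1 assume q1: "q1 \<in> C"
          have "u (\<lambda>x. f x + g x) - q1 f \<le> u g"
          proof (rule ge)
            fix q2 assume q2: "q2 \<in> C"
            \<comment> \<open>In a chain the smaller of \<open>q1\<close> and \<open>q2\<close>
              serves both arguments at once; this keeps the infimum subadditive.\<close>
            obtain q where q: "q \<in> C" "q f \<le> q1 f" "q g \<le> q2 g"
              using lin[OF q1 q2] q1 q2 f g unfolding P_def by blast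
            have "u (\<lambda>x. f x + g x) \<le> q (\<lambda>x. f x + g x)" by (rule le[OF fg q(1)])
            also have "\<dots> \<le> q f + q g" using sub[OF q(1)] f g unfolding sublinear_on_def by blast
            finally show "u (\<lambda>x. f x + g x) - q1 f \<le> q2 g" using q by simp
          qed
          then show "u (\<lambda>x. f x + g x) - u g \<le> q1 f" by simp
        qed
        then show "u (\<lambda>x. f x + g x) \<le> u f + u g" by simp
      next
        fix f and a :: real assume f: "f \<in> V" and a: "a \<ge> 0"
        have af: "(\<lambda>x. a * f x) \<in> V" by (rule function_space_scale[OF V f])
        have eq: "q (\<lambda>x. a * f x) = a * q f" if "q \<in> C" for q
          using sub[OF that] f a unfolding sublinear_on_def by blast
        show "u (\<lambda>x. a * f x) = a * u f"
        proof (rule antisym)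
          show "a * u f \<le> u (\<lambda>x. a * f x)"
            by (intro ge) (simp add: eq le f a mult_left_mono)
          show "u (\<lambda>x. a * f x) \<le> a * u f"
          proof (cases "a = 0")
            case True
            obtain q where "q \<in> C" using False by blast
            then show ?thesis using le[OF af, of q] eq[of q] True by simp
          next
            case False
            with a have a: "a > 0" by simp
            have "u (\<lambda>x. a * f x) / a \<le> u f"
              by (rule ge) (simp add: le[OF af] eq[symmetric] a pos_divide_le_eq mult.commute)
            then show ?thesis using a by (simp add: field_simps)
          qed
        qed
      qed
      moreover have "u f \<le> S f" if "f \<in> V" for f
        using le[OF that] le_S[OF _ that] False by force
      ultimately have "cut u \<in> A" using cut[of u] by (auto simp: A_def cut_def)
      moreover have "\<forall>a\<in>C. P a (cut u)" using le by (auto simp: P_def cut_def)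
      ultimately show ?thesis by blast
    qed
  qed
  then obtain m where m: "m \<in> A" "\<And>a. a \<in> A \<Longrightarrow> P m a \<Longrightarrow> a = m" by blast
  show ?thesis
  proof (rule that[of m])
    show "sublinear_on V m" "\<forall>f\<in>V. m f \<le> S f" using m(1) by (auto simp: A_def)
    show "\<forall>q'. sublinear_on V q' \<longrightarrow> (\<forall>f\<in>V. q' f \<le> m f) \<longrightarrow> (\<forall>f\<in>V. q' f = m f)"
    proof (intro allI impI ballI)
    fix q' f assume q': "sublinear_on V q'" "\<forall>f\<in>V. q' f \<le> m f" and f: "f \<in> V"
    have "cut q' \<in> A" using cut[OF q'(1)] q'(2) m(1) by (force simp: A_def cut_def)
    moreover have "P m (cut q')" using q'(2) by (auto simp: P_def cut_def)
    ultimately have "cut q' = m" by (rule m(2))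
    then show "q' f = m f" using f by (auto simp: cut_def)
    qed
  qed
qed

text \<open>A minimal sublinear functional is fixed by every lowering, hence additive. It is sought
  below \<open>lowered S f0\<close> rather than below \<open>S\<close>: there the value at
  \<open>- f0\<close> is at most \<open>- S f0\<close>, and linearity turns this into
  \<open>L f0 = S f0\<close>.\<close>

lemma Hahn_Banach_functions:
  assumes V: "function_space V" and S: "sublinear_on V S" and f0: "f0 \<in> V"
  obtains L where "linear_functional_on V L" "\<And>f. f \<in> V \<Longrightarrow> L f \<le> S f" "L f0 = S f0"
proof -
  obtain q where q: "sublinear_on V q" and qS: "\<forall>f\<in>V. q f \<le> lowered S f0 f"
    and min: "\<forall>q'. sublinear_on V q' \<longrightarrow> (\<forall>f\<in>V. q' f \<le> q f) \<longrightarrow> (\<forall>f\<in>V. q' f = q f)"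
    using ex_minimal_sublinear[OF V sublinear_on_lowered[OF V S f0]] by blast
  have add: "q (\<lambda>x. f x + g x) = q f + q g" if f: "f \<in> V" and g: "g \<in> V" for f g
  proof (rule antisym)
    show "q (\<lambda>x. f x + g x) \<le> q f + q g" using q f g unfolding sublinear_on_def by blast
    have "lowered q g f' \<le> q f'" if "f' \<in> V" for f'
      using lowered_le[OF V q g that, of 0] by simp
    then have "lowered q g f = q f"
      using min sublinear_on_lowered[OF V q g] f by blast
    then show "q f + q g \<le> q (\<lambda>x. f x + g x)" using lowered_le[OF V q g f, of 1] by simp
  qed
  have neg: "q (\<lambda>x. - f x) = - q f" if f: "f \<in> V" for f
  proof -
    have "(\<lambda>x. - f x) \<in> V" using function_space_scale[OF V f, of "-1"] by simp
    from add[OF f this] show ?thesis using sublinear_on_zero[OF V q] by simp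
  qed
  have scale: "q (\<lambda>x. a * f x) = a * q f" if f: "f \<in> V" for f a
  proof (cases "a \<ge> 0")
    case True
    then show ?thesis using q f unfolding sublinear_on_def by blast
  next
    case False
    then have "q (\<lambda>x. (- a) * f x) = (- a) * q f"
      using q f unfolding sublinear_on_def by (meson le_cases neg_0_le_iff_le)
    moreover have "q (\<lambda>x. - ((- a) * f x)) = - q (\<lambda>x. (- a) * f x)"
      by (rule neg) (rule function_space_scale[OF V f])
    ultimately show ?thesis by simp
  qed
  have le: "q f \<le> S f" if "f \<in> V" for f
    using qS[rule_format, OF that] lowered_le[OF V S f0 that, of 0] by simp
  have "linear_functional_on V q"
    unfolding linear_functional_on_def using add scale function_space_scale[OF V] by simp
  moreover have "q f0 = S f0"
  proof (rule antisym)
    show "q f0 \<le> S f0" by (rule le[OF f0])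
    have m: "(\<lambda>x. - f0 x) \<in> V" using function_space_scale[OF V f0, of "-1"] by simp
    have "- q f0 \<le> S (\<lambda>x. - f0 x + 1 * f0 x) - 1 * S f0"
      using qS[rule_format, OF m] lowered_le[OF V S f0 m, of 1] neg[OF f0] by simp
    then show "S f0 \<le> q f0" using sublinear_on_zero[OF V S] by simp
  qed
  ultimately show ?thesis using that le by blast
qed



section \<open>Representation of positive functionals by measures on a compact metric set\<close>

lemma sets_restrict_borel:
  "sets (restrict_space borel Y) = sigma_sets Y {T \<inter> Y |T. open T}"
proof -
  have "sets (restrict_space borel Y) = {id -` A \<inter> Y |A. A \<in> sigma_sets UNIV {S. open S}}"
    unfolding sets_restrict_space borel_def by auto
  also have "\<dots> = sigma_sets Y {id -` A \<inter> Y |A. A \<in> {S. open S}}"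
    by (rule sigma_sets_vimage_commute) auto
  finally show ?thesis by simp
qed

locale compact_functional =
  fixes Y :: "'y::metric_space set" and L :: "('y \<Rightarrow> real) \<Rightarrow> real"
  assumes compact: "compact Y"
    and combination: "continuous_on Y f \<Longrightarrow> continuous_on Y g \<Longrightarrow>
      L (\<lambda>x. a * f x + b * g x) = a * L f + b * L g"
    and pos: "continuous_on Y f \<Longrightarrow> (\<And>y. y \<in> Y \<Longrightarrow> 0 \<le> f y) \<Longrightarrow> 0 \<le> L f"
    and one: "L (\<lambda>_. 1) = 1"
begin

lemma L_add: "continuous_on Y f \<Longrightarrow> continuous_on Y g \<Longrightarrow> L (\<lambda>x. f x + g x) = L f + L g"
  using combination[of f g 1 1] by simp

lemma L_diff: "continuous_on Y f \<Longrightarrow> continuous_on Y g \<Longrightarrow> L (\<lambda>x. f x - g x) = L f - L g"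
  using combination[of f g 1 "-1"] by simp

lemma L_scale: "continuous_on Y f \<Longrightarrow> L (\<lambda>x. a * f x) = a * L f"
  using combination[of f f a 0] by simp

lemma L_zero: "L (\<lambda>_. 0) = 0"
  using L_scale[of "\<lambda>_. 1" 0] by simp

lemma L_mono:
  "continuous_on Y f \<Longrightarrow> continuous_on Y g \<Longrightarrow> (\<And>y. y \<in> Y \<Longrightarrow> f y \<le> g y) \<Longrightarrow> L f \<le> L g"
  using pos[of "\<lambda>x. g x - f x"] L_diff[of g f] by (simp add: continuous_on_diff)

lemma L_sum:
  "finite I \<Longrightarrow> (\<And>i. i \<in> I \<Longrightarrow> continuous_on Y (f i)) \<Longrightarrow> L (\<lambda>x. \<Sum>i\<in>I. f i x) = (\<Sum>i\<in>I. L (f i))"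
proof (induction rule: finite_induct)
  case (insert i I)
  then have "L (\<lambda>x. f i x + (\<Sum>i\<in>I. f i x)) = L (f i) + L (\<lambda>x. \<Sum>i\<in>I. f i x)"
    by (intro L_add continuous_on_sum) auto
  with insert show ?case by simp
qed (simp add: L_zero)

text \<open>The outer measure is built from countable sums of continuous functions, in the manner of
  Daniell, instead of from open sets: countable subadditivity becomes a rearrangement of double
  series.\<close>

definition covers :: "'y set \<Rightarrow> (nat \<Rightarrow> 'y \<Rightarrow> real) set" where
  "covers A = {F. (\<forall>k. continuous_on Y (F k) \<and> (\<forall>y\<in>Y. 0 \<le> F k y)) \<and>
     (\<forall>y\<in>A. 1 \<le> (\<Sum>k. ennreal (F k y)))}"

definition outer :: "'y set \<Rightarrow> ennreal" where
  "outer A = (INF F\<in>covers A. \<Sum>k. ennreal (L (F k)))"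

lemma outer_le: "F \<in> covers A \<Longrightarrow> outer A \<le> (\<Sum>k. ennreal (L (F k)))"
  unfolding outer_def by (rule INF_lower)

lemma outer_le_double:
  assumes "\<And>k n. continuous_on Y (G k n)" "\<And>k n y. y \<in> Y \<Longrightarrow> 0 \<le> G k n y"
    and "\<And>y. y \<in> A \<Longrightarrow> 1 \<le> (\<Sum>k. \<Sum>n. ennreal (G k n y))"
  shows "outer A \<le> (\<Sum>k. \<Sum>n. ennreal (L (G k n)))"
proof -
  let ?F = "\<lambda>i. case prod_decode i of (k, n) \<Rightarrow> G k n"
  have sum: "(\<Sum>i. ennreal (H (?F i))) = (\<Sum>k. \<Sum>n. ennreal (H (G k n)))" for H :: "_ \<Rightarrow> real"
    using suminf_ennreal_2dimen[of "\<lambda>k. \<Sum>n. ennreal (H (G k n))" "\<lambda>(k, n). ennreal (H (G k n))"]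
    by (simp add: o_def case_prod_beta)
  have "?F \<in> covers A"
    unfolding covers_def using assms sum[of "\<lambda>f. f y" for y]
    by (auto simp: split_beta)
  then show ?thesis using outer_le sum[of L] by metis
qed

lemma outer_le_single:
  assumes "continuous_on Y f" "\<And>y. y \<in> Y \<Longrightarrow> 0 \<le> f y" "\<And>y. y \<in> A \<Longrightarrow> 1 \<le> f y"
  shows "outer A \<le> ennreal (L f)"
proof -
  let ?F = "\<lambda>k::nat. if k = 0 then f else (\<lambda>_. 0)"
  have sum: "(\<Sum>k. ennreal (H (?F k))) = ennreal (H f)" if "H (\<lambda>_. 0) = 0" for H :: "_ \<Rightarrow> real"
    using that by (subst suminf_finite[of "{0}"]) auto
  have "?F \<in> covers A"
    unfolding covers_def using assms sum[of "\<lambda>f. f y" for y] by auto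
  from outer_le[OF this] show ?thesis using sum[of L] L_zero by simp
qed

lemma outer_empty: "outer {} = 0"
  using outer_le_single[of "\<lambda>_. 0" "{}"] L_zero by simp

lemma outer_mono: "A \<subseteq> B \<Longrightarrow> outer A \<le> outer B"
  unfolding outer_def by (rule INF_superset_mono) (auto simp: covers_def)

text \<open>For the lower bound: the partial sums of a cover increase to at least 1 at every point,
  so the open sets where the \<open>n\<close>-th one exceeds \<open>1 - e\<close> exhaust
  \<open>Y\<close>. By compactness a single partial sum exceeds \<open>1 - e\<close> everywhere, and
  monotonicity of \<open>L\<close> applies to this finite sum.\<close>

lemma outer_space: "outer Y = 1"
proof (rule antisym)
  show "outer Y \<le> 1" using outer_le_single[of "\<lambda>_. 1" Y] one by simp
  show "1 \<le> outer Y"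
    unfolding outer_def
  proof (rule INF_greatest)
    fix F assume F: "F \<in> covers Y"
    have cont: "continuous_on Y (F k)" and F0: "y \<in> Y \<Longrightarrow> 0 \<le> F k y" for k y
      using F by (auto simp: covers_def)
    show "1 \<le> (\<Sum>k. ennreal (L (F k)))"
    proof (rule ennreal_le_epsilon)
      fix e :: real assume e: "e > 0" and fin: "(\<Sum>k. ennreal (L (F k))) < top"
      let ?s = "\<lambda>n y. \<Sum>k<n. F k y"
      have "\<exists>T. open T \<and> T \<inter> Y = {y\<in>Y. 1 - e < ?s n y}" for n
      proof -
        have "continuous_on Y (?s n)" by (intro continuous_on_sum cont)
        then have "\<exists>T. open T \<and> T \<inter> Y = ?s n -` {1 - e<..} \<inter> Y"
          unfolding continuous_on_open_invariant by (rule allE[of _ "{1 - e<..}"]) auto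
        moreover have "?s n -` {1 - e<..} \<inter> Y = {y\<in>Y. 1 - e < ?s n y}" by auto
        ultimately show ?thesis by simp
      qed
      then obtain T where T: "\<And>n. open (T n)" "\<And>n. T n \<inter> Y = {y\<in>Y. 1 - e < ?s n y}" by metis
      have "Y \<subseteq> (\<Union>n. T n)"
      proof
        fix y assume y: "y \<in> Y"
        have "ennreal (1 - e) < 1" using e by (simp add: ennreal_less_one_iff)
        also have "1 \<le> (SUP n. \<Sum>k<n. ennreal (F k y))"
          using F y by (simp add: covers_def suminf_eq_SUP del: sum_ennreal)
        finally obtain n where "ennreal (1 - e) < (\<Sum>k<n. ennreal (F k y))"
          by (auto simp: less_SUP_iff)
        also have "(\<Sum>k<n. ennreal (F k y)) = ennreal (?s n y)" using F0 y by (intro sum_ennreal) auto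
        finally have "1 - e < ?s n y"
          by (metis ennreal_leI linorder_not_less)
        then show "y \<in> (\<Union>n. T n)" using T(2)[of n] y by auto
      qed
      then obtain N where N: "finite N" "Y \<subseteq> (\<Union>n\<in>N. T n)"
        using compactE_image[OF compact, of UNIV T] T(1) by metis
      obtain m where m: "\<And>n. n \<in> N \<Longrightarrow> n \<le> m" using N(1) by (meson finite_nat_set_iff_bounded_le)
      have "1 - e \<le> ?s m y" if y: "y \<in> Y" for y
      proof -
        obtain n where n: "n \<in> N" "y \<in> T n" using N y by auto
        then have "1 - e < ?s n y" using T(2)[of n] y by auto
        also have "\<dots> \<le> ?s m y" using F0 y m[OF n(1)] by (intro sum_mono2) auto
        finally show ?thesis by simp
      qed
      then have "L (\<lambda>_. (1 - e) * 1) \<le> L (?s m)"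
        using cont by (intro L_mono continuous_on_sum continuous_intros) auto
      then have "1 - e \<le> (\<Sum>k<m. L (F k))"
        using L_scale[of "\<lambda>_. 1" "1 - e"] L_sum[of "{..<m}" F] cont one by simp
      then have "1 \<le> (\<Sum>k<m. L (F k)) + e" by simp
      then have "1 \<le> ennreal ((\<Sum>k<m. L (F k)) + e)" by (metis ennreal_1 ennreal_leI)
      also have "\<dots> = (\<Sum>k<m. ennreal (L (F k))) + ennreal e"
        using e pos cont F0 by (subst sum_ennreal) (auto simp: ennreal_plus sum_nonneg)
      also have "(\<Sum>k<m. ennreal (L (F k))) \<le> (\<Sum>k. ennreal (L (F k)))" by (rule sum_le_suminf) auto
      finally show "1 \<le> (\<Sum>k. ennreal (L (F k))) + ennreal e" by (simp add: add_right_mono)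
    qed
  qed
qed

lemma outer_measure_space_outer: "outer_measure_space (Pow Y) outer"
  unfolding outer_measure_space_def
proof (intro conjI)
  show "positive (Pow Y) outer" by (simp add: positive_def outer_empty)
  show "increasing (Pow Y) outer" by (simp add: increasing_def outer_mono)
  show "countably_subadditive (Pow Y) outer"
    unfolding countably_subadditive_def
  proof (intro allI impI)
    fix A :: "nat \<Rightarrow> 'y set"
    show "outer (\<Union>i. A i) \<le> (\<Sum>i. outer (A i))"
    proof (rule ennreal_le_epsilon)
      fix e :: real assume e: "0 < e" and fin: "(\<Sum>i. outer (A i)) < top"
      have *: "outer (A i) < outer (A i) + e * (1/2)^Suc i" for i
        using fin e by (auto simp add: less_top dest!: ennreal_suminf_lessD)
      have "\<exists>F. F \<in> covers (A i) \<and> (\<Sum>k. ennreal (L (F k))) < outer (A i) + e * (1/2)^Suc i" for i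
        using *[of i] unfolding outer_def by (auto simp: INF_less_iff)
      then obtain G where G: "\<And>i. G i \<in> covers (A i)"
        and le: "\<And>i. (\<Sum>k. ennreal (L (G i k))) < outer (A i) + e * (1/2)^Suc i" by metis
      have "outer (\<Union>i. A i) \<le> (\<Sum>i. \<Sum>k. ennreal (L (G i k)))"
      proof (rule outer_le_double)
        show "continuous_on Y (G i k)" "y \<in> Y \<Longrightarrow> 0 \<le> G i k y" for i k y
          using G[of i] by (auto simp: covers_def)
        fix y assume "y \<in> (\<Union>i. A i)"
        then obtain i where "y \<in> A i" by auto
        then have "1 \<le> (\<Sum>k. ennreal (G i k y))" using G[of i] by (auto simp: covers_def)
        also have "\<dots> = (\<Sum>i\<in>{i}. \<Sum>k. ennreal (G i k y))" by simp
        also have "\<dots> \<le> (\<Sum>i. \<Sum>k. ennreal (G i k y))" by (rule sum_le_suminf) auto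
        finally show "1 \<le> (\<Sum>i. \<Sum>k. ennreal (G i k y))" .
      qed
      also have "\<dots> \<le> (\<Sum>i. outer (A i) + e * (1/2)^Suc i)"
        using le by (intro suminf_le) (auto intro: less_imp_le)
      also have "\<dots> = (\<Sum>i. outer (A i)) + (\<Sum>i. ennreal e * ennreal ((1/2) ^ Suc i))"
        using e by (subst suminf_add[symmetric])
          (auto simp del: ennreal_suminf_cmult simp add: ennreal_mult[symmetric])
      also have "\<dots> = (\<Sum>i. outer (A i)) + e"
        unfolding ennreal_suminf_cmult
        by (subst suminf_ennreal_eq[OF zero_le_power power_half_series]) auto
      finally show "outer (\<Union>i. A i) \<le> (\<Sum>i. outer (A i)) + e" .
    qed
  qed
qed

text \<open>Caratheodory's condition for the set \<open>?U\<close> where \<open>u\<close> is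
  positive. Each member \<open>F k\<close> of a cover of \<open>A\<close> is cut by continuous
  functions \<open>w n\<close> increasing to the indicator of \<open>?U\<close>: the increments
  \<open>G k n\<close> together cover \<open>A \<inter> ?U\<close>, while a remainder
  \<open>R k n\<close> coincides with \<open>F k\<close> off \<open>?U\<close> and so covers the
  rest.\<close>

lemma outer_split:
  fixes u :: "'y \<Rightarrow> real"
  assumes u: "continuous_on Y u" and A: "A \<subseteq> Y"
  shows "outer (A \<inter> {y\<in>Y. 0 < u y}) + outer (A - {y\<in>Y. 0 < u y}) \<le> outer A"
  unfolding outer_def[of A]
proof (rule INF_greatest)
  fix F assume F: "F \<in> covers A"
  have contF: "continuous_on Y (F k)" and F0: "y \<in> Y \<Longrightarrow> 0 \<le> F k y" for k y
    using F by (auto simp: covers_def)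
  let ?U = "{y\<in>Y. 0 < u y}"
  define w where "w = (\<lambda>n y. min 1 (real n * max 0 (u y)))"
  have "w n y \<le> w (Suc n) y" for n y
    unfolding w_def by (intro min.mono mult_right_mono) auto
  then have w: "continuous_on Y (w n)" "0 \<le> w n y" "w n y \<le> 1" "w n y \<le> w (Suc n) y" "w 0 y = 0" for n y
    unfolding w_def using u by (auto intro!: continuous_intros)
  have w_lim: "(\<lambda>n. w n y) \<longlonglongrightarrow> 1" if "y \<in> ?U" for y
  proof (rule tendsto_eventually)
    have "\<forall>\<^sub>F n in sequentially. 1 / u y \<le> real n"
      using eventually_ge_at_top[of "nat \<lceil>1 / u y\<rceil>"] by eventually_elim linarith
    then show "\<forall>\<^sub>F n in sequentially. w n y = 1"
      by eventually_elim (use that in \<open>auto simp: w_def field_simps\<close>)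
  qed
  define G where "G = (\<lambda>k n y. F k y * (w (Suc n) y - w n y))"
  define R where "R = (\<lambda>k n y. F k y * (1 - w n y))"
  have contG: "continuous_on Y (G k n)" and G0: "y \<in> Y \<Longrightarrow> 0 \<le> G k n y" for k n y
    unfolding G_def using contF w F0 by (auto intro!: continuous_intros)
  have contR: "continuous_on Y (R k n)" and R0: "y \<in> Y \<Longrightarrow> 0 \<le> R k n y" for k n y
    unfolding R_def using contF w F0 by (auto intro!: continuous_intros)
  have split: "(\<Sum>n<N. G k n y) + R k N y = F k y" for k N y
    unfolding G_def R_def sum_distrib_left[symmetric] sum_lessThan_telescope[of "\<lambda>n. w n y"]
    by (simp add: w algebra_simps)
  have splitL: "(\<Sum>n<N. L (G k n)) + L (R k N) = L (F k)" for k N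
  proof -
    have "L (F k) = L (\<lambda>y. (\<Sum>n<N. G k n y) + R k N y)" by (simp add: split)
    also have "\<dots> = (\<Sum>n<N. L (G k n)) + L (R k N)"
      by (subst L_add) (auto intro!: continuous_intros contG contR L_sum)
    finally show ?thesis by simp
  qed
  have L0: "0 \<le> L (G k n)" "0 \<le> L (R k n)" for k n
    using contG G0 contR R0 by (auto intro: pos)
  have U: "outer (A \<inter> ?U) \<le> (\<Sum>k. \<Sum>n. ennreal (L (G k n)))"
  proof (rule outer_le_double[OF contG G0])
    fix y assume y: "y \<in> A \<inter> ?U"
    have "(\<lambda>N. \<Sum>n<N. G k n y) \<longlonglongrightarrow> F k y * (1 - w 0 y)" for k
      unfolding G_def sum_distrib_left[symmetric] sum_lessThan_telescope[of "\<lambda>n. w n y"]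
      using y by (intro tendsto_intros w_lim) auto
    then have "(\<lambda>n. G k n y) sums F k y" for k by (simp add: sums_def w)
    then have "(\<Sum>n. ennreal (G k n y)) = ennreal (F k y)" for k
      using G0 y by (intro suminf_ennreal_eq) auto
    then show "1 \<le> (\<Sum>k. \<Sum>n. ennreal (G k n y))" using F y by (auto simp: covers_def)
  qed
  show "outer (A \<inter> ?U) + outer (A - ?U) \<le> (\<Sum>k. ennreal (L (F k)))"
  proof (rule ennreal_le_epsilon)
    fix e :: real assume e: "0 < e"
    \<comment> \<open>The increments are summed over all \<open>n\<close> while the remainder is
      taken at a finite stage \<open>N\<close>, so the two overlap; stopping where the series is
      within \<open>e / 2^(k+1)\<close> of its sum bounds the overlap.\<close>
    have ex: "\<exists>N. (\<Sum>n. ennreal (L (G k n))) + ennreal (L (R k N)) \<le> ennreal (L (F k)) + e * (1/2)^Suc k" for k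
    proof -
      have bound: "(\<Sum>n<N. L (G k n)) \<le> L (F k)" for N using splitL[of k N] L0(2)[of k N] by simp
      have summ: "summable (\<lambda>n. L (G k n))"
        using L0(1) bound by (rule summableI_nonneg_bounded)
      define l where "l = (\<Sum>n. L (G k n))"
      have "(\<lambda>N. \<Sum>n<N. L (G k n)) \<longlonglongrightarrow> l"
        unfolding l_def by (rule summable_LIMSEQ[OF summ])
      moreover have "0 < e * (1/2)^Suc k" using e by simp
      ultimately have "\<forall>\<^sub>F N in sequentially. l - e * (1/2)^Suc k < (\<Sum>n<N. L (G k n))"
        by (intro order_tendstoD(1)) auto
      then obtain N where "l - e * (1/2)^Suc k < (\<Sum>n<N. L (G k n))" by (auto simp: eventually_sequentially)
      then have "l + L (R k N) \<le> L (F k) + e * (1/2)^Suc k" using splitL[of k N] by linarith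
      then have le: "ennreal (l + L (R k N)) \<le> ennreal (L (F k) + e * (1/2)^Suc k)" by (rule ennreal_leI)
      have l0: "0 \<le> l" unfolding l_def using L0 summ by (intro suminf_nonneg) auto
      have l_eq: "ennreal l = (\<Sum>n. ennreal (L (G k n)))"
        unfolding l_def using L0 summ by (simp add: suminf_ennreal2)
      have "(\<Sum>n. ennreal (L (G k n))) + ennreal (L (R k N)) = ennreal (l + L (R k N))"
        unfolding l_eq[symmetric] by (rule ennreal_plus[symmetric, OF l0 L0(2)])
      also note le
      also have "ennreal (L (F k) + e * (1/2)^Suc k) = ennreal (L (F k)) + e * (1/2)^Suc k"
        using e by (intro ennreal_plus pos contF F0) auto
      finally show ?thesis by blast
    qed
    then obtain N where N: "\<And>k. (\<Sum>n. ennreal (L (G k n))) + ennreal (L (R k (N k))) \<le> ennreal (L (F k)) + e * (1/2)^Suc k"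
      by metis
    have "(\<lambda>k. R k (N k)) \<in> covers (A - ?U)"
    proof -
      have "R k n y = F k y" if "y \<in> A - ?U" for k n y
        using that A unfolding R_def w_def by (auto simp: max_def)
      then show ?thesis using F contR R0 by (auto simp: covers_def)
    qed
    from outer_le[OF this] U have "outer (A \<inter> ?U) + outer (A - ?U) \<le>
        (\<Sum>k. \<Sum>n. ennreal (L (G k n))) + (\<Sum>k. ennreal (L (R k (N k))))" by (rule add_mono[rotated])
    also have "\<dots> = (\<Sum>k. (\<Sum>n. ennreal (L (G k n))) + ennreal (L (R k (N k))))"
      by (rule suminf_add) auto
    also have "\<dots> \<le> (\<Sum>k. ennreal (L (F k)) + e * (1/2)^Suc k)"
      using N by (intro suminf_le) auto
    also have "\<dots> = (\<Sum>k. ennreal (L (F k))) + (\<Sum>i. ennreal e * ennreal ((1/2) ^ Suc i))"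
      using e by (subst suminf_add[symmetric])
        (auto simp del: ennreal_suminf_cmult simp add: ennreal_mult[symmetric])
    also have "\<dots> = (\<Sum>k. ennreal (L (F k))) + e"
      unfolding ennreal_suminf_cmult
      by (subst suminf_ennreal_eq[OF zero_le_power power_half_series]) auto
    finally show "outer (A \<inter> ?U) + outer (A - ?U) \<le> (\<Sum>k. ennreal (L (F k))) + ennreal e" .
  qed
qed

text \<open>Caratheodory's construction gives the measure, open sets being positivity sets of a
  distance function. For the integral, only the inequality
  \<open>(\<integral>y. f y \<partial>\<eta>) \<le> L f\<close> for \<open>f\<close> between 0 and 1
  needs an argument: applied to \<open>1 - f\<close> it gives the reverse one, and affine rescaling
  reaches all continuous \<open>f\<close>.\<close>

theorem Riesz_representation:
  obtains \<eta> where "prob_space \<eta>" "sets \<eta> = sets (restrict_space borel Y)"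
    "\<And>f. continuous_on Y f \<Longrightarrow> (\<integral>y. f y \<partial>\<eta>) = L f"
proof -
  interpret P: sigma_algebra Y "Pow Y" by (rule sigma_algebra_Pow)
  let ?L = "lambda_system Y (Pow Y) outer"
  have ms: "measure_space Y ?L outer"
    by (rule P.caratheodory_lemma[OF outer_measure_space_outer])
  then interpret LS: sigma_algebra Y ?L by (simp add: measure_space_def)
  have oms: "outer (A \<union> B) \<le> outer A + outer B" if "A \<subseteq> Y" "B \<subseteq> Y" "A \<inter> B = {}" for A B
    using P.countably_subadditive_subadditive[of outer] outer_measure_space_outer that
    unfolding outer_measure_space_def subadditive_def by simp
  have pos_in: "{y\<in>Y. 0 < u y} \<in> ?L" if u: "continuous_on Y u" for u :: "'y \<Rightarrow> real"
    unfolding P.lambda_system_eq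
  proof (intro CollectI conjI ballI)
    show "{y\<in>Y. 0 < u y} \<in> Pow Y" by auto
    fix A assume A: "A \<in> Pow Y"
    have "outer A \<le> outer (A \<inter> {y\<in>Y. 0 < u y}) + outer (A - {y\<in>Y. 0 < u y})"
      using oms[of "A \<inter> {y\<in>Y. 0 < u y}" "A - {y\<in>Y. 0 < u y}"] A by (force simp: Int_Diff_Un)
    then show "outer (A \<inter> {y\<in>Y. 0 < u y}) + outer (A - {y\<in>Y. 0 < u y}) = outer A"
      using outer_split[OF u, of A] A by (auto intro: antisym)
  qed
  \<comment> \<open>The whole space is treated apart since \<open>infdist\<close> from the empty set
    is 0.\<close>
  have open_in: "T \<inter> Y \<in> ?L" if T: "open T" for T
  proof (cases "T = UNIV")
    case True then show ?thesis using LS.top by simp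
  next
    case False
    let ?u = "\<lambda>y. infdist y (- T)"
    have "- T \<noteq> {}" using False by auto
    then have "infdist y (- T) = 0 \<longleftrightarrow> y \<notin> T" for y
      using in_closed_iff_infdist_zero[of "- T" y] T by auto
    then have "{y\<in>Y. 0 < ?u y} = T \<inter> Y"
      using infdist_nonneg[of _ "- T"] by (auto simp: less_le)
    moreover have "continuous_on Y ?u" by (intro continuous_intros)
    ultimately show ?thesis using pos_in by metis
  qed
  have sub: "sets (restrict_space borel Y) \<subseteq> ?L"
  proof -
    have "sets (restrict_space borel Y) = sigma_sets Y {T \<inter> Y |T. open T}"
      by (rule sets_restrict_borel)
    also have "\<dots> \<subseteq> ?L"
      by (rule LS.sigma_sets_subset) (use open_in in auto)
    finally show ?thesis .
  qed
  define \<eta> where "\<eta> = measure_of Y (sets (restrict_space borel Y)) outer"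
  have space_eq: "space (restrict_space borel Y) = Y" by (simp add: space_restrict_space)
  have sets: "sets \<eta> = sets (restrict_space borel Y)" and space: "space \<eta> = Y"
    unfolding \<eta>_def using sets.sigma_sets_eq[of "restrict_space borel Y"] sets.space_closed[of "restrict_space borel Y"]
    by (simp_all add: space_eq)
  have em: "emeasure \<eta> A = outer A" if "A \<in> sets \<eta>" for A
  proof (rule emeasure_measure_of[OF \<eta>_def])
    show "sets (restrict_space borel Y) \<subseteq> Pow Y" using sets.space_closed[of "restrict_space borel Y"] by (simp add: space_eq)
    show "A \<in> sets \<eta>" by fact
    show "positive (sets \<eta>) outer" by (simp add: positive_def outer_empty)
    show "countably_additive (sets \<eta>) outer"
      using ms sub unfolding measure_space_def countably_additive_def sets by blast
  qed
  have prob: "prob_space \<eta>"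
    by (rule prob_spaceI) (metis em outer_space sets.top space)
  interpret prob_space \<eta> by fact
  have meas: "f \<in> borel_measurable \<eta>" if "continuous_on Y f" for f :: "'y \<Rightarrow> real"
    using borel_measurable_continuous_on_restrict[OF that] sets by (simp cong: measurable_cong_sets)
  have bdd: "\<exists>B. \<forall>y\<in>Y. \<bar>f y\<bar> \<le> B" if "continuous_on Y f" for f :: "'y \<Rightarrow> real"
    using compact_imp_bounded[OF compact_continuous_image[OF that compact]]
    by (auto simp: bounded_iff)
  have int: "integrable \<eta> f" if f: "continuous_on Y f" for f :: "'y \<Rightarrow> real"
  proof -
    obtain B where "\<forall>y\<in>Y. \<bar>f y\<bar> \<le> B" using bdd[OF f] by blast
    then show ?thesis using meas[OF f] space by (intro integrable_const_bound[of f B]) auto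
  qed
  have le1: "(\<integral>y. f y \<partial>\<eta>) \<le> L f" if f: "continuous_on Y f" and f01: "\<And>y. y \<in> Y \<Longrightarrow> 0 \<le> f y \<and> f y \<le> 1" for f
  proof (rule field_le_epsilon)
    fix e :: real assume e: "e > 0"
    obtain n :: nat where n: "n > 0" "1 / real n < e" using real_arch_inverse[THEN iffD1, OF e] by (auto simp: inverse_eq_divide)
    \<comment> \<open>The \<open>j\<close>-th horizontal slice of \<open>f\<close>, of height
      \<open>1 / n\<close>. Where \<open>f \<ge> (j + 1) / n\<close> the slice is full, so
      \<open>n * g j\<close> dominates the indicator of that set and \<open>L\<close> bounds its
      measure.\<close>
    define g where "g = (\<lambda>j y. min (max (f y - real j / n) 0) (1 / n))"
    have cg: "continuous_on Y (g j)" for j unfolding g_def by (intro continuous_intros f)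
    have sumg: "(\<Sum>j<m. g j y) = min (f y) (real m / n)" if y: "y \<in> Y" for y m
    proof (induction m)
      case 0 then show ?case using f01[OF y] by simp
    next
      case (Suc m)
      define a d where "a = real m / n" and "d = 1 / real n"
      have "d > 0" using n by (simp add: d_def)
      have "(\<Sum>j<Suc m. g j y) = min (f y) a + min (max (f y - a) 0) d"
        using Suc by (simp add: g_def a_def d_def)
      also have "\<dots> = min (f y) (a + d)" using \<open>d > 0\<close> by (auto simp: min_def max_def)
      also have "a + d = real (Suc m) / n" by (simp add: a_def d_def add_divide_distrib)
      finally show ?case .
    qed
    let ?E = "\<lambda>j. {y\<in>Y. real (Suc j) / n \<le> f y}"
    have E: "?E j \<in> sets \<eta>" for j
      using meas[OF f] unfolding space[symmetric] by measurable
    have mE: "measure \<eta> (?E j) \<le> n * L (g j)" for j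
    proof -
      have "outer (?E j) \<le> ennreal (L (\<lambda>y. n * g j y))"
      proof (rule outer_le_single)
        show "continuous_on Y (\<lambda>y. n * g j y)" by (intro continuous_intros cg)
        show "0 \<le> real n * g j y" for y by (simp add: g_def)
        show "1 \<le> real n * g j y" if y: "y \<in> ?E j" for y
        proof -
          have "1 / n \<le> f y - real j / n" using y by (simp add: add_divide_distrib)
          then have "g j y = 1 / n" by (simp add: g_def)
          then show ?thesis using n by simp
        qed
      qed
      then have "ennreal (measure \<eta> (?E j)) \<le> ennreal (n * L (g j))"
        using em[OF E] L_scale[OF cg] by (simp add: emeasure_eq_measure)
      moreover have "0 \<le> n * L (g j)" by (intro mult_nonneg_nonneg pos cg) (auto simp: g_def)
      ultimately show ?thesis by simp
    qed
    \<comment> \<open>Slice \<open>j + 1\<close> is nonzero only where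
      \<open>f > (j + 1) / n\<close>, so the indicators, shifted by one, dominate all slices but the
      lowest; that one accounts for the extra \<open>1 / n\<close>.\<close>
    have "f y \<le> (\<Sum>j<n. (1 / n) * indicator (?E j) y) + 1 / n" if y: "y \<in> Y" for y
    proof -
      have "f y = (\<Sum>j<n. g j y)" using sumg[OF y, of n] f01[OF y] n by simp
      also have "\<dots> = g 0 y + (\<Sum>j<n-1. g (Suc j) y)"
        using n sum.lessThan_Suc_shift[of "\<lambda>j. g j y" "n - 1"] by simp
      also have "g 0 y \<le> 1 / n" by (simp add: g_def)
      also have "(\<Sum>j<n-1. g (Suc j) y) \<le> (\<Sum>j<n-1. (1 / n) * indicator (?E j) y)"
        using y n by (intro sum_mono) (auto simp: g_def indicator_def)
      also have "\<dots> \<le> (\<Sum>j<n. (1 / n) * indicator (?E j) y)"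
        by (intro sum_mono2) (auto simp: indicator_def)
      finally show ?thesis by simp
    qed
    moreover have intE: "integrable \<eta> (\<lambda>y. (1 / n) * indicator (?E j) y :: real)" for j
      using E by (intro integrable_mult_right integrable_real_indicator) (auto simp: emeasure_eq_measure)
    then have intS: "integrable \<eta> (\<lambda>y. \<Sum>j<n. (1 / n) * indicator (?E j) y :: real)"
      by (intro Bochner_Integration.integrable_sum)
    then have "integrable \<eta> (\<lambda>y. (\<Sum>j<n. (1 / n) * indicator (?E j) y) + 1 / n)"
      by (intro Bochner_Integration.integrable_add) auto
    ultimately have "(\<integral>y. f y \<partial>\<eta>) \<le> (\<integral>y. (\<Sum>j<n. (1 / n) * indicator (?E j) y) + 1 / n \<partial>\<eta>)"
      using int[OF f] space by (intro integral_mono) blast+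
    also have "\<dots> = (\<integral>y. (\<Sum>j<n. (1 / n) * indicator (?E j) y) \<partial>\<eta>) + 1 / n"
      by (subst Bochner_Integration.integral_add[OF intS]) (simp_all add: prob_space)
    also have "(\<integral>y. (\<Sum>j<n. (1 / n) * indicator (?E j) y) \<partial>\<eta>) = (\<Sum>j<n. (1 / n) * measure \<eta> (?E j))"
      by (subst Bochner_Integration.integral_sum[OF intE]) (use E in simp)
    also have "(\<Sum>j<n. (1 / n) * measure \<eta> (?E j)) + 1 / n \<le> (\<Sum>j<n. L (g j)) + 1 / n"
      using mE n by (intro add_right_mono sum_mono) (simp add: field_simps)
    also have "(\<Sum>j<n. L (g j)) = L (\<lambda>y. \<Sum>j<n. g j y)" by (rule L_sum[symmetric]) (auto intro: cg)
    also have "L (\<lambda>y. \<Sum>j<n. g j y) \<le> L f"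
      using sumg f by (intro L_mono continuous_on_sum cg) auto
    finally show "(\<integral>y. f y \<partial>\<eta>) \<le> L f + e" using n by simp
  qed
  have eq1: "(\<integral>y. f y \<partial>\<eta>) = L f" if f: "continuous_on Y f" and f01: "\<And>y. y \<in> Y \<Longrightarrow> 0 \<le> f y \<and> f y \<le> 1" for f
  proof (rule antisym[OF le1[OF f f01]])
    have "(\<integral>y. 1 - f y \<partial>\<eta>) \<le> L (\<lambda>y. 1 - f y)"
      using f01 by (intro le1 continuous_intros f) auto
    then show "L f \<le> (\<integral>y. f y \<partial>\<eta>)"
      using int[OF f] L_diff[of "\<lambda>_. 1" f] f one by (simp add: prob_space)
  qed
  have "(\<integral>y. f y \<partial>\<eta>) = L f" if f: "continuous_on Y f" for f
  proof -
    obtain B where B: "\<forall>y\<in>Y. \<bar>f y\<bar> \<le> B" using bdd[OF f] by blast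
    define C where "C = max B 1"
    have C: "C > 0" "\<forall>y\<in>Y. \<bar>f y\<bar> \<le> C" using B by (auto simp: C_def)
    let ?h = "\<lambda>y. (1 / (2 * C)) * f y + (1 / 2) * 1"
    have "(\<integral>y. ?h y \<partial>\<eta>) = L ?h"
      using C by (intro eq1 continuous_intros f) (auto simp: field_simps abs_le_iff)
    moreover have "(\<integral>y. ?h y \<partial>\<eta>) = (1 / (2 * C)) * (\<integral>y. f y \<partial>\<eta>) + 1 / 2"
      using int[OF f] by (subst Bochner_Integration.integral_add) (auto simp: prob_space)
    moreover have "L ?h = (1 / (2 * C)) * L f + (1 / 2) * 1"
      using combination[OF f, of "\<lambda>_. 1" "1 / (2 * C)" "1 / 2"] one by simp
    ultimately show ?thesis using C by simp
  qed
  then show ?thesis using that[OF prob sets] by blast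
qed

end


text \<open>The functional on a subspace is given as a linear relation \<open>R\<close> between
  functions and values; applied to differences, \<open>pos\<close> makes it single-valued. The
  infimum of the values of majorants in \<open>R\<close> is sublinear, and the Hahn-Banach theorem
  at \<open>\<phi>\<close> yields a linear functional below it with equality at
  \<open>\<phi>\<close>. Being below it forces both positivity and agreement with \<open>R\<close>.
  The equality is the point: it turns knowledge about all representing measures into the existence
  of good majorants.\<close>

theorem extend_to_measure:
  fixes Y :: "'y::metric_space set" and R :: "(('y \<Rightarrow> real) \<times> real) set"
  assumes Y: "compact Y"
    and cont: "\<And>r a. (r, a) \<in> R \<Longrightarrow> continuous_on Y r"
    and lin: "\<And>r a s b \<alpha> \<beta>. (r, a) \<in> R \<Longrightarrow> (s, b) \<in> R \<Longrightarrow> (\<lambda>y. \<alpha> * r y + \<beta> * s y, \<alpha> * a + \<beta> * b) \<in> R"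
    and one: "((\<lambda>_. 1), 1) \<in> R"
    and pos: "\<And>r a. (r, a) \<in> R \<Longrightarrow> (\<And>y. y \<in> Y \<Longrightarrow> 0 \<le> r y) \<Longrightarrow> 0 \<le> a"
    and \<phi>: "continuous_on Y \<phi>"
  obtains \<eta> where "prob_space \<eta>" "sets \<eta> = sets (restrict_space borel Y)"
    "\<And>r a. (r, a) \<in> R \<Longrightarrow> (\<integral>y. r y \<partial>\<eta>) = a"
    "(\<integral>y. \<phi> y \<partial>\<eta>) = Inf {a. \<exists>r. (r, a) \<in> R \<and> (\<forall>y\<in>Y. \<phi> y \<le> r y)}"
proof -
  define V where "V = {f :: 'y \<Rightarrow> real. continuous_on Y f}"
  define D where "D = (\<lambda>\<psi>. {a. \<exists>r. (r, a) \<in> R \<and> (\<forall>y\<in>Y. \<psi> y \<le> r y)})"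
  define S where "S = (\<lambda>\<psi>. Inf (D \<psi>))"
  have V: "function_space V" by (auto simp: function_space_def V_def intro!: continuous_intros)
  have const: "(\<lambda>_. c, c) \<in> R" for c using lin[OF one one, of c 0] by simp
  have scale: "(\<lambda>y. c * r y, c * a) \<in> R" if "(r, a) \<in> R" for c r a using lin[OF that that, of c 0] by simp
  have bound: "\<exists>B. B \<in> D \<psi> \<and> (\<forall>a\<in>D \<psi>. - B \<le> a)" if \<psi>: "\<psi> \<in> V" for \<psi>
  proof -
    have "bounded (\<psi> ` Y)" using \<psi> Y by (auto simp: V_def intro!: compact_imp_bounded compact_continuous_image)
    then obtain B where B: "\<And>y. y \<in> Y \<Longrightarrow> \<bar>\<psi> y\<bar> \<le> B" by (auto simp: bounded_iff)
    have "B \<in> D \<psi>" unfolding D_def using const[of B] B by (force simp: abs_le_iff)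
    moreover have "- B \<le> a" if aD: "a \<in> D \<psi>" for a
    proof -
      obtain r where r: "(r, a) \<in> R" "\<And>y. y \<in> Y \<Longrightarrow> \<psi> y \<le> r y" using aD unfolding D_def by blast
      have "0 \<le> 1 * a + 1 * B"
      proof (rule pos[OF lin[OF r(1) const]])
        show "0 \<le> 1 * r y + 1 * B" if "y \<in> Y" for y using r(2)[OF that] B[OF that] by simp
      qed
      then show ?thesis by simp
    qed
    ultimately show ?thesis by blast
  qed
  have ne: "D \<psi> \<noteq> {}" and bdd: "bdd_below (D \<psi>)" if "\<psi> \<in> V" for \<psi>
    using bound[OF that] by (auto simp: bdd_below_def)
  have S_le: "S \<psi> \<le> a" if "\<psi> \<in> V" "a \<in> D \<psi>" for \<psi> a
    unfolding S_def using that bdd by (intro cInf_lower)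
  have S_ge: "z \<le> S \<psi>" if "\<psi> \<in> V" "\<And>a. a \<in> D \<psi> \<Longrightarrow> z \<le> a" for \<psi> z
    unfolding S_def using that ne by (intro cInf_greatest)
  have S_R: "S r \<le> a" if "(r, a) \<in> R" for r a
    using that cont[OF that] by (intro S_le) (auto simp: V_def D_def)
  have S_scale: "S (\<lambda>x. a * f x) \<le> a * S f" if f: "f \<in> V" and a: "a > 0" for f a
  proof -
    have "S (\<lambda>x. a * f x) / a \<le> S f"
    proof (rule S_ge[OF f])
      fix b assume "b \<in> D f"
      then obtain r where r: "(r, b) \<in> R" "\<And>y. y \<in> Y \<Longrightarrow> f y \<le> r y" unfolding D_def by blast
      have "a * b \<in> D (\<lambda>x. a * f x)" unfolding D_def using scale[OF r(1), of a] r(2) a by (auto intro!: exI)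
      then show "S (\<lambda>x. a * f x) / a \<le> b"
        using S_le[OF function_space_scale[OF V f]] a by (simp add: field_simps)
    qed
    then show ?thesis using a by (simp add: field_simps)
  qed
  have S: "sublinear_on V S"
    unfolding sublinear_on_def
  proof (intro conjI ballI allI impI)
    fix f g assume f: "f \<in> V" and g: "g \<in> V"
    have "S (\<lambda>x. f x + g x) - S g \<le> S f"
    proof (rule S_ge[OF f])
      fix a assume "a \<in> D f"
      then obtain r where r: "(r, a) \<in> R" "\<And>y. y \<in> Y \<Longrightarrow> f y \<le> r y" unfolding D_def by blast
      have "S (\<lambda>x. f x + g x) - a \<le> S g"
      proof (rule S_ge[OF g])
        fix b assume "b \<in> D g"
        then obtain s where s: "(s, b) \<in> R" "\<And>y. y \<in> Y \<Longrightarrow> g y \<le> s y" unfolding D_def by blast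
        have "1 * a + 1 * b \<in> D (\<lambda>x. f x + g x)"
          unfolding D_def using lin[OF r(1) s(1), of 1 1] r(2) s(2) by (auto intro!: exI add_mono)
        then show "S (\<lambda>x. f x + g x) - a \<le> b" using S_le[OF function_space_add[OF V f g]] by force
      qed
      then show "S (\<lambda>x. f x + g x) - S g \<le> a" by simp
    qed
    then show "S (\<lambda>x. f x + g x) \<le> S f + S g" by simp
  next
    fix f and a :: real assume f: "f \<in> V" and a: "a \<ge> 0"
    show "S (\<lambda>x. a * f x) = a * S f"
    proof (cases "a = 0")
      case True
      have "S (\<lambda>_. 0) = 0"
      proof (rule antisym[OF S_R[OF const[of 0]] S_ge])
        show "(\<lambda>_. 0) \<in> V" by (simp add: V_def)
        show "0 \<le> a" if "a \<in> D (\<lambda>_. 0)" for a using that pos by (auto simp: D_def)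
      qed
      with True show ?thesis by simp
    next
      case False
      with a have a: "a > 0" by simp
      have "S (\<lambda>x. inverse a * (a * f x)) \<le> inverse a * S (\<lambda>x. a * f x)"
        using a by (intro S_scale function_space_scale[OF V f]) auto
      then have "a * S f \<le> S (\<lambda>x. a * f x)" using a by (simp add: field_simps)
      with S_scale[OF f a] show ?thesis by simp
    qed
  qed
  have \<phi>V: "\<phi> \<in> V" using \<phi> by (simp add: V_def)
  obtain L where L: "linear_functional_on V L" "\<And>f. f \<in> V \<Longrightarrow> L f \<le> S f" "L \<phi> = S \<phi>"
    using Hahn_Banach_functions[OF V S \<phi>V] by blast
  have comb: "L (\<lambda>x. a * f x + b * g x) = a * L f + b * L g" if "f \<in> V" "g \<in> V" for f g :: "'y \<Rightarrow> real" and a b :: real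
    using L(1) that by (simp add: linear_functional_on_def)
  have neg: "L (\<lambda>x. - f x) = - L f" if "f \<in> V" for f :: "'y \<Rightarrow> real"
    using comb[OF that that, of "-1" 0] by simp
  have LR: "L r = a" if r: "(r, a) \<in> R" for r a
  proof (rule antisym)
    have rV: "r \<in> V" using cont[OF r] by (simp add: V_def)
    show "L r \<le> a" using L(2)[OF rV] S_R[OF r] by simp
    have "- L r \<le> S (\<lambda>x. - r x)"
      using L(2)[of "\<lambda>x. - r x"] neg[OF rV] rV by (simp add: V_def continuous_on_minus)
    also have "\<dots> \<le> - a" using S_R[OF scale[OF r, of "-1"]] by simp
    finally show "a \<le> L r" by simp
  qed
  interpret compact_functional Y L
  proof
    show "compact Y" by fact
    show "L (\<lambda>x. a * f x + b * g x) = a * L f + b * L g"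
      if "continuous_on Y f" "continuous_on Y g" for f g :: "'y \<Rightarrow> real" and a b :: real
      using comb that by (simp add: V_def)
    show "L (\<lambda>_. 1) = 1" by (rule LR[OF one])
    fix f :: "'y \<Rightarrow> real" assume f: "continuous_on Y f" "\<And>y. y \<in> Y \<Longrightarrow> 0 \<le> f y"
    then have fV: "f \<in> V" "(\<lambda>x. - f x) \<in> V" by (auto simp: V_def continuous_on_minus)
    have "0 \<in> D (\<lambda>x. - f x)" unfolding D_def using const[of 0] f(2) by (auto intro!: exI)
    then show "0 \<le> L f" using L(2)[OF fV(2)] neg[OF fV(1)] S_le[OF fV(2)] by force
  qed
  show ?thesis
  proof (rule Riesz_representation)
    fix \<eta> assume "prob_space \<eta>" "sets \<eta> = sets (restrict_space borel Y)"
      "\<And>f. continuous_on Y f \<Longrightarrow> (\<integral>y. f y \<partial>\<eta>) = L f"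
    then show ?thesis using LR cont \<phi> L(3) by (intro that[of \<eta>]) (simp_all add: S_def D_def)
  qed
qed

subsection \<open>Measures determined by a lattice of functions\<close>

definition function_lattice :: "('z \<Rightarrow> real) set \<Rightarrow> bool" where
  "function_lattice D \<longleftrightarrow> (\<forall>c. (\<lambda>_. c) \<in> D) \<and>
     (\<forall>u\<in>D. \<forall>v\<in>D. \<forall>a b. (\<lambda>z. a * u z + b * v z) \<in> D) \<and>
     (\<forall>u\<in>D. \<forall>v\<in>D. (\<lambda>z. min (u z) (v z)) \<in> D \<and> (\<lambda>z. max (u z) (v z)) \<in> D)"

text \<open>The cozero sets of the family, described without a topology. On \<open>X\<close> and on
  the projectivized bundle, neither of which comes with a metric, they replace the open sets:
  generation of the Borel sets, measurability and uniqueness of measures are all tested on functions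
  of \<open>D\<close>.\<close>

definition positivity_sets :: "'z set \<Rightarrow> ('z \<Rightarrow> real) set \<Rightarrow> 'z set set" where
  "positivity_sets \<Omega> D = {{z\<in>\<Omega>. 0 < u z} |u. u \<in> D}"

lemma function_latticeD:
  assumes "function_lattice D"
  shows "(\<lambda>_. c) \<in> D" "u \<in> D \<Longrightarrow> v \<in> D \<Longrightarrow> (\<lambda>z. a * u z + b * v z) \<in> D"
    "u \<in> D \<Longrightarrow> v \<in> D \<Longrightarrow> (\<lambda>z. min (u z) (v z)) \<in> D"
    "u \<in> D \<Longrightarrow> v \<in> D \<Longrightarrow> (\<lambda>z. max (u z) (v z)) \<in> D"
  using assms by (auto simp: function_lattice_def)

lemma function_lattice_continuous_on: "function_lattice {g. continuous_on X g}"
  by (auto simp: function_lattice_def intro!: continuous_intros)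

lemma positivity_sets_subset: "positivity_sets \<Omega> D \<subseteq> Pow \<Omega>"
  by (auto simp: positivity_sets_def)

lemma positivity_setsI: "u \<in> D \<Longrightarrow> {z\<in>\<Omega>. 0 < u z} \<in> positivity_sets \<Omega> D"
  by (auto simp: positivity_sets_def)

lemma positivity_sets_space:
  assumes "sets M = sigma_sets \<Omega> (positivity_sets \<Omega> D)"
  shows "space M = \<Omega>"
  using sets_eq_imp_space_eq[of M "measure_of \<Omega> (positivity_sets \<Omega> D) (\<lambda>_. 0)"] assms
  by (simp add: sets_measure_of[OF positivity_sets_subset] space_measure_of[OF positivity_sets_subset])

lemma function_lattice_measurable:
  assumes D: "function_lattice D" and u: "u \<in> D"
    and M: "sets M = sigma_sets \<Omega> (positivity_sets \<Omega> D)"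
  shows "u \<in> borel_measurable M"
  unfolding borel_measurable_iff_greater
proof
  fix a
  have sp: "space M = \<Omega>" by (rule positivity_sets_space[OF M])
  have "(\<lambda>z. 1 * u z + (- a) * 1) \<in> D"
    using function_latticeD(2)[OF D u function_latticeD(1)[OF D, of 1], of 1 "- a"] by simp
  then have "{z\<in>\<Omega>. 0 < 1 * u z + (- a) * 1} \<in> positivity_sets \<Omega> D"
    by (rule positivity_setsI)
  moreover have "{z\<in>\<Omega>. 0 < 1 * u z + (- a) * 1} = {w \<in> space M. a < u w}" by (auto simp: sp)
  ultimately show "{w \<in> space M. a < u w} \<in> sets M" using M by auto
qed

lemma positivity_measurable:
  assumes "sets N = sigma_sets \<Omega> (positivity_sets \<Omega> D)"
    and "\<And>x. x \<in> space M \<Longrightarrow> h x \<in> \<Omega>"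
    and "\<And>u. u \<in> D \<Longrightarrow> (\<lambda>x. u (h x)) \<in> borel_measurable M"
  shows "h \<in> measurable M N"
proof -
  have "h \<in> measurable M (measure_of \<Omega> (positivity_sets \<Omega> D) (\<lambda>_. 0))"
  proof (rule measurable_measure_of[OF positivity_sets_subset])
    show "h \<in> space M \<rightarrow> \<Omega>" using assms(2) by auto
    fix A assume "A \<in> positivity_sets \<Omega> D"
    then obtain u where u: "u \<in> D" "A = {z\<in>\<Omega>. 0 < u z}" by (auto simp: positivity_sets_def)
    have "h -` A \<inter> space M = {x\<in>space M. 0 < u (h x)}" using u assms(2) by auto
    also have "\<dots> \<in> sets M" using assms(3)[OF u(1)] by measurable
    finally show "h -` A \<inter> space M \<in> sets M" .
  qed
  also have "sets (measure_of \<Omega> (positivity_sets \<Omega> D) (\<lambda>_. 0)) = sets N"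
    unfolding assms(1) by (rule sets_measure_of[OF positivity_sets_subset])
  then have "measurable M (measure_of \<Omega> (positivity_sets \<Omega> D) (\<lambda>_. 0)) = measurable M N"
    by (intro measurable_cong_sets) auto
  finally show ?thesis .
qed

text \<open>Positivity sets are stable under intersection by \<open>min\<close>, and the indicator
  of such a set is the limit of the functions \<open>w n\<close>, which belong to the
  lattice.\<close>

lemma measure_eqI_function_lattice:
  assumes D: "function_lattice D"
    and M: "prob_space M" "sets M = sigma_sets \<Omega> (positivity_sets \<Omega> D)"
    and N: "prob_space N" "sets N = sigma_sets \<Omega> (positivity_sets \<Omega> D)"
    and eq: "\<And>u. u \<in> D \<Longrightarrow> (\<integral>z. u z \<partial>M) = (\<integral>z. u z \<partial>N)"
  shows "M = N"
proof (rule measure_eqI_generator_eq[where A="\<lambda>_::nat. \<Omega>" and \<Omega>=\<Omega> and E="positivity_sets \<Omega> D"])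
  show "positivity_sets \<Omega> D \<subseteq> Pow \<Omega>" by (rule positivity_sets_subset)
  show "Int_stable (positivity_sets \<Omega> D)"
  proof (rule Int_stableI)
    fix A B assume "A \<in> positivity_sets \<Omega> D" "B \<in> positivity_sets \<Omega> D"
    then obtain u v where uv: "u \<in> D" "v \<in> D" "A = {z\<in>\<Omega>. 0 < u z}" "B = {z\<in>\<Omega>. 0 < v z}"
      by (auto simp: positivity_sets_def)
    have "A \<inter> B = {z\<in>\<Omega>. 0 < min (u z) (v z)}" using uv by auto
    also have "\<dots> \<in> positivity_sets \<Omega> D"
      by (intro positivity_setsI function_latticeD(3)[OF D] uv)
    finally show "A \<inter> B \<in> positivity_sets \<Omega> D" .
  qed
  have "\<Omega> = {z\<in>\<Omega>. 0 < (1::real)}" by simp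
  then show "range (\<lambda>_::nat. \<Omega>) \<subseteq> positivity_sets \<Omega> D"
    using positivity_setsI[OF function_latticeD(1)[OF D, of 1]] by (metis image_subset_iff)
  show "emeasure M \<Omega> \<noteq> \<infinity>" for i
    using M(1) by (simp add: prob_space_def finite_measure.finite_emeasure_space finite_measure.emeasure_finite)
  fix A assume "A \<in> positivity_sets \<Omega> D"
  then obtain u where u: "u \<in> D" and A: "A = {z\<in>\<Omega>. 0 < u z}" by (auto simp: positivity_sets_def)
  \<comment> \<open>The summand \<open>0 * 0\<close> gives the expression literally the shape
    \<open>a * u z + b * v z\<close> of the closure rule for \<open>D\<close>.\<close>
  define w where "w = (\<lambda>n::nat. \<lambda>z. min 1 (real n * max 0 (u z) + 0 * 0))"
  have wD: "w n \<in> D" for n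
    unfolding w_def by (intro function_latticeD(3)[OF D function_latticeD(1)[OF D]]
        function_latticeD(2)[OF D function_latticeD(4)[OF D function_latticeD(1)[OF D] u] function_latticeD(1)[OF D]])
  have lim: "(\<lambda>n. \<integral>z. w n z \<partial>K) \<longlonglongrightarrow> measure K A"
    if K: "prob_space K" "sets K = sigma_sets \<Omega> (positivity_sets \<Omega> D)" for K
  proof -
    interpret prob_space K by fact
    have sp: "space K = \<Omega>" by (rule positivity_sets_space[OF K(2)])
    have AK: "A \<in> sets K" using K(2) \<open>A \<in> positivity_sets \<Omega> D\<close> by auto
    have "(\<lambda>n. \<integral>z. w n z \<partial>K) \<longlonglongrightarrow> (\<integral>z. indicator A z \<partial>K)"
    proof (rule integral_dominated_convergence[where w="\<lambda>_. 1"])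
      show "(indicator A :: _ \<Rightarrow> real) \<in> borel_measurable K" using AK by simp
      show "w n \<in> borel_measurable K" for n by (rule function_lattice_measurable[OF D wD K(2)])
      show "AE z in K. norm (w n z) \<le> 1" for n by (rule AE_I2) (auto simp: w_def)
      show "AE z in K. (\<lambda>n. w n z) \<longlonglongrightarrow> indicator A z"
      proof (rule AE_I2)
        fix z assume z: "z \<in> space K"
        show "(\<lambda>n. w n z) \<longlonglongrightarrow> indicator A z"
        proof (cases "0 < u z")
          case True
          have "\<forall>\<^sub>F n in sequentially. 1 / u z \<le> real n"
            using eventually_ge_at_top[of "nat \<lceil>1 / u z\<rceil>"] by eventually_elim linarith
          then have "\<forall>\<^sub>F n in sequentially. w n z = indicator A z"
            by eventually_elim (use True z in \<open>auto simp: w_def field_simps A sp\<close>)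
          then show ?thesis by (rule tendsto_eventually)
        next
          case False
          then show ?thesis by (simp add: w_def A)
        qed
      qed
    qed simp
    then show ?thesis using AK by simp
  qed
  have "measure M A = measure N A"
    using LIMSEQ_unique[OF lim[OF M]] lim[OF N] eq[OF wD] by simp
  then show "emeasure M A = emeasure N A"
    using M(1) N(1) by (simp add: prob_space_def finite_measure.emeasure_eq_measure)
qed (use assms in simp_all)

subsection \<open>Fekete's lemma\<close>

lemma Fekete:
  fixes a :: "nat \<Rightarrow> real"
  assumes sub: "\<And>m n. a (m + n) \<le> a m + a n" and low: "\<And>n. - C * real n \<le> a n"
  obtains l where "(\<lambda>n. a n / real n) \<longlonglongrightarrow> l" "\<And>n. n \<ge> 1 \<Longrightarrow> l \<le> a n / real n"
proof -
  define l where "l = (INF n\<in>{1..}. a n / real n)"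
  have bdd: "bdd_below ((\<lambda>n. a n / real n) ` {1..})"
    using low by (intro bdd_belowI2[of _ "- C"]) (simp add: field_simps)
  have le: "l \<le> a n / real n" if "n \<ge> 1" for n
    unfolding l_def using that by (intro cINF_lower bdd) auto
  \<comment> \<open>The term \<open>a 0\<close> has to be carried along, since subadditivity only
    gives \<open>a 0 \<ge> 0\<close>.\<close>
  have mult: "a (k * m) \<le> real k * a m + a 0" for k m
  proof (induction k)
    case (Suc k)
    have "a (m + k * m) \<le> a m + a (k * m)" by (rule sub)
    with Suc show ?case by (simp add: algebra_simps)
  qed simp
  have "(\<lambda>n. a n / real n) \<longlonglongrightarrow> l"
  proof (rule LIMSEQ_I)
    fix e :: real assume e: "e > 0"
    have "\<exists>m\<in>{1..}. a m / real m < l + e / 2"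
      using cINF_less_iff[OF _ bdd, of "l + e / 2"] e unfolding l_def by auto
    then obtain m where m: "m \<ge> 1" "a m / real m < l + e / 2" by auto
    \<comment> \<open>All errors of dividing \<open>n\<close> by \<open>m\<close>, bounded uniformly
      in \<open>n\<close>: the value at 0, the value at the remainder, and the slope lost on fewer
      than \<open>m\<close> steps.\<close>
    define B where "B = \<bar>a 0\<bar> + (\<Sum>r<m. \<bar>a r\<bar>) + real m * \<bar>a m / real m\<bar>"
    have "B \<ge> 0" unfolding B_def by (intro add_nonneg_nonneg sum_nonneg) auto
    obtain N :: nat where N: "real N > 2 * B / e" using reals_Archimedean2 by blast
    have "norm (a n / real n - l) < e" if n: "n \<ge> max 1 N" for n
    proof -
      let ?k = "n div m" and ?r = "n mod m"
      have r: "?r < m" using m by simp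
      have "a n = a (?k * m + ?r)" by simp
      also have "\<dots> \<le> a (?k * m) + a ?r" by (rule sub)
      also have "\<dots> \<le> real ?k * a m + a 0 + a ?r" using mult by simp
      also have "a ?r \<le> \<bar>a ?r\<bar>" by simp
      also have "\<bar>a ?r\<bar> \<le> (\<Sum>r<m. \<bar>a r\<bar>)" using r by (intro member_le_sum) auto
      also have "real ?k * a m = (real n - real ?r) * (a m / real m)"
      proof -
        have "real n = real ?k * real m + real ?r" by (metis div_mult_mod_eq of_nat_add of_nat_mult)
        then show ?thesis using m by simp
      qed
      also have "(real n - real ?r) * (a m / real m) \<le> real n * (a m / real m) + real m * \<bar>a m / real m\<bar>"
      proof -
        have "- (real ?r * (a m / real m)) \<le> real ?r * \<bar>a m / real m\<bar>"
          by (metis abs_ge_minus_self abs_mult abs_of_nat)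
        also have "\<dots> \<le> real m * \<bar>a m / real m\<bar>" using r by (intro mult_right_mono) auto
        finally show ?thesis unfolding left_diff_distrib by linarith
      qed
      finally have "a n \<le> real n * (a m / real m) + B" unfolding B_def by linarith
      then have "a n / real n \<le> a m / real m + B / real n" using n by (simp add: field_simps)
      moreover have "B / real n < e / 2"
      proof -
        have "2 * B / e < real n" using N n by linarith
        then show ?thesis using e n by (simp add: field_simps)
      qed
      ultimately have "a n / real n < l + e" using m(2) by linarith
      with le[of n] n show ?thesis by simp
    qed
    then show "\<exists>N. \<forall>n\<ge>N. norm (a n / real n - l) < e" by blast
  qed
  then show ?thesis using that le by blast
qed

subsection \<open>Independent increments\<close>

abbreviation shifted :: "nat \<Rightarrow> (nat \<Rightarrow> 't) \<Rightarrow> nat \<Rightarrow> 't" where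
  "shifted n \<omega> \<equiv> \<lambda>i. \<omega> (i + n)"

locale iid_noise = prob_space p for p :: "'t measure"
begin

sublocale SS: sequence_space p
  by unfold_locales

abbreviation S :: "(nat \<Rightarrow> 't) measure" where "S \<equiv> seq_space p"

sublocale S: prob_space S
  unfolding seq_space_def by (rule SS.prob_space_axioms)

lemma space_S: "space S = UNIV \<rightarrow> space p"
  by (auto simp: seq_space_def space_PiM PiE_def)

lemma shift_measurable [measurable]: "shifted n \<in> measurable S S"
  unfolding seq_space_def by (rule measurable_PiM_single') (auto simp: space_PiM PiE_def)

lemma shift_in_space: "\<omega> \<in> space S \<Longrightarrow> shifted n \<omega> \<in> space S"
  by (auto simp: space_S)

lemma cons_measurable [measurable]: "(\<lambda>(t, \<omega>). case_nat t \<omega>) \<in> measurable (p \<Otimes>\<^sub>M S) S"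
  unfolding seq_space_def by simp

lemma cons_in_space: "t \<in> space p \<Longrightarrow> \<omega> \<in> space S \<Longrightarrow> case_nat t \<omega> \<in> space S"
  by (auto simp: space_S Pi_iff split: nat.split)

text \<open>Prefixing an independent letter preserves the product law. The independence of one step
  from the later ones is always used in this form.\<close>

lemma distr_cons: "distr (p \<Otimes>\<^sub>M S) S (\<lambda>(t, \<omega>). case_nat t \<omega>) = S"
  unfolding seq_space_def by (rule SS.PiM_iter)

lemma coordinate_measurable [measurable]: "(\<lambda>\<omega>. \<omega> i) \<in> measurable S p"
  unfolding seq_space_def by simp

lemma distr_coordinate: "distr S p (\<lambda>\<omega>. \<omega> i) = p"
  unfolding seq_space_def by (rule SS.PiM_component) simp

text \<open>The first coordinate of the noise is independent of the shifted noise.\<close>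

lemma integral_first_step:
  fixes G :: "(nat \<Rightarrow> 't) \<Rightarrow> (nat \<Rightarrow> 't) \<Rightarrow> real"
  assumes int: "integrable S (\<lambda>\<omega>. G \<omega> (shifted 1 \<omega>))"
    and dep: "\<And>\<omega> \<omega>' \<eta>. \<omega> \<in> space S \<Longrightarrow> \<omega>' \<in> space S \<Longrightarrow> \<eta> \<in> space S \<Longrightarrow> \<omega> 0 = \<omega>' 0 \<Longrightarrow> G \<omega> \<eta> = G \<omega>' \<eta>"
  shows "integrable S (\<lambda>\<omega>. \<integral>\<eta>. G \<omega> \<eta> \<partial>S)"
    and "(\<integral>\<omega>. G \<omega> (shifted 1 \<omega>) \<partial>S) = (\<integral>\<omega>. (\<integral>\<eta>. G \<omega> \<eta> \<partial>S) \<partial>S)"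
proof -
  interpret P: pair_sigma_finite p S ..
  \<comment> \<open>The inner integral depends on the first letter only, so Fubini is applied to the
    product of \<open>p\<close> and \<open>S\<close>, where the integrand is the given integrable
    function composed with prefixing.\<close>
  define k where "k = (\<lambda>t. \<integral>\<eta>. G (case_nat t \<eta>) \<eta> \<partial>S)"
  have meas: "(\<lambda>\<omega>. G \<omega> (shifted 1 \<omega>)) \<in> borel_measurable S" using int by simp
  have shift_cons: "shifted 1 (case_nat t \<eta>) = \<eta>" for t :: 't and \<eta> by simp
  have "integrable (distr (p \<Otimes>\<^sub>M S) S (\<lambda>(t, \<omega>). case_nat t \<omega>)) (\<lambda>\<omega>. G \<omega> (shifted 1 \<omega>))"
    using int by (simp add: distr_cons)
  then have intP: "integrable (p \<Otimes>\<^sub>M S) (\<lambda>(t, \<eta>). G (case_nat t \<eta>) \<eta>)"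
    by (subst (asm) integrable_distr_eq[OF cons_measurable meas]) (simp add: case_prod_beta')
  have k: "integrable p k" unfolding k_def using P.integrable_fst[OF intP] by simp
  have keq: "(\<integral>\<eta>. G \<omega> \<eta> \<partial>S) = k (\<omega> 0)" if "\<omega> \<in> space S" for \<omega>
    unfolding k_def
  proof (rule Bochner_Integration.integral_cong[OF refl])
    fix \<eta> assume "\<eta> \<in> space S"
    then show "G \<omega> \<eta> = G (case_nat (\<omega> 0) \<eta>) \<eta>"
      using that by (intro dep cons_in_space) (auto simp: space_S)
  qed
  have k0: "integrable S (\<lambda>\<omega>. k (\<omega> 0))"
    using k integrable_distr[OF coordinate_measurable[of 0], of k] by (simp add: distr_coordinate)
  show "integrable S (\<lambda>\<omega>. \<integral>\<eta>. G \<omega> \<eta> \<partial>S)"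
    using k0 keq by (subst Bochner_Integration.integrable_cong[OF refl keq]) auto
  have "(\<integral>\<omega>. G \<omega> (shifted 1 \<omega>) \<partial>S) = (\<integral>\<omega>. G \<omega> (shifted 1 \<omega>) \<partial>distr (p \<Otimes>\<^sub>M S) S (\<lambda>(t, \<omega>). case_nat t \<omega>))"
    by (simp add: distr_cons)
  also have "\<dots> = (\<integral>x. (case x of (t, \<eta>) \<Rightarrow> G (case_nat t \<eta>) \<eta>) \<partial>(p \<Otimes>\<^sub>M S))"
    by (subst integral_distr[OF cons_measurable meas]) (simp add: case_prod_beta')
  also have "\<dots> = (\<integral>t. k t \<partial>p)" unfolding k_def by (rule P.integral_fst[OF intP, symmetric])
  also have "\<dots> = (\<integral>t. k t \<partial>distr S p (\<lambda>\<omega>. \<omega> 0))" by (simp add: distr_coordinate)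
  also have "\<dots> = (\<integral>\<omega>. k (\<omega> 0) \<partial>S)" using k by (intro integral_distr) auto
  also have "\<dots> = (\<integral>\<omega>. (\<integral>\<eta>. G \<omega> \<eta> \<partial>S) \<partial>S)"
    by (rule Bochner_Integration.integral_cong) (simp_all add: keq)
  finally show "(\<integral>\<omega>. G \<omega> (shifted 1 \<omega>) \<partial>S) = (\<integral>\<omega>. (\<integral>\<eta>. G \<omega> \<eta> \<partial>S) \<partial>S)" .
qed

text \<open>A shift deletes the letter that \<open>distr_cons\<close> prefixes, so it preserves the
  law; the general case iterates this.\<close>

lemma distr_shift: "distr S S (shifted n) = S"
proof (induction n)
  case 0
  then show ?case by (simp add: distr_id2)
next
  case (Suc n)
  have one: "distr S S (shifted 1) = S"
  proof -
    have "distr S S (shifted 1) = distr (distr (p \<Otimes>\<^sub>M S) S (\<lambda>(t, \<omega>). case_nat t \<omega>)) S (shifted 1)"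
      by (simp add: distr_cons)
    also have "\<dots> = distr (p \<Otimes>\<^sub>M S) S (\<lambda>x. snd x)"
      by (subst distr_distr[OF shift_measurable cons_measurable]) (simp add: o_def case_prod_beta')
    also have "\<dots> = S"
    proof (rule measure_eqI)
      fix A assume "A \<in> sets (distr (p \<Otimes>\<^sub>M S) S (\<lambda>x. snd x))"
      then have A: "A \<in> sets S" by simp
      have "snd -` A \<inter> space (p \<Otimes>\<^sub>M S) = space p \<times> A"
        using sets.sets_into_space[OF A] by (auto simp: space_pair_measure)
      then show "emeasure (distr (p \<Otimes>\<^sub>M S) S (\<lambda>x. snd x)) A = emeasure S A"
        using A by (simp add: emeasure_distr S.emeasure_pair_measure_Times emeasure_space_1)
    qed simp
    finally show ?thesis .
  qed
  have "distr S S (shifted (Suc n)) = distr (distr S S (shifted n)) S (shifted 1)"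
    by (subst distr_distr[OF shift_measurable shift_measurable]) (simp add: o_def)
  then show ?case using Suc one by simp
qed

end

subsection \<open>Random dynamics and the skew product\<close>

locale random_dynamics = iid_noise p for p :: "'t measure" +
  fixes f :: "(nat \<Rightarrow> 't) \<Rightarrow> 'a::topological_space \<Rightarrow> 'a" and X :: "'a set"
  assumes f_measurable: "(\<lambda>(\<omega>, x). f \<omega> x) \<in> measurable (S \<Otimes>\<^sub>M restrict_space borel X) (restrict_space borel X)"
    and f_dep: "\<And>\<omega> \<omega>'. \<omega> \<in> space S \<Longrightarrow> \<omega>' \<in> space S \<Longrightarrow> \<omega> 0 = \<omega>' 0 \<Longrightarrow> f \<omega> = f \<omega>'"
begin

abbreviation RX :: "'a measure" where "RX \<equiv> restrict_space borel X"

lemma space_RX: "space RX = X"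
  by (simp add: space_restrict_space)

lemma f_in: "\<omega> \<in> space S \<Longrightarrow> x \<in> X \<Longrightarrow> f \<omega> x \<in> X"
  using measurable_space[OF f_measurable, of "(\<omega>, x)"] by (simp add: space_pair_measure space_RX)

lemma iterate_measurable:
  "(\<lambda>(\<omega>, x). random_iterate f n \<omega> x) \<in> measurable (S \<Otimes>\<^sub>M RX) RX"
proof (induction n)
  case 0
  then show ?case by (simp add: case_prod_beta')
next
  case (Suc n)
  have "(\<lambda>y. (shifted n (fst y), (\<lambda>(\<omega>, x). random_iterate f n \<omega> x) y)) \<in> measurable (S \<Otimes>\<^sub>M RX) (S \<Otimes>\<^sub>M RX)"
    using Suc by (intro measurable_Pair measurable_compose[OF measurable_fst shift_measurable])
  from measurable_compose[OF this f_measurable] show ?case by (simp add: case_prod_beta')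
qed

end

locale stationary_dynamics = random_dynamics p f X
  for p :: "'t measure" and f :: "(nat \<Rightarrow> 't) \<Rightarrow> 'a::topological_space \<Rightarrow> 'a" and X +
  fixes \<mu> :: "'a measure"
  assumes stationary: "\<mu> \<in> stationary_on p f X"
begin

sublocale mu: prob_space \<mu>
  using stationary by (simp add: stationary_on_def stationary_measures_def)

lemma sets_mu [measurable_cong]: "sets \<mu> = sets RX"
  using stationary by (simp add: stationary_on_def stationary_measures_def)

lemma space_mu: "space \<mu> = X"
  using sets_eq_imp_space_eq[OF sets_mu] by (simp add: space_RX)

lemma emeasure_stationary:
  "B \<in> sets \<mu> \<Longrightarrow> emeasure \<mu> B = (\<integral>\<^sup>+\<omega>. emeasure \<mu> (f \<omega> -` B \<inter> X) \<partial>S)"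
  using stationary unfolding stationary_on_def stationary_measures_def
  by (simp add: sets_mu space_RX)

sublocale P: pair_prob_space S \<mu> ..

lemma f_measurable_mu: "(\<lambda>(\<omega>, x). f \<omega> x) \<in> measurable (S \<Otimes>\<^sub>M \<mu>) \<mu>"
  using f_measurable measurable_cong_sets[OF sets_pair_measure_cong[OF refl sets_mu] sets_mu] by blast

lemma iterate_measurable_mu: "(\<lambda>(\<omega>, x). random_iterate f n \<omega> x) \<in> measurable (S \<Otimes>\<^sub>M \<mu>) \<mu>"
  using iterate_measurable measurable_cong_sets[OF sets_pair_measure_cong[OF refl sets_mu] sets_mu] by blast

lemma skew_measurable:
  "(\<lambda>(\<omega>, x). (shifted n \<omega>, random_iterate f n \<omega> x)) \<in> measurable (S \<Otimes>\<^sub>M \<mu>) (S \<Otimes>\<^sub>M \<mu>)"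
  using iterate_measurable_mu[of n] unfolding case_prod_beta'
  by (intro measurable_Pair measurable_compose[OF measurable_fst shift_measurable])

text \<open>The skew product preserves the product measure. On a rectangle
  \<open>A \<times> B\<close> the condition on the shifted noise concerns the later letters and the
  condition on \<open>f \<omega> x\<close> the first letter; independence separates the two, and
  stationarity of \<open>\<mu>\<close> identifies the second factor.\<close>

lemma distr_skew_one:
  "distr (S \<Otimes>\<^sub>M \<mu>) (S \<Otimes>\<^sub>M \<mu>) (\<lambda>(\<omega>, x). (shifted 1 \<omega>, f \<omega> x)) = S \<Otimes>\<^sub>M \<mu>"
proof (rule pair_measure_eqI[symmetric])
  show "sigma_finite_measure S" "sigma_finite_measure \<mu>" ..
  show "sets (S \<Otimes>\<^sub>M \<mu>) = sets (distr (S \<Otimes>\<^sub>M \<mu>) (S \<Otimes>\<^sub>M \<mu>) (\<lambda>(\<omega>, x). (shifted 1 \<omega>, f \<omega> x)))" by simp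
  fix A B assume A: "A \<in> sets S" and B: "B \<in> sets \<mu>"
  have T: "(\<lambda>(\<omega>, x). (shifted 1 \<omega>, f \<omega> x)) \<in> measurable (S \<Otimes>\<^sub>M \<mu>) (S \<Otimes>\<^sub>M \<mu>)"
    using f_measurable_mu unfolding case_prod_beta'
    by (intro measurable_Pair measurable_compose[OF measurable_fst shift_measurable])
  define m where "m = (\<lambda>\<omega>. measure \<mu> (f \<omega> -` B \<inter> X))"
  let ?Q = "(\<lambda>(\<omega>, x). f \<omega> x) -` B \<inter> space (S \<Otimes>\<^sub>M \<mu>)"
  have Q: "?Q \<in> sets (S \<Otimes>\<^sub>M \<mu>)" by (rule measurable_sets[OF f_measurable_mu B])
  have slice: "Pair \<omega> -` ?Q = f \<omega> -` B \<inter> X" if "\<omega> \<in> space S" for \<omega>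
    using that by (auto simp: space_pair_measure space_mu)
  have "(\<lambda>\<omega>. emeasure \<mu> (Pair \<omega> -` ?Q)) \<in> borel_measurable S" by (rule mu.measurable_emeasure_Pair[OF Q])
  then have "(\<lambda>\<omega>. measure \<mu> (Pair \<omega> -` ?Q)) \<in> borel_measurable S" unfolding measure_def by simp
  then have m_meas: "m \<in> borel_measurable S"
    using measurable_cong[of S m "\<lambda>\<omega>. measure \<mu> (Pair \<omega> -` ?Q)"] slice by (simp add: m_def)
  have m_bd: "0 \<le> m \<omega>" "m \<omega> \<le> 1" for \<omega> by (simp_all add: m_def)
  have int: "integrable S (\<lambda>\<omega>. indicator A (shifted 1 \<omega>) * m \<omega>)"
  proof (rule S.integrable_const_bound[of _ 1])
    have "(\<lambda>\<omega>. indicator A (shifted 1 \<omega>) :: real) \<in> borel_measurable S"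
      by (rule measurable_compose[OF shift_measurable]) (use A in simp)
    then show "(\<lambda>\<omega>. indicator A (shifted 1 \<omega>) * m \<omega>) \<in> borel_measurable S"
      using m_meas by (rule borel_measurable_times)
    show "AE \<omega> in S. norm (indicator A (shifted 1 \<omega>) * m \<omega>) \<le> 1"
      using m_bd by (auto simp: indicator_def)
  qed
  have "emeasure \<mu> B = (\<integral>\<^sup>+\<omega>. ennreal (m \<omega>) \<partial>S)"
    using emeasure_stationary[OF B] by (simp add: m_def mu.emeasure_eq_measure)
  also have "\<dots> = ennreal (\<integral>\<omega>. m \<omega> \<partial>S)"
    using m_meas m_bd by (intro nn_integral_eq_integral S.integrable_const_bound[of _ 1]) auto
  finally have muB: "emeasure \<mu> B = ennreal (\<integral>\<omega>. m \<omega> \<partial>S)" .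
  have "emeasure (distr (S \<Otimes>\<^sub>M \<mu>) (S \<Otimes>\<^sub>M \<mu>) (\<lambda>(\<omega>, x). (shifted 1 \<omega>, f \<omega> x))) (A \<times> B) =
      emeasure (S \<Otimes>\<^sub>M \<mu>) ((\<lambda>(\<omega>, x). (shifted 1 \<omega>, f \<omega> x)) -` (A \<times> B) \<inter> space (S \<Otimes>\<^sub>M \<mu>))"
    using A B by (intro emeasure_distr T) auto
  also have "\<dots> = (\<integral>\<^sup>+\<omega>. emeasure \<mu> (Pair \<omega> -` ((\<lambda>(\<omega>, x). (shifted 1 \<omega>, f \<omega> x)) -` (A \<times> B) \<inter> space (S \<Otimes>\<^sub>M \<mu>))) \<partial>S)"
    using A B by (intro mu.emeasure_pair_measure_alt measurable_sets[OF T]) auto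
  also have "\<dots> = (\<integral>\<^sup>+\<omega>. ennreal (indicator A (shifted 1 \<omega>) * m \<omega>) \<partial>S)"
  proof (rule nn_integral_cong)
    fix \<omega> assume \<omega>: "\<omega> \<in> space S"
    have "Pair \<omega> -` ((\<lambda>(\<omega>, x). (shifted 1 \<omega>, f \<omega> x)) -` (A \<times> B) \<inter> space (S \<Otimes>\<^sub>M \<mu>)) =
        (if shifted 1 \<omega> \<in> A then f \<omega> -` B \<inter> X else {})"
      using \<omega> by (auto simp: space_pair_measure space_mu)
    then show "emeasure \<mu> (Pair \<omega> -` ((\<lambda>(\<omega>, x). (shifted 1 \<omega>, f \<omega> x)) -` (A \<times> B) \<inter> space (S \<Otimes>\<^sub>M \<mu>))) =
        ennreal (indicator A (shifted 1 \<omega>) * m \<omega>)"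
      by (simp add: m_def mu.emeasure_eq_measure)
  qed
  also have "\<dots> = ennreal (\<integral>\<omega>. indicator A (shifted 1 \<omega>) * m \<omega> \<partial>S)"
    using int m_bd by (intro nn_integral_eq_integral) auto
  also have "(\<integral>\<omega>. indicator A (shifted 1 \<omega>) * m \<omega> \<partial>S) = (\<integral>\<omega>. (\<integral>\<eta>. indicator A \<eta> * m \<omega> \<partial>S) \<partial>S)"
    by (rule integral_first_step(2)[where G="\<lambda>\<omega> \<eta>. indicator A \<eta> * m \<omega>", OF int])
      (auto simp: m_def dest: f_dep)
  also have "\<dots> = measure S A * (\<integral>\<omega>. m \<omega> \<partial>S)" using A by simp
  finally show "emeasure S A * emeasure \<mu> B =
      emeasure (distr (S \<Otimes>\<^sub>M \<mu>) (S \<Otimes>\<^sub>M \<mu>) (\<lambda>(\<omega>, x). (shifted 1 \<omega>, f \<omega> x))) (A \<times> B)"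
    using m_bd by (simp add: muB S.emeasure_eq_measure ennreal_mult')
qed

lemma distr_skew:
  "distr (S \<Otimes>\<^sub>M \<mu>) (S \<Otimes>\<^sub>M \<mu>) (\<lambda>(\<omega>, x). (shifted n \<omega>, random_iterate f n \<omega> x)) = S \<Otimes>\<^sub>M \<mu>"
proof (induction n)
  case 0
  then show ?case by (simp add: distr_id2 case_prod_beta')
next
  case (Suc n)
  have T: "(\<lambda>(\<omega>, x). (shifted 1 \<omega>, f \<omega> x)) \<in> measurable (S \<Otimes>\<^sub>M \<mu>) (S \<Otimes>\<^sub>M \<mu>)"
    using skew_measurable[of 1] by simp
  have "(\<lambda>(\<omega>, x). (shifted (Suc n) \<omega>, random_iterate f (Suc n) \<omega> x)) =
      (\<lambda>(\<omega>, x). (shifted 1 \<omega>, f \<omega> x)) \<circ> (\<lambda>(\<omega>, x). (shifted n \<omega>, random_iterate f n \<omega> x))"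
    by (auto simp: fun_eq_iff)
  then have "distr (S \<Otimes>\<^sub>M \<mu>) (S \<Otimes>\<^sub>M \<mu>) (\<lambda>(\<omega>, x). (shifted (Suc n) \<omega>, random_iterate f (Suc n) \<omega> x)) =
      distr (distr (S \<Otimes>\<^sub>M \<mu>) (S \<Otimes>\<^sub>M \<mu>) (\<lambda>(\<omega>, x). (shifted n \<omega>, random_iterate f n \<omega> x))) (S \<Otimes>\<^sub>M \<mu>)
        (\<lambda>(\<omega>, x). (shifted 1 \<omega>, f \<omega> x))"
    by (simp only: distr_distr[OF T skew_measurable])
  then show ?case by (simp only: Suc.IH distr_skew_one)
qed

lemma integral_f:
  assumes g: "g \<in> borel_measurable RX" and bd: "\<And>x. x \<in> X \<Longrightarrow> \<bar>g x\<bar> \<le> B"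
  shows "(\<integral>x. (\<integral>\<omega>. g (f \<omega> x) \<partial>S) \<partial>\<mu>) = (\<integral>x. g x \<partial>\<mu> :: real)"
proof -
  have T: "(\<lambda>(\<omega>, x). (shifted 1 \<omega>, f \<omega> x)) \<in> measurable (S \<Otimes>\<^sub>M \<mu>) (S \<Otimes>\<^sub>M \<mu>)"
    using skew_measurable[of 1] by simp
  have g': "g \<in> borel_measurable \<mu>" using g by measurable
  have gf: "(\<lambda>(\<omega>, x). g (f \<omega> x)) \<in> borel_measurable (S \<Otimes>\<^sub>M \<mu>)"
    using measurable_compose[OF f_measurable_mu g'] by (simp add: case_prod_beta')
  have int: "integrable (S \<Otimes>\<^sub>M \<mu>) (\<lambda>(\<omega>, x). g (f \<omega> x))"
    by (rule P.P.integrable_const_bound[of _ B, OF _ gf])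
      (auto intro!: AE_I2 bd f_in simp: space_pair_measure space_mu)
  have "(\<integral>x. (\<integral>\<omega>. g (f \<omega> x) \<partial>S) \<partial>\<mu>) = (\<integral>z. (case z of (\<omega>, x) \<Rightarrow> g (f \<omega> x)) \<partial>(S \<Otimes>\<^sub>M \<mu>))"
    by (rule P.integral_snd[OF int])
  also have "\<dots> = (\<integral>z. g (snd z) \<partial>distr (S \<Otimes>\<^sub>M \<mu>) (S \<Otimes>\<^sub>M \<mu>) (\<lambda>(\<omega>, x). (shifted 1 \<omega>, f \<omega> x)))"
    using g' by (subst integral_distr[OF T]) (auto simp: case_prod_beta')
  also have "\<dots> = (\<integral>z. (case z of (\<omega>, x) \<Rightarrow> g x) \<partial>(S \<Otimes>\<^sub>M \<mu>))"
    unfolding distr_skew_one by (simp add: case_prod_beta')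
  also have "\<dots> = (\<integral>x. (\<integral>\<omega>. g x \<partial>S) \<partial>\<mu>)"
  proof (rule P.integral_snd[symmetric])
    have "(\<lambda>z. g (snd z)) \<in> borel_measurable (S \<Otimes>\<^sub>M \<mu>)" using g' by measurable
    then show "integrable (S \<Otimes>\<^sub>M \<mu>) (\<lambda>(\<omega>, x). g x)"
      unfolding case_prod_beta'
      by (intro P.P.integrable_const_bound[of _ B]) (auto intro!: AE_I2 bd simp: space_pair_measure space_mu)
  qed
  also have "\<dots> = (\<integral>x. g x \<partial>\<mu>)" by (simp add: S.prob_space)
  finally show ?thesis .
qed

end

subsection \<open>Random cocycles over a compact base\<close>

text \<open>The problem with all geometry removed. \<open>MZ\<close> is a bundle over
  \<open>X\<close> with projection \<open>pr\<close>, \<open>ft\<close> the lifted dynamics, and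
  \<open>C\<close> plays the role of the continuous functions on the bundle, whose compactness is
  carried by the compact metric set \<open>Y\<close> and the surjection \<open>q\<close>.
  \<open>s\<close> is an additive cocycle over the bundle, \<open>b\<close> a subadditive cocycle
  over the base that dominates it, \<open>H\<close> an integrable bound for one step. In the
  application \<open>s\<close> is the logarithmic growth of a covector and \<open>b\<close> the
  logarithm of the norm of the inverse derivative.\<close>

locale random_cocycle = random_dynamics p f X
  for p :: "'t measure" and f :: "(nat \<Rightarrow> 't) \<Rightarrow> 'a::topological_space \<Rightarrow> 'a" and X +
  fixes MZ :: "'z measure" and C :: "('z \<Rightarrow> real) set" and pr :: "'z \<Rightarrow> 'a"
    and ft :: "(nat \<Rightarrow> 't) \<Rightarrow> 'z \<Rightarrow> 'z" and Y :: "'y::metric_space set" and q :: "'y \<Rightarrow> 'z"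
    and s :: "nat \<Rightarrow> (nat \<Rightarrow> 't) \<Rightarrow> 'z \<Rightarrow> real" and b :: "nat \<Rightarrow> (nat \<Rightarrow> 't) \<Rightarrow> 'a \<Rightarrow> real"
    and H :: "(nat \<Rightarrow> 't) \<Rightarrow> real"
  assumes compact_X: "compact X"
    and X_sets: "sets (restrict_space borel X) = sigma_sets X (positivity_sets X {g. continuous_on X g})"
    and pr_in: "\<And>z. z \<in> space MZ \<Longrightarrow> pr z \<in> X"
    and pr_onto: "\<And>x. x \<in> X \<Longrightarrow> \<exists>z\<in>space MZ. pr z = x"
    and ft_in: "\<And>\<omega> z. \<omega> \<in> space S \<Longrightarrow> z \<in> space MZ \<Longrightarrow> ft \<omega> z \<in> space MZ"
    and pr_ft: "\<And>\<omega> z. \<omega> \<in> space S \<Longrightarrow> z \<in> space MZ \<Longrightarrow> pr (ft \<omega> z) = f \<omega> (pr z)"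
    and ft_dep: "\<And>\<omega> \<omega>'. \<omega> \<in> space S \<Longrightarrow> \<omega>' \<in> space S \<Longrightarrow> \<omega> 0 = \<omega>' 0 \<Longrightarrow> ft \<omega> = ft \<omega>'"
    and Z_sets: "sets MZ = sigma_sets (space MZ) (positivity_sets (space MZ) C)"
    and C_lattice: "function_lattice C"
    and C_base: "\<And>g. continuous_on X g \<Longrightarrow> (\<lambda>z. g (pr z)) \<in> C"
    and C_ft: "\<And>u \<omega>. u \<in> C \<Longrightarrow> \<omega> \<in> space S \<Longrightarrow> (\<lambda>z. u (ft \<omega> z)) \<in> C"
    and C_transfer: "\<And>u. u \<in> C \<Longrightarrow> (\<lambda>z. \<integral>\<omega>. u (ft \<omega> z) \<partial>S) \<in> C"
    and compact_Y: "compact Y"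
    and q_image: "q ` Y = space MZ"
    and C_q: "\<And>u. u \<in> C \<Longrightarrow> continuous_on Y (\<lambda>y. u (q y))"
    and C_joint: "\<And>u. u \<in> C \<Longrightarrow>
      (\<lambda>(\<omega>, y). u (ft \<omega> (q y))) \<in> borel_measurable (S \<Otimes>\<^sub>M restrict_space borel Y)"
    and H_int: "integrable S H"
    and s_0: "\<And>\<omega> z. s 0 \<omega> z = 0"
    and s_Suc: "\<And>n \<omega> z. \<omega> \<in> space S \<Longrightarrow> z \<in> space MZ \<Longrightarrow>
      s (Suc n) \<omega> z = s 1 \<omega> z + s n (shifted 1 \<omega>) (ft \<omega> z)"
    and s_meas: "\<And>n z. z \<in> space MZ \<Longrightarrow> (\<lambda>\<omega>. s n \<omega> z) \<in> borel_measurable S"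
    and s_bound: "\<And>\<omega> z. \<omega> \<in> space S \<Longrightarrow> z \<in> space MZ \<Longrightarrow> \<bar>s 1 \<omega> z\<bar> \<le> H \<omega>"
    and potential: "(\<lambda>z. \<integral>\<omega>. s 1 \<omega> z \<partial>S) \<in> C"
    and b_meas: "\<And>n. (\<lambda>(\<omega>, x). b n \<omega> x) \<in> borel_measurable (S \<Otimes>\<^sub>M restrict_space borel X)"
    and s_le_b: "\<And>n \<omega> z. \<omega> \<in> space S \<Longrightarrow> z \<in> space MZ \<Longrightarrow> s n \<omega> z \<le> b n \<omega> (pr z)"
    and b_sub: "\<And>m n \<omega> x. \<omega> \<in> space S \<Longrightarrow> x \<in> X \<Longrightarrow>
      b (m + n) \<omega> x \<le> b m \<omega> x + b n (shifted m \<omega>) (random_iterate f m \<omega> x)"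
    and b_bound: "\<And>n \<omega> x. \<omega> \<in> space S \<Longrightarrow> x \<in> X \<Longrightarrow> b n \<omega> x \<le> (\<Sum>j<n. H (shifted j \<omega>))"
    and b_cont: "\<And>n. continuous_on X (\<lambda>x. \<integral>\<omega>. b n \<omega> x \<partial>S)"
begin

definition \<beta> :: "nat \<Rightarrow> 'a \<Rightarrow> real" where "\<beta> n x = (\<integral>\<omega>. b n \<omega> x \<partial>S)"

definition \<phi> :: "'z \<Rightarrow> real" where "\<phi> z = (\<integral>\<omega>. s 1 \<omega> z \<partial>S)"

text \<open>The sign matches \<open>lyap_min\<close>: \<open>b\<close> is a logarithm of the norm of
  an inverse, so \<open>- \<beta> n\<close> is the expected logarithm of a conorm.\<close>

definition exponent :: "'a measure \<Rightarrow> real" where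
  "exponent \<mu> = lim (\<lambda>n. 1 / real n * (\<integral>x. - \<beta> n x \<partial>\<mu>))"

definition transfer :: "('z \<Rightarrow> real) \<Rightarrow> 'z \<Rightarrow> real" where
  "transfer u z = (\<integral>\<omega>. u (ft \<omega> z) \<partial>S)"

definition Hsum :: "nat \<Rightarrow> (nat \<Rightarrow> 't) \<Rightarrow> real" where "Hsum n \<omega> = (\<Sum>j<n. H (shifted j \<omega>))"

lemma Hsum_integrable: "integrable S (Hsum n)"
proof -
  have "integrable S (\<lambda>\<omega>. H (shifted j \<omega>))" for j
    using integrable_distr[OF shift_measurable, of j H] H_int by (simp add: distr_shift)
  then show ?thesis unfolding Hsum_def[abs_def] by (intro Bochner_Integration.integrable_sum)
qed

lemma Hsum_integral: "(\<integral>\<omega>. Hsum n \<omega> \<partial>S) = real n * (\<integral>\<omega>. H \<omega> \<partial>S)"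
proof -
  have "(\<integral>\<omega>. H (shifted j \<omega>) \<partial>S) = (\<integral>\<omega>. H \<omega> \<partial>S)" for j
    using integral_distr[OF shift_measurable, of H j] H_int by (simp add: distr_shift)
  moreover have "integrable S (\<lambda>\<omega>. H (shifted j \<omega>))" for j
    using integrable_distr[OF shift_measurable, of j H] H_int by (simp add: distr_shift)
  ultimately show ?thesis
    unfolding Hsum_def by (subst Bochner_Integration.integral_sum) auto
qed

lemma s_abs_le: "\<omega> \<in> space S \<Longrightarrow> z \<in> space MZ \<Longrightarrow> \<bar>s n \<omega> z\<bar> \<le> Hsum n \<omega>"
proof (induction n arbitrary: \<omega> z)
  case 0
  then show ?case by (simp add: s_0 Hsum_def)
next
  case (Suc n)
  have "\<bar>s (Suc n) \<omega> z\<bar> \<le> H \<omega> + Hsum n (shifted 1 \<omega>)"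
    unfolding s_Suc[OF Suc.prems]
    using s_bound[OF Suc.prems] Suc.IH[OF shift_in_space[OF Suc.prems(1), of 1] ft_in[OF Suc.prems]] by linarith
  also have "\<dots> = Hsum (Suc n) \<omega>" unfolding Hsum_def sum.lessThan_Suc_shift by simp
  finally show ?case .
qed

text \<open>The bound assumed for \<open>b\<close> is one-sided. The lower bound goes through the
  bundle: any point over \<open>x\<close> has growth at least \<open>- Hsum n \<omega>\<close>, and
  \<open>b\<close> dominates this growth.\<close>

lemma b_abs_le:
  assumes "\<omega> \<in> space S" "x \<in> X"
  shows "\<bar>b n \<omega> x\<bar> \<le> Hsum n \<omega>"
proof -
  obtain z where z: "z \<in> space MZ" "pr z = x" using pr_onto[OF assms(2)] by blast
  show ?thesis
    using s_abs_le[OF assms(1) z(1), of n] s_le_b[OF assms(1) z(1), of n] b_bound[OF assms, of n] z(2)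
    by (simp add: Hsum_def)
qed

lemma s_integrable: "z \<in> space MZ \<Longrightarrow> integrable S (\<lambda>\<omega>. s n \<omega> z)"
  by (rule Bochner_Integration.integrable_bound[OF Hsum_integrable[of n] s_meas])
    (auto intro!: AE_I2 order_trans[OF s_abs_le])

lemma b_integrable: "x \<in> X \<Longrightarrow> integrable S (\<lambda>\<omega>. b n \<omega> x)"
  by (rule Bochner_Integration.integrable_bound[OF Hsum_integrable[of n]])
    (auto intro!: AE_I2 order_trans[OF b_abs_le] measurable_compose[OF measurable_Pair2' b_meas, simplified]
      simp: space_RX)

lemma C_measurable: "u \<in> C \<Longrightarrow> u \<in> borel_measurable MZ"
  by (rule function_lattice_measurable[OF C_lattice _ Z_sets])

lemma X_measurable: "continuous_on X g \<Longrightarrow> g \<in> borel_measurable RX" for g :: "'a \<Rightarrow> real"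
  by (rule borel_measurable_continuous_on_restrict)

lemma X_bounded:
  assumes "continuous_on X g"
  obtains B where "\<And>x. x \<in> X \<Longrightarrow> \<bar>g x\<bar> \<le> (B :: real)"
proof -
  have "bounded (g ` X)" by (rule compact_imp_bounded[OF compact_continuous_image[OF assms compact_X]])
  then show ?thesis using that by (auto simp: bounded_iff)
qed

lemma C_bounded:
  assumes "u \<in> C"
  obtains B where "\<And>z. z \<in> space MZ \<Longrightarrow> \<bar>u z\<bar> \<le> B"
proof -
  have "bounded ((\<lambda>y. u (q y)) ` Y)"
    by (rule compact_imp_bounded[OF compact_continuous_image[OF C_q[OF assms] compact_Y]])
  then obtain B where "\<And>y. y \<in> Y \<Longrightarrow> \<bar>u (q y)\<bar> \<le> B" by (auto simp: bounded_iff)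
  then have "\<bar>u z\<bar> \<le> B" if "z \<in> space MZ" for z using that q_image by (metis imageE)
  then show ?thesis by (rule that)
qed

lemma C_ft_measurable:
  assumes "u \<in> C" "z \<in> space MZ"
  shows "(\<lambda>\<omega>. u (ft \<omega> z)) \<in> borel_measurable S"
proof -
  obtain y where y: "y \<in> Y" "z = q y" using assms(2) q_image by auto
  have "(\<lambda>\<omega>. case (\<omega>, y) of (\<omega>, y) \<Rightarrow> u (ft \<omega> (q y))) \<in> borel_measurable S"
    by (rule measurable_compose[OF measurable_Pair2' C_joint[OF assms(1)]])
      (simp add: y space_restrict_space)
  then show ?thesis by (simp add: y)
qed

lemma C_ft_integrable:
  assumes "u \<in> C" "z \<in> space MZ"
  shows "integrable S (\<lambda>\<omega>. u (ft \<omega> z))"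
proof -
  obtain B where "\<And>z. z \<in> space MZ \<Longrightarrow> \<bar>u z\<bar> \<le> B" using C_bounded[OF assms(1)] by blast
  then show ?thesis
    using assms by (intro S.integrable_const_bound[of _ B] C_ft_measurable) (auto intro!: AE_I2 ft_in)
qed

text \<open>Integrating \<open>b_sub\<close> against the measure preserved by the skew product makes
  the integrals of \<open>\<beta> n\<close> subadditive in \<open>n\<close>, so Fekete's lemma
  applies. The second claim presents the exponent as an upper bound of quantities that depend
  weak-star continuously on \<open>\<mu>\<close>, whence its lower semicontinuity.\<close>

lemma exponent_limit:
  assumes \<mu>: "\<mu> \<in> stationary_on p f X"
  shows "(\<lambda>n. 1 / real n * (\<integral>x. - \<beta> n x \<partial>\<mu>)) \<longlonglongrightarrow> exponent \<mu>"
    and "n \<ge> 1 \<Longrightarrow> 1 / real n * (\<integral>x. - \<beta> n x \<partial>\<mu>) \<le> exponent \<mu>"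
proof -
  interpret stationary_dynamics p f X \<mu> by unfold_locales fact
  have bm: "(\<lambda>(\<omega>, x). b n \<omega> x) \<in> borel_measurable (S \<Otimes>\<^sub>M \<mu>)" for n
    using b_meas[of n] measurable_cong_sets[OF sets_pair_measure_cong[OF refl sets_mu] refl] by blast
  have Hi: "integrable (S \<Otimes>\<^sub>M \<mu>) (\<lambda>z. Hsum n (fst z))" for n
  proof -
    have "integrable (distr (S \<Otimes>\<^sub>M \<mu>) S fst) (Hsum n)"
      using Hsum_integrable mu.distr_pair_fst[of S] by simp
    then show ?thesis by (rule integrable_distr[OF measurable_fst])
  qed
  have bi: "integrable (S \<Otimes>\<^sub>M \<mu>) (\<lambda>(\<omega>, x). b n \<omega> x)" for n
    by (rule Bochner_Integration.integrable_bound[OF Hi[of n] bm])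
      (auto intro!: AE_I2 order_trans[OF b_abs_le] simp: space_pair_measure space_mu)
  define a where "a = (\<lambda>n. \<integral>z. (case z of (\<omega>, x) \<Rightarrow> b n \<omega> x) \<partial>(S \<Otimes>\<^sub>M \<mu>))"
  have a: "a n = (\<integral>x. \<beta> n x \<partial>\<mu>)" for n
    unfolding a_def \<beta>_def by (rule P.integral_snd[OF bi, symmetric])
  have sub: "a (m + n) \<le> a m + a n" for m n
  proof -
    let ?T = "\<lambda>(\<omega>, x). (shifted m \<omega>, random_iterate f m \<omega> x)"
    have "integrable (distr (S \<Otimes>\<^sub>M \<mu>) (S \<Otimes>\<^sub>M \<mu>) ?T) (\<lambda>(\<omega>, x). b n \<omega> x)"
      unfolding distr_skew by (rule bi)
    from integrable_distr[OF skew_measurable this]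
    have int: "integrable (S \<Otimes>\<^sub>M \<mu>) (\<lambda>(\<omega>, x). b n (shifted m \<omega>) (random_iterate f m \<omega> x))"
      by (simp add: case_prod_beta')
    have "a n = (\<integral>z. (case z of (\<omega>, x) \<Rightarrow> b n \<omega> x) \<partial>distr (S \<Otimes>\<^sub>M \<mu>) (S \<Otimes>\<^sub>M \<mu>) ?T)"
      unfolding distr_skew a_def ..
    also have "\<dots> = (\<integral>z. (case z of (\<omega>, x) \<Rightarrow> b n (shifted m \<omega>) (random_iterate f m \<omega> x)) \<partial>(S \<Otimes>\<^sub>M \<mu>))"
      by (subst integral_distr[OF skew_measurable bm]) (simp add: case_prod_beta')
    finally have "a m + a n = (\<integral>z. (case z of (\<omega>, x) \<Rightarrow> b m \<omega> x) +
        (case z of (\<omega>, x) \<Rightarrow> b n (shifted m \<omega>) (random_iterate f m \<omega> x)) \<partial>(S \<Otimes>\<^sub>M \<mu>))"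
      unfolding a_def by (simp only: Bochner_Integration.integral_add[OF bi int])
    moreover have "a (m + n) \<le> \<dots>"
      unfolding a_def using b_sub
      by (intro integral_mono bi Bochner_Integration.integrable_add int)
        (auto simp: space_pair_measure space_mu)
    ultimately show ?thesis by simp
  qed
  have low: "- (\<integral>\<omega>. H \<omega> \<partial>S) * real n \<le> a n" for n
  proof -
    have "(\<integral>z. - Hsum n (fst z) \<partial>(S \<Otimes>\<^sub>M \<mu>)) \<le> a n"
      unfolding a_def
    proof (rule integral_mono)
      show "integrable (S \<Otimes>\<^sub>M \<mu>) (\<lambda>z. - Hsum n (fst z))" using Hi by simp
      show "- Hsum n (fst z) \<le> (case z of (\<omega>, x) \<Rightarrow> b n \<omega> x)" if "z \<in> space (S \<Otimes>\<^sub>M \<mu>)" for z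
        using that b_abs_le[of "fst z" "snd z" n] by (auto simp: space_pair_measure space_mu abs_le_iff)
    qed (rule bi)
    also have "(\<integral>z. - Hsum n (fst z) \<partial>(S \<Otimes>\<^sub>M \<mu>)) = - (\<integral>z. Hsum n (fst z) \<partial>(S \<Otimes>\<^sub>M \<mu>))" by simp
    also have "(\<integral>z. Hsum n (fst z) \<partial>(S \<Otimes>\<^sub>M \<mu>)) = (\<integral>\<omega>. Hsum n \<omega> \<partial>distr (S \<Otimes>\<^sub>M \<mu>) S fst)"
      using Hsum_integrable[of n] by (subst integral_distr) auto
    also have "\<dots> = real n * (\<integral>\<omega>. H \<omega> \<partial>S)" using mu.distr_pair_fst[of S] by (simp add: Hsum_integral)
    finally show ?thesis by (simp add: mult.commute)
  qed
  obtain l where l: "(\<lambda>n. a n / real n) \<longlonglongrightarrow> l" "\<And>n. n \<ge> 1 \<Longrightarrow> l \<le> a n / real n"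
    using Fekete[OF sub low] by metis
  have eq: "1 / real n * (\<integral>x. - \<beta> n x \<partial>\<mu>) = - (a n / real n)" for n by (simp add: a)
  have lim: "(\<lambda>n. 1 / real n * (\<integral>x. - \<beta> n x \<partial>\<mu>)) \<longlonglongrightarrow> - l"
    unfolding eq by (rule tendsto_minus[OF l(1)])
  then have e: "exponent \<mu> = - l" unfolding exponent_def by (rule limI)
  show "(\<lambda>n. 1 / real n * (\<integral>x. - \<beta> n x \<partial>\<mu>)) \<longlonglongrightarrow> exponent \<mu>" using lim e by simp
  show "n \<ge> 1 \<Longrightarrow> 1 / real n * (\<integral>x. - \<beta> n x \<partial>\<mu>) \<le> exponent \<mu>" unfolding eq e using l(2) by simp
qed

text \<open>The expected Birkhoff sum of \<open>g\<close> over the first \<open>n\<close> points of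
  the random orbit of \<open>x\<close>, that is the sum of the powers 0 to \<open>n - 1\<close> of
  the Markov operator applied to \<open>g\<close>. The recursion peels off the first step, as
  \<open>s_Suc\<close> does.\<close>

primrec birkhoff :: "('a \<Rightarrow> real) \<Rightarrow> nat \<Rightarrow> 'a \<Rightarrow> real" where
  "birkhoff g 0 x = 0"
| "birkhoff g (Suc n) x = g x + (\<integral>\<omega>. birkhoff g n (f \<omega> x) \<partial>S)"

lemma birkhoff_measurable:
  assumes g: "g \<in> borel_measurable RX"
  shows "birkhoff g n \<in> borel_measurable RX"
proof (induction n)
  case 0
  have "birkhoff g 0 = (\<lambda>_. 0)" by (simp add: fun_eq_iff)
  then show ?case by simp
next
  case (Suc n)
  have "(\<lambda>(x, \<omega>). birkhoff g n (f \<omega> x)) \<in> borel_measurable (RX \<Otimes>\<^sub>M S)"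
    using measurable_compose[OF measurable_pair_swap' measurable_compose[OF f_measurable Suc]]
    by (simp add: case_prod_beta')
  then have "(\<lambda>x. \<integral>\<omega>. birkhoff g n (f \<omega> x) \<partial>S) \<in> borel_measurable RX"
    by (rule S.borel_measurable_lebesgue_integral)
  moreover have "birkhoff g (Suc n) = (\<lambda>x. g x + (\<integral>\<omega>. birkhoff g n (f \<omega> x) \<partial>S))" by (simp add: fun_eq_iff)
  ultimately show ?case using g by simp
qed

lemma birkhoff_f_measurable:
  assumes g: "g \<in> borel_measurable RX" and x: "x \<in> X"
  shows "(\<lambda>\<omega>. birkhoff g n (f \<omega> x)) \<in> borel_measurable S"
  using measurable_compose[OF measurable_compose[OF measurable_Pair2' f_measurable] birkhoff_measurable[OF g]] x
  by (simp add: space_RX)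

lemma birkhoff_bounded:
  assumes g: "g \<in> borel_measurable RX" and B: "\<And>x. x \<in> X \<Longrightarrow> \<bar>g x\<bar> \<le> B"
  shows "x \<in> X \<Longrightarrow> \<bar>birkhoff g n x\<bar> \<le> real n * B"
proof (induction n arbitrary: x)
  case (Suc n)
  have bd: "\<bar>birkhoff g n (f \<omega> x)\<bar> \<le> real n * B" if "\<omega> \<in> space S" for \<omega>
    by (rule Suc.IH[OF f_in[OF that Suc.prems]])
  then have "integrable S (\<lambda>\<omega>. birkhoff g n (f \<omega> x))"
    using birkhoff_f_measurable[OF g Suc.prems, of n]
    by (intro S.integrable_const_bound[of _ "real n * B"]) auto
  then have "(\<integral>\<omega>. norm (birkhoff g n (f \<omega> x)) \<partial>S) \<le> (\<integral>\<omega>. real n * B \<partial>S)"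
    using bd by (intro integral_mono) auto
  with integral_norm_bound have "norm (\<integral>\<omega>. birkhoff g n (f \<omega> x) \<partial>S) \<le> (\<integral>\<omega>. real n * B \<partial>S)"
    by (rule order_trans)
  then show ?case using B[OF Suc.prems] by (simp add: S.prob_space algebra_simps)
qed simp

lemma integral_birkhoff:
  assumes \<mu>: "\<mu> \<in> stationary_on p f X" and g: "g \<in> borel_measurable RX" and B: "\<And>x. x \<in> X \<Longrightarrow> \<bar>g x\<bar> \<le> B"
  shows "integrable \<mu> (birkhoff g n)" "(\<integral>x. birkhoff g n x \<partial>\<mu>) = real n * (\<integral>x. g x \<partial>\<mu>)"
proof -
  interpret stationary_dynamics p f X \<mu> by unfold_locales fact
  have int: "integrable \<mu> h" if "h \<in> borel_measurable RX" "\<And>x. x \<in> X \<Longrightarrow> \<bar>h x\<bar> \<le> c" for h :: "'a \<Rightarrow> real" and c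
  proof -
    have "h \<in> borel_measurable \<mu>" using that(1) by measurable
    then show ?thesis using that(2) by (intro mu.integrable_const_bound[of _ c]) (auto simp: space_mu)
  qed
  have int_b: "integrable \<mu> (birkhoff g n)" for n
    by (rule int[OF birkhoff_measurable[OF g] birkhoff_bounded[OF g B]])
  show "integrable \<mu> (birkhoff g n)" by (rule int_b)
  have int_g: "integrable \<mu> g" by (rule int[OF g B])
  show "(\<integral>x. birkhoff g n x \<partial>\<mu>) = real n * (\<integral>x. g x \<partial>\<mu>)"
  proof (induction n)
    case (Suc n)
    have "integrable \<mu> (\<lambda>x. birkhoff g (Suc n) x - g x)"
      by (rule Bochner_Integration.integrable_diff[OF int_b int_g])
    then have i2: "integrable \<mu> (\<lambda>x. \<integral>\<omega>. birkhoff g n (f \<omega> x) \<partial>S)" by simp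
    have "(\<integral>x. birkhoff g (Suc n) x \<partial>\<mu>) = (\<integral>x. g x \<partial>\<mu>) + (\<integral>x. (\<integral>\<omega>. birkhoff g n (f \<omega> x) \<partial>S) \<partial>\<mu>)"
      by (simp add: int_g i2)
    also have "(\<integral>x. (\<integral>\<omega>. birkhoff g n (f \<omega> x) \<partial>S) \<partial>\<mu>) = (\<integral>x. birkhoff g n x \<partial>\<mu>)"
      by (rule integral_f[OF birkhoff_measurable[OF g] birkhoff_bounded[OF g B]])
    finally show ?case using Suc by (simp add: algebra_simps)
  qed simp
qed

text \<open>Iterating the inequality for \<open>c\<close> telescopes the coboundary: the accumulated
  \<open>c\<close> and \<open>g\<close> are at least \<open>u\<close> minus the \<open>n\<close>-th
  iterate of \<open>transfer\<close> on \<open>u\<close>, and that iterate is at most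
  \<open>B\<close>. \<open>W\<close> is any supersolution of the recursion for the sums of
  \<open>c\<close>; it is used with the expected growth for \<open>c = \<phi>\<close> and with 0 for
  \<open>c = 0\<close>.\<close>

lemma birkhoff_lower:
  assumes g: "g \<in> borel_measurable RX" and gB: "\<And>x. x \<in> X \<Longrightarrow> \<bar>g x\<bar> \<le> B'"
    and u: "u \<in> C" and uB: "\<And>z. z \<in> space MZ \<Longrightarrow> u z \<le> B"
    and W0: "\<And>z. z \<in> space MZ \<Longrightarrow> 0 \<le> W 0 z"
    and Wi: "\<And>n z. z \<in> space MZ \<Longrightarrow> integrable S (\<lambda>\<omega>. W n (ft \<omega> z))"
    and W: "\<And>n z. z \<in> space MZ \<Longrightarrow> c z + (\<integral>\<omega>. W n (ft \<omega> z) \<partial>S) \<le> W (Suc n) z"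
    and c: "\<And>z. z \<in> space MZ \<Longrightarrow> 0 \<le> c z + g (pr z) + (transfer u z - u z)"
  shows "z \<in> space MZ \<Longrightarrow> u z - B \<le> W n z + birkhoff g n (pr z)"
proof (induction n arbitrary: z)
  case 0
  then show ?case using W0[of z] uB[of z] by simp
next
  case (Suc n)
  note z = Suc.prems
  have ib: "integrable S (\<lambda>\<omega>. birkhoff g n (f \<omega> (pr z)))"
    using birkhoff_f_measurable[OF g pr_in[OF z]] birkhoff_bounded[OF g gB] f_in pr_in[OF z]
    by (intro S.integrable_const_bound[of _ "real n * B'"]) auto
  have "transfer u z - B = (\<integral>\<omega>. u (ft \<omega> z) - B \<partial>S)"
    unfolding transfer_def using C_ft_integrable[OF u z] by (simp add: S.prob_space)
  also have "\<dots> \<le> (\<integral>\<omega>. W n (ft \<omega> z) + birkhoff g n (f \<omega> (pr z)) \<partial>S)"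
  proof (rule integral_mono)
    fix \<omega> assume \<omega>: "\<omega> \<in> space S"
    show "u (ft \<omega> z) - B \<le> W n (ft \<omega> z) + birkhoff g n (f \<omega> (pr z))"
      using Suc.IH[OF ft_in[OF \<omega> z]] pr_ft[OF \<omega> z] by simp
  qed (use C_ft_integrable[OF u z] Wi[OF z] ib in auto)
  also have "\<dots> = (\<integral>\<omega>. W n (ft \<omega> z) \<partial>S) + (\<integral>\<omega>. birkhoff g n (f \<omega> (pr z)) \<partial>S)"
    by (rule Bochner_Integration.integral_add[OF Wi[OF z] ib])
  finally show ?case using W[OF z, of n] c[OF z] by simp
qed

text \<open>First-step analysis: \<open>ft \<omega> z\<close> depends on the first letter and the
  remaining growth on the shifted noise, so the remaining growth may be averaged over fresh noise
  \<open>\<eta>\<close>.\<close>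

lemma s_step:
  assumes z: "z \<in> space MZ"
  shows "integrable S (\<lambda>\<omega>. \<integral>\<eta>. s n \<eta> (ft \<omega> z) \<partial>S)"
    and "(\<integral>\<omega>. s (Suc n) \<omega> z \<partial>S) = \<phi> z + (\<integral>\<omega>. (\<integral>\<eta>. s n \<eta> (ft \<omega> z) \<partial>S) \<partial>S)"
proof -
  have "integrable S (\<lambda>\<omega>. s (Suc n) \<omega> z - s 1 \<omega> z)"
    by (rule Bochner_Integration.integrable_diff[OF s_integrable[OF z] s_integrable[OF z]])
  also have "integrable S (\<lambda>\<omega>. s (Suc n) \<omega> z - s 1 \<omega> z) \<longleftrightarrow> integrable S (\<lambda>\<omega>. s n (shifted 1 \<omega>) (ft \<omega> z))"
  proof (rule Bochner_Integration.integrable_cong[OF refl])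
    show "s (Suc n) \<omega> z - s 1 \<omega> z = s n (shifted 1 \<omega>) (ft \<omega> z)" if "\<omega> \<in> space S" for \<omega>
      using s_Suc[OF that z, of n] by linarith
  qed
  finally have int: "integrable S (\<lambda>\<omega>. s n (shifted 1 \<omega>) (ft \<omega> z))" .
  note first = integral_first_step[where G="\<lambda>\<omega> \<eta>. s n \<eta> (ft \<omega> z)", OF int]
  show "integrable S (\<lambda>\<omega>. \<integral>\<eta>. s n \<eta> (ft \<omega> z) \<partial>S)" by (rule first(1)) (metis ft_dep)
  have "(\<integral>\<omega>. s (Suc n) \<omega> z \<partial>S) = (\<integral>\<omega>. s 1 \<omega> z + s n (shifted 1 \<omega>) (ft \<omega> z) \<partial>S)"
    by (rule Bochner_Integration.integral_cong[OF refl]) (rule s_Suc[OF _ z])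
  also have "\<dots> = \<phi> z + (\<integral>\<omega>. s n (shifted 1 \<omega>) (ft \<omega> z) \<partial>S)"
    unfolding \<phi>_def by (rule Bochner_Integration.integral_add[OF s_integrable[OF z] int])
  also have "(\<integral>\<omega>. s n (shifted 1 \<omega>) (ft \<omega> z) \<partial>S) = (\<integral>\<omega>. (\<integral>\<eta>. s n \<eta> (ft \<omega> z) \<partial>S) \<partial>S)"
    by (rule first(2)) (metis ft_dep)
  finally show "(\<integral>\<omega>. s (Suc n) \<omega> z \<partial>S) = \<phi> z + (\<integral>\<omega>. (\<integral>\<eta>. s n \<eta> (ft \<omega> z) \<partial>S) \<partial>S)" .
qed

text \<open>The expected growth along every point of the bundle is at least
  \<open>- birkhoff g n\<close> up to the constant \<open>2 * B\<close>, and \<open>b\<close>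
  dominates the growth. Stationarity integrates the Birkhoff sum to \<open>n\<close> times the
  integral of \<open>g\<close>, and the constant disappears after division by \<open>n\<close>. Here
  \<open>\<mu>\<close> is any stationary measure, while \<open>g\<close> and \<open>u\<close> do not
  depend on it.\<close>

lemma exponent_le:
  assumes \<mu>: "\<mu> \<in> stationary_on p f X" and g: "continuous_on X g" and u: "u \<in> C"
    and le: "\<And>z. z \<in> space MZ \<Longrightarrow> - \<phi> z \<le> g (pr z) + (transfer u z - u z)"
  shows "exponent \<mu> \<le> (\<integral>x. g x \<partial>\<mu>)"
proof -
  interpret stationary_dynamics p f X \<mu> by unfold_locales fact
  obtain B' where B': "\<And>x. x \<in> X \<Longrightarrow> \<bar>g x\<bar> \<le> B'" using X_bounded[OF g] by blast
  obtain B where B: "\<And>z. z \<in> space MZ \<Longrightarrow> \<bar>u z\<bar> \<le> B" using C_bounded[OF u] by blast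
  note gm = X_measurable[OF g]
  have lower: "u z - B \<le> (\<integral>\<omega>. s n \<omega> z \<partial>S) + birkhoff g n (pr z)" if z: "z \<in> space MZ" for n z
  proof (rule birkhoff_lower[where W="\<lambda>n z. \<integral>\<omega>. s n \<omega> z \<partial>S" and c=\<phi>, OF gm B' u _ _ _ _ _ z])
    show "u z \<le> B" if "z \<in> space MZ" for z using B[OF that] by (simp add: abs_le_iff)
    show "0 \<le> (\<integral>\<omega>. s 0 \<omega> z \<partial>S)" for z by (simp add: s_0)
    show "\<phi> z + (\<integral>\<omega>. (\<integral>\<eta>. s n \<eta> (ft \<omega> z) \<partial>S) \<partial>S) \<le> (\<integral>\<omega>. s (Suc n) \<omega> z \<partial>S)"
      if "z \<in> space MZ" for n z by (simp add: s_step(2)[OF that])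
    show "0 \<le> \<phi> z + g (pr z) + (transfer u z - u z)" if "z \<in> space MZ" for z
      using le[OF that] by simp
  qed (use s_step(1) in blast)+
  have \<beta>_lower: "- 2 * B - birkhoff g n x \<le> \<beta> n x" if x: "x \<in> X" for n x
  proof -
    obtain z where z: "z \<in> space MZ" "pr z = x" using pr_onto[OF x] by blast
    have "(\<integral>\<omega>. s n \<omega> z \<partial>S) \<le> \<beta> n x"
      unfolding \<beta>_def using z s_le_b[OF _ z(1)]
      by (intro integral_mono s_integrable b_integrable x) auto
    then show ?thesis using lower[OF z(1), of n] B[OF z(1)] z(2) by (simp add: abs_le_iff)
  qed
  have bound: "1 / real n * (\<integral>x. - \<beta> n x \<partial>\<mu>) \<le> (\<integral>x. g x \<partial>\<mu>) + 2 * B / real n" if n: "n \<ge> 1" for n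
  proof -
    have "\<beta> n \<in> borel_measurable \<mu>"
      using X_measurable[OF b_cont[of n]] unfolding \<beta>_def[abs_def] by measurable
    moreover obtain B2 where "\<And>x. x \<in> X \<Longrightarrow> \<bar>\<beta> n x\<bar> \<le> B2"
      using X_bounded[OF b_cont[of n]] unfolding \<beta>_def[symmetric] by blast
    ultimately have int: "integrable \<mu> (\<beta> n)" by (intro mu.integrable_const_bound[of _ B2]) (auto simp: space_mu)
    have "(\<integral>x. - \<beta> n x \<partial>\<mu>) \<le> (\<integral>x. 2 * B + birkhoff g n x \<partial>\<mu>)"
    proof (rule integral_mono)
      show "integrable \<mu> (\<lambda>x. - \<beta> n x)" using int by simp
      show "integrable \<mu> (\<lambda>x. 2 * B + birkhoff g n x)"
        using integral_birkhoff(1)[OF \<mu> gm B', of n] by simp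
      show "- \<beta> n x \<le> 2 * B + birkhoff g n x" if "x \<in> space \<mu>" for x
        using \<beta>_lower[of x n] that by (simp add: space_mu)
    qed
    also have "\<dots> = 2 * B + real n * (\<integral>x. g x \<partial>\<mu>)"
      using integral_birkhoff[OF \<mu> gm B', of n] by (simp add: mu.prob_space)
    finally show ?thesis using n by (simp add: field_simps)
  qed
  have "(\<lambda>n. (\<integral>x. g x \<partial>\<mu>) + 2 * B / real n) \<longlonglongrightarrow> (\<integral>x. g x \<partial>\<mu>) + 0"
    by (intro tendsto_intros lim_const_over_n)
  then show ?thesis
    using LIMSEQ_le[OF exponent_limit(1)[OF \<mu>]] bound by (metis add.right_neutral)
qed

text \<open>A coboundary on the bundle cannot be integrated against a measure on the base, so the
  sign is found by iteration: the Birkhoff sums of \<open>g\<close> are bounded below uniformly in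
  \<open>n\<close>, and their integrals are \<open>n\<close> times that of \<open>g\<close>. This is
  the positivity required for extending the functional on \<open>g\<close> and
  \<open>u\<close>.\<close>

lemma coboundary_positive:
  assumes \<mu>: "\<mu> \<in> stationary_on p f X" and g: "continuous_on X g" and u: "u \<in> C"
    and le: "\<And>z. z \<in> space MZ \<Longrightarrow> 0 \<le> g (pr z) + (transfer u z - u z)"
  shows "0 \<le> (\<integral>x. g x \<partial>\<mu>)"
proof -
  interpret stationary_dynamics p f X \<mu> by unfold_locales fact
  obtain B' where B': "\<And>x. x \<in> X \<Longrightarrow> \<bar>g x\<bar> \<le> B'" using X_bounded[OF g] by blast
  obtain B where B: "\<And>z. z \<in> space MZ \<Longrightarrow> \<bar>u z\<bar> \<le> B" using C_bounded[OF u] by blast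
  note gm = X_measurable[OF g]
  have lower: "- 2 * B \<le> birkhoff g n x" if x: "x \<in> X" for n x
  proof -
    obtain z where z: "z \<in> space MZ" "pr z = x" using pr_onto[OF x] by blast
    have "u z - B \<le> 0 + birkhoff g n (pr z)"
      by (rule birkhoff_lower[where W="\<lambda>_ _. 0" and c="\<lambda>_. 0", OF gm B' u _ _ _ _ _ z(1)])
        (use B le in \<open>auto simp: abs_le_iff\<close>)
    then show ?thesis using B[OF z(1)] z(2) by (simp add: abs_le_iff)
  qed
  have "- 2 * B \<le> real n * (\<integral>x. g x \<partial>\<mu>)" for n
  proof -
    have "(\<integral>x. - 2 * B \<partial>\<mu>) \<le> (\<integral>x. birkhoff g n x \<partial>\<mu>)"
      using lower integral_birkhoff(1)[OF \<mu> gm B', of n]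
      by (intro integral_mono) (auto simp: space_mu)
    then show ?thesis using integral_birkhoff(2)[OF \<mu> gm B', of n] by (simp add: mu.prob_space)
  qed
  show ?thesis
  proof (rule ccontr)
    assume neg: "\<not> 0 \<le> (\<integral>x. g x \<partial>\<mu>)"
    then obtain n :: nat where "real n > 2 * B / - (\<integral>x. g x \<partial>\<mu>)" using reals_Archimedean2 by blast
    then have "real n * (\<integral>x. g x \<partial>\<mu>) < - 2 * B" using neg by (simp add: field_simps)
    with \<open>- 2 * B \<le> real n * (\<integral>x. g x \<partial>\<mu>)\<close> show False by simp
  qed
qed

end

section \<open>Weak-star continuity, stationary lifts and duality\<close>

lemma continuous_map_weak_star:
  assumes h: "continuous_on X h"
  shows "continuous_map (weak_star X I) euclideanreal (\<lambda>\<mu>. \<integral>x. h x \<partial>\<mu>)"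
proof -
  let ?F = "\<lambda>\<mu>. \<lambda>\<phi>\<in>{\<phi>. continuous_on X \<phi>}. \<integral>x. \<phi> x \<partial>\<mu>"
  have "continuous_map (product_topology (\<lambda>_. euclideanreal) {\<phi>. continuous_on X \<phi>}) euclideanreal (\<lambda>x. x h)"
    by (rule continuous_map_product_projection) (use h in simp)
  then have "continuous_map (weak_star X I) euclideanreal ((\<lambda>x. x h) \<circ> ?F)"
    unfolding weak_star_def by (rule continuous_map_pullback)
  moreover have "(\<lambda>x. x h) \<circ> ?F = (\<lambda>\<mu>. \<integral>x. h x \<partial>\<mu>)" using h by (auto simp: fun_eq_iff)
  ultimately show ?thesis by simp
qed

lemma topspace_weak_star: "topspace (weak_star X I) = I"
  unfolding weak_star_def topspace_pullback_topology by (auto simp: PiE_def extensional_def)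

context random_cocycle
begin

abbreviation RY :: "'y measure" where "RY \<equiv> restrict_space borel Y"

lemma space_RY: "space RY = Y"
  by (simp add: space_restrict_space)

lemma q_measurable: "q \<in> measurable RY MZ"
  by (rule positivity_measurable[OF Z_sets])
    (use q_image C_q in \<open>auto simp: space_RY intro: borel_measurable_continuous_on_restrict\<close>)

lemma pr_measurable: "pr \<in> measurable MZ RX"
  by (rule positivity_measurable[OF X_sets]) (auto intro: pr_in C_measurable C_base)

lemma ft_measurable: "\<omega> \<in> space S \<Longrightarrow> ft \<omega> \<in> measurable MZ MZ"
  by (rule positivity_measurable[OF Z_sets]) (auto intro: ft_in C_measurable C_ft)

lemma q_in: "y \<in> Y \<Longrightarrow> q y \<in> space MZ"
  using q_image by auto

lemma ft_q_measurable: "(\<lambda>(\<omega>, y). ft \<omega> (q y)) \<in> measurable (S \<Otimes>\<^sub>M RY) MZ"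
proof (rule positivity_measurable[OF Z_sets])
  show "(case x of (\<omega>, y) \<Rightarrow> ft \<omega> (q y)) \<in> space MZ" if "x \<in> space (S \<Otimes>\<^sub>M RY)" for x
    using that by (auto simp: space_pair_measure space_RY intro!: ft_in q_in)
  show "(\<lambda>x. u (case x of (\<omega>, y) \<Rightarrow> ft \<omega> (q y))) \<in> borel_measurable (S \<Otimes>\<^sub>M RY)" if "u \<in> C" for u
    using C_joint[OF that] by (simp add: case_prod_beta')
qed

lemma transfer_in_C: "u \<in> C \<Longrightarrow> transfer u \<in> C"
  unfolding transfer_def[abs_def] by (rule C_transfer)

lemma phi_in_C: "\<phi> \<in> C"
  unfolding \<phi>_def[abs_def] by (rule potential)

text \<open>The law of \<open>ft \<omega> (q y)\<close> and the law of \<open>q y\<close> give every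
  function of \<open>C\<close> the same integral, hence coincide; disintegrating the former over
  \<open>\<omega>\<close> is the stationarity equation.\<close>

lemma lift_stationary:
  assumes \<eta>: "prob_space \<eta>" "sets \<eta> = sets RY"
    and inv: "\<And>u. u \<in> C \<Longrightarrow> (\<integral>y. transfer u (q y) \<partial>\<eta>) = (\<integral>y. u (q y) \<partial>\<eta>)"
  shows "distr \<eta> MZ q \<in> stationary_measures p ft MZ"
proof -
  interpret eta: prob_space \<eta> by fact
  interpret P: pair_prob_space S \<eta> ..
  have qm: "q \<in> measurable \<eta> MZ" using q_measurable measurable_cong_sets[OF \<eta>(2) refl] by blast
  have space_eta: "space \<eta> = Y" using sets_eq_imp_space_eq[OF \<eta>(2)] by (simp add: space_RY)
  have meq: "measurable (S \<Otimes>\<^sub>M \<eta>) N = measurable (S \<Otimes>\<^sub>M RY) N" for N :: "'n measure"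
    by (rule measurable_cong_sets[OF sets_pair_measure_cong[OF refl \<eta>(2)] refl])
  have fq: "(\<lambda>(\<omega>, y). ft \<omega> (q y)) \<in> measurable (S \<Otimes>\<^sub>M \<eta>) MZ" unfolding meq by (rule ft_q_measurable)
  let ?\<nu> = "distr \<eta> MZ q" and ?\<nu>' = "distr (S \<Otimes>\<^sub>M \<eta>) MZ (\<lambda>(\<omega>, y). ft \<omega> (q y))"
  have "?\<nu>' = ?\<nu>"
  proof (rule measure_eqI_function_lattice[OF C_lattice])
    show "prob_space ?\<nu>'" by (rule P.P.prob_space_distr[OF fq])
    show "prob_space ?\<nu>" by (rule eta.prob_space_distr[OF qm])
    show "sets ?\<nu>' = sigma_sets (space MZ) (positivity_sets (space MZ) C)"
      "sets ?\<nu> = sigma_sets (space MZ) (positivity_sets (space MZ) C)" by (simp_all add: Z_sets[symmetric])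
    fix u assume u: "u \<in> C"
    obtain B where B: "\<And>z. z \<in> space MZ \<Longrightarrow> \<bar>u z\<bar> \<le> B" using C_bounded[OF u] by blast
    have int: "integrable (S \<Otimes>\<^sub>M \<eta>) (\<lambda>(\<omega>, y). u (ft \<omega> (q y)))"
      using C_joint[OF u] unfolding meq[symmetric]
      by (intro P.P.integrable_const_bound[of _ B])
        (auto intro!: AE_I2 B ft_in q_in simp: space_pair_measure space_eta)
    have "(\<integral>z. u z \<partial>?\<nu>') = (\<integral>x. (case x of (\<omega>, y) \<Rightarrow> u (ft \<omega> (q y))) \<partial>(S \<Otimes>\<^sub>M \<eta>))"
      by (subst integral_distr[OF fq C_measurable[OF u]]) (simp add: case_prod_beta')
    also have "\<dots> = (\<integral>y. transfer u (q y) \<partial>\<eta>)"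
      unfolding transfer_def by (rule P.integral_snd[OF int, symmetric])
    also have "\<dots> = (\<integral>y. u (q y) \<partial>\<eta>)" by (rule inv[OF u])
    also have "\<dots> = (\<integral>z. u z \<partial>?\<nu>)" by (rule integral_distr[OF qm C_measurable[OF u], symmetric])
    finally show "(\<integral>z. u z \<partial>?\<nu>') = (\<integral>z. u z \<partial>?\<nu>)" .
  qed
  have "emeasure ?\<nu> B = (\<integral>\<^sup>+\<omega>. emeasure ?\<nu> (ft \<omega> -` B \<inter> space MZ) \<partial>S)" if B: "B \<in> sets MZ" for B
  proof -
    let ?Q = "(\<lambda>(\<omega>, y). ft \<omega> (q y)) -` B \<inter> space (S \<Otimes>\<^sub>M \<eta>)"
    have "emeasure ?\<nu> B = emeasure ?\<nu>' B" using \<open>?\<nu>' = ?\<nu>\<close> by simp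
    also have "\<dots> = emeasure (S \<Otimes>\<^sub>M \<eta>) ?Q" by (rule emeasure_distr[OF fq B])
    also have "\<dots> = (\<integral>\<^sup>+\<omega>. emeasure \<eta> (Pair \<omega> -` ?Q) \<partial>S)"
      by (rule eta.emeasure_pair_measure_alt[OF measurable_sets[OF fq B]])
    also have "\<dots> = (\<integral>\<^sup>+\<omega>. emeasure ?\<nu> (ft \<omega> -` B \<inter> space MZ) \<partial>S)"
    proof (rule nn_integral_cong)
      fix \<omega> assume \<omega>: "\<omega> \<in> space S"
      have "Pair \<omega> -` ?Q = q -` (ft \<omega> -` B \<inter> space MZ) \<inter> space \<eta>"
        using \<omega> by (auto simp: space_pair_measure space_eta q_in)
      then show "emeasure \<eta> (Pair \<omega> -` ?Q) = emeasure ?\<nu> (ft \<omega> -` B \<inter> space MZ)"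
        using emeasure_distr[OF qm measurable_sets[OF ft_measurable[OF \<omega>] B]] by simp
    qed
    finally show ?thesis .
  qed
  then show ?thesis
    unfolding stationary_measures_def using eta.prob_space_distr[OF qm] by simp
qed

lemma lift_projection:
  assumes \<eta>: "prob_space \<eta>" "sets \<eta> = sets RY" and \<mu>: "prob_space \<mu>" "sets \<mu> = sets RX"
    and eq: "\<And>g :: 'a \<Rightarrow> real. continuous_on X g \<Longrightarrow> (\<integral>y. g (pr (q y)) \<partial>\<eta>) = (\<integral>x. g x \<partial>\<mu>)"
  shows "distr (distr \<eta> MZ q) RX pr = \<mu>"
proof (rule measure_eqI_function_lattice[OF function_lattice_continuous_on[of X]])
  interpret eta: prob_space \<eta> by fact
  have qm: "q \<in> measurable \<eta> MZ" using q_measurable measurable_cong_sets[OF \<eta>(2) refl] by blast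
  have pm: "pr \<in> measurable (distr \<eta> MZ q) RX" using pr_measurable by simp
  show "prob_space (distr (distr \<eta> MZ q) RX pr)"
    by (rule prob_space.prob_space_distr[OF eta.prob_space_distr[OF qm] pm])
  show "prob_space \<mu>" by fact
  show "sets (distr (distr \<eta> MZ q) RX pr) = sigma_sets X (positivity_sets X {g. continuous_on X g})"
    "sets \<mu> = sigma_sets X (positivity_sets X {g. continuous_on X g})"
    using \<mu>(2) X_sets by simp_all
  fix g :: "'a \<Rightarrow> real" assume "g \<in> {g. continuous_on X g}"
  then have g: "continuous_on X g" by simp
  have "(\<integral>x. g x \<partial>distr (distr \<eta> MZ q) RX pr) = (\<integral>z. g (pr z) \<partial>distr \<eta> MZ q)"
    by (rule integral_distr[OF pm X_measurable[OF g]])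
  also have "\<dots> = (\<integral>y. g (pr (q y)) \<partial>\<eta>)"
    by (rule integral_distr[OF qm C_measurable[OF C_base[OF g]]])
  finally show "(\<integral>x. g x \<partial>distr (distr \<eta> MZ q) RX pr) = (\<integral>x. g x \<partial>\<mu>)" by (simp add: eq[OF g])
qed

text \<open>By duality, if no stationary lift has smaller integral of the potential, then the potential
  is cohomologous, up to a small error in the integral, to a function bounded below by one that
  lives on the base.\<close>

lemma ex_coboundary:
  assumes \<mu>: "\<mu> \<in> stationary_on p f X" and e: "e > 0"
    and lifts: "\<And>\<nu>. \<nu> \<in> stationary_measures p ft MZ \<Longrightarrow> distr \<nu> RX pr = \<mu> \<Longrightarrow> (\<integral>z. \<phi> z \<partial>\<nu>) = - exponent \<mu>"
  obtains g u where "continuous_on X g" "u \<in> C"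
    "\<And>z. z \<in> space MZ \<Longrightarrow> - \<phi> z \<le> g (pr z) + (transfer u z - u z)"
    "(\<integral>x. g x \<partial>\<mu>) < exponent \<mu> + e"
proof -
  interpret stationary_dynamics p f X \<mu> by unfold_locales fact
  \<comment> \<open>The functional to extend. Pairs with \<open>g = 0\<close> force a representing
    measure to be invariant under \<open>transfer\<close>, pairs with \<open>u = 0\<close> force its
    image to project to \<open>\<mu>\<close>. The functions are pulled back to \<open>Y\<close>,
    where measures can be produced.\<close>
  define R where "R = {(r, a). \<exists>g u. continuous_on X g \<and> u \<in> C \<and> a = (\<integral>x. g x \<partial>\<mu>) \<and>
     (\<forall>y\<in>Y. r y = g (pr (q y)) + (transfer u (q y) - u (q y)))}"
  have RI: "(r, a) \<in> R" if "continuous_on X g" "u \<in> C" "a = (\<integral>x. g x \<partial>\<mu>)"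
      "\<And>y. y \<in> Y \<Longrightarrow> r y = g (pr (q y)) + (transfer u (q y) - u (q y))" for r a g u
    unfolding R_def using that by blast
  have RE: thesis' if "(r, a) \<in> R" "\<And>g u. continuous_on X g \<Longrightarrow> u \<in> C \<Longrightarrow> a = (\<integral>x. g x \<partial>\<mu>) \<Longrightarrow>
      (\<And>y. y \<in> Y \<Longrightarrow> r y = g (pr (q y)) + (transfer u (q y) - u (q y))) \<Longrightarrow> thesis'" for r a thesis'
    using that unfolding R_def by blast
  have g_int: "integrable \<mu> g" if g: "continuous_on X g" for g :: "'a \<Rightarrow> real"
  proof -
    obtain B where "\<And>x. x \<in> X \<Longrightarrow> \<bar>g x\<bar> \<le> B" using X_bounded[OF g] by blast
    moreover have "g \<in> borel_measurable \<mu>" using X_measurable[OF g] by measurable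
    ultimately show ?thesis by (intro mu.integrable_const_bound[of _ B]) (auto simp: space_mu)
  qed
  have C0: "(\<lambda>_. 0) \<in> C" by (rule function_latticeD(1)[OF C_lattice])
  have const: "((\<lambda>_. c), c) \<in> R" for c
    by (rule RI[OF _ C0, of "\<lambda>_. c"]) (auto simp: transfer_def mu.prob_space)
  have phi_q: "continuous_on Y (\<lambda>y. - \<phi> (q y))"
    by (intro continuous_on_minus C_q phi_in_C)
  obtain \<eta> where \<eta>: "prob_space \<eta>" "sets \<eta> = sets RY"
    and \<eta>R: "\<forall>r a. (r, a) \<in> R \<longrightarrow> (\<integral>y. r y \<partial>\<eta>) = a"
    and \<eta>\<phi>: "(\<integral>y. - \<phi> (q y) \<partial>\<eta>) = Inf {a. \<exists>r. (r, a) \<in> R \<and> (\<forall>y\<in>Y. - \<phi> (q y) \<le> r y)}"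
  proof (rule extend_to_measure[OF compact_Y, of R "\<lambda>y. - \<phi> (q y)"])
    show "continuous_on Y r" if "(r, a) \<in> R" for r a
    proof (rule RE[OF that])
      fix g u assume gu: "continuous_on X g" "u \<in> C" and
        r: "\<And>y. y \<in> Y \<Longrightarrow> r y = g (pr (q y)) + (transfer u (q y) - u (q y))"
      have "continuous_on Y (\<lambda>y. g (pr (q y)) + (transfer u (q y) - u (q y)))"
        by (intro continuous_on_add continuous_on_diff C_q[OF C_base] C_q transfer_in_C gu)
      then show ?thesis using r by (simp cong: continuous_on_cong)
    qed
    show "(\<lambda>y. \<alpha> * r y + \<beta>' * r' y, \<alpha> * a + \<beta>' * a') \<in> R" if "(r, a) \<in> R" "(r', a') \<in> R" for r a r' a' \<alpha> \<beta>'
    proof (rule RE[OF that(1)], rule RE[OF that(2)])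
      fix g u g' u' assume gu: "continuous_on X g" "u \<in> C" "continuous_on X g'" "u' \<in> C"
        and a: "a = (\<integral>x. g x \<partial>\<mu>)" "a' = (\<integral>x. g' x \<partial>\<mu>)"
        and r: "\<And>y. y \<in> Y \<Longrightarrow> r y = g (pr (q y)) + (transfer u (q y) - u (q y))"
          "\<And>y. y \<in> Y \<Longrightarrow> r' y = g' (pr (q y)) + (transfer u' (q y) - u' (q y))"
      show ?thesis
      proof (rule RI[of "\<lambda>x. \<alpha> * g x + \<beta>' * g' x" "\<lambda>z. \<alpha> * u z + \<beta>' * u' z"])
        show "continuous_on X (\<lambda>x. \<alpha> * g x + \<beta>' * g' x)" by (intro continuous_intros gu)
        show "(\<lambda>z. \<alpha> * u z + \<beta>' * u' z) \<in> C" by (rule function_latticeD(2)[OF C_lattice gu(2,4)])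
        show "\<alpha> * a + \<beta>' * a' = (\<integral>x. \<alpha> * g x + \<beta>' * g' x \<partial>\<mu>)"
          using g_int[OF gu(1)] g_int[OF gu(3)] by (simp add: a)
        fix y assume y: "y \<in> Y"
        have t: "transfer (\<lambda>z. \<alpha> * u z + \<beta>' * u' z) (q y) = \<alpha> * transfer u (q y) + \<beta>' * transfer u' (q y)"
          unfolding transfer_def
          using C_ft_integrable[OF gu(2) q_in[OF y]] C_ft_integrable[OF gu(4) q_in[OF y]] by simp
        show "\<alpha> * r y + \<beta>' * r' y = \<alpha> * g (pr (q y)) + \<beta>' * g' (pr (q y)) +
            (transfer (\<lambda>z. \<alpha> * u z + \<beta>' * u' z) (q y) - (\<alpha> * u (q y) + \<beta>' * u' (q y)))"
          unfolding r(1)[OF y] r(2)[OF y] t by (simp add: algebra_simps)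
      qed
    qed
    show "((\<lambda>_. 1), 1) \<in> R" by (rule const)
    show "0 \<le> a" if ra: "(r, a) \<in> R" and r0: "\<And>y. y \<in> Y \<Longrightarrow> 0 \<le> r y" for r a
    proof (rule RE[OF ra])
      fix g u assume gu: "continuous_on X g" "u \<in> C" and a: "a = (\<integral>x. g x \<partial>\<mu>)"
        and r: "\<And>y. y \<in> Y \<Longrightarrow> r y = g (pr (q y)) + (transfer u (q y) - u (q y))"
      have "0 \<le> g (pr z) + (transfer u z - u z)" if "z \<in> space MZ" for z
      proof -
        from that q_image obtain y where "y \<in> Y" "z = q y" by auto
        then show ?thesis using r0[of y] r[of y] by simp
      qed
      then show "0 \<le> a" unfolding a by (rule coboundary_positive[OF stationary gu])
    qed
    show "continuous_on Y (\<lambda>y. - \<phi> (q y))" by (rule phi_q)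
  qed blast
  let ?\<nu> = "distr \<eta> MZ q"
  have "(\<integral>y. transfer u (q y) \<partial>\<eta>) = (\<integral>y. u (q y) \<partial>\<eta>)" if u: "u \<in> C" for u
  proof -
    have "((\<lambda>y. transfer u (q y) - u (q y)), 0) \<in> R"
      by (rule RI[OF _ u, of "\<lambda>_. 0"]) auto
    then have "(\<integral>y. transfer u (q y) - u (q y) \<partial>\<eta>) = 0" using \<eta>R by blast
    moreover have "integrable \<eta> (\<lambda>y. w (q y))" if w: "w \<in> C" for w
    proof -
      interpret eta: prob_space \<eta> by fact
      obtain B where B: "\<And>z. z \<in> space MZ \<Longrightarrow> \<bar>w z\<bar> \<le> B" using C_bounded[OF w] by blast
      have "space \<eta> = Y" using sets_eq_imp_space_eq[OF \<eta>(2)] by (simp add: space_RY)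
      then have "AE y in \<eta>. norm (w (q y)) \<le> B" by (auto intro!: AE_I2 B q_in)
      moreover have "(\<lambda>y. w (q y)) \<in> borel_measurable \<eta>"
        using measurable_compose[OF q_measurable C_measurable[OF w]] measurable_cong_sets[OF \<eta>(2) refl] by blast
      ultimately show ?thesis by (rule eta.integrable_const_bound)
    qed
    note int = this
    have "(\<integral>y. transfer u (q y) - u (q y) \<partial>\<eta>) = (\<integral>y. transfer u (q y) \<partial>\<eta>) - (\<integral>y. u (q y) \<partial>\<eta>)"
      by (rule Bochner_Integration.integral_diff[OF int[OF transfer_in_C[OF u]] int[OF u]])
    ultimately show ?thesis by simp
  qed
  then have \<nu>: "?\<nu> \<in> stationary_measures p ft MZ" by (rule lift_stationary[OF \<eta>])
  have "(\<integral>y. g (pr (q y)) \<partial>\<eta>) = (\<integral>x. g x \<partial>\<mu>)" if g: "continuous_on X g" for g :: "'a \<Rightarrow> real"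
  proof -
    have "((\<lambda>y. g (pr (q y))), \<integral>x. g x \<partial>\<mu>) \<in> R"
      by (rule RI[OF g C0]) (auto simp: transfer_def)
    then show ?thesis using \<eta>R by blast
  qed
  then have "distr ?\<nu> RX pr = \<mu>" by (rule lift_projection[OF \<eta> mu.prob_space_axioms sets_mu])
  with \<nu> have "(\<integral>z. \<phi> z \<partial>?\<nu>) = - exponent \<mu>" by (rule lifts)
  moreover have "(\<integral>z. \<phi> z \<partial>?\<nu>) = (\<integral>y. \<phi> (q y) \<partial>\<eta>)"
    using q_measurable measurable_cong_sets[OF \<eta>(2) refl]
    by (intro integral_distr C_measurable[OF phi_in_C]) blast
  \<comment> \<open>The extension was chosen extremal at \<open>- \<phi>\<close>, so the integral
    known from \<open>lifts\<close> equals the infimum over the majorants; a majorant with value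
    close to it provides \<open>g\<close> and \<open>u\<close>.\<close>
  ultimately have lt: "Inf {a. \<exists>r. (r, a) \<in> R \<and> (\<forall>y\<in>Y. - \<phi> (q y) \<le> r y)} < exponent \<mu> + e"
    using \<eta>\<phi> e by simp
  have ne: "{a. \<exists>r. (r, a) \<in> R \<and> (\<forall>y\<in>Y. - \<phi> (q y) \<le> r y)} \<noteq> {}"
  proof -
    obtain B where B: "\<And>z. z \<in> space MZ \<Longrightarrow> \<bar>\<phi> z\<bar> \<le> B" using C_bounded[OF phi_in_C] by blast
    have "\<forall>y\<in>Y. - \<phi> (q y) \<le> B" using B[OF q_in] by (simp add: abs_le_iff)
    then show ?thesis using const[of B] by blast
  qed
  from cInf_lessD[OF ne lt] obtain a r where r: "(r, a) \<in> R" "\<And>y. y \<in> Y \<Longrightarrow> - \<phi> (q y) \<le> r y" "a < exponent \<mu> + e"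
    by auto
  show ?thesis
  proof (rule RE[OF r(1)])
    fix g u assume gu: "continuous_on X g" "u \<in> C" and a: "a = (\<integral>x. g x \<partial>\<mu>)"
      and req: "\<And>y. y \<in> Y \<Longrightarrow> r y = g (pr (q y)) + (transfer u (q y) - u (q y))"
    show ?thesis
    proof (rule that[OF gu])
      show "- \<phi> z \<le> g (pr z) + (transfer u z - u z)" if "z \<in> space MZ" for z
      proof -
        from that q_image obtain y where "y \<in> Y" "z = q y" by auto
        then show ?thesis using r(2)[of y] req[of y] by simp
      qed
      show "(\<integral>x. g x \<partial>\<mu>) < exponent \<mu> + e" using r(3) a by simp
    qed
  qed
qed

theorem exponent_continuous_at:
  assumes \<mu>: "\<mu> \<in> stationary_on p f X"
    and lifts: "\<And>\<nu>. \<nu> \<in> stationary_measures p ft MZ \<Longrightarrow> distr \<nu> RX pr = \<mu> \<Longrightarrow> (\<integral>z. \<phi> z \<partial>\<nu>) = - exponent \<mu>"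
  shows "topcontinuous_at (weak_star X (stationary_on p f X)) euclideanreal exponent \<mu>"
  unfolding topcontinuous_at_def topspace_weak_star
proof (intro conjI allI impI)
  show "\<mu> \<in> stationary_on p f X" by fact
  show "exponent \<in> stationary_on p f X \<rightarrow> topspace euclideanreal" by simp
  let ?W = "weak_star X (stationary_on p f X)"
  fix V assume "openin euclideanreal V \<and> exponent \<mu> \<in> V"
  then obtain e where e: "e > 0" "\<And>t. \<bar>t - exponent \<mu>\<bar> < e \<Longrightarrow> t \<in> V"
    by (auto simp: open_real)
  have "\<forall>\<^sub>F n in sequentially. exponent \<mu> - e < 1 / real n * (\<integral>x. - \<beta> n x \<partial>\<mu>)"
    using exponent_limit(1)[OF \<mu>] e(1) by (intro order_tendstoD(1)) auto
  then have "\<forall>\<^sub>F n in sequentially. n \<ge> 1 \<and> exponent \<mu> - e < 1 / real n * (\<integral>x. - \<beta> n x \<partial>\<mu>)"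
    using eventually_ge_at_top[of 1] by eventually_elim simp
  then obtain n where n: "n \<ge> 1" "exponent \<mu> - e < 1 / real n * (\<integral>x. - \<beta> n x \<partial>\<mu>)"
    by (auto simp: eventually_sequentially)
  obtain g u where gu: "continuous_on X g" "u \<in> C"
    "\<forall>z\<in>space MZ. - \<phi> z \<le> g (pr z) + (transfer u z - u z)" "(\<integral>x. g x \<partial>\<mu>) < exponent \<mu> + e"
    using ex_coboundary[OF \<mu> e(1) lifts] by (metis (no_types, lifting))
  \<comment> \<open>At every stationary measure the exponent lies between the values of
    \<open>?L\<close> and \<open>?G\<close>, and both are weak-star continuous; at
    \<open>\<mu>\<close> they are within \<open>e\<close> of the exponent on the side that
    matters.\<close>
  let ?L = "\<lambda>\<nu>. 1 / real n * (\<integral>x. - \<beta> n x \<partial>\<nu>)" and ?G = "\<lambda>\<nu>. \<integral>x. g x \<partial>\<nu>"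
  have "continuous_map ?W euclideanreal ?L"
    using b_cont[of n] unfolding \<beta>_def[abs_def]
    by (intro continuous_map_real_mult continuous_map_weak_star continuous_on_minus) simp_all
  then have "openin ?W {\<nu> \<in> topspace ?W. ?L \<nu> \<in> {exponent \<mu> - e<..}}"
    by (rule openin_continuous_map_preimage) auto
  moreover have "openin ?W {\<nu> \<in> topspace ?W. ?G \<nu> \<in> {..<exponent \<mu> + e}}"
    by (rule openin_continuous_map_preimage[OF continuous_map_weak_star[OF gu(1)]]) auto
  ultimately have "openin ?W ({\<nu> \<in> topspace ?W. ?L \<nu> \<in> {exponent \<mu> - e<..}} \<inter>
      {\<nu> \<in> topspace ?W. ?G \<nu> \<in> {..<exponent \<mu> + e}})" (is "openin ?W ?U")
    by (rule openin_Int)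
  moreover have "\<mu> \<in> ?U" using \<mu> n gu by (simp add: topspace_weak_star)
  moreover have "exponent \<nu> \<in> V" if "\<nu> \<in> ?U" for \<nu>
  proof (rule e(2))
    have \<nu>: "\<nu> \<in> stationary_on p f X" using that by (simp add: topspace_weak_star)
    have "exponent \<mu> - e < exponent \<nu>" using that exponent_limit(2)[OF \<nu> n(1)] by simp
    moreover have "exponent \<nu> < exponent \<mu> + e"
      using that exponent_le[OF \<nu> gu(1,2)] gu(3) by force
    ultimately show "\<bar>exponent \<nu> - exponent \<mu>\<bar> < e" by simp
  qed
  ultimately show "\<exists>U. openin ?W U \<and> \<mu> \<in> U \<and> (\<forall>y\<in>U. exponent y \<in> V)" by blast
qed

end

lemma linear_expand:
  fixes F :: "'e::euclidean_space \<Rightarrow> 'b::real_vector"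
  assumes "linear F"
  shows "F e = (\<Sum>b\<in>Basis. (e \<bullet> b) *\<^sub>R F b)"
proof -
  have "F e = F (\<Sum>b\<in>Basis. (e \<bullet> b) *\<^sub>R b)" by (simp add: euclidean_representation)
  then show ?thesis using assms by (simp add: linear_sum linear_scale)
qed

subsection \<open>Charts, derivatives and tangent vectors\<close>

locale riem =
  fixes M :: "('a::{t2_space, second_countable_topology}, 'e::euclidean_space) riemannian"
  assumes riemannian: "riemannian_manifold M"
begin

text \<open>The base point is given on the manifold and not in coordinates, so that the derivatives
  in different charts are named at the same \<open>x\<close>; the value is meaningful for charts
  \<open>c\<close> around \<open>x\<close> and \<open>c'\<close> around \<open>h x\<close>.\<close>

definition chart_D :: "('a, 'e) chart \<Rightarrow> ('a, 'e) chart \<Rightarrow> ('a \<Rightarrow> 'a) \<Rightarrow> 'a \<Rightarrow> 'e \<Rightarrow> 'e" where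
  "chart_D c c' h x = frechet_derivative (snd c' \<circ> h \<circ> chart_inv c) (at (snd c x))"

lemma atlas: "smooth_atlas (atlas M)"
  using riemannian by (simp add: riemannian_manifold_def)

lemma
  assumes c: "c \<in> atlas M"
  shows chart_dom_open: "open (fst c)" and chart_img_open: "open (snd c ` fst c)"
    and chart_cont: "continuous_on (fst c) (snd c)"
    and chart_inv_cont: "continuous_on (snd c ` fst c) (chart_inv c)"
    and chart_inv_chart: "x \<in> fst c \<Longrightarrow> chart_inv c (snd c x) = x"
    and chart_inv_in: "w \<in> snd c ` fst c \<Longrightarrow> chart_inv c w \<in> fst c"
    and chart_chart_inv: "w \<in> snd c ` fst c \<Longrightarrow> snd c (chart_inv c w) = w"
proof -
  have "is_chart c" using atlas c by (auto simp: smooth_atlas_def)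
  then show "open (fst c)" "open (snd c ` fst c)" "continuous_on (fst c) (snd c)"
    "continuous_on (snd c ` fst c) (chart_inv c)" "x \<in> fst c \<Longrightarrow> chart_inv c (snd c x) = x"
    "w \<in> snd c ` fst c \<Longrightarrow> chart_inv c w \<in> fst c" "w \<in> snd c ` fst c \<Longrightarrow> snd c (chart_inv c w) = w"
    unfolding is_chart_def homeomorphism_def by auto
qed

lemma charts_atD: "c \<in> charts_at M x \<Longrightarrow> c \<in> atlas M \<and> x \<in> fst c"
  by (simp add: charts_at_def)

lemma charts_atI: "c \<in> atlas M \<Longrightarrow> x \<in> fst c \<Longrightarrow> c \<in> charts_at M x"
  by (simp add: charts_at_def)

lemma ex_chart: "\<exists>c. c \<in> charts_at M x"
proof -
  have "x \<in> (\<Union>c\<in>atlas M. fst c)" using atlas by (simp add: smooth_atlas_def)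
  then obtain c where "c \<in> atlas M" "x \<in> fst c" by blast
  then show ?thesis using charts_atI by blast
qed

lemma chart_open_image:
  assumes c: "c \<in> atlas M" and U: "open U"
  shows "open (snd c ` (fst c \<inter> U))"
proof -
  have "snd c ` (fst c \<inter> U) = chart_inv c -` U \<inter> snd c ` fst c"
    using chart_inv_chart[OF c] by auto
  then show ?thesis
    using continuous_on_open_vimage[OF chart_img_open[OF c]] chart_inv_cont[OF c] U by metis
qed

definition C1_map :: "('a \<Rightarrow> 'a) \<Rightarrow> bool" where
  "C1_map h \<longleftrightarrow> C1_map_on M UNIV h"

lemma C1_map_cont: "C1_map h \<Longrightarrow> continuous_on UNIV h"
  by (simp add: C1_map_def C1_map_on_def)

text \<open>The coordinates at which \<open>snd c' \<circ> h \<circ> chart_inv c\<close> really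
  represents \<open>h\<close>. Elsewhere \<open>chart_inv\<close> and \<open>snd c'\<close> take
  arbitrary values, so local statements are confined to this set, which is open for continuous
  \<open>h\<close>.\<close>

definition transition_dom :: "('a, 'e) chart \<Rightarrow> ('a, 'e) chart \<Rightarrow> ('a \<Rightarrow> 'a) \<Rightarrow> 'e set" where
  "transition_dom c c' h = snd c ` (fst c \<inter> h -` fst c')"

lemma regI: "c \<in> charts_at M x \<Longrightarrow> c' \<in> charts_at M (h x) \<Longrightarrow> snd c x \<in> transition_dom c c' h"
  by (auto simp: transition_dom_def charts_at_def)

lemma regD:
  assumes "c \<in> atlas M" "c' \<in> atlas M" "w \<in> transition_dom c c' h"
  shows "c \<in> charts_at M (chart_inv c w)" "c' \<in> charts_at M (h (chart_inv c w))"
    "snd c (chart_inv c w) = w" "w \<in> snd c ` fst c"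
proof -
  obtain x where "w = snd c x" "x \<in> fst c" "h x \<in> fst c'" using assms(3) by (auto simp: transition_dom_def)
  then show "c \<in> charts_at M (chart_inv c w)" "c' \<in> charts_at M (h (chart_inv c w))"
    "snd c (chart_inv c w) = w" "w \<in> snd c ` fst c"
    using assms chart_inv_chart[OF assms(1), of x] by (simp_all add: charts_at_def)
qed

lemma transition_dom_open:
  assumes "C1_map h" "c \<in> atlas M" "c' \<in> atlas M"
  shows "open (transition_dom c c' h)"
  unfolding transition_dom_def
  by (intro chart_open_image assms open_vimage chart_dom_open C1_map_cont)

lemma C1_mapD:
  assumes h: "C1_map h" and c: "c \<in> atlas M" "c' \<in> atlas M"
  shows "w \<in> transition_dom c c' h \<Longrightarrow> (snd c' \<circ> h \<circ> chart_inv c) differentiable (at w)"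
    and "continuous_on (transition_dom c c' h) (\<lambda>w. frechet_derivative (snd c' \<circ> h \<circ> chart_inv c) (at w) e)"
proof -
  have "Ck_on 1 (transition_dom c c' h) (snd c' \<circ> h \<circ> chart_inv c)"
    using h c by (auto simp: C1_map_def C1_map_on_def transition_dom_def)
  then show "w \<in> transition_dom c c' h \<Longrightarrow> (snd c' \<circ> h \<circ> chart_inv c) differentiable (at w)"
    and "continuous_on (transition_dom c c' h) (\<lambda>w. frechet_derivative (snd c' \<circ> h \<circ> chart_inv c) (at w) e)"
    by (auto simp: One_nat_def)
qed

lemma C1_mapI:
  assumes "continuous_on UNIV h"
    and "\<And>c c' w. c \<in> atlas M \<Longrightarrow> c' \<in> atlas M \<Longrightarrow> w \<in> transition_dom c c' h \<Longrightarrow> (snd c' \<circ> h \<circ> chart_inv c) differentiable (at w)"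
    and "\<And>c c' e w. c \<in> atlas M \<Longrightarrow> c' \<in> atlas M \<Longrightarrow> w \<in> transition_dom c c' h \<Longrightarrow>
      isCont (\<lambda>w. frechet_derivative (snd c' \<circ> h \<circ> chart_inv c) (at w) e) w"
  shows "C1_map h"
  unfolding C1_map_def C1_map_on_def
proof (intro conjI ballI)
  fix c c' assume c: "c \<in> atlas M" "c' \<in> atlas M"
  have "Ck_on (Suc 0) (transition_dom c c' h) (snd c' \<circ> h \<circ> chart_inv c)"
    unfolding Ck_on.simps
    by (intro conjI ballI allI continuous_at_imp_continuous_on assms(2,3)[OF c])
  then show "Ck_on 1 (snd c ` (fst c \<inter> UNIV \<inter> h -` fst c')) (snd c' \<circ> h \<circ> chart_inv c)"
    by (simp add: transition_dom_def)
qed (rule assms(1))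

lemma C1_id: "C1_map id"
proof -
  have "Ck_on 1 (snd c ` (fst c \<inter> fst c')) (snd c' \<circ> chart_inv c)" if "c \<in> atlas M" "c' \<in> atlas M" for c c'
    using atlas that unfolding smooth_atlas_def by blast
  then show ?thesis unfolding C1_map_def C1_map_on_def by (auto simp: continuous_on_id)
qed

lemma C1_diff:
  assumes "C1_map h" "c \<in> charts_at M x" "c' \<in> charts_at M (h x)"
  shows "(snd c' \<circ> h \<circ> chart_inv c) differentiable (at (snd c x))"
  using C1_mapD(1)[OF assms(1) _ _ regI[of c x c' h, OF assms(2,3)]] charts_atD[OF assms(2)] charts_atD[OF assms(3)]
  by simp

lemma chart_D_has_derivative:
  assumes "C1_map h" "c \<in> charts_at M x" "c' \<in> charts_at M (h x)"
  shows "((snd c' \<circ> h \<circ> chart_inv c) has_derivative chart_D c c' h x) (at (snd c x))"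
  unfolding chart_D_def using C1_diff[OF assms] by (simp add: frechet_derivative_works)

lemma linear_chart_D:
  assumes "C1_map h" "c \<in> charts_at M x" "c' \<in> charts_at M (h x)"
  shows "linear (chart_D c c' h x)"
  using chart_D_has_derivative[OF assms] by (rule has_derivative_linear)

lemma chain_has_derivative:
  assumes h: "C1_map h" and h': "C1_map h'" and c: "c \<in> charts_at M x"
    and c': "c' \<in> charts_at M (h x)" and c'': "c'' \<in> charts_at M (h' (h x))"
  shows "((snd c'' \<circ> (h' \<circ> h) \<circ> chart_inv c) has_derivative (chart_D c' c'' h' (h x) \<circ> chart_D c c' h x)) (at (snd c x))"
proof -
  note at = charts_atD[OF c] charts_atD[OF c'] charts_atD[OF c'']
  have x: "chart_inv c (snd c x) = x" using at chart_inv_chart by blast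
  have "((snd c'' \<circ> h' \<circ> chart_inv c') has_derivative chart_D c' c'' h' (h x)) (at ((snd c' \<circ> h \<circ> chart_inv c) (snd c x)))"
    using chart_D_has_derivative[OF h' c' c''] by (simp add: x)
  from diff_chain_at[OF chart_D_has_derivative[OF h c c'] this]
  show ?thesis
  proof (rule has_derivative_transform_within_open)
    show "open (transition_dom c c' h)" using transition_dom_open[OF h] at by blast
    show "snd c x \<in> transition_dom c c' h" by (rule regI[of c x c' h, OF c c'])
    fix w assume w: "w \<in> transition_dom c c' h"
    have "chart_inv c' (snd c' (h (chart_inv c w))) = h (chart_inv c w)"
      using regD[OF _ _ w] at chart_inv_chart charts_atD by blast
    then show "((snd c'' \<circ> h' \<circ> chart_inv c') \<circ> (snd c' \<circ> h \<circ> chart_inv c)) w = (snd c'' \<circ> (h' \<circ> h) \<circ> chart_inv c) w"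
      by simp
  qed
qed

lemma chain_rule:
  assumes "C1_map h" "C1_map h'" "c \<in> charts_at M x" "c' \<in> charts_at M (h x)" "c'' \<in> charts_at M (h' (h x))"
  shows "chart_D c c'' (h' \<circ> h) x = chart_D c' c'' h' (h x) \<circ> chart_D c c' h x"
  unfolding chart_D_def[of c c''] using frechet_derivative_at[OF chain_has_derivative[OF assms]] by simp

text \<open>The definition of a C1 map gives continuity of the derivative in each fixed direction;
  linearity and an expansion in a basis make it jointly continuous in the point and the
  direction.\<close>

lemma chart_D_joint:
  assumes h: "C1_map h" and c: "c \<in> atlas M" "c' \<in> atlas M"
  shows "continuous_on (transition_dom c c' h \<times> UNIV) (\<lambda>(w, d). chart_D c c' h (chart_inv c w) d)"
proof -
  have lin: "chart_D c c' h (chart_inv c w) d = (\<Sum>b\<in>Basis. (d \<bullet> b) *\<^sub>R frechet_derivative (snd c' \<circ> h \<circ> chart_inv c) (at w) b)"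
    if w: "w \<in> transition_dom c c' h" for w d
    using linear_expand[OF linear_chart_D[OF h regD(1,2)[OF c w]], of d] regD(3)[OF c w] by (simp add: chart_D_def)
  have "continuous_on (transition_dom c c' h \<times> UNIV) (\<lambda>z. \<Sum>b\<in>Basis. (snd z \<bullet> b) *\<^sub>R frechet_derivative (snd c' \<circ> h \<circ> chart_inv c) (at (fst z)) b)"
    by (intro continuous_on_sum continuous_on_scaleR continuous_intros
        continuous_on_compose2[OF C1_mapD(2)[OF h c]]) auto
  then show ?thesis
    by (rule continuous_on_eq) (auto simp: lin)
qed

lemma loc_cont:
  assumes h: "C1_map h" and c: "c \<in> atlas M" "c' \<in> atlas M"
  shows "continuous_on (transition_dom c c' h) (\<lambda>w. snd c' (h (chart_inv c w)))"
proof (intro continuous_at_imp_continuous_on ballI)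
  fix w assume "w \<in> transition_dom c c' h"
  from differentiable_imp_continuous_within[OF C1_mapD(1)[OF h c this]]
  show "isCont (\<lambda>w. snd c' (h (chart_inv c w))) w" by (simp add: o_def)
qed

lemma C1_comp:
  assumes h: "C1_map h" and h': "C1_map h'"
  shows "C1_map (h' \<circ> h)"
proof (rule C1_mapI)
  show "continuous_on UNIV (h' \<circ> h)"
    using C1_map_cont[OF h] C1_map_cont[OF h'] continuous_on_compose2 continuous_on_compose
    by (metis continuous_on_subset subset_UNIV)
  fix c c'' w assume cc: "c \<in> atlas M" "c'' \<in> atlas M" and w: "w \<in> transition_dom c c'' (h' \<circ> h)"
  note wD = regD[OF cc w]
  obtain c' where c': "c' \<in> charts_at M (h (chart_inv c w))" using ex_chart by blast
  then have c'a: "c' \<in> atlas M" using charts_atD by blast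
  have "((snd c'' \<circ> (h' \<circ> h) \<circ> chart_inv c) has_derivative
      (chart_D c' c'' h' (h (chart_inv c w)) \<circ> chart_D c c' h (chart_inv c w))) (at (snd c (chart_inv c w)))"
    using chain_has_derivative[OF h h' wD(1) c'] wD(2) by simp
  then show "(snd c'' \<circ> (h' \<circ> h) \<circ> chart_inv c) differentiable (at w)"
    unfolding wD(3) differentiable_def by blast
  fix e
  let ?F = "\<lambda>w. snd c' (h (chart_inv c w))"
  \<comment> \<open>On this set the intermediate point stays in the chart \<open>c'\<close> and the
    final one in \<open>c''\<close>, so the chain rule holds with fixed charts and continuity can be
    read off from the two factors.\<close>
  define U where "U = transition_dom c c' h \<inter> ?F -` transition_dom c' c'' h'"
  have opU: "open U"
    unfolding U_def using loc_cont[OF h cc(1) c'a] transition_dom_open[OF h cc(1) c'a] transition_dom_open[OF h' c'a cc(2)]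
    by (metis continuous_on_open_vimage Int_commute)
  have wr: "w \<in> transition_dom c c' h" using regI[of c _ c' h, OF wD(1) c'] wD(3) by simp
  have wU: "w \<in> U"
    unfolding U_def using wr regI[of c' _ c'' h', OF c'] wD(2) by simp
  have UD: "frechet_derivative (snd c'' \<circ> (h' \<circ> h) \<circ> chart_inv c) (at v) e =
      chart_D c' c'' h' (chart_inv c' (?F v)) (chart_D c c' h (chart_inv c v) e)" if v: "v \<in> U" for v
  proof -
    have vr: "v \<in> transition_dom c c' h" "?F v \<in> transition_dom c' c'' h'" using v by (auto simp: U_def)
    note v1 = regD[OF cc(1) c'a vr(1)] and v2 = regD[OF c'a cc(2) vr(2)]
    have eq: "chart_inv c' (?F v) = h (chart_inv c v)"
      using v1(2) chart_inv_chart charts_atD by blast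
    have "chart_D c c'' (h' \<circ> h) (chart_inv c v) = chart_D c' c'' h' (h (chart_inv c v)) \<circ> chart_D c c' h (chart_inv c v)"
      using v1 v2 eq by (intro chain_rule[OF h h']) auto
    then show ?thesis using v1(3) eq by (simp add: chart_D_def[of c c''])
  qed
  have "continuous_on U (\<lambda>v. (\<lambda>(w, d). chart_D c' c'' h' (chart_inv c' w) d) (?F v, chart_D c c' h (chart_inv c v) e))"
  proof (rule continuous_on_compose2[OF chart_D_joint[OF h' c'a cc(2)]])
    have "continuous_on U (\<lambda>v. (\<lambda>(w, d). chart_D c c' h (chart_inv c w) d) (v, e))"
      by (rule continuous_on_compose2[OF chart_D_joint[OF h cc(1) c'a]])
        (auto simp: U_def intro!: continuous_intros)
    then show "continuous_on U (\<lambda>v. (?F v, chart_D c c' h (chart_inv c v) e))"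
      using continuous_on_subset[OF loc_cont[OF h cc(1) c'a], of U]
      by (intro continuous_on_Pair) (auto simp: U_def)
  qed (auto simp: U_def)
  then have "continuous_on U (\<lambda>v. frechet_derivative (snd c'' \<circ> (h' \<circ> h) \<circ> chart_inv c) (at v) e)"
    by (rule continuous_on_eq) (simp add: UD)
  then show "isCont (\<lambda>w. frechet_derivative (snd c'' \<circ> (h' \<circ> h) \<circ> chart_inv c) (at w) e) w"
    using opU wU continuous_on_eq_continuous_at by blast
qed

lemma chart_D_id: "c \<in> charts_at M x \<Longrightarrow> chart_D c c id x = (\<lambda>e. e)"
proof -
  assume c: "c \<in> charts_at M x"
  note c' = charts_atD[OF c]
  have "((\<lambda>w. w) has_derivative (\<lambda>e. e)) (at (snd c x))" by (rule has_derivative_ident)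
  then have "((snd c \<circ> id \<circ> chart_inv c) has_derivative (\<lambda>e. e)) (at (snd c x))"
  proof (rule has_derivative_transform_within_open)
    show "open (snd c ` fst c)" "snd c x \<in> snd c ` fst c" using c' chart_img_open by auto
    show "w = (snd c \<circ> id \<circ> chart_inv c) w" if "w \<in> snd c ` fst c" for w
      using chart_chart_inv[OF _ that] c' by simp
  qed
  then show ?thesis unfolding chart_D_def by (rule frechet_derivative_at[symmetric])
qed

lemma coord_vector_apply:
  "c' \<in> charts_at M x \<Longrightarrow> coord_vector M c x e c' = chart_D c c' id x e"
  by (simp add: coord_vector_def chart_D_def)

lemma coord_vector_outside: "c' \<notin> charts_at M x \<Longrightarrow> coord_vector M c x e c' = 0"
  by (simp add: coord_vector_def)

lemma coord_vector_self: "c \<in> charts_at M x \<Longrightarrow> coord_vector M c x e c = e"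
  by (simp add: coord_vector_apply chart_D_id)

lemma chart_D_id_comp:
  assumes "c \<in> charts_at M x" "c' \<in> charts_at M x" "c'' \<in> charts_at M x"
  shows "chart_D c' c'' id x (chart_D c c' id x e) = chart_D c c'' id x e"
  using chain_rule[OF C1_id C1_id assms(1), of c' c''] assms by simp

lemma coord_vector_tangent: "c \<in> charts_at M x \<Longrightarrow> coord_vector M c x e \<in> tangent_space M x"
  unfolding tangent_space_def
proof (intro CollectI conjI allI impI ballI)
  fix c1 c2 assume "c \<in> charts_at M x" "c1 \<in> charts_at M x" "c2 \<in> charts_at M x"
  then show "coord_vector M c x e c2 =
      frechet_derivative (snd c2 \<circ> chart_inv c1) (at (snd c1 x)) (coord_vector M c x e c1)"
    using chart_D_id_comp[of c x c1 c2 e] by (simp add: coord_vector_apply) (simp add: chart_D_def)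
qed (rule coord_vector_outside)

lemma tangent_coord_vector:
  assumes c: "c \<in> charts_at M x" and v: "v \<in> tangent_space M x"
  shows "coord_vector M c x (v c) = v"
proof
  fix c'
  show "coord_vector M c x (v c) c' = v c'"
  proof (cases "c' \<in> charts_at M x")
    case True
    then have "v c' = frechet_derivative (snd c' \<circ> chart_inv c) (at (snd c x)) (v c)"
      using v c unfolding tangent_space_def by blast
    then show ?thesis using True by (simp add: coord_vector_def)
  next
    case False
    then have "v c' = 0" using v unfolding tangent_space_def by blast
    then show ?thesis using False by (simp add: coord_vector_def)
  qed
qed

text \<open>\<open>D_map\<close> is computed in some chosen chart \<open>c0\<close>. Changes of
  chart are derivatives of \<open>id\<close> between charts, and the chain rule for
  \<open>h \<circ> id = id \<circ> h\<close> removes the choice.\<close>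

lemma D_map_coord_vector:
  assumes h: "C1_map h" and c: "c \<in> charts_at M x" and c': "c' \<in> charts_at M (h x)"
  shows "D_map M h x (coord_vector M c x e) = coord_vector M c' (h x) (chart_D c c' h x e)"
proof
  fix c2
  define c0 where "c0 = (SOME c. c \<in> charts_at M x)"
  have c0: "c0 \<in> charts_at M x" unfolding c0_def by (rule someI_ex[OF ex_chart])
  show "D_map M h x (coord_vector M c x e) c2 = coord_vector M c' (h x) (chart_D c c' h x e) c2"
  proof (cases "c2 \<in> charts_at M (h x)")
    case True
    have "D_map M h x (coord_vector M c x e) c2 = chart_D c0 c2 h x (chart_D c c0 id x e)"
      using True c0 by (simp add: D_map_def Let_def c0_def[symmetric] chart_D_def[symmetric] coord_vector_apply)
    also have "\<dots> = chart_D c c2 (h \<circ> id) x e"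
      using chain_rule[OF C1_id h c, of c0 c2] c0 True by simp
    also have "\<dots> = chart_D c c2 (id \<circ> h) x e" by simp
    also have "\<dots> = chart_D c' c2 id (h x) (chart_D c c' h x e)"
      using chain_rule[OF h C1_id c c', of c2] True by simp
    finally show ?thesis using True by (simp add: coord_vector_apply)
  next
    case False
    then show ?thesis by (simp add: D_map_def Let_def coord_vector_outside)
  qed
qed

end

subsection \<open>Suprema of quotients of homogeneous functions\<close>

text \<open>Continuous seminorms without the triangle inequality. The notion covers both the pairing
  \<open>\<bar>e \<bullet> d\<bar>\<close> with a covector and the Riemannian length of the image of
  \<open>d\<close>.\<close>

definition homogeneous :: "('e::euclidean_space \<Rightarrow> real) \<Rightarrow> bool" where
  "homogeneous \<phi> \<longleftrightarrow> continuous_on UNIV \<phi> \<and> (\<forall>a d. \<phi> (a *\<^sub>R d) = \<bar>a\<bar> * \<phi> d) \<and> (\<forall>d. 0 \<le> \<phi> d)"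

text \<open>The best constant in \<open>\<phi> \<le> K * \<psi>\<close>. It is taken over the
  Euclidean unit sphere, so that the index set is compact and does not vary with the base point;
  operator norms of a derivative and of its inverse and norms of covectors are all of this
  form.\<close>

definition ratio_sup :: "('e::euclidean_space \<Rightarrow> real) \<Rightarrow> ('e \<Rightarrow> real) \<Rightarrow> real" where
  "ratio_sup \<phi> \<psi> = (SUP d\<in>sphere 0 1. \<phi> d / \<psi> d)"

lemma sphere_nonempty: "sphere (0 :: 'e::euclidean_space) 1 \<noteq> {}"
proof -
  obtain b :: 'e where "b \<in> Basis" using nonempty_Basis by blast
  then have "b \<in> sphere 0 1" by simp
  then show ?thesis by blast
qed

lemma homogeneousD:
  assumes "homogeneous \<phi>"
  shows "continuous_on A \<phi>" "\<phi> (a *\<^sub>R d) = \<bar>a\<bar> * \<phi> d" "0 \<le> \<phi> d"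
  using assms continuous_on_subset[of UNIV \<phi> A] by (auto simp: homogeneous_def)

lemma homogeneous_inner: "homogeneous (\<lambda>d. \<bar>e \<bullet> d\<bar>)"
  unfolding homogeneous_def by (auto simp: abs_mult intro!: continuous_intros)

lemma normalize_sphere: "d \<noteq> 0 \<Longrightarrow> inverse (norm d) *\<^sub>R d \<in> sphere 0 1"
  by simp

lemma
  fixes \<phi> \<psi> :: "'e::euclidean_space \<Rightarrow> real"
  assumes \<phi>: "homogeneous \<phi>" and \<psi>: "homogeneous \<psi>" and pos: "\<And>d. d \<noteq> 0 \<Longrightarrow> 0 < \<psi> d"
  shows ratio_sup_bdd: "bdd_above ((\<lambda>d. \<phi> d / \<psi> d) ` sphere 0 1)"
    and ratio_sup_ge: "\<phi> d \<le> ratio_sup \<phi> \<psi> * \<psi> d"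
    and ratio_sup_nonneg: "0 \<le> ratio_sup \<phi> \<psi>"
    and ratio_sup_le: "(\<And>d. d \<noteq> 0 \<Longrightarrow> \<phi> d \<le> K * \<psi> d) \<Longrightarrow> ratio_sup \<phi> \<psi> \<le> K"
    and Sup_ratio: "Sup {\<phi> d |d. \<psi> d = 1} = ratio_sup \<phi> \<psi>"
proof -
  have nz: "d \<noteq> 0" if "d \<in> sphere 0 1" for d :: 'e using that by auto
  have cont: "continuous_on (sphere 0 1) (\<lambda>d. \<phi> d / \<psi> d)"
    using pos nz by (intro continuous_on_divide homogeneousD(1) \<phi> \<psi>) (metis less_irrefl)
  show bdd: "bdd_above ((\<lambda>d. \<phi> d / \<psi> d) ` sphere 0 1)"
    by (intro bounded_imp_bdd_above compact_imp_bounded compact_continuous_image cont compact_sphere)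
  have upper: "\<phi> d / \<psi> d \<le> ratio_sup \<phi> \<psi>" if "d \<in> sphere 0 1" for d
    unfolding ratio_sup_def using that bdd by (rule cSUP_upper)
  show nonneg: "0 \<le> ratio_sup \<phi> \<psi>"
  proof -
    obtain d :: 'e where d: "d \<in> sphere 0 1" using sphere_nonempty by blast
    have "0 \<le> \<phi> d / \<psi> d" using homogeneousD(3)[OF \<phi>] homogeneousD(3)[OF \<psi>] by simp
    then show ?thesis using upper[OF d] by linarith
  qed
  have ratio: "\<phi> (inverse (norm d) *\<^sub>R d) / \<psi> (inverse (norm d) *\<^sub>R d) = \<phi> d / \<psi> d" if "d \<noteq> 0" for d
    using that by (simp add: homogeneousD(2)[OF \<phi>] homogeneousD(2)[OF \<psi>])
  have le: "\<phi> d / \<psi> d \<le> ratio_sup \<phi> \<psi>" if d: "d \<noteq> 0" for d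
    using upper[OF normalize_sphere[OF d]] ratio[OF d] by simp
  show "\<phi> d \<le> ratio_sup \<phi> \<psi> * \<psi> d" for d
  proof (cases "d = 0")
    case True
    then show ?thesis using homogeneousD(2)[OF \<phi>, of 0 0] homogeneousD(2)[OF \<psi>, of 0 0] by simp
  next
    case False
    then show ?thesis using le[OF False] pos[OF False] by (simp add: pos_divide_le_eq)
  qed
  show "ratio_sup \<phi> \<psi> \<le> K" if K: "\<And>d. d \<noteq> 0 \<Longrightarrow> \<phi> d \<le> K * \<psi> d"
    unfolding ratio_sup_def
    using K pos nz by (intro cSUP_least sphere_nonempty) (simp add: pos_divide_le_eq)
  have "{\<phi> d |d. \<psi> d = 1} = (\<lambda>d. \<phi> d / \<psi> d) ` sphere 0 1"
  proof (intro set_eqI iffI)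
    fix t assume "t \<in> {\<phi> d |d. \<psi> d = 1}"
    then obtain d where d: "t = \<phi> d" "\<psi> d = 1" by blast
    then have "d \<noteq> 0" using homogeneousD(2)[OF \<psi>, of 0 0] by auto
    then show "t \<in> (\<lambda>d. \<phi> d / \<psi> d) ` sphere 0 1"
      using ratio[of d] normalize_sphere[of d] d by (intro image_eqI[of _ _ "inverse (norm d) *\<^sub>R d"]) auto
  next
    fix t assume "t \<in> (\<lambda>d. \<phi> d / \<psi> d) ` sphere 0 1"
    then obtain d where d: "d \<in> sphere 0 1" "t = \<phi> d / \<psi> d" by blast
    have p: "0 < \<psi> d" by (rule pos[OF nz[OF d(1)]])
    have "t = \<phi> (inverse (\<psi> d) *\<^sub>R d)" "\<psi> (inverse (\<psi> d) *\<^sub>R d) = 1"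
      using d p by (simp_all add: homogeneousD(2)[OF \<phi>] homogeneousD(2)[OF \<psi>] field_simps)
    then show "t \<in> {\<phi> d |d. \<psi> d = 1}" by blast
  qed
  then show "Sup {\<phi> d |d. \<psi> d = 1} = ratio_sup \<phi> \<psi>" by (simp add: ratio_sup_def)
qed

lemma ratio_sup_pos:
  assumes "homogeneous \<phi>" "homogeneous \<psi>" "\<And>d. d \<noteq> 0 \<Longrightarrow> 0 < \<psi> d" and d: "0 < \<phi> d"
  shows "0 < ratio_sup \<phi> \<psi>"
proof -
  have "0 < ratio_sup \<phi> \<psi> * \<psi> d" using ratio_sup_ge[OF assms(1-3), of d] d by linarith
  then show ?thesis using homogeneousD(3)[OF assms(2), of d] by (simp add: zero_less_mult_iff)
qed

text \<open>By compactness of \<open>K\<close>, the values \<open>F (y, k)\<close> are close to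
  \<open>F (x, k)\<close> uniformly in \<open>k\<close> once \<open>y\<close> is near
  \<open>x\<close>.\<close>

lemma continuous_on_SUP_compact:
  fixes F :: "'x::metric_space \<times> 'k::metric_space \<Rightarrow> real"
  assumes K: "compact K" "K \<noteq> {}" and F: "continuous_on (A \<times> K) F"
  shows "continuous_on A (\<lambda>x. SUP k\<in>K. F (x, k))"
  unfolding continuous_on_iff
proof (intro ballI allI impI)
  fix x e assume x: "x \<in> A" and e: "(0::real) < e"
  have bdd: "bdd_above ((\<lambda>k. F (y, k)) ` K)" if "y \<in> A" for y
    using that by (intro bounded_imp_bdd_above compact_imp_bounded compact_continuous_image K
        continuous_on_compose2[OF F]) (auto intro!: continuous_intros)
  obtain X0 where X0: "x \<in> X0" "open X0" "\<forall>y\<in>X0 \<inter> A. \<forall>k\<in>K. dist (F (y, k)) (F (x, k)) \<le> e / 2"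
    using continuous_on_prod_compactE[OF F K(1) x, of "e / 2"] e by auto
  obtain r where r: "r > 0" "ball x r \<subseteq> X0" using X0(1,2) by (auto simp: open_contains_ball)
  have "dist (SUP k\<in>K. F (y, k)) (SUP k\<in>K. F (x, k)) < e" if y: "y \<in> A" "dist y x < r" for y
  proof -
    have close: "\<bar>F (y, k) - F (x, k)\<bar> \<le> e / 2" if "k \<in> K" for k
      using X0(3) r(2) y that by (auto simp: dist_real_def dist_commute subset_iff)
    have "(SUP k\<in>K. F (y, k)) \<le> (SUP k\<in>K. F (x, k)) + e / 2"
    proof (rule cSUP_least[OF K(2)])
      fix k assume k: "k \<in> K"
      then have "F (x, k) \<le> (SUP k\<in>K. F (x, k))" by (rule cSUP_upper[OF _ bdd[OF x]])
      then show "F (y, k) \<le> (SUP k\<in>K. F (x, k)) + e / 2" using close[OF k] by linarith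
    qed
    moreover have "(SUP k\<in>K. F (x, k)) \<le> (SUP k\<in>K. F (y, k)) + e / 2"
    proof (rule cSUP_least[OF K(2)])
      fix k assume k: "k \<in> K"
      then have "F (y, k) \<le> (SUP k\<in>K. F (y, k))" by (rule cSUP_upper[OF _ bdd[OF y(1)]])
      then show "F (x, k) \<le> (SUP k\<in>K. F (y, k)) + e / 2" using close[OF k] by linarith
    qed
    ultimately show ?thesis using e by (simp add: dist_real_def abs_le_iff)
  qed
  then show "\<exists>d>0. \<forall>y\<in>A. dist y x < d \<longrightarrow> dist (SUP k\<in>K. F (y, k)) (SUP k\<in>K. F (x, k)) < e"
    using r(1) by blast
qed

lemma continuous_on_local:
  fixes f :: "'x::t2_space \<Rightarrow> 'y::topological_space"
  assumes "\<And>z. z \<in> A \<Longrightarrow> \<exists>U. open U \<and> z \<in> U \<and> continuous_on (U \<inter> A) f"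
  shows "continuous_on A f"
  unfolding continuous_on_eq_continuous_within
proof
  fix z assume z: "z \<in> A"
  obtain U where U: "open U" "z \<in> U" "continuous_on (U \<inter> A) f" using assms[OF z] by blast
  have "at z within (U \<inter> A) = at z within A" by (rule at_within_nhd[OF U(2,1)]) auto
  moreover have "continuous (at z within (U \<inter> A)) f"
    using U z by (simp add: continuous_on_eq_continuous_within)
  ultimately show "continuous (at z within A) f" by simp
qed

context riem
begin

subsection \<open>The metric in coordinates\<close>

lemma coord_vector_linear:
  assumes c: "c \<in> charts_at M x"
  shows "coord_vector M c x (a *\<^sub>R e + b *\<^sub>R e') = (\<lambda>c'. a *\<^sub>R coord_vector M c x e c' + b *\<^sub>R coord_vector M c x e' c')"
proof
  fix c'
  show "coord_vector M c x (a *\<^sub>R e + b *\<^sub>R e') c' = a *\<^sub>R coord_vector M c x e c' + b *\<^sub>R coord_vector M c x e' c'"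
    using linear_chart_D[OF C1_id c, of c']
    by (cases "c' \<in> charts_at M x") (simp_all add: coord_vector_apply coord_vector_outside linear_add linear_scale)
qed

lemma coord_vector_scale:
  "c \<in> charts_at M x \<Longrightarrow> coord_vector M c x (a *\<^sub>R e) = (\<lambda>c'. a *\<^sub>R coord_vector M c x e c')"
  using coord_vector_linear[of c x a e 0 e] by simp

lemma coord_vector_eq_zero:
  assumes "c \<in> charts_at M x" "coord_vector M c x e = (\<lambda>_. 0)"
  shows "e = 0"
  using coord_vector_self[OF assms(1), of e] assms(2) by simp

lemma metric_linear:
  "v \<in> tangent_space M x \<Longrightarrow> w \<in> tangent_space M x \<Longrightarrow> u \<in> tangent_space M x \<Longrightarrow>
    metric M x (\<lambda>c. a *\<^sub>R v c + b *\<^sub>R w c) u = a * metric M x v u + b * metric M x w u"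
  using riemannian unfolding riemannian_manifold_def by blast

lemma metric_sym:
  "v \<in> tangent_space M x \<Longrightarrow> w \<in> tangent_space M x \<Longrightarrow> metric M x v w = metric M x w v"
  using riemannian unfolding riemannian_manifold_def by blast

lemma metric_pos: "v \<in> tangent_space M x \<Longrightarrow> v \<noteq> (\<lambda>_. 0) \<Longrightarrow> 0 < metric M x v v"
  using riemannian unfolding riemannian_manifold_def by blast

lemma linear_metric_coord:
  assumes c: "c \<in> charts_at M x"
  shows "linear (\<lambda>e. metric M x (coord_vector M c x e) (coord_vector M c x e'))"
proof (rule linearI)
  note t = coord_vector_tangent[OF c]
  show "metric M x (coord_vector M c x (e1 + e2)) (coord_vector M c x e') =
      metric M x (coord_vector M c x e1) (coord_vector M c x e') +
      metric M x (coord_vector M c x e2) (coord_vector M c x e')" for e1 e2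
    using metric_linear[where a=1 and b=1, OF t[of e1] t[of e2] t[of e']] coord_vector_linear[OF c, of 1 e1 1 e2] by simp
  show "metric M x (coord_vector M c x (r *\<^sub>R e)) (coord_vector M c x e') =
      r *\<^sub>R metric M x (coord_vector M c x e) (coord_vector M c x e')" for r e
    using metric_linear[where a=r and b=0, OF t[of e] t[of e] t[of e']] coord_vector_scale[OF c, of r e] by simp
qed

lemma metric_coord_expand:
  assumes c: "c \<in> charts_at M x"
  shows "metric M x (coord_vector M c x e) (coord_vector M c x e) =
    (\<Sum>b\<in>Basis. \<Sum>b'\<in>Basis. (e \<bullet> b) * ((e \<bullet> b') * metric M x (coord_vector M c x b') (coord_vector M c x b)))"
proof -
  note t = coord_vector_tangent[OF c]
  have "metric M x (coord_vector M c x e) (coord_vector M c x e) =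
      (\<Sum>b\<in>Basis. (e \<bullet> b) * metric M x (coord_vector M c x b) (coord_vector M c x e))"
    using linear_expand[OF linear_metric_coord[OF c], of e e] by simp
  also have "\<dots> = (\<Sum>b\<in>Basis. (e \<bullet> b) * metric M x (coord_vector M c x e) (coord_vector M c x b))"
    by (simp add: metric_sym[OF t t])
  also have "\<dots> = (\<Sum>b\<in>Basis. (e \<bullet> b) *
      (\<Sum>b'\<in>Basis. (e \<bullet> b') * metric M x (coord_vector M c x b') (coord_vector M c x b)))"
  proof -
    have "metric M x (coord_vector M c x e) (coord_vector M c x b) =
        (\<Sum>b'\<in>Basis. (e \<bullet> b') * metric M x (coord_vector M c x b') (coord_vector M c x b))" for b
      using linear_expand[OF linear_metric_coord[where e'=b, OF c], of e] by simp
    then show ?thesis by simp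
  qed
  finally show ?thesis by (simp add: sum_distrib_left)
qed

definition chart_norm :: "('a, 'e) chart \<Rightarrow> 'a \<Rightarrow> 'e \<Rightarrow> real" where
  "chart_norm c x e = tnorm M x (coord_vector M c x e)"

text \<open>Smoothness of the metric is given only for its coefficients on coordinate vectors; the
  norm is the square root of the quadratic form with these coefficients.\<close>

lemma chart_norm_continuous:
  assumes c: "c \<in> atlas M"
  shows "continuous_on ((snd c ` fst c) \<times> UNIV) (\<lambda>(w, e). chart_norm c (chart_inv c w) e)"
proof -
  let ?g = "\<lambda>b b' w. metric M (chart_inv c w) (coord_vector M c (chart_inv c w) b') (coord_vector M c (chart_inv c w) b)"
  have g: "continuous_on (snd c ` fst c) (?g b b')" for b b'
  proof -
    have "Ck_on 0 (snd c ` fst c) (?g b b')"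
      using riemannian c unfolding riemannian_manifold_def by blast
    then show ?thesis by simp
  qed
  have "continuous_on ((snd c ` fst c) \<times> UNIV)
      (\<lambda>z. sqrt (\<Sum>b\<in>Basis. \<Sum>b'\<in>Basis. (snd z \<bullet> b) * ((snd z \<bullet> b') * ?g b b' (fst z))))"
    by (intro continuous_on_real_sqrt continuous_on_sum continuous_on_mult continuous_intros
        continuous_on_compose2[OF g]) auto
  then show ?thesis
    by (rule continuous_on_eq)
      (auto simp: chart_norm_def tnorm_def metric_coord_expand charts_atI[OF c] chart_inv_in[OF c])
qed

lemma chart_norm_scale: "c \<in> charts_at M x \<Longrightarrow> chart_norm c x (a *\<^sub>R e) = \<bar>a\<bar> * chart_norm c x e"
proof -
  assume c: "c \<in> charts_at M x"
  note t = coord_vector_tangent[OF c]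
  have "metric M x (coord_vector M c x (a *\<^sub>R e)) (coord_vector M c x (a *\<^sub>R e)) =
      a * (a * metric M x (coord_vector M c x e) (coord_vector M c x e))"
    using linear_scale[OF linear_metric_coord[OF c]] metric_sym[OF t t, of e "a *\<^sub>R e"] by simp
  then show ?thesis
    by (simp add: chart_norm_def tnorm_def real_sqrt_mult[symmetric] mult.assoc[symmetric])
      (simp add: real_sqrt_mult)
qed

lemma chart_norm_pos: "c \<in> charts_at M x \<Longrightarrow> e \<noteq> 0 \<Longrightarrow> 0 < chart_norm c x e"
  unfolding chart_norm_def tnorm_def
  using metric_pos[OF coord_vector_tangent] coord_vector_eq_zero by (metis real_sqrt_gt_zero)

lemma chart_norm_nonneg: "c \<in> charts_at M x \<Longrightarrow> 0 \<le> chart_norm c x e"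
  using chart_norm_scale[of c x 0 0] chart_norm_pos[of c x e] by (cases "e = 0") auto

subsection \<open>Immersions\<close>

text \<open>The consequence of being a local diffeomorphism on which the rest is built: a C1 map
  with invertible derivatives. In this form the property passes to composites by the chain rule and
  holds for the identity.\<close>

definition immersion :: "('a \<Rightarrow> 'a) \<Rightarrow> bool" where
  "immersion h \<longleftrightarrow> C1_map h \<and> (\<forall>x. \<forall>c\<in>charts_at M x. \<forall>c'\<in>charts_at M (h x). bij (chart_D c c' h x))"

lemma immersion_C1: "immersion h \<Longrightarrow> C1_map h"
  by (simp add: immersion_def)

lemma immersion_bij: "immersion h \<Longrightarrow> c \<in> charts_at M x \<Longrightarrow> c' \<in> charts_at M (h x) \<Longrightarrow> bij (chart_D c c' h x)"
  by (simp add: immersion_def)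

lemma immersion_id: "immersion id"
  unfolding immersion_def
proof (intro conjI allI ballI C1_id)
  fix x c c' assume c: "c \<in> charts_at M x" "c' \<in> charts_at M (id x)"
  then have c': "c' \<in> charts_at M x" by simp
  show "bij (chart_D c c' id x)"
    by (rule o_bij[of "chart_D c' c id x"])
      (use c c' in \<open>auto simp: fun_eq_iff chart_D_id_comp chart_D_id\<close>)
qed

lemma immersion_comp: "immersion h \<Longrightarrow> immersion h' \<Longrightarrow> immersion (h' \<circ> h)"
  unfolding immersion_def
proof (intro conjI allI ballI)
  assume h: "C1_map h \<and> (\<forall>x. \<forall>c\<in>charts_at M x. \<forall>c'\<in>charts_at M (h x). bij (chart_D c c' h x))"
    and h': "C1_map h' \<and> (\<forall>x. \<forall>c\<in>charts_at M x. \<forall>c'\<in>charts_at M (h' x). bij (chart_D c c' h' x))"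
  show "C1_map (h' \<circ> h)" using C1_comp h h' by blast
  fix x c c'' assume c: "c \<in> charts_at M x" "c'' \<in> charts_at M ((h' \<circ> h) x)"
  obtain c' where c': "c' \<in> charts_at M (h x)" using ex_chart by blast
  have "chart_D c c'' (h' \<circ> h) x = chart_D c' c'' h' (h x) \<circ> chart_D c c' h x"
    using h h' c c' by (intro chain_rule) auto
  moreover have "bij (chart_D c c' h x)" "bij (chart_D c' c'' h' (h x))" using h h' c c' by auto
  ultimately show "bij (chart_D c c'' (h' \<circ> h) x)" by (simp add: bij_comp)
qed

text \<open>Differentiating the local inverse after \<open>h\<close> gives the derivative a left
  inverse, so it is injective and, source and target having the same dimension, bijective. Being C1
  is a local property and passes from the neighbourhoods \<open>U\<close> to the whole
  manifold.\<close>

lemma immersion_local_diffeo: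
  assumes "C1_local_diffeo M h"
  shows "immersion h"
proof -
  have loc: "\<exists>U. open U \<and> x \<in> U \<and> open (h ` U) \<and> inj_on h U \<and> C1_map_on M U h \<and> C1_map_on M (h ` U) (inv_into U h)" for x
    using assms unfolding C1_local_diffeo_def by blast
  have cont: "continuous_on UNIV h"
  proof (intro continuous_at_imp_continuous_on ballI)
    fix x
    obtain U where "open U" "x \<in> U" "C1_map_on M U h" using loc[of x] by blast
    then show "isCont h x"
      unfolding C1_map_on_def using continuous_on_eq_continuous_at by blast
  qed
  have Ck: "\<exists>V. open V \<and> w \<in> V \<and> Ck_on 1 V (snd c' \<circ> h \<circ> chart_inv c)"
    if c: "c \<in> atlas M" "c' \<in> atlas M" and w: "w \<in> transition_dom c c' h" for c c' w
  proof -
    note wD = regD[OF c w]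
    obtain U where U: "open U" "chart_inv c w \<in> U" "C1_map_on M U h" using loc[of "chart_inv c w"] by blast
    let ?V = "snd c ` (fst c \<inter> U \<inter> h -` fst c')"
    have "open ?V"
      unfolding Int_assoc
      by (intro chart_open_image c open_Int U open_vimage chart_dom_open cont)
    moreover have "w \<in> ?V" using wD charts_atD U by (intro image_eqI[of _ _ "chart_inv c w"]) auto
    moreover have "Ck_on 1 ?V (snd c' \<circ> h \<circ> chart_inv c)" using U(3) c unfolding C1_map_on_def by blast
    ultimately show ?thesis by blast
  qed
  have C1: "C1_map h"
  proof (rule C1_mapI[OF cont])
    fix c c' w assume c: "c \<in> atlas M" "c' \<in> atlas M" and w: "w \<in> transition_dom c c' h"
    obtain V where V: "open V" "w \<in> V" "Ck_on (Suc 0) V (snd c' \<circ> h \<circ> chart_inv c)"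
      using Ck[OF c w] unfolding One_nat_def by blast
    show "(snd c' \<circ> h \<circ> chart_inv c) differentiable (at w)" using V by simp
    show "isCont (\<lambda>w. frechet_derivative (snd c' \<circ> h \<circ> chart_inv c) (at w) e) w" for e
      using V continuous_on_eq_continuous_at by (auto simp: o_def)
  qed
  show ?thesis
    unfolding immersion_def
  proof (intro conjI allI ballI C1)
    fix x c c' assume c: "c \<in> charts_at M x" and c': "c' \<in> charts_at M (h x)"
    note at = charts_atD[OF c] charts_atD[OF c']
    obtain U where U: "open U" "x \<in> U" "open (h ` U)" "inj_on h U" "C1_map_on M (h ` U) (inv_into U h)"
      using loc[of x] by blast
    let ?g = "inv_into U h"
    let ?G = "snd c \<circ> ?g \<circ> chart_inv c'" and ?F = "snd c' \<circ> h \<circ> chart_inv c"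
    have gh: "?g (h y) = y" if "y \<in> U" for y using inv_into_f_f[OF U(4) that] .
    have "Ck_on (Suc 0) (snd c' ` (fst c' \<inter> h ` U \<inter> ?g -` fst c)) ?G"
      using U(5) at unfolding C1_map_on_def One_nat_def by blast
    moreover have "snd c' (h x) \<in> snd c' ` (fst c' \<inter> h ` U \<inter> ?g -` fst c)"
      using at U gh by (intro imageI) auto
    ultimately have "?G differentiable (at (snd c' (h x)))" unfolding Ck_on.simps by blast
    then obtain G' where G': "(?G has_derivative G') (at (snd c' (h x)))" by (auto simp: differentiable_def)
    have Fx: "?F (snd c x) = snd c' (h x)" using at chart_inv_chart by simp
    from diff_chain_at[OF chart_D_has_derivative[OF C1 c c'], of ?G G'] G'
    have GF: "(?G \<circ> ?F has_derivative G' \<circ> chart_D c c' h x) (at (snd c x))" by (simp only: Fx)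
    have "((\<lambda>w. w) has_derivative G' \<circ> chart_D c c' h x) (at (snd c x))"
    proof (rule has_derivative_transform_within_open[OF GF])
      show "open (snd c ` (fst c \<inter> (U \<inter> h -` fst c')))"
        using at U by (intro chart_open_image open_Int open_vimage chart_dom_open cont) auto
      show "snd c x \<in> snd c ` (fst c \<inter> (U \<inter> h -` fst c'))" using at U by auto
      fix w assume "w \<in> snd c ` (fst c \<inter> (U \<inter> h -` fst c'))"
      then obtain y where y: "w = snd c y" "y \<in> fst c" "y \<in> U" "h y \<in> fst c'" by auto
      then show "(?G \<circ> ?F) w = w" using at chart_inv_chart gh by simp
    qed
    then have "G' \<circ> chart_D c c' h x = (\<lambda>e. e)"
      using has_derivative_unique has_derivative_ident by blast
    then have "inj (chart_D c c' h x)" by (metis inj_on_id2 inj_on_imageI2)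
    then show "bij (chart_D c c' h x)"
      using linear_chart_D[OF C1 c c'] linear_injective_imp_surjective by (auto simp: bij_def)
  qed
qed

text \<open>The Riemannian length of the image under \<open>h\<close> of the tangent vector with
  coordinates \<open>d\<close>, with a chart at the source only. For \<open>h = id\<close> it is the
  length of the vector itself. All norms below are quotients involving such functions, so inverse
  derivatives need not be written in coordinates.\<close>

definition push_norm :: "('a \<Rightarrow> 'a) \<Rightarrow> ('a, 'e) chart \<Rightarrow> 'a \<Rightarrow> 'e \<Rightarrow> real" where
  "push_norm h c x d = tnorm M (h x) (D_map M h x (coord_vector M c x d))"

lemma push_norm_eq:
  assumes "C1_map h" "c \<in> charts_at M x" "c' \<in> charts_at M (h x)"
  shows "push_norm h c x d = chart_norm c' (h x) (chart_D c c' h x d)"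
  unfolding push_norm_def chart_norm_def D_map_coord_vector[OF assms] ..

lemma push_norm_id: "c \<in> charts_at M x \<Longrightarrow> push_norm id c x d = chart_norm c x d"
  using push_norm_eq[OF C1_id, of c x c d] by (simp add: chart_D_id)

lemma push_norm_pos:
  assumes h: "immersion h" and c: "c \<in> charts_at M x" and d: "d \<noteq> 0"
  shows "0 < push_norm h c x d"
proof -
  obtain c' where c': "c' \<in> charts_at M (h x)" using ex_chart by blast
  have "chart_D c c' h x d \<noteq> 0"
    using immersion_bij[OF h c c'] linear_chart_D[OF immersion_C1[OF h] c c'] d
    by (metis bij_is_inj injD linear_0)
  then show ?thesis using push_norm_eq[OF immersion_C1[OF h] c c'] chart_norm_pos[OF c'] by simp
qed

lemma push_norm_continuous:
  assumes h: "C1_map h" and c: "c \<in> atlas M"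
  shows "continuous_on ((snd c ` fst c) \<times> UNIV) (\<lambda>(w, d). push_norm h c (chart_inv c w) d)"
proof (rule continuous_on_local)
  fix z assume z: "z \<in> (snd c ` fst c) \<times> (UNIV :: 'e set)"
  obtain w0 d0 where w0: "z = (w0, d0)" "w0 \<in> snd c ` fst c" using z by auto
  have c0: "c \<in> charts_at M (chart_inv c w0)" using c chart_inv_in[OF c w0(2)] by (rule charts_atI)
  obtain c' where c': "c' \<in> charts_at M (h (chart_inv c w0))" using ex_chart by blast
  note c'a = charts_atD[OF c', THEN conjunct1]
  let ?F = "\<lambda>w. snd c' (h (chart_inv c w))"
  have w0r: "w0 \<in> transition_dom c c' h" using regI[of c _ c' h, OF c0 c'] chart_chart_inv[OF c w0(2)] by simp
  have "continuous_on (transition_dom c c' h \<times> UNIV) (\<lambda>z. (\<lambda>(w, e). chart_norm c' (chart_inv c' w) e) (?F (fst z), (\<lambda>(w, d). chart_D c c' h (chart_inv c w) d) z))"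
  proof (rule continuous_on_compose2[OF chart_norm_continuous[OF c'a]])
    show "continuous_on (transition_dom c c' h \<times> UNIV) (\<lambda>z. (?F (fst z), (\<lambda>(w, d). chart_D c c' h (chart_inv c w) d) z))"
      by (intro continuous_on_Pair chart_D_joint[OF h c c'a] continuous_on_compose2[OF loc_cont[OF h c c'a]])
        (auto intro!: continuous_intros)
    show "(\<lambda>z. (?F (fst z), (\<lambda>(w, d). chart_D c c' h (chart_inv c w) d) z)) ` (transition_dom c c' h \<times> UNIV) \<subseteq> snd c' ` fst c' \<times> UNIV"
      using regD(2)[OF c c'a] charts_atD by fastforce
  qed
  then have "continuous_on (transition_dom c c' h \<times> UNIV) (\<lambda>(w, d). push_norm h c (chart_inv c w) d)"
  proof (rule continuous_on_eq)
    fix z :: "'e \<times> 'e" assume "z \<in> transition_dom c c' h \<times> UNIV"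
    then obtain w d where z: "z = (w, d)" "w \<in> transition_dom c c' h" by auto
    note r = regD[OF c c'a z(2)]
    have "chart_inv c' (snd c' (h (chart_inv c w))) = h (chart_inv c w)"
      using chart_inv_chart[OF c'a] charts_atD[OF r(2)] by blast
    then show "(\<lambda>(w, e). chart_norm c' (chart_inv c' w) e) (?F (fst z), (\<lambda>(w, d). chart_D c c' h (chart_inv c w) d) z) =
        (\<lambda>(w, d). push_norm h c (chart_inv c w) d) z"
      using push_norm_eq[OF h r(1,2)] z by simp
  qed
  then have "continuous_on (transition_dom c c' h \<times> UNIV \<inter> (snd c ` fst c) \<times> UNIV) (\<lambda>(w, d). push_norm h c (chart_inv c w) d)"
    by (rule continuous_on_subset) auto
  then show "\<exists>U. open U \<and> z \<in> U \<and> continuous_on (U \<inter> (snd c ` fst c) \<times> UNIV) (\<lambda>(w, d). push_norm h c (chart_inv c w) d)"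
    using transition_dom_open[OF h c c'a] w0r w0(1) by (intro exI[of _ "transition_dom c c' h \<times> UNIV"]) (auto intro: open_Times)
qed

lemma push_norm_homogeneous:
  assumes h: "C1_map h" and c: "c \<in> charts_at M x"
  shows "homogeneous (push_norm h c x)"
  unfolding homogeneous_def
proof (intro conjI allI)
  obtain c' where c': "c' \<in> charts_at M (h x)" using ex_chart by blast
  note ca = charts_atD[OF c]
  have "continuous_on UNIV (\<lambda>d. (\<lambda>(w, d). push_norm h c (chart_inv c w) d) (snd c x, d))"
    using ca by (intro continuous_on_compose2[OF push_norm_continuous[OF h, of c]]) (auto intro!: continuous_intros)
  then show "continuous_on UNIV (push_norm h c x)" using ca chart_inv_chart by simp
  show "push_norm h c x (a *\<^sub>R d) = \<bar>a\<bar> * push_norm h c x d" for a d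
    using push_norm_eq[OF h c c'] linear_scale[OF linear_chart_D[OF h c c']] chart_norm_scale[OF c'] by simp
  show "0 \<le> push_norm h c x d" for d using push_norm_eq[OF h c c'] chart_norm_nonneg[OF c'] by simp
qed

subsection \<open>Operator norms and covectors in coordinates\<close>

lemma D_map_tangent:
  assumes "C1_map h" "v \<in> tangent_space M x"
  shows "D_map M h x v \<in> tangent_space M (h x)"
proof -
  obtain c c' where c: "c \<in> charts_at M x" "c' \<in> charts_at M (h x)" using ex_chart by blast
  show ?thesis
    using D_map_coord_vector[OF assms(1) c, of "v c"] tangent_coord_vector[OF c(1) assms(2)]
      coord_vector_tangent[OF c(2)] by simp
qed

lemma D_map_bij:
  assumes h: "immersion h"
  shows "bij_betw (D_map M h x) (tangent_space M x) (tangent_space M (h x))"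
proof -
  obtain c c' where c: "c \<in> charts_at M x" "c' \<in> charts_at M (h x)" using ex_chart by blast
  note D = D_map_coord_vector[OF immersion_C1[OF h] c] and bij = immersion_bij[OF h c]
  show ?thesis
  proof (rule bij_betwI')
    fix v w assume v: "v \<in> tangent_space M x" "w \<in> tangent_space M x"
    have "v = w" if "D_map M h x v = D_map M h x w"
    proof -
      have "coord_vector M c' (h x) (chart_D c c' h x (v c)) = coord_vector M c' (h x) (chart_D c c' h x (w c))"
        using that D[of "v c"] D[of "w c"] v tangent_coord_vector[OF c(1)] by simp
      then have "chart_D c c' h x (v c) = chart_D c c' h x (w c)" by (metis coord_vector_self[OF c(2)])
      then have "v c = w c" using bij by (metis bij_is_inj injD)
      then show ?thesis using tangent_coord_vector[OF c(1)] v by metis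
    qed
    then show "(D_map M h x v = D_map M h x w) = (v = w)" by blast
  next
    fix v assume "v \<in> tangent_space M x"
    then show "D_map M h x v \<in> tangent_space M (h x)" by (rule D_map_tangent[OF immersion_C1[OF h]])
  next
    fix w assume w: "w \<in> tangent_space M (h x)"
    obtain d where d: "w c' = chart_D c c' h x d" using bij by (metis bij_pointE)
    have "w = D_map M h x (coord_vector M c x d)"
      using D[of d] d tangent_coord_vector[OF c(2) w] by simp
    then show "\<exists>v\<in>tangent_space M x. w = D_map M h x v"
      using coord_vector_tangent[OF c(1)] by blast
  qed
qed

lemma D_inv_D_map:
  "immersion h \<Longrightarrow> v \<in> tangent_space M x \<Longrightarrow> D_inv M h x (D_map M h x v) = v"
  unfolding D_inv_def using D_map_bij by (metis bij_betw_def inv_into_f_f)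

lemma tangent_normalized_iff:
  assumes c: "c \<in> charts_at M x"
  shows "{G v |v. v \<in> tangent_space M x \<and> Q v} = {G (coord_vector M c x d) |d. Q (coord_vector M c x d)}"
  using coord_vector_tangent[OF c] tangent_coord_vector[OF c] by (auto) (metis)+

text \<open>Since the derivative is onto, tangent vectors at \<open>h x\<close> are images of
  coordinate vectors at \<open>x\<close>; in the suprema that define norms at \<open>h x\<close> the
  inverse derivative then cancels.\<close>

lemma tangent_image_iff:
  assumes h: "immersion h" and c: "c \<in> charts_at M x"
  shows "{G w |w. w \<in> tangent_space M (h x) \<and> Q w} =
    {G (D_map M h x (coord_vector M c x d)) |d. Q (D_map M h x (coord_vector M c x d))}"
proof -
  have "tangent_space M (h x) = D_map M h x ` tangent_space M x"
    using D_map_bij[OF h] by (simp add: bij_betw_def)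
  then have "{G w |w. w \<in> tangent_space M (h x) \<and> Q w} =
      {G (D_map M h x v) |v. v \<in> tangent_space M x \<and> Q (D_map M h x v)}" by auto
  then show ?thesis
    unfolding tangent_normalized_iff[OF c, of "\<lambda>v. G (D_map M h x v)" "\<lambda>v. Q (D_map M h x v)"] .
qed

lemma op_norm_D_map:
  assumes h: "immersion h" and c: "c \<in> charts_at M x"
  shows "op_norm M x (h x) (D_map M h x) = ratio_sup (push_norm h c x) (push_norm id c x)"
proof -
  have "op_norm M x (h x) (D_map M h x) = Sup {push_norm h c x d |d. push_norm id c x d = 1}"
    unfolding op_norm_def tangent_normalized_iff[OF c, of "\<lambda>v. tnorm M (h x) (D_map M h x v)"]
    by (simp add: push_norm_id[OF c] chart_norm_def) (simp add: push_norm_def)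
  also have "\<dots> = ratio_sup (push_norm h c x) (push_norm id c x)"
    using push_norm_pos[OF immersion_id c] by (intro Sup_ratio push_norm_homogeneous immersion_C1 h immersion_id c) auto
  finally show ?thesis .
qed

lemma op_norm_D_inv:
  assumes h: "immersion h" and c: "c \<in> charts_at M x"
  shows "op_norm M (h x) x (D_inv M h x) = ratio_sup (push_norm id c x) (push_norm h c x)"
proof -
  have "op_norm M (h x) x (D_inv M h x) = Sup {push_norm id c x d |d. push_norm h c x d = 1}"
    unfolding op_norm_def tangent_image_iff[OF h c, of "\<lambda>v. tnorm M x (D_inv M h x v)"]
    by (simp add: push_norm_id[OF c] chart_norm_def D_inv_D_map[OF h coord_vector_tangent[OF c]]) (simp add: push_norm_def)
  also have "\<dots> = ratio_sup (push_norm id c x) (push_norm h c x)"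
    using push_norm_pos[OF h c] by (intro Sup_ratio push_norm_homogeneous immersion_C1 h immersion_id c) auto
  finally show ?thesis .
qed

lemma covec_norm_D_costar:
  assumes h: "immersion h" and c: "c \<in> charts_at M x"
  shows "covec_norm M (h x) (D_costar M h x (coord_covector M c x e)) = ratio_sup (\<lambda>d. \<bar>e \<bullet> d\<bar>) (push_norm h c x)"
proof -
  have "covec_norm M (h x) (D_costar M h x (coord_covector M c x e)) = Sup {\<bar>e \<bullet> d\<bar> |d. push_norm h c x d = 1}"
    unfolding covec_norm_def tangent_image_iff[OF h c, of "\<lambda>v. \<bar>D_costar M h x (coord_covector M c x e) v\<bar>"]
    using coord_vector_tangent[OF c] D_map_tangent[OF immersion_C1[OF h]]
    by (simp add: D_costar_def D_inv_D_map[OF h] coord_covector_def coord_vector_self[OF c] push_norm_def)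
  also have "\<dots> = ratio_sup (\<lambda>d. \<bar>e \<bullet> d\<bar>) (push_norm h c x)"
    using push_norm_pos[OF h c] by (intro Sup_ratio push_norm_homogeneous homogeneous_inner immersion_C1 h c) auto
  finally show ?thesis .
qed

lemma covec_norm_coord:
  assumes c: "c \<in> charts_at M x"
  shows "covec_norm M x (coord_covector M c x e) = ratio_sup (\<lambda>d. \<bar>e \<bullet> d\<bar>) (push_norm id c x)"
proof -
  have "covec_norm M x (coord_covector M c x e) = Sup {\<bar>e \<bullet> d\<bar> |d. push_norm id c x d = 1}"
    unfolding covec_norm_def tangent_normalized_iff[OF c, of "\<lambda>v. \<bar>coord_covector M c x e v\<bar>"]
    using coord_vector_tangent[OF c]
    by (simp add: coord_covector_def coord_vector_self[OF c] push_norm_id[OF c] chart_norm_def)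
  also have "\<dots> = ratio_sup (\<lambda>d. \<bar>e \<bullet> d\<bar>) (push_norm id c x)"
    using push_norm_pos[OF immersion_id c] by (intro Sup_ratio push_norm_homogeneous homogeneous_inner immersion_C1 immersion_id c) auto
  finally show ?thesis .
qed

end

subsection \<open>Solutions of adjoint linear equations\<close>

definition adj :: "('e::euclidean_space \<Rightarrow> 'e) \<Rightarrow> 'e \<Rightarrow> 'e" where
  "adj A v = (\<Sum>b\<in>Basis. (v \<bullet> A b) *\<^sub>R b)"

lemma adj_inner: "linear A \<Longrightarrow> adj A v \<bullet> d = v \<bullet> A d"
proof -
  assume "linear A"
  then have "v \<bullet> A d = (\<Sum>b\<in>Basis. (d \<bullet> b) * (v \<bullet> A b))"
    using linear_expand[of A d] by (simp add: inner_sum_right)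
  moreover have "adj A v \<bullet> d = (\<Sum>b\<in>Basis. (v \<bullet> A b) * (b \<bullet> d))"
    by (simp add: adj_def inner_sum_left)
  moreover have "(\<Sum>b\<in>Basis. (d \<bullet> b) * (v \<bullet> A b)) = (\<Sum>b\<in>Basis. (v \<bullet> A b) * (b \<bullet> d))"
    by (rule sum.cong[OF refl]) (metis inner_commute mult.commute)
  ultimately show ?thesis by simp
qed

lemma adj_diff: "adj A (v - w) = adj A v - adj A w"
  by (simp add: adj_def inner_diff_left scaleR_diff_left sum_subtractf)

lemma adj_scale: "adj A (a *\<^sub>R v) = a *\<^sub>R adj A v"
  by (simp add: adj_def scaleR_sum_right)

lemma adj_eq_zero:
  assumes "linear A" "bij A" "adj A v = 0"
  shows "v = 0"
proof -
  obtain d where "A d = v" using assms(2) by (metis bij_pointE)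
  then have "v \<bullet> v = 0" using adj_inner[OF assms(1), of v d] assms(3) by simp
  then show ?thesis by simp
qed

text \<open>Continuity of the inverse transpose, stated for the solution \<open>v\<close> of the
  equation. The least value \<open>m x\<close> of \<open>norm (adj (A x) d)\<close> on the unit
  sphere is positive by invertibility and continuous by compactness. Inserting \<open>v x0\<close>
  into the equation at \<open>x\<close> bounds the distance from \<open>v x\<close> to
  \<open>v x0\<close> by \<open>norm (r x - adj (A x) (v x0)) / m x\<close>, which tends to
  0.\<close>

lemma continuous_on_adj_solution:
  fixes A :: "'x::metric_space \<Rightarrow> 'e::euclidean_space \<Rightarrow> 'e"
  assumes lin: "\<And>x. x \<in> S \<Longrightarrow> linear (A x)" and bij: "\<And>x. x \<in> S \<Longrightarrow> bij (A x)"
    and cont: "\<And>b. continuous_on S (\<lambda>x. A x b)" and r: "continuous_on S r"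
    and sol: "\<And>x. x \<in> S \<Longrightarrow> adj (A x) (v x) = r x"
  shows "continuous_on S v"
proof -
  \<comment> \<open>A minimum, written as minus a supremum so that
    \<open>continuous_on_SUP_compact\<close> applies.\<close>
  define m where "m = (\<lambda>x. - (SUP d\<in>sphere 0 1. - norm (adj (A x) d)))"
  have contA: "continuous_on (S \<times> UNIV) (\<lambda>z. adj (A (fst z)) (snd z))"
    unfolding adj_def
    by (intro continuous_on_sum continuous_on_scaleR continuous_on_inner continuous_on_compose2[OF cont] continuous_intros) auto
  have F: "continuous_on (S \<times> sphere 0 1) (\<lambda>z. - norm (adj (A (fst z)) (snd z)))"
    by (intro continuous_on_minus continuous_on_norm continuous_on_subset[OF contA]) auto
  have "continuous_on S (\<lambda>x. SUP d\<in>sphere 0 1. - norm (adj (A (fst (x, d))) (snd (x, d))))"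
    by (rule continuous_on_SUP_compact[OF compact_sphere sphere_nonempty F])
  then have m_cont: "continuous_on S m" unfolding m_def by (simp add: continuous_on_minus)
  have m_le: "m x * norm d \<le> norm (adj (A x) d)" if x: "x \<in> S" for x d
  proof (cases "d = 0")
    case False
    have "bdd_above ((\<lambda>d. - norm (adj (A x) d)) ` sphere 0 1)"
      by (rule bdd_aboveI[of _ 0]) auto
    then have "- norm (adj (A x) (inverse (norm d) *\<^sub>R d)) \<le> - m x"
      unfolding m_def minus_minus by (intro cSUP_upper normalize_sphere False)
    then have "m x \<le> inverse (norm d) * norm (adj (A x) d)" by (simp add: adj_scale)
    then show ?thesis using False by (simp add: field_simps)
  qed simp
  have m_pos: "0 < m x" if x: "x \<in> S" for x
  proof -
    have "continuous_on (sphere 0 1) (\<lambda>d. norm (adj (A x) d))"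
      unfolding adj_def by (intro continuous_intros)
    then obtain d0 where d0: "d0 \<in> sphere 0 1" "\<And>d. d \<in> sphere 0 1 \<Longrightarrow> norm (adj (A x) d0) \<le> norm (adj (A x) d)"
      using continuous_attains_inf[OF compact_sphere sphere_nonempty] by metis
    have "d0 \<noteq> 0" using d0(1) by auto
    then have "adj (A x) d0 \<noteq> 0" using adj_eq_zero[OF lin[OF x] bij[OF x]] by blast
    then have "0 < norm (adj (A x) d0)" by simp
    also have "norm (adj (A x) d0) \<le> m x"
      unfolding m_def using d0(2)
      by (subst le_minus_iff) (intro cSUP_least sphere_nonempty, simp)
    finally show ?thesis .
  qed
  show ?thesis
    unfolding continuous_on_def
  proof
    fix x0 assume x0: "x0 \<in> S"
    have "((\<lambda>x. norm (r x - adj (A x) (v x0)) / m x) \<longlongrightarrow> norm (r x0 - adj (A x0) (v x0)) / m x0) (at x0 within S)"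
    proof (intro tendsto_divide tendsto_norm tendsto_diff)
      show "(r \<longlongrightarrow> r x0) (at x0 within S)" "(m \<longlongrightarrow> m x0) (at x0 within S)"
        using r m_cont x0 by (auto simp: continuous_on_def)
      show "m x0 \<noteq> 0" using m_pos[OF x0] by simp
      have "continuous_on S (\<lambda>x. adj (A x) (v x0))"
        unfolding adj_def by (intro continuous_intros cont)
      then show "((\<lambda>x. adj (A x) (v x0)) \<longlongrightarrow> adj (A x0) (v x0)) (at x0 within S)"
        using x0 by (simp add: continuous_on_def)
    qed
    then have lim: "((\<lambda>x. norm (r x - adj (A x) (v x0)) / m x) \<longlongrightarrow> 0) (at x0 within S)"
      using sol[OF x0] by simp
    have "((\<lambda>x. v x - v x0) \<longlongrightarrow> 0) (at x0 within S)"
    proof (rule Lim_null_comparison[OF _ lim])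
      show "\<forall>\<^sub>F x in at x0 within S. norm (v x - v x0) \<le> norm (r x - adj (A x) (v x0)) / m x"
        unfolding eventually_at_filter
      proof (rule eventuallyI, intro impI)
        fix x assume x: "x \<in> S"
        have "m x * norm (v x - v x0) \<le> norm (r x - adj (A x) (v x0))"
          using m_le[OF x, of "v x - v x0"] by (simp add: adj_diff sol[OF x])
        then show "norm (v x - v x0) \<le> norm (r x - adj (A x) (v x0)) / m x"
          using m_pos[OF x] by (simp add: field_simps)
      qed
    qed
    then show "(v \<longlongrightarrow> v x0) (at x0 within S)" by (simp add: LIM_zero_iff)
  qed
qed

lemma ratio_sup_scale:
  assumes \<psi>: "homogeneous \<psi>" and pos: "\<And>d. d \<noteq> 0 \<Longrightarrow> 0 < \<psi> d"
  shows "ratio_sup (\<lambda>d. \<bar>(a *\<^sub>R e) \<bullet> d\<bar>) \<psi> = \<bar>a\<bar> * ratio_sup (\<lambda>d. \<bar>e \<bullet> d\<bar>) \<psi>"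
proof -
  have le: "ratio_sup (\<lambda>d. \<bar>(a *\<^sub>R e) \<bullet> d\<bar>) \<psi> \<le> \<bar>a\<bar> * ratio_sup (\<lambda>d. \<bar>e \<bullet> d\<bar>) \<psi>" for a e
  proof (rule ratio_sup_le[OF homogeneous_inner \<psi> pos])
    fix d :: 'a
    have "\<bar>a\<bar> * \<bar>e \<bullet> d\<bar> \<le> \<bar>a\<bar> * (ratio_sup (\<lambda>d. \<bar>e \<bullet> d\<bar>) \<psi> * \<psi> d)"
      by (intro mult_left_mono ratio_sup_ge[OF homogeneous_inner \<psi> pos]) auto
    then show "\<bar>(a *\<^sub>R e) \<bullet> d\<bar> \<le> \<bar>a\<bar> * ratio_sup (\<lambda>d. \<bar>e \<bullet> d\<bar>) \<psi> * \<psi> d"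
      by (simp add: abs_mult mult.assoc)
  qed
  show ?thesis
  proof (cases "a = 0")
    case True
    have "0 \<le> ratio_sup (\<lambda>d. \<bar>(a *\<^sub>R e) \<bullet> d\<bar>) \<psi>" by (rule ratio_sup_nonneg[OF homogeneous_inner \<psi> pos])
    then show ?thesis using le[of a e] True by simp
  next
    case False
    have "ratio_sup (\<lambda>d. \<bar>e \<bullet> d\<bar>) \<psi> \<le> \<bar>inverse a\<bar> * ratio_sup (\<lambda>d. \<bar>(a *\<^sub>R e) \<bullet> d\<bar>) \<psi>"
      using le[of "inverse a" "a *\<^sub>R e"] False by simp
    then have "\<bar>a\<bar> * ratio_sup (\<lambda>d. \<bar>e \<bullet> d\<bar>) \<psi> \<le> ratio_sup (\<lambda>d. \<bar>(a *\<^sub>R e) \<bullet> d\<bar>) \<psi>"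
      using False by (simp add: field_simps)
    then show ?thesis using le[of a e] by simp
  qed
qed

lemma ratio_sup_inner_pos:
  "homogeneous \<psi> \<Longrightarrow> (\<And>d. d \<noteq> 0 \<Longrightarrow> 0 < \<psi> d) \<Longrightarrow> e \<noteq> 0 \<Longrightarrow> 0 < ratio_sup (\<lambda>d. \<bar>e \<bullet> d\<bar>) \<psi>"
  by (rule ratio_sup_pos[OF homogeneous_inner, of \<psi> e e]) auto

lemma ratio_sup_mult_le:
  assumes "homogeneous \<phi>" "homogeneous \<psi>" "homogeneous \<theta>"
    and \<psi>: "\<And>d. d \<noteq> 0 \<Longrightarrow> 0 < \<psi> d" and \<theta>: "\<And>d. d \<noteq> 0 \<Longrightarrow> 0 < \<theta> d"
  shows "ratio_sup \<phi> \<theta> \<le> ratio_sup \<phi> \<psi> * ratio_sup \<psi> \<theta>"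
proof (rule ratio_sup_le[OF assms(1,3) \<theta>])
  fix d
  have "\<phi> d \<le> ratio_sup \<phi> \<psi> * \<psi> d" by (rule ratio_sup_ge[OF assms(1,2) \<psi>])
  also have "\<dots> \<le> ratio_sup \<phi> \<psi> * (ratio_sup \<psi> \<theta> * \<theta> d)"
    by (intro mult_left_mono ratio_sup_ge[OF assms(2,3) \<theta>] ratio_sup_nonneg[OF assms(1,2) \<psi>])
  finally show "\<phi> d \<le> ratio_sup \<phi> \<psi> * ratio_sup \<psi> \<theta> * \<theta> d" by (simp add: mult.assoc)
qed

subsection \<open>The cotangent cocycle in coordinates\<close>

context riem
begin

text \<open>The coordinate form of \<open>D_costar\<close>: the inverse transpose of the derivative
  applied to the coordinates of a covector. It is defined as the solution of a linear equation, the
  form in which continuity and measurability are obtained.\<close>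

definition covec_push :: "('a, 'e) chart \<Rightarrow> ('a, 'e) chart \<Rightarrow> ('a \<Rightarrow> 'a) \<Rightarrow> 'a \<Rightarrow> 'e \<Rightarrow> 'e" where
  "covec_push c c' h x e = (SOME v. adj (chart_D c c' h x) v = e)"

lemma
  assumes h: "immersion h" and c: "c \<in> charts_at M x" and c': "c' \<in> charts_at M (h x)"
  shows adj_covec_push: "adj (chart_D c c' h x) (covec_push c c' h x e) = e"
    and covec_push_inner: "covec_push c c' h x e \<bullet> chart_D c c' h x d = e \<bullet> d"
    and covec_push_nonzero: "e \<noteq> 0 \<Longrightarrow> covec_push c c' h x e \<noteq> 0"
proof -
  note lin = linear_chart_D[OF immersion_C1[OF h] c c'] and bij = immersion_bij[OF h c c']
  have "linear (adj (chart_D c c' h x))"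
    unfolding adj_def by (rule linearI) (simp_all add: inner_add_left scaleR_left_distrib sum.distrib scaleR_sum_right)
  moreover from this have "inj (adj (chart_D c c' h x))"
    using adj_eq_zero[OF lin bij] by (simp add: linear_injective_0)
  ultimately have "surj (adj (chart_D c c' h x))" by (rule linear_injective_imp_surjective) simp
  then have "\<exists>v. adj (chart_D c c' h x) v = e" for e by (metis surjD)
  then show eq: "adj (chart_D c c' h x) (covec_push c c' h x e) = e" for e unfolding covec_push_def by (rule someI_ex)
  show "covec_push c c' h x e \<bullet> chart_D c c' h x d = e \<bullet> d" using adj_inner[OF lin, of "covec_push c c' h x e" d] eq by simp
  show "covec_push c c' h x e \<noteq> 0" if "e \<noteq> 0"
    using eq[of e] that by (auto simp: adj_def)
qed

lemma covec_push_continuous: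
  assumes h: "immersion h" and c: "c \<in> atlas M" "c' \<in> atlas M"
  shows "continuous_on (transition_dom c c' h \<times> UNIV) (\<lambda>(w, e). covec_push c c' h (chart_inv c w) e)"
proof (rule continuous_on_adj_solution)
  note r = regD[OF c]
  show "linear (chart_D c c' h (chart_inv c (fst z)))" "bij (chart_D c c' h (chart_inv c (fst z)))"
    if z: "z \<in> transition_dom c c' h \<times> UNIV" for z :: "'e \<times> 'e"
  proof -
    have "fst z \<in> transition_dom c c' h" using z by auto
    note r' = r(1,2)[OF this]
    show "linear (chart_D c c' h (chart_inv c (fst z)))" by (rule linear_chart_D[OF immersion_C1[OF h] r'])
    show "bij (chart_D c c' h (chart_inv c (fst z)))" by (rule immersion_bij[OF h r'])
  qed
  show "continuous_on (transition_dom c c' h \<times> UNIV) (\<lambda>z. chart_D c c' h (chart_inv c (fst z)) b)" for b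
  proof -
    have "continuous_on (transition_dom c c' h \<times> UNIV) (\<lambda>z. (\<lambda>(w, d). chart_D c c' h (chart_inv c w) d) (fst z, b))"
      by (rule continuous_on_compose2[OF chart_D_joint[OF immersion_C1[OF h] c]]) (auto intro!: continuous_intros)
    then show ?thesis by simp
  qed
  show "continuous_on (transition_dom c c' h \<times> UNIV) snd" by (intro continuous_intros)
  show "adj (chart_D c c' h (chart_inv c (fst z))) (case z of (w, e) \<Rightarrow> covec_push c c' h (chart_inv c w) e) = snd z"
    if z: "z \<in> transition_dom c c' h \<times> UNIV" for z :: "'e \<times> 'e"
  proof -
    have "fst z \<in> transition_dom c c' h" using z by auto
    from adj_covec_push[OF h r(1,2)[OF this], of "snd z"] show ?thesis by (simp add: case_prod_beta)
  qed
qed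

lemma coord_covector_cotangent:
  assumes c: "c \<in> charts_at M x"
  shows "coord_covector M c x e \<in> cotangent_space M x"
  unfolding cotangent_space_def
proof (intro CollectI conjI allI impI ballI)
  fix v w and a b :: real assume v: "v \<in> tangent_space M x" and w: "w \<in> tangent_space M x"
  have "(\<lambda>c. a *\<^sub>R v c + b *\<^sub>R w c) = coord_vector M c x (a *\<^sub>R v c + b *\<^sub>R w c)"
    using coord_vector_linear[OF c, of a "v c" b "w c"] tangent_coord_vector[OF c v] tangent_coord_vector[OF c w] by simp
  then have "(\<lambda>c. a *\<^sub>R v c + b *\<^sub>R w c) \<in> tangent_space M x"
    using coord_vector_tangent[OF c] by metis
  then show "coord_covector M c x e (\<lambda>c. a *\<^sub>R v c + b *\<^sub>R w c) = a * coord_covector M c x e v + b * coord_covector M c x e w"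
    using v w by (simp add: coord_covector_def inner_add_right)
qed (simp add: coord_covector_def)

lemma cotangent_coord_covector:
  assumes c: "c \<in> charts_at M x" and \<xi>: "\<xi> \<in> cotangent_space M x"
  obtains e where "\<xi> = coord_covector M c x e"
proof -
  have lin: "linear (\<lambda>d. \<xi> (coord_vector M c x d))"
  proof (rule linearI)
    have comb: "\<xi> (coord_vector M c x (a *\<^sub>R d + b *\<^sub>R d')) = a * \<xi> (coord_vector M c x d) + b * \<xi> (coord_vector M c x d')" for a b d d'
      using \<xi> coord_vector_tangent[OF c] unfolding coord_vector_linear[OF c] cotangent_space_def by blast
    show "\<xi> (coord_vector M c x (d + d')) = \<xi> (coord_vector M c x d) + \<xi> (coord_vector M c x d')" for d d'
      using comb[of 1 d 1 d'] by simp
    show "\<xi> (coord_vector M c x (r *\<^sub>R d)) = r *\<^sub>R \<xi> (coord_vector M c x d)" for r d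
      using comb[of r d 0 d] by simp
  qed
  define e where "e = (\<Sum>b\<in>Basis. \<xi> (coord_vector M c x b) *\<^sub>R b)"
  have "\<xi> v = coord_covector M c x e v" for v
  proof (cases "v \<in> tangent_space M x")
    case True
    have "\<xi> v = \<xi> (coord_vector M c x (v c))" using tangent_coord_vector[OF c True] by simp
    also have "\<dots> = e \<bullet> v c"
    proof -
      have "e \<bullet> v c = (\<Sum>b\<in>Basis. \<xi> (coord_vector M c x b) * (b \<bullet> v c))"
        by (simp add: e_def inner_sum_left)
      also have "\<dots> = (\<Sum>b\<in>Basis. (v c \<bullet> b) * \<xi> (coord_vector M c x b))"
        by (rule sum.cong[OF refl]) (metis inner_commute mult.commute)
      finally show ?thesis using linear_expand[OF lin, of "v c"] by simp
    qed
    finally show ?thesis using True by (simp add: coord_covector_def)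
  next
    case False
    then show ?thesis using \<xi> by (simp add: coord_covector_def cotangent_space_def)
  qed
  then show ?thesis using that by blast
qed

lemma coord_covector_scale: "coord_covector M c x (a *\<^sub>R e) = (\<lambda>v. a * coord_covector M c x e v)"
  by (auto simp: coord_covector_def)

lemma coord_covector_zero_iff:
  assumes c: "c \<in> charts_at M x"
  shows "coord_covector M c x e = (\<lambda>_. 0) \<longleftrightarrow> e = 0"
proof
  assume "coord_covector M c x e = (\<lambda>_. 0)"
  then have "coord_covector M c x e (coord_vector M c x e) = 0" by simp
  then show "e = 0" using coord_vector_tangent[OF c] by (simp add: coord_covector_def coord_vector_self[OF c])
qed (auto simp: coord_covector_def)

definition covec_point :: "('a, 'e) chart \<Rightarrow> 'a \<Rightarrow> 'e \<Rightarrow> 'a \<times> ('a, 'e) covec set" where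
  "covec_point c x e = (x, proj_class (coord_covector M c x e))"

lemma proj_class_scale:
  assumes "a \<noteq> 0"
  shows "proj_class (\<lambda>v. a * \<xi> v) = proj_class \<xi>"
  unfolding proj_class_def
proof (intro set_eqI iffI)
  fix \<zeta> assume "\<zeta> \<in> {\<lambda>v. b * (a * \<xi> v) |b. b \<noteq> 0}"
  then obtain b where "b \<noteq> 0" "\<zeta> = (\<lambda>v. (b * a) * \<xi> v)" by (auto simp: mult.assoc)
  then show "\<zeta> \<in> {\<lambda>v. b * \<xi> v |b. b \<noteq> 0}" using assms by (intro CollectI exI[of _ "b * a"]) simp
next
  fix \<zeta> assume "\<zeta> \<in> {\<lambda>v. b * \<xi> v |b. b \<noteq> 0}"
  then obtain b where "b \<noteq> 0" "\<zeta> = (\<lambda>v. (b / a) * (a * \<xi> v))" using assms by auto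
  then show "\<zeta> \<in> {\<lambda>v. b * (a * \<xi> v) |b. b \<noteq> 0}" using assms by (intro CollectI exI[of _ "b / a"]) simp
qed

lemma covec_point_scale: "a \<noteq> 0 \<Longrightarrow> covec_point c x (a *\<^sub>R e) = covec_point c x e"
  by (simp add: covec_point_def coord_covector_scale proj_class_scale)

lemma proj_cotangentE:
  assumes "z \<in> proj_cotangent M X" and c: "c \<in> charts_at M (fst z)"
  obtains e where "e \<noteq> 0" "z = covec_point c (fst z) e" "fst z \<in> X"
proof -
  obtain x \<xi> where z: "z = (x, proj_class \<xi>)" "x \<in> X" "\<xi> \<in> cotangent_space M x" "\<xi> \<noteq> (\<lambda>_. 0)"
    using assms(1) by (auto simp: proj_cotangent_def)
  obtain e where e: "\<xi> = coord_covector M c x e"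
    using cotangent_coord_covector[of c x \<xi>] c z by auto
  then have "e \<noteq> 0" using z(1,4) c coord_covector_zero_iff by auto
  then show ?thesis using that e z by (simp add: covec_point_def)
qed

lemma covec_point_in: "c \<in> charts_at M x \<Longrightarrow> x \<in> X \<Longrightarrow> e \<noteq> 0 \<Longrightarrow> covec_point c x e \<in> proj_cotangent M X"
  unfolding covec_point_def proj_cotangent_def using coord_covector_cotangent coord_covector_zero_iff by blast

lemma fst_covec_point [simp]: "fst (covec_point c x e) = x"
  by (simp add: covec_point_def)

text \<open>\<open>proj_map M f \<omega>\<close> is \<open>lift (f \<omega>)\<close>; separating the
  single map from the noise allows continuity to be treated for a fixed map.\<close>

definition lift :: "('a \<Rightarrow> 'a) \<Rightarrow> 'a \<times> ('a, 'e) covec set \<Rightarrow> 'a \<times> ('a, 'e) covec set" where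
  "lift h = (\<lambda>(x, L). (h x, D_costar M h x ` L))"

lemma D_costar_coord:
  assumes h: "immersion h" and c: "c \<in> charts_at M x" and c': "c' \<in> charts_at M (h x)"
  shows "D_costar M h x (coord_covector M c x e) = coord_covector M c' (h x) (covec_push c c' h x e)"
proof
  fix v
  show "D_costar M h x (coord_covector M c x e) v = coord_covector M c' (h x) (covec_push c c' h x e) v"
  proof (cases "v \<in> tangent_space M (h x)")
    case True
    then obtain u where u: "u \<in> tangent_space M x" "v = D_map M h x u"
      using D_map_bij[OF h, of x] by (auto simp: bij_betw_def)
    have uc: "u = coord_vector M c x (u c)" by (rule tangent_coord_vector[OF c u(1), symmetric])
    have "v c' = chart_D c c' h x (u c)"
      using D_map_coord_vector[OF immersion_C1[OF h] c c', of "u c"] uc u(2) coord_vector_self[OF c'] by simp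
    then show ?thesis
      using True u D_inv_D_map[OF h u(1)] covec_push_inner[OF h c c']
      by (simp add: D_costar_def coord_covector_def)
  qed (simp add: D_costar_def coord_covector_def)
qed

lemma lift_covec_point:
  assumes h: "immersion h" and c: "c \<in> charts_at M x" and c': "c' \<in> charts_at M (h x)"
  shows "lift h (covec_point c x e) = covec_point c' (h x) (covec_push c c' h x e)"
proof -
  have "D_costar M h x ` proj_class \<xi> = proj_class (D_costar M h x \<xi>)" for \<xi>
  proof -
    have "D_costar M h x (\<lambda>v. a * \<xi> v) = (\<lambda>v. a * D_costar M h x \<xi> v)" for a
      by (auto simp: D_costar_def)
    then show ?thesis unfolding proj_class_def by (auto simp: image_iff) metis
  qed
  then show ?thesis by (simp add: lift_def covec_point_def D_costar_coord[OF assms])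
qed

lemma fst_lift: "fst (lift h z) = h (fst z)"
  by (simp add: lift_def case_prod_beta)

text \<open>Continuity on the bundle over \<open>X\<close>, tested in the coordinates of a point and
  of a nonzero covector; only the values on \<open>proj_cotangent M X\<close> are restricted. This
  is the family \<open>C\<close> of the abstract cocycle.\<close>

definition bundle_continuous :: "'a set \<Rightarrow> ('a \<times> ('a, 'e) covec set \<Rightarrow> real) set" where
  "bundle_continuous X = {u. \<forall>c\<in>atlas M. continuous_on (snd c ` (fst c \<inter> X) \<times> (- {0})) (\<lambda>(w, e). u (covec_point c (chart_inv c w) e))}"

lemma bundle_continuous_lift:
  assumes u: "u \<in> bundle_continuous X" and h: "immersion h" and hX: "h ` X \<subseteq> X"
  shows "(\<lambda>z. u (lift h z)) \<in> bundle_continuous X"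
  unfolding bundle_continuous_def
proof (intro CollectI ballI)
  fix c assume c: "c \<in> atlas M"
  show "continuous_on (snd c ` (fst c \<inter> X) \<times> (- {0})) (\<lambda>(w, e). u (lift h (covec_point c (chart_inv c w) e)))"
  proof (rule continuous_on_local)
  fix z assume z: "z \<in> snd c ` (fst c \<inter> X) \<times> (- {0 :: 'e})"
  obtain x0 e0 where x0: "z = (snd c x0, e0)" "x0 \<in> fst c" "x0 \<in> X" using z by auto
  have c0: "c \<in> charts_at M x0" using c x0 by (intro charts_atI)
  obtain c' where c': "c' \<in> charts_at M (h x0)" using ex_chart by blast
  note c'a = charts_atD[OF c', THEN conjunct1]
  let ?U = "transition_dom c c' h \<times> (UNIV :: 'e set)" and ?B = "snd c ` (fst c \<inter> X) \<times> (- {0 :: 'e})"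
  let ?F = "\<lambda>z. (snd c' (h (chart_inv c (fst z))), (\<lambda>(w, e). covec_push c c' h (chart_inv c w) e) z)"
  have G: "continuous_on (snd c' ` (fst c' \<inter> X) \<times> (- {0})) (\<lambda>(w, e). u (covec_point c' (chart_inv c' w) e))"
    using u c'a unfolding bundle_continuous_def by blast
  have "continuous_on (?U \<inter> ?B) (\<lambda>z. (\<lambda>(w, e). u (covec_point c' (chart_inv c' w) e)) (?F z))"
  proof (rule continuous_on_compose2[OF G])
    show "continuous_on (?U \<inter> ?B) ?F"
      by (intro continuous_on_Pair continuous_on_subset[OF covec_push_continuous[OF h c c'a]]
          continuous_on_compose2[OF loc_cont[OF immersion_C1[OF h] c c'a]]) (auto intro!: continuous_intros)
    show "?F ` (?U \<inter> ?B) \<subseteq> snd c' ` (fst c' \<inter> X) \<times> (- {0})"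
    proof (rule image_subsetI)
      fix y assume y: "y \<in> ?U \<inter> ?B"
      then obtain w e where we: "y = (w, e)" "w \<in> transition_dom c c' h" "e \<noteq> 0" "w \<in> snd c ` (fst c \<inter> X)" by auto
      note r = regD[OF c c'a we(2)]
      have "chart_inv c w \<in> X" using we(4) chart_inv_chart[OF c] by auto
      then show "?F y \<in> snd c' ` (fst c' \<inter> X) \<times> (- {0})"
        using we r hX charts_atD[OF r(2)] covec_push_nonzero[OF h r(1,2) we(3)] by auto
    qed
  qed
  then have "continuous_on (?U \<inter> ?B) (\<lambda>(w, e). u (lift h (covec_point c (chart_inv c w) e)))"
  proof (rule continuous_on_eq)
    fix y assume "y \<in> ?U \<inter> ?B"
    then obtain w e where we: "y = (w, e)" "w \<in> transition_dom c c' h" by auto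
    note r = regD[OF c c'a we(2)]
    have "chart_inv c' (snd c' (h (chart_inv c w))) = h (chart_inv c w)"
      using chart_inv_chart[OF c'a] charts_atD[OF r(2)] by blast
    then show "(\<lambda>(w, e). u (covec_point c' (chart_inv c' w) e)) (?F y) = (\<lambda>(w, e). u (lift h (covec_point c (chart_inv c w) e))) y"
      using lift_covec_point[OF h r(1,2)] we by simp
  qed
  moreover have "z \<in> ?U" using regI[of c x0 c' h, OF c0 c'] x0(1) by simp
  ultimately show "\<exists>U. open U \<and> z \<in> U \<and> continuous_on (U \<inter> ?B) (\<lambda>(w, e). u (lift h (covec_point c (chart_inv c w) e)))"
    using transition_dom_open[OF immersion_C1[OF h] c c'a] by (intro exI[of _ ?U]) (auto intro: open_Times)
  qed
qed

text \<open>The integrand of \<open>proj_potential\<close> for a single map; the choice of the unit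
  covector repeats the one made there.\<close>

definition covec_growth :: "('a \<Rightarrow> 'a) \<Rightarrow> 'a \<times> ('a, 'e) covec set \<Rightarrow> real" where
  "covec_growth h z = ln (covec_norm M (h (fst z)) (D_costar M h (fst z) (SOME \<xi>. \<xi> \<in> snd z \<and> covec_norm M (fst z) \<xi> = 1)))"

text \<open>The chosen unit covector is a multiple \<open>a\<close> of the one with coordinates
  \<open>e\<close>, with \<open>\<bar>a\<bar>\<close> the inverse of its norm. By homogeneity the
  logarithm splits into a difference that no longer depends on the choice, and the cocycle property
  becomes a cancellation.\<close>

lemma covec_growth_covec_point:
  assumes h: "immersion h" and c: "c \<in> charts_at M x" and e: "e \<noteq> 0"
  shows "covec_growth h (covec_point c x e) = ln (ratio_sup (\<lambda>d. \<bar>e \<bullet> d\<bar>) (push_norm h c x)) - ln (ratio_sup (\<lambda>d. \<bar>e \<bullet> d\<bar>) (push_norm id c x))"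
proof -
  let ?n = "ratio_sup (\<lambda>d. \<bar>e \<bullet> d\<bar>) (push_norm id c x)" and ?m = "ratio_sup (\<lambda>d. \<bar>e \<bullet> d\<bar>) (push_norm h c x)"
  note hom = push_norm_homogeneous[OF immersion_C1[OF h] c] push_norm_homogeneous[OF C1_id c]
  note pos = push_norm_pos[OF h c] push_norm_pos[OF immersion_id c]
  have n: "0 < ?n" and m: "0 < ?m" using hom pos e by (auto intro: ratio_sup_inner_pos)
  have norm: "covec_norm M x (coord_covector M c x (a *\<^sub>R e)) = \<bar>a\<bar> * ?n" for a
    unfolding covec_norm_coord[OF c] by (rule ratio_sup_scale[OF hom(2) pos(2)])
  have cls: "snd (covec_point c x e) = {coord_covector M c x (a *\<^sub>R e) |a. a \<noteq> 0}"
    by (simp add: covec_point_def proj_class_def coord_covector_scale)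
  let ?\<xi> = "SOME \<xi>. \<xi> \<in> snd (covec_point c x e) \<and> covec_norm M x \<xi> = 1"
  have "\<exists>\<xi>. \<xi> \<in> snd (covec_point c x e) \<and> covec_norm M x \<xi> = 1"
    using n norm[of "inverse ?n"] unfolding cls
    by (intro exI[of _ "coord_covector M c x (inverse ?n *\<^sub>R e)"]) auto
  then have "?\<xi> \<in> snd (covec_point c x e) \<and> covec_norm M x ?\<xi> = 1" by (rule someI_ex)
  then obtain a where a: "?\<xi> = coord_covector M c x (a *\<^sub>R e)" "\<bar>a\<bar> * ?n = 1"
    unfolding cls using norm by auto
  have sc: "ratio_sup (\<lambda>d. \<bar>(a *\<^sub>R e) \<bullet> d\<bar>) (push_norm h c x) = \<bar>a\<bar> * ?m"
    by (rule ratio_sup_scale[OF hom(1) pos(1)])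
  have "covec_growth h (covec_point c x e) = ln (\<bar>a\<bar> * ?m)"
    unfolding covec_growth_def fst_covec_point a(1) covec_norm_D_costar[OF h c] sc ..
  also have "\<bar>a\<bar> * ?m = ?m / ?n" using a(2) n by (simp add: field_simps)
  also have "ln (?m / ?n) = ln ?m - ln ?n" using n m by (simp add: ln_div)
  finally show ?thesis .
qed

lemma ratio_sup_continuous:
  assumes h: "immersion h" and c: "c \<in> atlas M"
  shows "continuous_on ((snd c ` fst c) \<times> UNIV) (\<lambda>(w, e). ratio_sup (\<lambda>d. \<bar>e \<bullet> d\<bar>) (push_norm h c (chart_inv c w)))"
    and "immersion h' \<Longrightarrow> continuous_on (snd c ` fst c) (\<lambda>w. ratio_sup (push_norm h' c (chart_inv c w)) (push_norm h c (chart_inv c w)))"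
proof -
  have pos: "push_norm h c (chart_inv c w) d \<noteq> 0" if "w \<in> snd c ` fst c" "d \<in> sphere 0 1" for w d
    using push_norm_pos[OF h charts_atI[OF c chart_inv_in[OF c that(1)]], of d] that(2) by force
  have "continuous_on (((snd c ` fst c) \<times> UNIV) \<times> sphere 0 1)
      (\<lambda>z. \<bar>snd (fst z) \<bullet> snd z\<bar> / (\<lambda>(w, d). push_norm h c (chart_inv c w) d) (fst (fst z), snd z))"
    using pos
    by (intro continuous_on_divide continuous_intros continuous_on_compose2[OF push_norm_continuous[OF immersion_C1[OF h] c]]) auto
  from continuous_on_SUP_compact[OF compact_sphere sphere_nonempty this]
  show "continuous_on ((snd c ` fst c) \<times> UNIV) (\<lambda>(w, e). ratio_sup (\<lambda>d. \<bar>e \<bullet> d\<bar>) (push_norm h c (chart_inv c w)))"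
    by (simp add: ratio_sup_def case_prod_beta')
  assume h': "immersion h'"
  have "continuous_on ((snd c ` fst c) \<times> sphere 0 1)
      (\<lambda>z. (\<lambda>(w, d). push_norm h' c (chart_inv c w) d) z / (\<lambda>(w, d). push_norm h c (chart_inv c w) d) z)"
    using pos
    by (intro continuous_on_divide continuous_on_subset[OF push_norm_continuous[OF immersion_C1[OF h] c]]
        continuous_on_subset[OF push_norm_continuous[OF immersion_C1[OF h'] c]]) auto
  from continuous_on_SUP_compact[OF compact_sphere sphere_nonempty this]
  show "continuous_on (snd c ` fst c) (\<lambda>w. ratio_sup (push_norm h' c (chart_inv c w)) (push_norm h c (chart_inv c w)))"
    by (simp add: ratio_sup_def)
qed

lemma covec_growth_bundle_continuous:
  assumes h: "immersion h"
  shows "covec_growth h \<in> bundle_continuous X"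
  unfolding bundle_continuous_def
proof (intro CollectI ballI)
  fix c assume c: "c \<in> atlas M"
  let ?B = "snd c ` (fst c \<inter> X) \<times> (- {0 :: 'e})"
  let ?R = "\<lambda>h (w, e). ratio_sup (\<lambda>d. \<bar>e \<bullet> d\<bar>) (push_norm h c (chart_inv c w))"
  have c0: "c \<in> charts_at M (chart_inv c w)" if "w \<in> snd c ` fst c" for w
    by (rule charts_atI[OF c chart_inv_in[OF c that]])
  have pos: "?R h z \<noteq> 0" if "z \<in> ?B" "immersion h" for z h
    using that ratio_sup_inner_pos[OF push_norm_homogeneous[OF immersion_C1[OF that(2)] c0] push_norm_pos[OF that(2) c0]]
    by (fastforce dest: less_imp_neq)
  have "continuous_on ?B (\<lambda>z. ln (?R h z) - ln (?R id z))"
    using pos h immersion_id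
    by (intro continuous_on_diff continuous_on_ln continuous_on_subset[OF ratio_sup_continuous(1)[OF h c]]
      continuous_on_subset[OF ratio_sup_continuous(1)[OF immersion_id c]]) auto
  then show "continuous_on ?B (\<lambda>(w, e). covec_growth h (covec_point c (chart_inv c w) e))"
  proof (rule continuous_on_eq)
    fix z assume "z \<in> ?B"
    then have "c \<in> charts_at M (chart_inv c (fst z))" "snd z \<noteq> 0" by (auto intro: c0)
    from covec_growth_covec_point[OF h this]
    show "ln (?R h z) - ln (?R id z) = (\<lambda>(w, e). covec_growth h (covec_point c (chart_inv c w) e)) z"
      by (simp add: case_prod_beta)
  qed
qed

abbreviation D_norm :: "('a \<Rightarrow> 'a) \<Rightarrow> 'a \<Rightarrow> real" where "D_norm h x \<equiv> op_norm M x (h x) (D_map M h x)"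
abbreviation D_inv_norm :: "('a \<Rightarrow> 'a) \<Rightarrow> 'a \<Rightarrow> real" where "D_inv_norm h x \<equiv> op_norm M (h x) x (D_inv M h x)"

lemma op_norms_pos: "immersion h \<Longrightarrow> 0 < D_norm h x" "immersion h \<Longrightarrow> 0 < D_inv_norm h x"
proof -
  assume h: "immersion h"
  obtain c where c: "c \<in> charts_at M x" using ex_chart by blast
  obtain d :: 'e where "d \<in> sphere 0 1" using sphere_nonempty by blast
  then have d: "d \<noteq> 0" by auto
  note hom = push_norm_homogeneous[OF immersion_C1[OF h] c] push_norm_homogeneous[OF C1_id c]
  note pos = push_norm_pos[OF h c] push_norm_pos[OF immersion_id c]
  show "0 < D_norm h x" unfolding op_norm_D_map[OF h c] by (rule ratio_sup_pos[OF hom pos(2) pos(1)[OF d]])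
  show "0 < D_inv_norm h x" unfolding op_norm_D_inv[OF h c] by (rule ratio_sup_pos[OF hom(2,1) pos(1) pos(2)[OF d]])
qed

lemma op_norms_continuous:
  assumes h: "immersion h"
  shows "continuous_on UNIV (D_norm h)" "continuous_on UNIV (D_inv_norm h)"
proof -
  have *: "continuous_on UNIV \<Phi>" if "\<And>c. c \<in> atlas M \<Longrightarrow> continuous_on (snd c ` fst c) (\<Psi> c)"
    "\<And>c x. c \<in> charts_at M x \<Longrightarrow> \<Phi> x = \<Psi> c (snd c x)" for \<Phi> :: "'a \<Rightarrow> real" and \<Psi>
  proof (rule continuous_on_local)
    fix x
    obtain c where c: "c \<in> charts_at M x" using ex_chart by blast
    note ca = charts_atD[OF c]
    have "continuous_on (fst c) (\<lambda>x. \<Psi> c (snd c x))"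
      using ca by (intro continuous_on_compose2[OF that(1) chart_cont]) auto
    then have "continuous_on (fst c) \<Phi>"
      by (rule continuous_on_eq) (use that(2) ca charts_atI in metis)
    then show "\<exists>U. open U \<and> x \<in> U \<and> continuous_on (U \<inter> UNIV) \<Phi>"
      using ca chart_dom_open by (intro exI[of _ "fst c"]) auto
  qed
  have inv: "chart_inv c (snd c x) = x" if "c \<in> charts_at M x" for c x
    using charts_atD[OF that] chart_inv_chart by blast
  show "continuous_on UNIV (D_norm h)"
    by (rule *[OF ratio_sup_continuous(2)[OF immersion_id _ h]]) (simp_all add: op_norm_D_map[OF h] inv)
  show "continuous_on UNIV (D_inv_norm h)"
    by (rule *[OF ratio_sup_continuous(2)[OF h _ immersion_id]]) (simp_all add: op_norm_D_inv[OF h] inv)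
qed

text \<open>The norms \<open>?n\<close> and \<open>?m\<close> of the covector before and after are
  compared by \<open>ratio_sup_mult_le\<close>, with the norm of the inverse derivative as second
  factor in one direction and the norm of the derivative in the other. The lower bound is where the
  derivative itself enters, besides its inverse.\<close>

lemma covec_growth_bounds:
  assumes h: "immersion h" and c: "c \<in> charts_at M x" and e: "e \<noteq> 0"
  shows "covec_growth h (covec_point c x e) \<le> ln (D_inv_norm h x)" "- ln (D_norm h x) \<le> covec_growth h (covec_point c x e)"
proof -
  let ?n = "ratio_sup (\<lambda>d. \<bar>e \<bullet> d\<bar>) (push_norm id c x)" and ?m = "ratio_sup (\<lambda>d. \<bar>e \<bullet> d\<bar>) (push_norm h c x)"
  note hom = push_norm_homogeneous[OF immersion_C1[OF h] c] push_norm_homogeneous[OF C1_id c]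
  note pos = push_norm_pos[OF h c] push_norm_pos[OF immersion_id c]
  have n: "0 < ?n" and m: "0 < ?m" using hom pos e by (auto intro: ratio_sup_inner_pos)
  have "?m \<le> ?n * D_inv_norm h x"
    unfolding op_norm_D_inv[OF h c] by (rule ratio_sup_mult_le[OF homogeneous_inner hom(2,1) pos(2,1)])
  then have "ln ?m \<le> ln (?n * D_inv_norm h x)" using m n op_norms_pos(2)[OF h, of x] by (intro ln_mono) auto
  also have "\<dots> = ln ?n + ln (D_inv_norm h x)" by (rule ln_mult_pos[OF n op_norms_pos(2)[OF h]])
  finally show "covec_growth h (covec_point c x e) \<le> ln (D_inv_norm h x)" unfolding covec_growth_covec_point[OF assms] by simp
  have "?n \<le> ?m * D_norm h x"
    unfolding op_norm_D_map[OF h c] by (rule ratio_sup_mult_le[OF homogeneous_inner hom(1,2) pos(1,2)])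
  then have "ln ?n \<le> ln (?m * D_norm h x)" using m n op_norms_pos(1)[OF h, of x] by (intro ln_mono) auto
  also have "\<dots> = ln ?m + ln (D_norm h x)" by (rule ln_mult_pos[OF m op_norms_pos(1)[OF h]])
  finally show "- ln (D_norm h x) \<le> covec_growth h (covec_point c x e)" unfolding covec_growth_covec_point[OF assms] by simp
qed

lemma push_norm_comp:
  assumes h: "C1_map h" and h': "C1_map h'" and c: "c \<in> charts_at M x" and c': "c' \<in> charts_at M (h x)"
  shows "push_norm h' c' (h x) (chart_D c c' h x d) = push_norm (h' \<circ> h) c x d"
proof -
  obtain c'' where c'': "c'' \<in> charts_at M (h' (h x))" using ex_chart by blast
  show ?thesis
    using push_norm_eq[OF h' c' c''] push_norm_eq[OF C1_comp[OF h h'] c, of c''] chain_rule[OF h h' c c' c''] c'' by simp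
qed

text \<open>Substituting the derivative of \<open>h\<close> at \<open>d\<close> for the variable
  turns the pairing with the pushed covector into the pairing with \<open>e\<close>, and the length
  after \<open>h'\<close> into the length after \<open>h' \<circ> h\<close>.\<close>

lemma ratio_sup_covec_push:
  assumes h: "immersion h" and h': "immersion h'" and c: "c \<in> charts_at M x" and c': "c' \<in> charts_at M (h x)"
  shows "ratio_sup (\<lambda>d. \<bar>covec_push c c' h x e \<bullet> d\<bar>) (push_norm h' c' (h x)) = ratio_sup (\<lambda>d. \<bar>e \<bullet> d\<bar>) (push_norm (h' \<circ> h) c x)"
proof -
  have surj: "\<exists>d'. d = chart_D c c' h x d'" for d using immersion_bij[OF h c c'] by (metis bij_pointE)
  have "Sup {\<bar>covec_push c c' h x e \<bullet> d\<bar> |d. push_norm h' c' (h x) d = 1} =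
      Sup {\<bar>covec_push c c' h x e \<bullet> chart_D c c' h x d\<bar> |d. push_norm h' c' (h x) (chart_D c c' h x d) = 1}"
    by (rule arg_cong[where f=Sup]) (use surj in auto, metis+)
  also have "\<dots> = Sup {\<bar>e \<bullet> d\<bar> |d. push_norm (h' \<circ> h) c x d = 1}"
    by (simp only: covec_push_inner[OF h c c'] push_norm_comp[OF immersion_C1[OF h] immersion_C1[OF h'] c c'])
  finally show ?thesis
    using Sup_ratio[OF homogeneous_inner push_norm_homogeneous[OF immersion_C1[OF h'] c'] push_norm_pos[OF h' c']]
      Sup_ratio[OF homogeneous_inner push_norm_homogeneous[OF C1_comp[OF immersion_C1[OF h] immersion_C1[OF h']] c]
        push_norm_pos[OF immersion_comp[OF h h'] c]] by simp
qed

text \<open>In the difference form of \<open>covec_growth_covec_point\<close>, the logarithm of the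
  norm at the intermediate point occurs with both signs.\<close>

lemma covec_growth_cocycle:
  assumes h: "immersion h" and h': "immersion h'" and z: "z \<in> proj_cotangent M X"
  shows "covec_growth (h' \<circ> h) z = covec_growth h z + covec_growth h' (lift h z)"
proof -
  obtain c where c: "c \<in> charts_at M (fst z)" using ex_chart by blast
  obtain c' where c': "c' \<in> charts_at M (h (fst z))" using ex_chart by blast
  obtain e where e: "e \<noteq> 0" "z = covec_point c (fst z) e" using proj_cotangentE[OF z c] by metis
  define x where "x = fst z"
  have zx: "z = covec_point c x e" "c \<in> charts_at M x" "c' \<in> charts_at M (h x)" using e c c' by (simp_all add: x_def)
  have "covec_growth h' (lift h z) = ln (ratio_sup (\<lambda>d. \<bar>e \<bullet> d\<bar>) (push_norm (h' \<circ> h) c x)) - ln (ratio_sup (\<lambda>d. \<bar>e \<bullet> d\<bar>) (push_norm h c x))"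
    unfolding zx(1) lift_covec_point[OF h zx(2,3)] covec_growth_covec_point[OF h' zx(3) covec_push_nonzero[OF h zx(2,3) e(1)]]
      ratio_sup_covec_push[OF h h' zx(2,3)] ratio_sup_covec_push[OF h immersion_id zx(2,3)] by simp
  then show ?thesis
    unfolding zx(1) covec_growth_covec_point[OF h zx(2) e(1)] covec_growth_covec_point[OF immersion_comp[OF h h'] zx(2) e(1)] by simp
qed

lemma D_inv_norm_comp:
  assumes h: "immersion h" and h': "immersion h'"
  shows "D_inv_norm (h' \<circ> h) x \<le> D_inv_norm h x * D_inv_norm h' (h x)"
proof -
  obtain c where c: "c \<in> charts_at M x" using ex_chart by blast
  obtain c' where c': "c' \<in> charts_at M (h x)" using ex_chart by blast
  note hh = immersion_comp[OF h h'] and sm = immersion_C1[OF h] immersion_C1[OF h']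
  have "ratio_sup (push_norm h c x) (push_norm (h' \<circ> h) c x) \<le> ratio_sup (push_norm id c' (h x)) (push_norm h' c' (h x))"
  proof (rule ratio_sup_le[OF push_norm_homogeneous[OF sm(1) c] push_norm_homogeneous[OF immersion_C1[OF hh] c] push_norm_pos[OF hh c]])
    fix d
    have "push_norm id c' (h x) (chart_D c c' h x d) \<le> ratio_sup (push_norm id c' (h x)) (push_norm h' c' (h x)) * push_norm h' c' (h x) (chart_D c c' h x d)"
      by (rule ratio_sup_ge[OF push_norm_homogeneous[OF C1_id c'] push_norm_homogeneous[OF sm(2) c'] push_norm_pos[OF h' c']])
    then show "push_norm h c x d \<le> ratio_sup (push_norm id c' (h x)) (push_norm h' c' (h x)) * push_norm (h' \<circ> h) c x d"
      using push_norm_comp[OF sm(1) C1_id c c', of d] push_norm_comp[OF sm c c', of d] by simp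
  qed
  moreover have "ratio_sup (push_norm id c x) (push_norm (h' \<circ> h) c x) \<le> ratio_sup (push_norm id c x) (push_norm h c x) * ratio_sup (push_norm h c x) (push_norm (h' \<circ> h) c x)"
    by (rule ratio_sup_mult_le[OF push_norm_homogeneous[OF C1_id c] push_norm_homogeneous[OF sm(1) c]
        push_norm_homogeneous[OF immersion_C1[OF hh] c] push_norm_pos[OF h c] push_norm_pos[OF hh c]])
  moreover have "0 \<le> ratio_sup (push_norm id c x) (push_norm h c x)"
    by (rule ratio_sup_nonneg[OF push_norm_homogeneous[OF C1_id c] push_norm_homogeneous[OF sm(1) c] push_norm_pos[OF h c]])
  ultimately have "D_inv_norm (h' \<circ> h) x \<le> ratio_sup (push_norm id c x) (push_norm h c x) * ratio_sup (push_norm id c' (h x)) (push_norm h' c' (h x))"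
    using op_norm_D_inv[OF hh c] by (simp add: mult_left_mono order_trans)
  then show ?thesis using op_norm_D_inv[OF h c] op_norm_D_inv[OF h' c'] by simp
qed

end

subsection \<open>Measurability\<close>

text \<open>One point is taken from each basic open set that meets \<open>X\<close>. The same
  \<open>D\<close> works for all continuous functions, so a supremum over \<open>X\<close> depending
  on a parameter becomes a countable supremum with fixed index set.\<close>

lemma countable_supremum:
  fixes X :: "'x::second_countable_topology set"
  obtains D where "countable D" "D \<subseteq> X" "X \<noteq> {} \<Longrightarrow> D \<noteq> {}"
    "\<And>g :: 'x \<Rightarrow> real. continuous_on X g \<Longrightarrow> bdd_above (g ` X) \<Longrightarrow> (SUP x\<in>X. g x) = (SUP x\<in>D. g x)"
proof -
  obtain \<B> :: "'x set set" where \<B>: "countable \<B>" "topological_basis \<B>"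
    using ex_countable_basis by blast
  define D where "D = (\<lambda>B. SOME x. x \<in> B \<inter> X) ` {B\<in>\<B>. B \<inter> X \<noteq> {}}"
  have pick: "(SOME x. x \<in> B \<inter> X) \<in> B \<inter> X" if "B \<inter> X \<noteq> {}" for B
  proof -
    have "\<exists>x. x \<in> B \<inter> X" using that by blast
    then show ?thesis by (rule someI_ex)
  qed
  have DI: "(SOME x. x \<in> B \<inter> X) \<in> D" if "B \<in> \<B>" "B \<inter> X \<noteq> {}" for B
    unfolding D_def using that by (intro imageI) simp
  have DX: "D \<subseteq> X"
  proof
    fix x assume "x \<in> D"
    then obtain B where B: "x = (SOME x. x \<in> B \<inter> X)" "B \<inter> X \<noteq> {}" unfolding D_def by blast
    show "x \<in> X" using pick[OF B(2)] unfolding B(1) by blast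
  qed
  have meet: "\<exists>d\<in>D. d \<in> T" if T: "open T" "x \<in> T" "x \<in> X" for T x
  proof -
    obtain B where B: "B \<in> \<B>" "x \<in> B" "B \<subseteq> T" using topological_basisE[OF \<B>(2) T(1,2)] by blast
    then have ne: "B \<inter> X \<noteq> {}" using T(3) by blast
    show ?thesis using pick[OF ne] DI[OF B(1) ne] B(3) by (intro bexI) auto
  qed
  show ?thesis
  proof (rule that[of D])
    show "countable D" unfolding D_def using \<B>(1) by auto
    show "D \<subseteq> X" by fact
    show ne: "D \<noteq> {}" if "X \<noteq> {}"
      using meet[OF open_UNIV UNIV_I] that by blast
    fix g :: "'x \<Rightarrow> real" assume g: "continuous_on X g" and bdd: "bdd_above (g ` X)"
    have bddD: "bdd_above (g ` D)" using bdd DX by (meson bdd_above_mono image_mono)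
    show "(SUP x\<in>X. g x) = (SUP x\<in>D. g x)"
    proof (cases "X = {}")
      case True
      then show ?thesis using DX by simp
    next
      case False
      show ?thesis
      proof (rule antisym)
        show "(SUP x\<in>D. g x) \<le> (SUP x\<in>X. g x)" using DX ne[OF False] bdd by (intro cSUP_subset_mono) auto
        show "(SUP x\<in>X. g x) \<le> (SUP x\<in>D. g x)"
        proof (rule cSUP_least[OF False])
          fix x assume x: "x \<in> X"
          show "g x \<le> (SUP x\<in>D. g x)"
          proof (rule field_le_epsilon)
            fix e :: real assume e: "e > 0"
            have "\<exists>T. open T \<and> T \<inter> X = g -` {g x - e<..} \<inter> X"
              using g unfolding continuous_on_open_invariant by (rule allE[of _ "{g x - e<..}"]) auto
            then obtain T where T: "open T" "T \<inter> X = g -` {g x - e<..} \<inter> X" by blast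
            have "x \<in> g -` {g x - e<..} \<inter> X" using x e by simp
            then have "x \<in> T" unfolding T(2)[symmetric] by simp
            then obtain d where d: "d \<in> D" "d \<in> T" using meet[OF T(1) _ x] by blast
            then have "d \<in> T \<inter> X" using DX by blast
            then have "g x - e < g d" unfolding T(2) by simp
            also have "g d \<le> (SUP x\<in>D. g x)" by (rule cSUP_upper[OF d(1) bddD])
            finally show "g x \<le> (SUP x\<in>D. g x) + e" by simp
          qed
        qed
      qed
    qed
  qed
qed

lemma measurable_SUP_continuous:
  fixes X :: "'x::second_countable_topology set" and g :: "'l \<Rightarrow> 'x \<Rightarrow> real"
  assumes X: "X \<noteq> {}" and m: "\<And>x. x \<in> X \<Longrightarrow> (\<lambda>l. g l x) \<in> borel_measurable L"
    and g: "\<And>l. l \<in> space L \<Longrightarrow> continuous_on X (g l)" "\<And>l. l \<in> space L \<Longrightarrow> bdd_above (g l ` X)"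
  shows "(\<lambda>l. SUP x\<in>X. g l x) \<in> borel_measurable L"
proof -
  obtain D where D: "countable D" "D \<subseteq> X" "D \<noteq> {}"
    and eq: "\<And>g :: 'x \<Rightarrow> real. continuous_on X g \<Longrightarrow> bdd_above (g ` X) \<Longrightarrow> (SUP x\<in>X. g x) = (SUP x\<in>D. g x)"
    using countable_supremum[of X] X by metis
  have "(\<lambda>l. SUP x\<in>D. g l x) \<in> borel_measurable L"
  proof (rule borel_measurable_cSUP[OF D(1)])
    show "(\<lambda>l. g l x) \<in> borel_measurable L" if "x \<in> D" for x using m that D(2) by blast
    show "bdd_above ((\<lambda>x. g l x) ` D)" if "l \<in> space L" for l
      using g(2)[OF that] D(2) by (meson bdd_above_mono image_mono)
  qed
  then show ?thesis
    by (rule measurable_cong[THEN iffD1, rotated]) (simp add: eq g)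
qed

lemma ratio_sup_measurable:
  fixes \<phi> \<psi> :: "'l \<Rightarrow> 'e::euclidean_space \<Rightarrow> real"
  assumes m: "\<And>d. (\<lambda>l. \<phi> l d) \<in> borel_measurable L" "\<And>d. (\<lambda>l. \<psi> l d) \<in> borel_measurable L"
    and hom: "\<And>l. l \<in> space L \<Longrightarrow> homogeneous (\<phi> l)" "\<And>l. l \<in> space L \<Longrightarrow> homogeneous (\<psi> l)"
    and pos: "\<And>l d. l \<in> space L \<Longrightarrow> d \<noteq> 0 \<Longrightarrow> 0 < \<psi> l d"
  shows "(\<lambda>l. ratio_sup (\<phi> l) (\<psi> l)) \<in> borel_measurable L"
  unfolding ratio_sup_def
proof (rule measurable_SUP_continuous[OF sphere_nonempty])
  show "(\<lambda>l. \<phi> l d / \<psi> l d) \<in> borel_measurable L" for d using m by measurable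
  fix l assume l: "l \<in> space L"
  show "bdd_above ((\<lambda>d. \<phi> l d / \<psi> l d) ` sphere 0 1)" by (rule ratio_sup_bdd[OF hom(1)[OF l] hom(2)[OF l] pos[OF l]])
  have "\<psi> l d \<noteq> 0" if "d \<in> sphere 0 1" for d
  proof -
    have "d \<noteq> 0" using that by auto
    then show ?thesis using pos[OF l] by force
  qed
  then show "continuous_on (sphere 0 1) (\<lambda>d. \<phi> l d / \<psi> l d)"
    by (intro continuous_on_divide homogeneousD(1) hom l) auto
qed

text \<open>\<open>v\<close> is known only through its equation. For compact \<open>K\<close>, the
  solution lies in \<open>K\<close> iff a countable dense subset of \<open>K\<close> contains
  approximate solutions of every precision: compactness yields an exact solution in
  \<open>K\<close>, and invertibility identifies it with \<open>v\<close>. Half-spaces are countable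
  unions of compact sets, which gives measurability.\<close>

lemma measurable_adj_solution:
  fixes A :: "'l \<Rightarrow> 'e::euclidean_space \<Rightarrow> 'e"
  assumes m: "\<And>b. (\<lambda>l. A l b) \<in> borel_measurable L" and r: "r \<in> borel_measurable L"
    and lin: "\<And>l. l \<in> space L \<Longrightarrow> linear (A l)" and bij: "\<And>l. l \<in> space L \<Longrightarrow> bij (A l)"
    and sol: "\<And>l. l \<in> space L \<Longrightarrow> adj (A l) (v l) = r l"
  shows "v \<in> borel_measurable L"
proof -
  have K: "{l\<in>space L. v l \<in> K} \<in> sets L" if K: "compact K" for K
  proof -
    obtain D where D: "countable D" "D \<subseteq> K" "K \<subseteq> closure D" using separable by blast
    have "(\<lambda>l. adj (A l) d) \<in> borel_measurable L" for d
      unfolding adj_def using m by measurable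
    then have meas: "{l\<in>space L. norm (adj (A l) d - r l) < 1 / Suc n} \<in> sets L" for d and n :: nat
      using r by measurable
    have cont: "continuous_on UNIV (adj (A l))" for l unfolding adj_def by (intro continuous_intros)
    have "{l\<in>space L. v l \<in> K} = (\<Inter>n. \<Union>d\<in>D. {l\<in>space L. norm (adj (A l) d - r l) < 1 / Suc n})" (is "_ = ?R")
    proof (intro set_eqI iffI)
      fix l assume "l \<in> {l\<in>space L. v l \<in> K}"
      then have l: "l \<in> space L" "v l \<in> K" by auto
      then have "v l \<in> closure D" using D by blast
      then obtain x where x: "\<And>n. x n \<in> D" "x \<longlonglongrightarrow> v l" by (auto simp: closure_sequential)
      have "(\<lambda>n. adj (A l) (x n)) \<longlonglongrightarrow> r l"
        using continuous_on_tendsto_compose[OF cont[of l] x(2)] unfolding sol[OF l(1)] by simp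
      then have lim: "(\<lambda>n. norm (adj (A l) (x n) - r l)) \<longlonglongrightarrow> 0" by (simp add: LIM_zero tendsto_norm_zero)
      show "l \<in> ?R"
      proof
        fix n
        have "\<forall>\<^sub>F k in sequentially. norm (adj (A l) (x k) - r l) < 1 / Suc n"
          by (rule order_tendstoD(2)[OF lim]) simp
        then obtain k where "norm (adj (A l) (x k) - r l) < 1 / Suc n" by (auto simp: eventually_sequentially)
        then show "l \<in> (\<Union>d\<in>D. {l\<in>space L. norm (adj (A l) d - r l) < 1 / Suc n})"
          using x(1)[of k] l(1) by blast
      qed
    next
      fix l assume "l \<in> ?R"
      then have "\<forall>n. \<exists>d. d \<in> D \<and> l \<in> space L \<and> norm (adj (A l) d - r l) < 1 / Suc n" by auto
      then obtain x where x: "\<And>n. x n \<in> D" "l \<in> space L" "\<And>n. norm (adj (A l) (x n) - r l) < 1 / Suc n" by metis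
      then have "\<forall>n. x n \<in> K" using D(2) by blast
      then obtain k \<rho> where k: "k \<in> K" "strict_mono \<rho>" "(x \<circ> \<rho>) \<longlonglongrightarrow> k"
        using K unfolding compact_def by metis
      have "(\<lambda>n. norm (adj (A l) (x n) - r l)) \<longlonglongrightarrow> 0"
      proof (rule tendsto_sandwich[of "\<lambda>_. 0" _ _ "\<lambda>n. 1 / Suc n"])
        show "(\<lambda>n. 1 / real (Suc n)) \<longlonglongrightarrow> 0" by (rule LIMSEQ_Suc[OF lim_1_over_n])
        show "\<forall>\<^sub>F n in sequentially. norm (adj (A l) (x n) - r l) \<le> 1 / real (Suc n)"
          using x(3) by (intro always_eventually allI less_imp_le)
      qed auto
      then have "(\<lambda>n. adj (A l) (x n)) \<longlonglongrightarrow> r l" by (simp add: LIM_zero_iff tendsto_norm_zero_iff)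
      then have "(\<lambda>n. adj (A l) ((x \<circ> \<rho>) n)) \<longlonglongrightarrow> r l"
        using LIMSEQ_subseq_LIMSEQ[OF _ k(2)] by (force simp: o_def)
      moreover have "(\<lambda>n. adj (A l) ((x \<circ> \<rho>) n)) \<longlonglongrightarrow> adj (A l) k"
        by (rule continuous_on_tendsto_compose[OF cont k(3)]) auto
      ultimately have "adj (A l) k = r l" by (rule LIMSEQ_unique[rotated])
      then have "adj (A l) (k - v l) = 0" using sol[OF x(2)] by (simp add: adj_diff)
      then have "k = v l" using adj_eq_zero[OF lin[OF x(2)] bij[OF x(2)]] by fastforce
      then show "l \<in> {l\<in>space L. v l \<in> K}" using k(1) x(2) by simp
    qed
    also have "\<dots> \<in> sets L" using meas D(1) by (intro sets.countable_INT sets.countable_UN') auto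
    finally show ?thesis .
  qed
  show ?thesis
  proof (rule borel_measurable_euclidean_space[THEN iffD2], rule ballI, unfold borel_measurable_iff_le, rule allI)
    fix b :: 'e and a :: real
    have "{l\<in>space L. v l \<bullet> b \<le> a} = (\<Union>n::nat. {l\<in>space L. v l \<in> cball 0 (real n) \<inter> {x. x \<bullet> b \<le> a}})"
      using real_arch_simple by auto
    also have "\<dots> \<in> sets L"
    proof (intro sets.countable_UN image_subsetI K)
      have "closed {x. x \<bullet> b \<le> a}" using closed_halfspace_le[of b a] by (simp add: inner_commute)
      then show "compact (cball 0 (real n) \<inter> {x. x \<bullet> b \<le> a})" for n by (intro compact_Int_closed compact_cball)
    qed
    finally show "{l\<in>space L. v l \<bullet> b \<le> a} \<in> sets L" .
  qed
qed

lemma measurable_If_continuous: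
  fixes f :: "'x::topological_space \<Rightarrow> 'y::topological_space"
  assumes "V \<in> sets borel" "continuous_on V f"
  shows "(\<lambda>x. if x \<in> V then f x else a) \<in> measurable borel borel"
  using assms borel_measurable_continuous_on_restrict
  by (subst measurable_If_restrict_space_iff) auto

text \<open>The derivative becomes a limit along the fixed sequence \<open>1 / (n + 1)\<close>, so
  that its measurability in a parameter is inherited from that of the map.\<close>

lemma difference_quotient_limit:
  fixes F :: "'x::euclidean_space \<Rightarrow> 'y::euclidean_space"
  assumes F: "(F has_derivative D) (at w)"
  shows "(\<lambda>n. real (Suc n) *\<^sub>R (F (w + inverse (real (Suc n)) *\<^sub>R b) - F w)) \<longlonglongrightarrow> D b"
proof (cases "b = 0")
  case True
  then show ?thesis using linear_0[OF has_derivative_linear[OF F]] by simp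
next
  case False
  let ?t = "\<lambda>n. inverse (real (Suc n)) *\<^sub>R b"
  note lin = has_derivative_linear[OF F]
  have "?t \<longlonglongrightarrow> 0 *\<^sub>R b" by (intro tendsto_scaleR tendsto_const LIMSEQ_inverse_real_of_nat)
  then have "filterlim ?t (at 0) sequentially"
    using False by (intro filterlim_atI) (auto simp del: of_nat_Suc)
  moreover have "((\<lambda>h. norm (F (w + h) - F w - D h) / norm h) \<longlongrightarrow> 0) (at 0)"
    using F by (simp add: has_derivative_at)
  ultimately have "(\<lambda>n. norm (F (w + ?t n) - F w - D (?t n)) / norm (?t n)) \<longlonglongrightarrow> 0"
    by (rule filterlim_compose[rotated])
  then have "(\<lambda>n. norm (F (w + ?t n) - F w - D (?t n)) / norm (?t n) * norm b) \<longlonglongrightarrow> 0 * norm b"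
    by (intro tendsto_mult tendsto_const)
  moreover have "norm (F (w + ?t n) - F w - D (?t n)) / norm (?t n) * norm b =
      norm (real (Suc n) *\<^sub>R (F (w + ?t n) - F w) - D b)" for n
  proof -
    have "real (Suc n) *\<^sub>R (F (w + ?t n) - F w) - D b = real (Suc n) *\<^sub>R (F (w + ?t n) - F w - D (?t n))"
      using linear_scale[OF lin] by (simp add: scaleR_diff_right del: of_nat_Suc)
    moreover have "norm Z / norm (?t n) * norm b = real (Suc n) * norm Z" for Z :: 'y
      using False by (simp add: field_simps del: of_nat_Suc)
    ultimately show ?thesis by (simp del: of_nat_Suc)
  qed
  ultimately have "(\<lambda>n. norm (real (Suc n) *\<^sub>R (F (w + ?t n) - F w) - D b)) \<longlonglongrightarrow> 0" by simp
  then show ?thesis by (simp add: LIM_zero_iff tendsto_norm_zero_iff)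
qed

context riem
begin

lemma ex_countable_atlas:
  obtains A where "countable A" "A \<subseteq> atlas M" "\<And>x. \<exists>c\<in>A. x \<in> fst c"
proof -
  have "\<And>S. S \<in> fst ` atlas M \<Longrightarrow> open S" using chart_dom_open by auto
  then obtain \<F> where \<F>: "\<F> \<subseteq> fst ` atlas M" "countable \<F>" "\<Union>\<F> = \<Union>(fst ` atlas M)"
    by (rule Lindelof)
  obtain A where A: "countable A" "A \<subseteq> atlas M" "\<F> = fst ` A"
    using countable_subset_image[of \<F> fst "atlas M"] \<F> by metis
  have "\<Union>(fst ` atlas M) = UNIV" using atlas by (simp add: smooth_atlas_def)
  then have "\<exists>c\<in>A. x \<in> fst c" for x using \<F>(3) A(3) by (metis UNIV_I UN_iff)
  then show ?thesis using that A by blast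
qed

lemma family_restrict:
  assumes "(\<lambda>(l, y). h l y) \<in> measurable (L \<Otimes>\<^sub>M borel) Q"
  shows "(\<lambda>(l, y). h l y) \<in> measurable (restrict_space L \<Omega> \<Otimes>\<^sub>M borel) Q"
proof -
  have "(\<lambda>z. (id (fst z), snd z)) \<in> measurable (restrict_space L \<Omega> \<Otimes>\<^sub>M borel) (L \<Otimes>\<^sub>M borel)"
    by (intro measurable_Pair measurable_snd
        measurable_compose[OF measurable_fst measurable_restrict_space1[OF measurable_ident]])
  from measurable_compose[OF this assms] show ?thesis by simp
qed

lemma family_at:
  assumes "(\<lambda>(l, y). h l y) \<in> measurable (L \<Otimes>\<^sub>M borel) Q" "x \<in> borel_measurable L"
  shows "(\<lambda>l. h l (x l)) \<in> measurable L Q"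
  using measurable_compose[OF measurable_Pair[OF measurable_ident assms(2)] assms(1)] by simp

lemma chart_D_measurable:
  assumes h: "(\<lambda>(l, y). h l y) \<in> measurable (L \<Otimes>\<^sub>M borel) borel" and x: "x \<in> borel_measurable L"
    and c: "c \<in> atlas M" "c' \<in> atlas M"
    and l: "\<And>l. l \<in> space L \<Longrightarrow> C1_map (h l)" "\<And>l. l \<in> space L \<Longrightarrow> x l \<in> fst c"
      "\<And>l. l \<in> space L \<Longrightarrow> h l (x l) \<in> fst c'"
  shows "(\<lambda>l. chart_D c c' (h l) (x l) b) \<in> borel_measurable L"
proof -
  let ?V = "snd c ` fst c"
  \<comment> \<open>The coordinate maps are extended by default values to be Borel on the whole
    space. The difference quotients of the extended maps agree with the true ones only for large
    \<open>n\<close>, once the shifted coordinate lies in the open set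
    \<open>transition_dom\<close>.\<close>
  define ci where "ci = (\<lambda>w. if w \<in> ?V then chart_inv c w else undefined)"
  define cs where "cs = (\<lambda>(c :: ('a, 'e) chart) y. if y \<in> fst c then snd c y else (0 :: 'e))"
  have ci: "ci \<in> borel_measurable borel"
    unfolding ci_def using chart_img_open[OF c(1)] chart_inv_cont[OF c(1)] by (intro measurable_If_continuous) auto
  have cs: "cs c \<in> borel_measurable borel" if "c \<in> atlas M" for c
    unfolding cs_def using chart_dom_open[OF that] chart_cont[OF that] by (intro measurable_If_continuous) auto
  have hw: "(\<lambda>l. cs c' (h l (ci (w l)))) \<in> borel_measurable L" if "w \<in> borel_measurable L" for w
    by (rule measurable_compose[OF family_at[OF h measurable_compose[OF that ci]] cs[OF c(2)]])
  have w0: "(\<lambda>l. snd c (x l)) \<in> borel_measurable L"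
    using measurable_compose[OF x cs[OF c(1)]]
    by (rule measurable_cong[THEN iffD1, rotated]) (simp add: cs_def l)
  define Q where "Q = (\<lambda>n l. real (Suc n) *\<^sub>R (cs c' (h l (ci (snd c (x l) + inverse (real (Suc n)) *\<^sub>R b))) -
      cs c' (h l (ci (snd c (x l))))))"
  have "Q n \<in> borel_measurable L" for n
    unfolding Q_def using w0 by (intro borel_measurable_scaleR borel_measurable_diff hw borel_measurable_add) auto
  moreover have "(\<lambda>n. Q n l) \<longlonglongrightarrow> chart_D c c' (h l) (x l) b" if ls: "l \<in> space L" for l
  proof -
    let ?F = "snd c' \<circ> h l \<circ> chart_inv c" and ?w = "snd c (x l)"
    note c0 = charts_atI[OF c(1) l(2)[OF ls]] and c0' = charts_atI[OF c(2) l(3)[OF ls]]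
    have wr: "?w \<in> transition_dom c c' (h l)" by (rule regI[of c "x l" c' "h l", OF c0 c0'])
    have eq: "cs c' (h l (ci w)) = ?F w" if "w \<in> transition_dom c c' (h l)" for w
      using regD[OF c that] charts_atD by (auto simp: ci_def cs_def)
    have "(\<lambda>n. ?w + inverse (real (Suc n)) *\<^sub>R b) \<longlonglongrightarrow> ?w + 0 *\<^sub>R b"
      by (intro tendsto_add tendsto_const tendsto_scaleR LIMSEQ_inverse_real_of_nat)
    then have "\<forall>\<^sub>F n in sequentially. ?w + inverse (real (Suc n)) *\<^sub>R b \<in> transition_dom c c' (h l)"
      using transition_dom_open[OF l(1)[OF ls] c] wr by (auto dest: topological_tendstoD)
    then have "\<forall>\<^sub>F n in sequentially. real (Suc n) *\<^sub>R (?F (?w + inverse (real (Suc n)) *\<^sub>R b) - ?F ?w) = Q n l"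
      by eventually_elim (simp add: Q_def eq wr del: o_apply)
    then show ?thesis
      using difference_quotient_limit[OF chart_D_has_derivative[OF l(1)[OF ls] c0 c0'], of b]
      by (rule Lim_transform_eventually[rotated])
  qed
  ultimately show ?thesis by (rule borel_measurable_LIMSEQ_metric)
qed

text \<open>Countably many chart domains cover the manifold, so measurability may be proved with
  \<open>x l\<close> confined to a fixed chart.\<close>

lemma measurable_chart_pieces:
  assumes x: "x \<in> borel_measurable L"
    and piece: "\<And>c. c \<in> atlas M \<Longrightarrow> g \<in> measurable (restrict_space L {l. x l \<in> fst c}) Q"
  shows "g \<in> measurable L Q"
proof -
  obtain A where A: "countable A" "A \<subseteq> atlas M" "\<And>x. \<exists>c\<in>A. x \<in> fst c" by (rule ex_countable_atlas) blast
  show ?thesis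
  proof (rule measurable_piecewise_restrict[where C="(\<lambda>c. {l. x l \<in> fst c}) ` A"])
    show "countable ((\<lambda>c. {l. x l \<in> fst c}) ` A)" using A(1) by simp
    show "space L \<subseteq> \<Union> ((\<lambda>c. {l. x l \<in> fst c}) ` A)" using A(3) by auto
    fix \<Omega> assume "\<Omega> \<in> (\<lambda>c. {l. x l \<in> fst c}) ` A"
    then obtain c where c: "c \<in> atlas M" "\<Omega> = {l. x l \<in> fst c}" using A(2) by auto
    have "\<Omega> \<inter> space L = x -` fst c \<inter> space L" using c by auto
    also have "\<dots> \<in> sets L" using x chart_dom_open[OF c(1)] by (intro measurable_sets) auto
    finally show "\<Omega> \<inter> space L \<in> sets L" .
    show "g \<in> measurable (restrict_space L \<Omega>) Q" unfolding c(2) by (rule piece[OF c(1)])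
  qed
qed

lemma push_norm_measurable:
  assumes h: "(\<lambda>(l, y). h l y) \<in> measurable (L \<Otimes>\<^sub>M borel) borel" and x: "x \<in> borel_measurable L"
    and c: "c \<in> atlas M"
    and l: "\<And>l. l \<in> space L \<Longrightarrow> C1_map (h l)" "\<And>l. l \<in> space L \<Longrightarrow> x l \<in> fst c"
  shows "(\<lambda>l. push_norm (h l) c (x l) d) \<in> borel_measurable L"
proof (rule measurable_chart_pieces[OF family_at[OF h x]])
  fix c' assume c': "c' \<in> atlas M"
  let ?L = "restrict_space L {l. h l (x l) \<in> fst c'}"
  have sp: "l \<in> space L" "h l (x l) \<in> fst c'" if "l \<in> space ?L" for l
    using that by (auto simp: space_restrict_space)
  note h' = family_restrict[OF h, of "{l. h l (x l) \<in> fst c'}"]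
  have x': "x \<in> borel_measurable ?L" using x by (rule measurable_restrict_space1)
  let ?chart_norm = "\<lambda>z. if z \<in> (snd c' ` fst c') \<times> UNIV then (\<lambda>(w, e). chart_norm c' (chart_inv c' w) e) z else 0"
  have chart_norm: "?chart_norm \<in> borel_measurable borel"
    using chart_img_open[OF c'] chart_norm_continuous[OF c'] by (intro measurable_If_continuous) (auto intro!: borel_open open_Times)
  have D: "(\<lambda>l. chart_D c c' (h l) (x l) d) \<in> borel_measurable ?L"
    by (rule chart_D_measurable[OF h' x' c c']) (use sp l in blast)+
  have cs: "(\<lambda>y. if y \<in> fst c' then snd c' y else 0) \<in> borel_measurable borel"
    using chart_dom_open[OF c'] chart_cont[OF c'] by (intro measurable_If_continuous) auto
  have "(\<lambda>l. (if h l (x l) \<in> fst c' then snd c' (h l (x l)) else 0, chart_D c c' (h l) (x l) d)) \<in> borel_measurable ?L"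
    using measurable_compose[OF family_at[OF h' x'] cs] D by (rule borel_measurable_Pair)
  from measurable_compose[OF this chart_norm]
  show "(\<lambda>l. push_norm (h l) c (x l) d) \<in> borel_measurable ?L"
  proof (rule measurable_cong[THEN iffD1, rotated])
    fix l assume "l \<in> space ?L"
    note l' = sp[OF this]
    show "?chart_norm (if h l (x l) \<in> fst c' then snd c' (h l (x l)) else 0, chart_D c c' (h l) (x l) d) = push_norm (h l) c (x l) d"
      using l' push_norm_eq[OF l(1)[OF l'(1)] charts_atI[OF c l(2)[OF l'(1)]] charts_atI[OF c' l'(2)]]
        chart_inv_chart[OF c' l'(2)] by simp
  qed
qed

lemma const_family: "(\<lambda>(l, y). (k :: 'a \<Rightarrow> 'a) y) \<in> measurable (L \<Otimes>\<^sub>M borel) borel" if "k \<in> borel_measurable borel"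
  using measurable_compose[OF measurable_snd that] by (simp add: case_prod_beta')

lemma op_norms_measurable:
  assumes h: "(\<lambda>(l, y). h l y) \<in> measurable (L \<Otimes>\<^sub>M borel) borel" and x: "x \<in> borel_measurable L"
    and l: "\<And>l. l \<in> space L \<Longrightarrow> immersion (h l)"
  shows "(\<lambda>l. D_norm (h l) (x l)) \<in> borel_measurable L" "(\<lambda>l. D_inv_norm (h l) (x l)) \<in> borel_measurable L"
proof -
  have "(\<lambda>l. D_norm (h l) (x l)) \<in> borel_measurable (restrict_space L {l. x l \<in> fst c}) \<and>
      (\<lambda>l. D_inv_norm (h l) (x l)) \<in> borel_measurable (restrict_space L {l. x l \<in> fst c})" if c: "c \<in> atlas M" for c
  proof -
    let ?L = "restrict_space L {l. x l \<in> fst c}"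
    have sp: "immersion (h l)" "x l \<in> fst c" "c \<in> charts_at M (x l)" if "l \<in> space ?L" for l
      using that l c by (auto simp: space_restrict_space charts_at_def)
    note h' = family_restrict[OF h, of "{l. x l \<in> fst c}"]
    have x': "x \<in> borel_measurable ?L" using x by (rule measurable_restrict_space1)
    have id: "(\<lambda>(l, y). id y) \<in> measurable (?L \<Otimes>\<^sub>M borel) (borel :: 'a measure)" by (rule const_family) simp
    have m1: "(\<lambda>l. push_norm (h l) c (x l) d) \<in> borel_measurable ?L" for d
      by (rule push_norm_measurable[OF h' x' c]) (use sp immersion_C1 in blast)+
    have m2: "(\<lambda>l. push_norm id c (x l) d) \<in> borel_measurable ?L" for d
      by (rule push_norm_measurable[OF id x' c]) (use sp C1_id in blast)+
    note m = m1 m2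
    have hom: "homogeneous (push_norm (h l) c (x l))" "homogeneous (push_norm id c (x l))"
      and pos: "d \<noteq> 0 \<Longrightarrow> 0 < push_norm (h l) c (x l) d" "d \<noteq> 0 \<Longrightarrow> 0 < push_norm id c (x l) d" if "l \<in> space ?L" for l d
      using push_norm_homogeneous[OF immersion_C1 sp(3), OF sp(1)] push_norm_homogeneous[OF C1_id sp(3)]
        push_norm_pos[OF sp(1,3)] push_norm_pos[OF immersion_id sp(3)] that by blast+
    have "(\<lambda>l. ratio_sup (push_norm (h l) c (x l)) (push_norm id c (x l))) \<in> borel_measurable ?L"
      by (rule ratio_sup_measurable[OF m hom pos(2)])
    moreover have "(\<lambda>l. ratio_sup (push_norm id c (x l)) (push_norm (h l) c (x l))) \<in> borel_measurable ?L"
      by (rule ratio_sup_measurable[OF m(2,1) hom(2,1) pos(1)])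
    ultimately show ?thesis
      using measurable_cong[of ?L "\<lambda>l. D_norm (h l) (x l)" "\<lambda>l. ratio_sup (push_norm (h l) c (x l)) (push_norm id c (x l))" borel]
        measurable_cong[of ?L "\<lambda>l. D_inv_norm (h l) (x l)" "\<lambda>l. ratio_sup (push_norm id c (x l)) (push_norm (h l) c (x l))" borel]
        op_norm_D_map op_norm_D_inv sp by blast
  qed
  then show "(\<lambda>l. D_norm (h l) (x l)) \<in> borel_measurable L" "(\<lambda>l. D_inv_norm (h l) (x l)) \<in> borel_measurable L"
    by (blast intro: measurable_chart_pieces[OF x])+
qed

lemma covec_growth_measurable:
  assumes h: "(\<lambda>(l, y). h l y) \<in> measurable (L \<Otimes>\<^sub>M borel) borel"
    and l: "\<And>l. l \<in> space L \<Longrightarrow> immersion (h l)" and z: "z \<in> proj_cotangent M X"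
  shows "(\<lambda>l. covec_growth (h l) z) \<in> borel_measurable L"
proof -
  obtain c where c: "c \<in> charts_at M (fst z)" using ex_chart by blast
  obtain e where e: "e \<noteq> 0" "z = covec_point c (fst z) e" using proj_cotangentE[OF z c] by metis
  define x where "x = fst z"
  have zx: "z = covec_point c x e" "c \<in> charts_at M x" using e c by (simp_all add: x_def)
  note ca = charts_atD[OF zx(2)]
  have "(\<lambda>l. push_norm (h l) c x d) \<in> borel_measurable L" for d
    by (rule push_norm_measurable[OF h]) (use ca l immersion_C1 in auto)
  then have "(\<lambda>l. ratio_sup (\<lambda>d. \<bar>e \<bullet> d\<bar>) (push_norm (h l) c x)) \<in> borel_measurable L"
    using l zx(2) by (intro ratio_sup_measurable homogeneous_inner push_norm_homogeneous immersion_C1 push_norm_pos) auto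
  then have "(\<lambda>l. ln (ratio_sup (\<lambda>d. \<bar>e \<bullet> d\<bar>) (push_norm (h l) c x)) - ln (ratio_sup (\<lambda>d. \<bar>e \<bullet> d\<bar>) (push_norm id c x))) \<in> borel_measurable L"
    by measurable
  then show ?thesis
    by (rule measurable_cong[THEN iffD1, rotated]) (simp add: zx(1) covec_growth_covec_point[OF l zx(2) e(1)])
qed

lemma covec_push_measurable:
  assumes h: "(\<lambda>(l, y). h l y) \<in> measurable (L \<Otimes>\<^sub>M borel) borel" and x: "x \<in> borel_measurable L"
    and e: "e \<in> borel_measurable L" and c: "c \<in> atlas M" "c' \<in> atlas M"
    and l: "\<And>l. l \<in> space L \<Longrightarrow> immersion (h l)" "\<And>l. l \<in> space L \<Longrightarrow> x l \<in> fst c"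
      "\<And>l. l \<in> space L \<Longrightarrow> h l (x l) \<in> fst c'"
  shows "(\<lambda>l. covec_push c c' (h l) (x l) (e l)) \<in> borel_measurable L"
proof (rule measurable_adj_solution[where A="\<lambda>l. chart_D c c' (h l) (x l)"])
  show "(\<lambda>l. chart_D c c' (h l) (x l) b) \<in> borel_measurable L" for b
    by (rule chart_D_measurable[OF h x c]) (use l immersion_C1 in blast)+
  show "e \<in> borel_measurable L" by fact
  fix l' assume l': "l' \<in> space L"
  note c0 = charts_atI[OF c(1) l(2)[OF l']] charts_atI[OF c(2) l(3)[OF l']]
  show "linear (chart_D c c' (h l') (x l'))" by (rule linear_chart_D[OF immersion_C1[OF l(1)[OF l']] c0])
  show "bij (chart_D c c' (h l') (x l'))" by (rule immersion_bij[OF l(1)[OF l'] c0])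
  show "adj (chart_D c c' (h l') (x l')) (covec_push c c' (h l') (x l') (e l')) = e l'" by (rule adj_covec_push[OF l(1)[OF l'] c0])
qed

lemma bundle_continuous_lift_measurable:
  assumes u: "u \<in> bundle_continuous X" and X: "closed X"
    and h: "(\<lambda>(l, y). h l y) \<in> measurable (L \<Otimes>\<^sub>M borel) borel" and x: "x \<in> borel_measurable L"
    and e: "e \<in> borel_measurable L" and c: "c \<in> atlas M"
    and l: "\<And>l. l \<in> space L \<Longrightarrow> immersion (h l)" "\<And>l. l \<in> space L \<Longrightarrow> x l \<in> fst c"
      "\<And>l. l \<in> space L \<Longrightarrow> h l (x l) \<in> X" "\<And>l. l \<in> space L \<Longrightarrow> e l \<noteq> 0"
  shows "(\<lambda>l. u (lift (h l) (covec_point c (x l) (e l)))) \<in> borel_measurable L"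
proof (rule measurable_chart_pieces[OF family_at[OF h x]])
  fix c' assume c': "c' \<in> atlas M"
  let ?L = "restrict_space L {l. h l (x l) \<in> fst c'}"
  have sp: "l \<in> space L" "h l (x l) \<in> fst c'" if "l \<in> space ?L" for l
    using that by (auto simp: space_restrict_space)
  note h' = family_restrict[OF h, of "{l. h l (x l) \<in> fst c'}"]
  have x': "x \<in> borel_measurable ?L" using x by (rule measurable_restrict_space1)
  have e': "e \<in> borel_measurable ?L" using e by (rule measurable_restrict_space1)
  let ?B = "snd c' ` (fst c' \<inter> X) \<times> (- {0 :: 'e})"
  let ?u = "\<lambda>z. if z \<in> ?B then (\<lambda>(w, e). u (covec_point c' (chart_inv c' w) e)) z else 0"
  \<comment> \<open>As \<open>X\<close> is closed, the coordinates of its points form a difference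
    of two open sets, hence a Borel set.\<close>
  have "snd c' ` (fst c' \<inter> - X) = snd c' ` fst c' - snd c' ` (fst c' \<inter> X)"
    using chart_inv_chart[OF c'] by (auto simp: image_iff) metis
  then have "snd c' ` (fst c' \<inter> X) = snd c' ` fst c' - snd c' ` (fst c' \<inter> - X)" by auto
  moreover have "open (snd c' ` (fst c' \<inter> - X))" using X by (intro chart_open_image[OF c']) auto
  ultimately have "snd c' ` (fst c' \<inter> X) \<in> sets borel" using chart_img_open[OF c'] by auto
  then have "?B \<in> sets (borel \<Otimes>\<^sub>M borel)" by (intro pair_measureI) auto
  then have B: "?B \<in> sets borel" unfolding borel_prod .
  have um: "?u \<in> borel_measurable borel"
    using B u c' unfolding bundle_continuous_def by (intro measurable_If_continuous) auto
  have D: "(\<lambda>l. covec_push c c' (h l) (x l) (e l)) \<in> borel_measurable ?L"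
    by (rule covec_push_measurable[OF h' x' e' c c']) (use sp l in blast)+
  have cs: "(\<lambda>y. if y \<in> fst c' then snd c' y else 0) \<in> borel_measurable borel"
    using chart_dom_open[OF c'] chart_cont[OF c'] by (intro measurable_If_continuous) auto
  have "(\<lambda>l. (if h l (x l) \<in> fst c' then snd c' (h l (x l)) else 0, covec_push c c' (h l) (x l) (e l))) \<in> borel_measurable ?L"
    using measurable_compose[OF family_at[OF h' x'] cs] D by (rule borel_measurable_Pair)
  from measurable_compose[OF this um]
  show "(\<lambda>l. u (lift (h l) (covec_point c (x l) (e l)))) \<in> borel_measurable ?L"
  proof (rule measurable_cong[THEN iffD1, rotated])
    fix l' assume "l' \<in> space ?L"
    note l' = sp[OF this]
    note c0 = charts_atI[OF c l(2)[OF l'(1)]] charts_atI[OF c' l'(2)]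
    show "?u (if h l' (x l') \<in> fst c' then snd c' (h l' (x l')) else 0, covec_push c c' (h l') (x l') (e l')) =
        u (lift (h l') (covec_point c (x l') (e l')))"
      using l' l(3)[OF l'(1)] covec_push_nonzero[OF l(1)[OF l'(1)] c0 l(4)[OF l'(1)]] lift_covec_point[OF l(1)[OF l'(1)] c0]
        chart_inv_chart[OF c' l'(2)] by auto
  qed
qed

end

lemma continuous_on_integral_dominated:
  fixes F :: "'l \<Rightarrow> 'x::{first_countable_topology, t2_space} \<Rightarrow> real"
  assumes m: "\<And>x. x \<in> A \<Longrightarrow> (\<lambda>l. F l x) \<in> borel_measurable L"
    and c: "\<And>l. l \<in> space L \<Longrightarrow> continuous_on A (F l)"
    and H: "integrable L H" "\<And>l x. l \<in> space L \<Longrightarrow> x \<in> A \<Longrightarrow> \<bar>F l x\<bar> \<le> H l"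
  shows "continuous_on A (\<lambda>x. \<integral>l. F l x \<partial>L)"
  unfolding continuous_on_sequentially
proof (intro allI ballI impI)
  fix x a assume a: "a \<in> A" and x: "(\<forall>n. x n \<in> A) \<and> x \<longlonglongrightarrow> a"
  have "(\<lambda>n. \<integral>l. F l (x n) \<partial>L) \<longlonglongrightarrow> (\<integral>l. F l a \<partial>L)"
  proof (rule integral_dominated_convergence[where w=H])
    show "(\<lambda>l. F l a) \<in> borel_measurable L" "(\<lambda>l. F l (x n)) \<in> borel_measurable L" for n
      using m a x by auto
    show "AE l in L. norm (F l (x n)) \<le> H l" for n using H(2) x by (intro AE_I2) auto
    show "AE l in L. (\<lambda>n. F l (x n)) \<longlonglongrightarrow> F l a"
    proof (rule AE_I2)
      fix l assume "l \<in> space L"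
      from c[OF this] show "(\<lambda>n. F l (x n)) \<longlonglongrightarrow> F l a"
        unfolding continuous_on_sequentially using a x by (simp add: o_def)
    qed
  qed (rule H(1))
  then show "((\<lambda>x. \<integral>l. F l x \<partial>L) \<circ> x) \<longlonglongrightarrow> (\<integral>l. F l a \<partial>L)" by (simp add: o_def)
qed

lemma ex_positive_exactly_on:
  fixes V :: "'x::metric_space set"
  assumes "open V"
  obtains \<rho> :: "'x \<Rightarrow> real" where "continuous_on UNIV \<rho>" "\<And>w. 0 \<le> \<rho> w" "\<And>w. 0 < \<rho> w \<longleftrightarrow> w \<in> V"
proof (cases "V = UNIV")
  case True
  then show ?thesis using that[of "\<lambda>_. 1"] by simp
next
  case False
  then have ne: "- V \<noteq> {}" by auto
  have z: "infdist w (- V) = 0 \<longleftrightarrow> w \<in> - V" for w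
    using in_closed_iff_infdist_zero[of "- V" w] assms ne by auto
  have nn: "0 \<le> infdist w (- V)" for w by (rule infdist_nonneg)
  show ?thesis
  proof (rule that[of "\<lambda>w. infdist w (- V)"])
    show "continuous_on UNIV (\<lambda>w. infdist w (- V))" by (intro continuous_intros)
    show "0 < infdist w (- V) \<longleftrightarrow> w \<in> V" for w using z[of w] nn[of w] by (auto simp: less_le)
  qed (rule nn)
qed

context riem
begin

subsection \<open>Continuous functions on the projectivized cotangent bundle\<close>

lemma bundle_continuous_I:
  assumes "\<And>c. c \<in> atlas M \<Longrightarrow> continuous_on (snd c ` (fst c \<inter> X) \<times> (- {0 :: 'e})) (\<lambda>z. u (covec_point c (chart_inv c (fst z)) (snd z)))"
  shows "u \<in> bundle_continuous X"
  using assms unfolding bundle_continuous_def case_prod_beta' by blast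

lemma bundle_continuous_D:
  assumes "u \<in> bundle_continuous X" "c \<in> atlas M"
  shows "continuous_on (snd c ` (fst c \<inter> X) \<times> (- {0 :: 'e})) (\<lambda>z. u (covec_point c (chart_inv c (fst z)) (snd z)))"
  using assms unfolding bundle_continuous_def case_prod_beta' by blast

lemma bundle_continuous_lattice: "function_lattice (bundle_continuous X)"
  unfolding function_lattice_def
  by (intro conjI allI ballI; rule bundle_continuous_I; intro continuous_intros bundle_continuous_D)

lemma bundle_continuous_base:
  assumes g: "continuous_on X g"
  shows "(\<lambda>z. g (fst z)) \<in> bundle_continuous X"
proof (rule bundle_continuous_I)
  fix c assume c: "c \<in> atlas M"
  have "continuous_on (snd c ` (fst c \<inter> X)) (\<lambda>w. g (chart_inv c w))"
    by (rule continuous_on_compose2[OF g continuous_on_subset[OF chart_inv_cont[OF c]]])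
      (auto simp: chart_inv_chart[OF c])
  then show "continuous_on (snd c ` (fst c \<inter> X) \<times> (- {0 :: 'e})) (\<lambda>z. g (fst (covec_point c (chart_inv c (fst z)) (snd z))))"
    unfolding fst_covec_point by (rule continuous_on_compose2) (auto intro!: continuous_intros)
qed

lemma chart_point:
  assumes "c \<in> atlas M" "w \<in> snd c ` (fst c \<inter> X)"
  shows "c \<in> charts_at M (chart_inv c w)" "chart_inv c w \<in> X"
  using assms chart_inv_chart[OF assms(1)] by (auto simp: charts_at_def)

lemma bundle_continuous_integral:
  fixes F :: "'l \<Rightarrow> 'a \<times> ('a, 'e) covec set \<Rightarrow> real"
  assumes m: "\<And>z. z \<in> proj_cotangent M X \<Longrightarrow> (\<lambda>l. F l z) \<in> borel_measurable L"
    and F: "\<And>l. l \<in> space L \<Longrightarrow> F l \<in> bundle_continuous X"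
    and H: "integrable L H" "\<And>l z. l \<in> space L \<Longrightarrow> z \<in> proj_cotangent M X \<Longrightarrow> \<bar>F l z\<bar> \<le> H l"
  shows "(\<lambda>z. \<integral>l. F l z \<partial>L) \<in> bundle_continuous X"
proof (rule bundle_continuous_I)
  fix c assume c: "c \<in> atlas M"
  let ?B = "snd c ` (fst c \<inter> X) \<times> (- {0 :: 'e})"
  have Z: "covec_point c (chart_inv c (fst z)) (snd z) \<in> proj_cotangent M X" if "z \<in> ?B" for z
  proof -
    have "fst z \<in> snd c ` (fst c \<inter> X)" "snd z \<noteq> 0" using that by auto
    then show ?thesis using chart_point[OF c] by (intro covec_point_in)
  qed
  show "continuous_on ?B (\<lambda>z. \<integral>l. F l (covec_point c (chart_inv c (fst z)) (snd z)) \<partial>L)"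
    by (rule continuous_on_integral_dominated[OF m bundle_continuous_D[OF F c] H(1) H(2)]) (auto intro: Z)
qed

lemma covec_point_change:
  assumes c: "c \<in> charts_at M x" and c': "c' \<in> charts_at M x"
  shows "covec_point c x e = covec_point c' x (covec_push c c' id x e)"
proof -
  have "covec_push c c id x e \<bullet> d = e \<bullet> d" for d
    using covec_push_inner[OF immersion_id c, of c e d] c chart_D_id[OF c] by simp
  then have "covec_push c c id x e = e" using vector_eq_rdot by blast
  then show ?thesis
    using lift_covec_point[OF immersion_id c, of c e] lift_covec_point[OF immersion_id c, of c' e] c c' by simp
qed

lemma covec_point_eqD:
  assumes c: "c \<in> charts_at M x" and eq: "covec_point c x e = covec_point c x e'"
  obtains a where "a \<noteq> 0" "e' = a *\<^sub>R e"
proof -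
  have "coord_covector M c x e' \<in> proj_class (coord_covector M c x e')"
    unfolding proj_class_def by (intro CollectI exI[of _ 1]) simp
  then have "coord_covector M c x e' \<in> proj_class (coord_covector M c x e)" using eq by (simp add: covec_point_def)
  then obtain a where a: "a \<noteq> 0" "coord_covector M c x e' = (\<lambda>v. a * coord_covector M c x e v)"
    unfolding proj_class_def by blast
  then have eq': "coord_covector M c x e' = coord_covector M c x (a *\<^sub>R e)" by (simp add: coord_covector_scale)
  have "e' \<bullet> d = (a *\<^sub>R e) \<bullet> d" for d
    using fun_cong[OF eq', of "coord_vector M c x d"] coord_vector_tangent[OF c, of d]
    by (simp add: coord_covector_def coord_vector_self[OF c])
  then have "e' = a *\<^sub>R e" using vector_eq_rdot by blast
  then show ?thesis using that a(1) by blast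
qed

definition chart_ball :: "('a, 'e) chart \<times> 'e \<times> real \<Rightarrow> 'a set" where
  "chart_ball = (\<lambda>(c, v, r). {x \<in> fst c. dist (snd c x) v < r})"

text \<open>The closed ball, and not only the open one, is required to lie in the chart image: the
  bump is then supported in a compact part of the chart domain and extends continuously by
  0.\<close>

definition admissible :: "('a, 'e) chart \<times> 'e \<times> real \<Rightarrow> bool" where
  "admissible = (\<lambda>(c, v, r). c \<in> atlas M \<and> 0 < r \<and> cball v r \<subseteq> snd c ` fst c)"

text \<open>Only continuity and the set of positivity matter, so no normalization is made.\<close>

definition bump :: "('a, 'e) chart \<times> 'e \<times> real \<Rightarrow> 'a \<Rightarrow> real" where
  "bump = (\<lambda>(c, v, r) x. if x \<in> fst c then max 0 (r - dist (snd c x) v) else 0)"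

lemma chart_ball_open: "admissible t \<Longrightarrow> open (chart_ball t)"
proof -
  assume t: "admissible t"
  obtain c v r where t': "t = (c, v, r)" by (cases t)
  have c: "c \<in> atlas M" using t by (simp add: admissible_def t')
  have "open (snd c -` ball v r \<inter> fst c)"
    using chart_cont[OF c] chart_dom_open[OF c] continuous_on_open_vimage by blast
  also have "snd c -` ball v r \<inter> fst c = chart_ball t" by (auto simp: chart_ball_def t' dist_commute)
  finally show ?thesis .
qed

lemma bump_pos_iff: "0 < bump t x \<longleftrightarrow> x \<in> chart_ball t"
  by (cases t) (auto simp: bump_def chart_ball_def)

lemma bump_nonneg: "0 \<le> bump t x"
  by (cases t) (auto simp: bump_def)

text \<open>The preimage of the closed coordinate ball is compact, hence closed in a Hausdorff
  space; its complement serves as \<open>G\<close>.\<close>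

lemma bump_zero_open:
  assumes t: "admissible (c, v, r)"
  obtains G where "open G" "fst c \<union> G = UNIV" "\<And>x. x \<in> G \<Longrightarrow> bump (c, v, r) x = 0"
proof -
  have c: "c \<in> atlas M" and sub: "cball v r \<subseteq> snd c ` fst c" using t by (auto simp: admissible_def)
  let ?K = "chart_inv c ` cball v r"
  have "compact ?K" by (rule compact_continuous_image[OF continuous_on_subset[OF chart_inv_cont[OF c] sub] compact_cball])
  then have "open (- ?K)" using compact_imp_closed by blast
  moreover have "fst c \<union> - ?K = UNIV" using chart_inv_in[OF c] sub by auto
  moreover have "bump (c, v, r) x = 0" if "x \<in> - ?K" for x
  proof (rule ccontr)
    assume "bump (c, v, r) x \<noteq> 0"
    then have "x \<in> chart_ball (c, v, r)" using bump_pos_iff bump_nonneg by (metis less_le)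
    then have "x \<in> fst c" "snd c x \<in> cball v r" by (auto simp: chart_ball_def dist_commute)
    then have "x \<in> ?K" using chart_inv_chart[OF c] by (metis imageI)
    then show False using that by simp
  qed
  ultimately show ?thesis using that by blast
qed

lemma bump_mult_continuous:
  assumes t: "admissible (c, v, r)" and \<rho>: "continuous_on UNIV \<rho>"
  shows "continuous_on UNIV (\<lambda>x. bump (c, v, r) x * \<rho> (snd c x))"
proof (rule continuous_on_local)
  fix x
  have c: "c \<in> atlas M" using t by (simp add: admissible_def)
  obtain G where G: "open G" "fst c \<union> G = UNIV" "\<And>x. x \<in> G \<Longrightarrow> bump (c, v, r) x = 0"
    using bump_zero_open[OF t] by blast
  show "\<exists>U. open U \<and> x \<in> U \<and> continuous_on (U \<inter> UNIV) (\<lambda>x. bump (c, v, r) x * \<rho> (snd c x))"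
  proof (cases "x \<in> fst c")
    case True
    have "continuous_on (fst c) (\<lambda>x. max 0 (r - dist (snd c x) v) * \<rho> (snd c x))"
      by (intro continuous_intros chart_cont[OF c] continuous_on_compose2[OF \<rho> chart_cont[OF c]]) auto
    then have "continuous_on (fst c) (\<lambda>x. bump (c, v, r) x * \<rho> (snd c x))"
      by (rule continuous_on_eq) (simp add: bump_def)
    then show ?thesis using True chart_dom_open[OF c] by (intro exI[of _ "fst c"]) simp
  next
    case False
    then have "x \<in> G" using G(2) by blast
    moreover have "continuous_on G (\<lambda>x. bump (c, v, r) x * \<rho> (snd c x))"
      by (rule continuous_on_eq[OF continuous_on_const[of G 0]]) (simp add: G(3))
    ultimately show ?thesis using G(1) by (intro exI[of _ G]) simp
  qed
qed

lemma ex_finite_chart_balls: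
  fixes X :: "'a set"
  assumes "compact X"
  obtains T where "finite T" "\<And>t. t \<in> T \<Longrightarrow> admissible t" "X \<subseteq> \<Union>(chart_ball ` T)"
proof -
  have ex: "\<exists>t. admissible t \<and> x \<in> chart_ball t" for x
  proof -
    obtain c where c: "c \<in> charts_at M x" using ex_chart by blast
    note ca = charts_atD[OF c]
    obtain r where "r > 0" "cball (snd c x) r \<subseteq> snd c ` fst c"
      using chart_img_open[of c] ca open_contains_cball by (metis imageI)
    then show ?thesis using ca by (intro exI[of _ "(c, snd c x, r)"]) (auto simp: admissible_def chart_ball_def)
  qed
  then have "X \<subseteq> \<Union>(chart_ball ` {t. admissible t})" by blast
  then obtain T where "T \<subseteq> {t. admissible t}" "finite T" "X \<subseteq> (\<Union>t\<in>T. chart_ball t)"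
    using compactE_image[OF assms, of "{t. admissible t}" chart_ball] chart_ball_open by blast
  then show ?thesis using that by blast
qed

text \<open>In the absence of a metric on the manifold, an open set is cut into finitely many pieces
  inside chart balls covering \<open>X\<close>. In coordinates there is a continuous function
  positive exactly on the open set, and multiplication by the bump extends it by 0.\<close>

lemma sets_restrict_borel_positivity:
  fixes X :: "'a set"
  assumes X: "compact X"
  shows "sets (restrict_space borel X) = sigma_sets X (positivity_sets X {g. continuous_on X g})"
proof -
  have "sigma_sets X {T \<inter> X |T. open T} = sigma_sets X (positivity_sets X {g. continuous_on X g})"
  proof (rule sigma_sets_eqI)
    fix A assume "A \<in> {T \<inter> X |T. open T}"
    then obtain V where V: "A = V \<inter> X" "open V" by blast
    obtain T where T: "finite T" "\<And>t. t \<in> T \<Longrightarrow> admissible t" "X \<subseteq> \<Union>(chart_ball ` T)"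
      using ex_finite_chart_balls[OF X] by blast
    have "A = (\<Union>t\<in>T. V \<inter> X \<inter> chart_ball t)" using T(3) V by blast
    also have "\<dots> \<in> sigma_sets X (positivity_sets X {g. continuous_on X g})"
    proof (rule sigma_sets_UNION[OF countable_finite, OF finite_imageI[OF T(1)]])
      fix B assume "B \<in> (\<lambda>t. V \<inter> X \<inter> chart_ball t) ` T"
      then obtain c v r where t: "(c, v, r) \<in> T" and B: "B = V \<inter> X \<inter> chart_ball (c, v, r)" by auto
      note adm = T(2)[OF t]
      have c: "c \<in> atlas M" using adm by (simp add: admissible_def)
      obtain \<rho> :: "'e \<Rightarrow> real" where \<rho>: "continuous_on UNIV \<rho>" "\<And>w. 0 \<le> \<rho> w" "\<And>w. 0 < \<rho> w \<longleftrightarrow> w \<in> snd c ` (fst c \<inter> V)"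
        using ex_positive_exactly_on[OF chart_open_image[OF c V(2)]] by blast
      let ?g = "\<lambda>x. bump (c, v, r) x * \<rho> (snd c x)"
      have "continuous_on X ?g"
        using continuous_on_subset[OF bump_mult_continuous[OF adm \<rho>(1)], of X] by simp
      then have "{x\<in>X. 0 < ?g x} \<in> positivity_sets X {g. continuous_on X g}"
        by (intro positivity_setsI) simp
      moreover have "{x\<in>X. 0 < ?g x} = B"
      proof -
        have "0 < ?g x \<longleftrightarrow> x \<in> chart_ball (c, v, r) \<and> x \<in> V" for x
        proof -
          have "0 < ?g x \<longleftrightarrow> 0 < bump (c, v, r) x \<and> 0 < \<rho> (snd c x)"
            using bump_nonneg[of "(c, v, r)" x] \<rho>(2)[of "snd c x"] by (auto simp: zero_less_mult_iff)
          also have "\<dots> \<longleftrightarrow> x \<in> chart_ball (c, v, r) \<and> snd c x \<in> snd c ` (fst c \<inter> V)"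
            by (simp add: bump_pos_iff \<rho>(3))
          also have "\<dots> \<longleftrightarrow> x \<in> chart_ball (c, v, r) \<and> x \<in> V"
          proof -
            have "snd c x \<in> snd c ` (fst c \<inter> V) \<longleftrightarrow> x \<in> V" if "x \<in> chart_ball (c, v, r)"
            proof -
              have x: "x \<in> fst c" using that by (simp add: chart_ball_def)
              show ?thesis
              proof
                assume "snd c x \<in> snd c ` (fst c \<inter> V)"
                then obtain y where y: "snd c x = snd c y" "y \<in> fst c" "y \<in> V" by blast
                have "chart_inv c (snd c x) = chart_inv c (snd c y)" using y(1) by (rule arg_cong)
                then have "x = y" unfolding chart_inv_chart[OF c x] chart_inv_chart[OF c y(2)] .
                then show "x \<in> V" using y(3) by simp
              qed (use x in blast)
            qed
            then show ?thesis by blast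
          qed
          finally show ?thesis .
        qed
        then show ?thesis unfolding B by blast
      qed
      ultimately have "B \<in> positivity_sets X {g. continuous_on X g}" by simp
      then show "B \<in> sigma_sets X (positivity_sets X {g. continuous_on X g})" by (rule sigma_sets.Basic)
    qed
    finally show "A \<in> sigma_sets X (positivity_sets X {g. continuous_on X g})" .
  next
    fix A assume "A \<in> positivity_sets X {g. continuous_on X g}"
    then obtain g :: "'a \<Rightarrow> real" where g: "continuous_on X g" "A = {x\<in>X. 0 < g x}" by (auto simp: positivity_sets_def)
    have "\<exists>T. open T \<and> T \<inter> X = g -` {0<..} \<inter> X"
      using g(1) unfolding continuous_on_open_invariant by (rule allE[of _ "{0<..}"]) auto
    moreover have "g -` {0<..} \<inter> X = A" using g(2) by auto
    ultimately show "A \<in> sigma_sets X {T \<inter> X |T. open T}" by blast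
  qed
  then show ?thesis by (simp add: sets_restrict_borel)
qed

lemma proj_cotangent_subset: "X \<subseteq> X' \<Longrightarrow> proj_cotangent M X \<subseteq> proj_cotangent M X'"
  unfolding proj_cotangent_def by blast

lemma fst_proj_cotangent: "z \<in> proj_cotangent M X \<Longrightarrow> fst z \<in> X"
  unfolding proj_cotangent_def by auto

lemma openin_positivity:
  assumes u: "u \<in> bundle_continuous X" and X: "closed X"
  shows "openin (subtopology (proj_cotangent_topology M) (proj_cotangent M X)) {z\<in>proj_cotangent M X. 0 < u z}"
proof -
  \<comment> \<open>The set is enlarged by the whole bundle over the complement of \<open>X\<close>;
    it is then open in the full bundle because \<open>X\<close> is closed, and intersecting with the
    bundle over \<open>X\<close> undoes the enlargement.\<close>
  let ?W = "{z\<in>proj_cotangent M UNIV. fst z \<notin> X \<or> 0 < u z}"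
  have "proj_cotangent_open M ?W"
    unfolding proj_cotangent_open_def
  proof (intro conjI ballI)
    fix c assume c: "c \<in> atlas M"
    let ?G = "\<lambda>z. u (covec_point c (chart_inv c (fst z)) (snd z))"
    let ?B = "snd c ` (fst c \<inter> X) \<times> (- {0 :: 'e})" and ?B' = "snd c ` (fst c \<inter> - X) \<times> (- {0 :: 'e})"
    have "\<exists>T. open T \<and> T \<inter> ?B = ?G -` {0<..} \<inter> ?B"
      using bundle_continuous_D[OF u c] unfolding continuous_on_open_invariant by (rule allE[of _ "{0<..}"]) auto
    then obtain T where T: "open T" "T \<inter> ?B = ?G -` {0<..} \<inter> ?B" by blast
    have TB: "z \<in> T \<longleftrightarrow> 0 < ?G z" if "z \<in> ?B" for z using T(2) that by blast
    let ?P = "{(w, e). w \<in> snd c ` fst c \<and> e \<noteq> 0 \<and> (chart_inv c w, proj_class (coord_covector M c (chart_inv c w) e)) \<in> ?W}"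
    have "?P = ?B' \<union> (T \<inter> snd c ` fst c \<times> (- {0}))"
    proof (intro set_eqI)
      fix z :: "'e \<times> 'e"
      obtain w e where z: "z = (w, e)" by (cases z)
      show "z \<in> ?P \<longleftrightarrow> z \<in> ?B' \<union> (T \<inter> snd c ` fst c \<times> (- {0}))"
      proof (cases "w \<in> snd c ` fst c \<and> e \<noteq> 0")
        case True
        then obtain x where x: "x \<in> fst c" "w = snd c x" by auto
        have inv: "chart_inv c w = x" using x chart_inv_chart[OF c] by simp
        have PPin: "covec_point c x e \<in> proj_cotangent M UNIV" using True x c by (intro covec_point_in) (auto simp: charts_at_def)
        have P: "z \<in> ?P \<longleftrightarrow> x \<notin> X \<or> 0 < u (covec_point c x e)"
          using True PPin by (simp add: z inv covec_point_def)
        have B': "z \<in> ?B' \<longleftrightarrow> x \<notin> X"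
          using True x chart_inv_chart[OF c] by (auto simp: z) (metis)
        have B: "x \<in> X \<Longrightarrow> z \<in> ?B" using True x by (auto simp: z)
        have "z \<in> snd c ` fst c \<times> (- {0})" using True by (simp add: z)
        then show ?thesis using P B' B TB[of z] by (auto simp: z inv)
      next
        case False
        then show ?thesis by (auto simp: z)
      qed
    qed
    moreover have "open (?B' \<union> (T \<inter> snd c ` fst c \<times> (- {0})))"
      using T(1) X chart_open_image[OF c, of "- X"] chart_img_open[OF c]
      by (intro open_Un open_Int open_Times) auto
    ultimately show "open ?P" by simp
  qed auto
  moreover have "{z\<in>proj_cotangent M X. 0 < u z} = ?W \<inter> proj_cotangent M X"
    using proj_cotangent_subset[of X UNIV] fst_proj_cotangent by blast
  ultimately show ?thesis
    unfolding openin_subtopology openin_proj_cotangent_topology by blast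
qed

text \<open>In a chart \<open>W\<close> becomes an open set of coordinate pairs, and
  \<open>\<rho>\<close> is positive exactly there; \<open>\<sigma>\<close> turns
  \<open>\<rho>\<close> into a function of projective classes, and the bump extends the result by 0
  beyond the chart.\<close>

lemma ex_bundle_continuous_positive_exactly_on:
  assumes W: "proj_cotangent_open M W" and t: "admissible t"
  obtains u where "u \<in> bundle_continuous X" "{z\<in>proj_cotangent M X. 0 < u z} = {z\<in>proj_cotangent M X. z \<in> W \<and> fst z \<in> chart_ball t}"
proof -
  obtain c v r where t': "t = (c, v, r)" by (cases t)
  have c: "c \<in> atlas M" and adm: "admissible (c, v, r)" using t by (auto simp: admissible_def t')
  let ?P = "{(w, e). w \<in> snd c ` fst c \<and> e \<noteq> 0 \<and> (chart_inv c w, proj_class (coord_covector M c (chart_inv c w) e)) \<in> W}"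
  have "open ?P" using W c unfolding proj_cotangent_open_def by blast
  then obtain \<rho> :: "'e \<times> 'e \<Rightarrow> real" where \<rho>: "continuous_on UNIV \<rho>" "\<And>w. 0 \<le> \<rho> w" "\<And>w. 0 < \<rho> w \<longleftrightarrow> w \<in> ?P"
    using ex_positive_exactly_on by blast
  \<comment> \<open>Normalizing removes positive factors of the covector, and the product over
    \<open>n e\<close> and \<open>- n e\<close> removes its sign. The set of positivity is
    unaffected because membership in \<open>W\<close> depends on the class only.\<close>
  define n where "n = (\<lambda>e :: 'e. inverse (norm e) *\<^sub>R e)"
  define \<sigma> where "\<sigma> = (\<lambda>w e. \<rho> (w, n e) * \<rho> (w, - n e))"
  have \<sigma>_scale: "\<sigma> w (a *\<^sub>R e) = \<sigma> w e" if "a \<noteq> 0" for w a e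
  proof -
    have "n (a *\<^sub>R e) = (if 0 < a then n e else - n e)" using that by (auto simp: n_def field_simps)
    then show ?thesis by (simp add: \<sigma>_def mult.commute)
  qed
  have \<sigma>_pos: "0 < \<sigma> (snd c x) e \<longleftrightarrow> covec_point c x e \<in> W" if x: "x \<in> fst c" and e: "e \<noteq> 0" for x e
  proof -
    have inv: "chart_inv c (snd c x) = x" by (rule chart_inv_chart[OF c x])
    have P: "(snd c x, a *\<^sub>R e) \<in> ?P \<longleftrightarrow> covec_point c x e \<in> W" if "a \<noteq> 0" for a
      using covec_point_scale[OF that, of c x e] x e that by (auto simp: inv covec_point_def)
    have "0 < \<sigma> (snd c x) e \<longleftrightarrow> 0 < \<rho> (snd c x, n e) \<and> 0 < \<rho> (snd c x, - n e)"
      using \<rho>(2)[of "(snd c x, n e)"] \<rho>(2)[of "(snd c x, - n e)"] by (auto simp: \<sigma>_def zero_less_mult_iff)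
    also have "\<dots> \<longleftrightarrow> (snd c x, inverse (norm e) *\<^sub>R e) \<in> ?P \<and> (snd c x, (- inverse (norm e)) *\<^sub>R e) \<in> ?P"
      by (simp only: \<rho>(3) n_def scaleR_minus_left)
    also have "\<dots> \<longleftrightarrow> covec_point c x e \<in> W" using P[of "inverse (norm e)"] P[of "- inverse (norm e)"] e by simp
    finally show ?thesis .
  qed
  have \<sigma>_cont: "continuous_on (UNIV \<times> (- {0})) (\<lambda>z. \<sigma> (fst z) (snd z))"
    unfolding \<sigma>_def n_def
    by (intro continuous_on_mult continuous_on_compose2[OF \<rho>(1)] continuous_intros) auto
  \<comment> \<open>Coordinates of some representative of the class; two choices differ by a nonzero
    factor, which \<open>\<sigma>\<close> ignores.\<close>
  define E where "E = (\<lambda>z. SOME e. e \<noteq> 0 \<and> z = covec_point c (fst z) e)"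
  define u where "u = (\<lambda>z. bump (c, v, r) (fst z) * \<sigma> (snd c (fst z)) (E z))"
  have u_covec_point: "u (covec_point c x e) = bump (c, v, r) x * \<sigma> (snd c x) e" if x: "x \<in> fst c" and e: "e \<noteq> 0" for x e
  proof -
    have "E (covec_point c x e) \<noteq> 0 \<and> covec_point c x e = covec_point c (fst (covec_point c x e)) (E (covec_point c x e))"
      unfolding E_def by (rule someI[of _ e]) (simp add: e)
    then have "covec_point c x e = covec_point c x (E (covec_point c x e))" by simp
    then obtain a where "a \<noteq> 0" "E (covec_point c x e) = a *\<^sub>R e"
      using covec_point_eqD[OF charts_atI[OF c x], of e "E (covec_point c x e)"] by metis
    then show ?thesis by (simp add: u_def \<sigma>_scale)
  qed
  have u0: "u z = 0" if "bump (c, v, r) (fst z) = 0" for z using that by (simp add: u_def)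
  obtain G where G: "open G" "fst c \<union> G = UNIV" "\<And>x. x \<in> G \<Longrightarrow> bump (c, v, r) x = 0"
    using bump_zero_open[OF adm] by blast
  have bump_c: "continuous_on (fst c) (bump (c, v, r))"
    by (rule continuous_on_eq[of _ "\<lambda>x. max 0 (r - dist (snd c x) v)"])
      (auto simp: bump_def intro!: continuous_intros chart_cont[OF c])
  show ?thesis
  proof (rule that[of u])
    show "u \<in> bundle_continuous X"
    proof (rule bundle_continuous_I, rule continuous_on_local)
      fix c2 z assume c2: "c2 \<in> atlas M" and z: "z \<in> snd c2 ` (fst c2 \<inter> X) \<times> (- {0 :: 'e})"
      let ?B = "snd c2 ` (fst c2 \<inter> X) \<times> (- {0 :: 'e})" and ?u = "\<lambda>z. u (covec_point c2 (chart_inv c2 (fst z)) (snd z))"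
      obtain x0 e0 where x0: "z = (snd c2 x0, e0)" "x0 \<in> fst c2" "x0 \<in> X" using z by auto
      show "\<exists>U. open U \<and> z \<in> U \<and> continuous_on (U \<inter> ?B) ?u"
      proof (cases "x0 \<in> fst c")
        case True
        let ?U = "transition_dom c2 c id \<times> (UNIV :: 'e set)"
        let ?C = "\<lambda>z. (\<lambda>(w, e). covec_push c2 c id (chart_inv c2 w) e) z" and ?F = "\<lambda>z. snd c (chart_inv c2 (fst z))"
        have r: "c2 \<in> charts_at M (chart_inv c2 (fst y))" "c \<in> charts_at M (chart_inv c2 (fst y))" "snd y \<noteq> 0"
          if "y \<in> ?U \<inter> ?B" for y :: "'e \<times> 'e"
          using that regD[OF c2 c, of "fst y" id] by auto
        have F: "continuous_on (?U \<inter> ?B) ?F"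
        proof -
          have "continuous_on (?U \<inter> ?B) (\<lambda>y. snd c (id (chart_inv c2 (fst y))))"
            by (rule continuous_on_compose2[OF loc_cont[OF C1_id c2 c]]) (auto intro!: continuous_intros)
          then show ?thesis by simp
        qed
        have ci: "continuous_on (?U \<inter> ?B) (\<lambda>y. chart_inv c2 (fst y))"
          by (rule continuous_on_compose2[OF chart_inv_cont[OF c2]]) (auto intro!: continuous_intros)
        have C: "continuous_on (?U \<inter> ?B) ?C"
          by (rule continuous_on_subset[OF covec_push_continuous[OF immersion_id c2 c]]) auto
        have sub: "(\<lambda>y. chart_inv c2 (fst y)) ` (?U \<inter> ?B) \<subseteq> fst c"
          using r charts_atD by blast
        have "continuous_on (?U \<inter> ?B) (\<lambda>y. bump (c, v, r) (chart_inv c2 (fst y)) * \<sigma> (fst (?F y, ?C y)) (snd (?F y, ?C y)))"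
        proof (intro continuous_on_mult continuous_on_compose2[OF bump_c ci sub] continuous_on_compose2[OF \<sigma>_cont] continuous_on_Pair F C)
          show "(\<lambda>y. (?F y, ?C y)) ` (?U \<inter> ?B) \<subseteq> UNIV \<times> (- {0})"
          proof (rule image_subsetI)
            fix y assume y: "y \<in> ?U \<inter> ?B"
            have "?C y \<noteq> 0" using covec_push_nonzero[OF immersion_id r(1)[OF y] _ r(3)[OF y], of c] r(2)[OF y] by (simp add: case_prod_beta)
            then show "(?F y, ?C y) \<in> UNIV \<times> (- {0})" by simp
          qed
        qed
        then have "continuous_on (?U \<inter> ?B) ?u"
        proof (rule continuous_on_eq)
          fix y assume y: "y \<in> ?U \<inter> ?B"
          have "?C y \<noteq> 0" using covec_push_nonzero[OF immersion_id r(1)[OF y] _ r(3)[OF y], of c] r(2)[OF y] by (simp add: case_prod_beta)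
          then show "bump (c, v, r) (chart_inv c2 (fst y)) * \<sigma> (fst (?F y, ?C y)) (snd (?F y, ?C y)) = ?u y"
            using u_covec_point[of "chart_inv c2 (fst y)" "?C y"] charts_atD[OF r(2)[OF y]] covec_point_change[OF r(1)[OF y] r(2)[OF y], of "snd y"]
            by (simp add: case_prod_beta)
        qed
        moreover have "open ?U" using transition_dom_open[OF C1_id c2 c] by (intro open_Times) auto
        moreover have "z \<in> ?U" using x0 True by (auto simp: transition_dom_def)
        ultimately show ?thesis by blast
      next
        case False
        then have xG: "x0 \<in> G" using G(2) by blast
        let ?U = "snd c2 ` (fst c2 \<inter> G) \<times> (UNIV :: 'e set)"
        have "continuous_on (?U \<inter> ?B) ?u"
        proof (rule continuous_on_eq[OF continuous_on_const[of _ 0]])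
          fix y assume "y \<in> ?U \<inter> ?B"
          then have "fst y \<in> snd c2 ` (fst c2 \<inter> G)" by (simp add: mem_Times_iff)
          then obtain x where "fst y = snd c2 x" "x \<in> fst c2" "x \<in> G" by blast
          then have "chart_inv c2 (fst y) \<in> G" using chart_inv_chart[OF c2] by simp
          then show "0 = ?u y" by (simp add: u0 G(3))
        qed
        moreover have "open ?U" using chart_open_image[OF c2 G(1)] by (intro open_Times) auto
        moreover have "z \<in> ?U" using x0 xG by auto
        ultimately show ?thesis by blast
      qed
    qed
    have "0 < u z \<longleftrightarrow> z \<in> W \<and> fst z \<in> chart_ball t" if z: "z \<in> proj_cotangent M X" for z
    proof (cases "fst z \<in> fst c")
      case True
      then obtain e where e: "e \<noteq> 0" "z = covec_point c (fst z) e"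
        using proj_cotangentE[OF z] charts_atI[OF c True] by metis
      define x where "x = fst z"
      have zx: "z = covec_point c x e" "x \<in> fst c" using e True by (simp_all add: x_def)
      have "0 < u z \<longleftrightarrow> 0 < bump (c, v, r) x \<and> 0 < \<sigma> (snd c x) e"
      proof -
        have "0 \<le> \<sigma> (snd c x) e" unfolding \<sigma>_def by (intro mult_nonneg_nonneg \<rho>(2))
        then show ?thesis
          using bump_nonneg[of "(c, v, r)" x] unfolding zx(1) u_covec_point[OF zx(2) e(1)] by (auto simp: zero_less_mult_iff)
      qed
      then show ?thesis using \<sigma>_pos[OF zx(2) e(1)] by (auto simp: bump_pos_iff t' zx(1))
    next
      case False
      then have "bump (c, v, r) (fst z) = 0" "fst z \<notin> chart_ball t" by (auto simp: bump_def chart_ball_def t')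
      then show ?thesis using u0[of z] by simp
    qed
    then show "{z\<in>proj_cotangent M X. 0 < u z} = {z\<in>proj_cotangent M X. z \<in> W \<and> fst z \<in> chart_ball t}" by blast
  qed
qed

lemma space_proj_cotangent_borel: "space (proj_cotangent_borel M X) = proj_cotangent M X"
  unfolding proj_cotangent_borel_def
  by (rule space_measure_of) (blast dest: openin_imp_subset)

lemma sets_proj_cotangent_borel:
  assumes X: "compact X"
  shows "sets (proj_cotangent_borel M X) = sigma_sets (proj_cotangent M X) (positivity_sets (proj_cotangent M X) (bundle_continuous X))"
proof -
  let ?Z = "proj_cotangent M X" and ?T = "subtopology (proj_cotangent_topology M) (proj_cotangent M X)"
  have "sets (proj_cotangent_borel M X) = sigma_sets ?Z {W. openin ?T W}"
    unfolding proj_cotangent_borel_def by (rule sets_measure_of) (blast dest: openin_imp_subset)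
  also have "\<dots> = sigma_sets ?Z (positivity_sets ?Z (bundle_continuous X))"
  proof (rule sigma_sets_eqI)
    fix A assume "A \<in> {W. openin ?T W}"
    then obtain W where W: "proj_cotangent_open M W" "A = W \<inter> ?Z"
      unfolding openin_subtopology openin_proj_cotangent_topology by auto
    obtain T where T: "finite T" "\<And>t. t \<in> T \<Longrightarrow> admissible t" "X \<subseteq> \<Union>(chart_ball ` T)"
      using ex_finite_chart_balls[OF X] by blast
    have "A = (\<Union>t\<in>T. {z\<in>?Z. z \<in> W \<and> fst z \<in> chart_ball t})"
      using T(3) fst_proj_cotangent unfolding W(2) by blast
    also have "\<dots> \<in> sigma_sets ?Z (positivity_sets ?Z (bundle_continuous X))"
    proof (rule sigma_sets_UNION[OF countable_finite, OF finite_imageI[OF T(1)]])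
      fix B assume "B \<in> (\<lambda>t. {z\<in>?Z. z \<in> W \<and> fst z \<in> chart_ball t}) ` T"
      then obtain t where t: "t \<in> T" "B = {z\<in>?Z. z \<in> W \<and> fst z \<in> chart_ball t}" by blast
      obtain u where u: "u \<in> bundle_continuous X" "{z\<in>?Z. 0 < u z} = {z\<in>?Z. z \<in> W \<and> fst z \<in> chart_ball t}"
        using ex_bundle_continuous_positive_exactly_on[OF W(1) T(2)[OF t(1)]] by blast
      have "B \<in> positivity_sets ?Z (bundle_continuous X)" unfolding t(2) u(2)[symmetric] by (rule positivity_setsI[OF u(1)])
      then show "B \<in> sigma_sets ?Z (positivity_sets ?Z (bundle_continuous X))" by (rule sigma_sets.Basic)
    qed
    finally show "A \<in> sigma_sets ?Z (positivity_sets ?Z (bundle_continuous X))" .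
  next
    fix A assume "A \<in> positivity_sets ?Z (bundle_continuous X)"
    then obtain u where "u \<in> bundle_continuous X" "A = {z\<in>?Z. 0 < u z}" by (auto simp: positivity_sets_def)
    then have "openin ?T A" using openin_positivity[OF _ compact_imp_closed[OF X]] by blast
    then show "A \<in> sigma_sets ?Z {W. openin ?T W}" by blast
  qed
  finally show ?thesis .
qed

end

section \<open>A compact metric parametrization of the projectivized bundle\<close>

context riem
begin

text \<open>The representation theorem asks for a compact subset of a metric type, while points of
  the bundle are pairs with sets of functionals. \<open>Y\<close> is a finite disjoint union of
  compact sets of coordinates: points of \<open>X\<close> in closed chart balls, times unit
  covectors. Several triples may name the same point of the bundle, which is harmless since measures
  are only pushed forward.\<close>

lemma ex_parametrization:
  fixes X :: "'a set"
  assumes X: "compact X"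
  obtains ch :: "real \<Rightarrow> ('a, 'e) chart" and I :: "real set" and Y :: "(real \<times> 'e \<times> 'e) set"
  where "finite I" "\<And>i. i \<in> I \<Longrightarrow> ch i \<in> atlas M" "compact Y"
    "\<And>i w e. (i, w, e) \<in> Y \<Longrightarrow> i \<in> I \<and> w \<in> snd (ch i) ` (fst (ch i) \<inter> X) \<and> e \<noteq> 0"
    "(\<lambda>(i, w, e). covec_point (ch i) (chart_inv (ch i) w) e) ` Y = proj_cotangent M X"
proof -
  obtain T where T: "finite T" "\<And>t. t \<in> T \<Longrightarrow> admissible t" "X \<subseteq> \<Union>(chart_ball ` T)"
    using ex_finite_chart_balls[OF X] by blast
  obtain m and tt :: "nat \<Rightarrow> ('a, 'e) chart \<times> 'e \<times> real" where tt: "T = tt ` {i. i < m}"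
    using T(1) finite_imp_nat_seg_image_inj_on by metis
  \<comment> \<open>The index of a chart is a real number, so that the triples live in a Euclidean
    product and pieces with different indices are apart.\<close>
  define I where "I = real ` {..<m}"
  define tr where "tr = (\<lambda>t::real. tt (nat \<lfloor>t\<rfloor>))"
  have TI: "T = tr ` I" unfolding tt I_def tr_def by (auto simp: image_iff)
  have I: "finite I" by (simp add: I_def)
  have adm: "admissible (tr i)" if "i \<in> I" for i using T(2) TI that by blast
  define ch where "ch = (\<lambda>i. fst (tr i))"
  define K where "K = (\<lambda>i. cball (fst (snd (tr i))) (snd (snd (tr i))))"
  define B where "B = (\<lambda>i. snd (ch i) ` (chart_inv (ch i) ` K i \<inter> X))"
  define Y where "Y = (\<Union>i\<in>I. {i} \<times> (B i \<times> sphere (0 :: 'e) 1))"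
  have ch: "ch i \<in> atlas M" and KV: "K i \<subseteq> snd (ch i) ` fst (ch i)" if "i \<in> I" for i
    using adm[OF that] by (auto simp: admissible_def ch_def K_def case_prod_beta)
  have Kc: "chart_inv (ch i) ` K i \<subseteq> fst (ch i)" if "i \<in> I" for i
    using KV[OF that] chart_inv_in[OF ch[OF that]] by blast
  have B: "compact (B i)" if i: "i \<in> I" for i
  proof -
    have "compact (chart_inv (ch i) ` K i)"
      unfolding K_def
      by (intro compact_continuous_image continuous_on_subset[OF chart_inv_cont[OF ch[OF i]]] compact_cball)
        (use KV[OF i] in \<open>simp add: K_def\<close>)
    then have "compact (chart_inv (ch i) ` K i \<inter> X)"
      using compact_imp_closed[OF X] by (rule compact_Int_closed)
    then show ?thesis
      unfolding B_def
      using Kc[OF i] by (intro compact_continuous_image continuous_on_subset[OF chart_cont[OF ch[OF i]]]) auto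
  qed
  have Yin: "i \<in> I \<and> w \<in> snd (ch i) ` (fst (ch i) \<inter> X) \<and> e \<noteq> 0" if "(i, w, e) \<in> Y" for i w e
  proof -
    have i: "i \<in> I" "w \<in> B i" "norm e = 1" using that by (auto simp: Y_def)
    then have "w \<in> snd (ch i) ` (fst (ch i) \<inter> X)" using Kc[OF i(1)] unfolding B_def by blast
    then show ?thesis using i by auto
  qed
  show ?thesis
  proof (rule that[of I ch Y])
    show "compact Y" unfolding Y_def using B I by (intro compact_UN compact_Times compact_sphere) auto
    show "(\<lambda>(i, w, e). covec_point (ch i) (chart_inv (ch i) w) e) ` Y = proj_cotangent M X"
    proof (intro equalityI subsetI)
      fix z assume "z \<in> (\<lambda>(i, w, e). covec_point (ch i) (chart_inv (ch i) w) e) ` Y"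
      then obtain i w e where z: "(i, w, e) \<in> Y" "z = covec_point (ch i) (chart_inv (ch i) w) e" by auto
      note y = Yin[OF z(1)]
      have i: "i \<in> I" and w: "w \<in> snd (ch i) ` (fst (ch i) \<inter> X)" and e: "e \<noteq> 0" using y by auto
      show "z \<in> proj_cotangent M X"
        unfolding z(2) by (rule covec_point_in[OF chart_point[OF ch[OF i] w] e])
    next
      fix z assume z: "z \<in> proj_cotangent M X"
      then have x: "fst z \<in> X" by (rule fst_proj_cotangent)
      then obtain i where i: "i \<in> I" "fst z \<in> chart_ball (tr i)" using T(3) TI by auto
      have xi: "fst z \<in> fst (ch i)" "snd (ch i) (fst z) \<in> K i"
        using i(2) by (auto simp: chart_ball_def ch_def K_def case_prod_beta dist_commute)
      have inv: "chart_inv (ch i) (snd (ch i) (fst z)) = fst z" by (rule chart_inv_chart[OF ch[OF i(1)] xi(1)])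
      obtain e where e: "e \<noteq> 0" "z = covec_point (ch i) (fst z) e"
        using proj_cotangentE[OF z charts_atI[OF ch[OF i(1)] xi(1)]] by metis
      let ?e = "inverse (norm e) *\<^sub>R e"
      have "fst z \<in> chart_inv (ch i) ` K i \<inter> X" using xi(2) inv x by (metis IntI imageI)
      then have "snd (ch i) (fst z) \<in> B i" unfolding B_def by (rule imageI)
      then have "(i, snd (ch i) (fst z), ?e) \<in> Y" using i(1) e(1) by (auto simp: Y_def)
      moreover have "z = covec_point (ch i) (chart_inv (ch i) (snd (ch i) (fst z))) ?e"
        using e covec_point_scale[of "inverse (norm e)" "ch i" "fst z" e] by (simp add: inv)
      ultimately show "z \<in> (\<lambda>(i, w, e). covec_point (ch i) (chart_inv (ch i) w) e) ` Y"
        by (intro image_eqI[of _ _ "(i, snd (ch i) (fst z), ?e)"]) auto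
    qed
  qed (use I ch Yin in auto)
qed

end

lemma random_iterate_add:
  "random_iterate f (m + n) \<omega> = random_iterate f n (shifted m \<omega>) \<circ> random_iterate f m \<omega>"
  proof (induction n)
  case (Suc n)
  have "shifted (m + n) \<omega> = shifted n (shifted m \<omega>)" by (simp add: add.assoc add.commute[of n m])
  then show ?case using Suc.IH by (simp only: add_Suc_right random_iterate.simps o_assoc)
qed simp

subsection \<open>The cotangent cocycle of a random map\<close>

text \<open>Differentiability and invariance of \<open>X\<close> are assumed for every noise
  sequence here; a general random map is brought to this form at the end by a change on a null
  set.\<close>

locale random_immersion = riem M + iid_noise p
  for M :: "('a::{t2_space, second_countable_topology}, 'e::euclidean_space) riemannian" and p :: "'t measure" +
  fixes f :: "(nat \<Rightarrow> 't) \<Rightarrow> 'a \<Rightarrow> 'a" and X :: "'a set"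
  assumes f_meas: "(\<lambda>(\<omega>, x). f \<omega> x) \<in> measurable (S \<Otimes>\<^sub>M borel) borel"
    and f_dep0: "\<And>\<omega> \<omega>'. \<omega> \<in> space S \<Longrightarrow> \<omega>' \<in> space S \<Longrightarrow> \<omega> 0 = \<omega>' 0 \<Longrightarrow> f \<omega> = f \<omega>'"
    and f_immersion: "\<And>\<omega>. \<omega> \<in> space S \<Longrightarrow> immersion (f \<omega>)"
    and f_X: "\<And>\<omega>. \<omega> \<in> space S \<Longrightarrow> f \<omega> ` X \<subseteq> X"
    and X_compact: "compact X" and X_nonempty: "X \<noteq> {}"
    and log_bound: "(\<integral>\<^sup>+ \<omega>. ennreal (log_plus (D_sup M X (f \<omega>)) + log_plus (D_inv_sup M X (f \<omega>))) \<partial>S) < \<infinity>"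
begin

abbreviation "F \<equiv> random_iterate f"
abbreviation "Z \<equiv> proj_cotangent M X"
abbreviation "MZ \<equiv> proj_cotangent_borel M X"

definition H :: "(nat \<Rightarrow> 't) \<Rightarrow> real" where
  "H \<omega> = log_plus (D_sup M X (f \<omega>)) + log_plus (D_inv_sup M X (f \<omega>))"

lemma log_plus_nonneg: "0 \<le> log_plus t"
  by (simp add: log_plus_def)

lemma F_immersion: "\<omega> \<in> space S \<Longrightarrow> immersion (F n \<omega>)"
  by (induction n) (auto intro: immersion_id immersion_comp f_immersion shift_in_space)

lemma F_X: "\<omega> \<in> space S \<Longrightarrow> x \<in> X \<Longrightarrow> F n \<omega> x \<in> X"
proof (induction n)
  case (Suc n)
  then show ?case using f_X[OF shift_in_space[OF Suc.prems(1)], of n] by auto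
qed simp

lemma F_measurable: "(\<lambda>(\<omega>, x). F n \<omega> x) \<in> measurable (S \<Otimes>\<^sub>M borel) borel"
proof (induction n)
  case 0
  then show ?case by (simp add: case_prod_beta')
next
  case (Suc n)
  have "(\<lambda>y. (shifted n (fst y), (\<lambda>(\<omega>, x). F n \<omega> x) y)) \<in> measurable (S \<Otimes>\<^sub>M borel) (S \<Otimes>\<^sub>M borel)"
    using Suc by (intro measurable_Pair measurable_compose[OF measurable_fst shift_measurable])
  from measurable_compose[OF this f_meas] show ?case by (simp add: case_prod_beta')
qed

lemma op_norm_le_sup:
  assumes \<omega>: "\<omega> \<in> space S" and x: "x \<in> X"
  shows "ln (D_inv_norm (f \<omega>) x) \<le> H \<omega>" "ln (D_norm (f \<omega>) x) \<le> H \<omega>"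
proof -
  note g = f_immersion[OF \<omega>]
  have bdd: "bdd_above (D_inv_norm (f \<omega>) ` X)" "bdd_above (D_norm (f \<omega>) ` X)"
    by (intro bounded_imp_bdd_above compact_imp_bounded compact_continuous_image X_compact
        continuous_on_subset[OF op_norms_continuous(2)[OF g]] continuous_on_subset[OF op_norms_continuous(1)[OF g]]; simp)+
  have "D_inv_norm (f \<omega>) x \<le> D_inv_sup M X (f \<omega>)" unfolding D_inv_sup_def by (rule cSUP_upper[OF x bdd(1)])
  then have "ln (D_inv_norm (f \<omega>) x) \<le> ln (D_inv_sup M X (f \<omega>))"
    using op_norms_pos(2)[OF g, of x] by (intro ln_mono) auto
  then show "ln (D_inv_norm (f \<omega>) x) \<le> H \<omega>"
    using log_plus_nonneg[of "D_sup M X (f \<omega>)"] by (simp add: H_def log_plus_def max_def split: if_splits)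
  have "D_norm (f \<omega>) x \<le> D_sup M X (f \<omega>)" unfolding D_sup_def by (rule cSUP_upper[OF x bdd(2)])
  then have "ln (D_norm (f \<omega>) x) \<le> ln (D_sup M X (f \<omega>))"
    using op_norms_pos(1)[OF g, of x] by (intro ln_mono) auto
  then show "ln (D_norm (f \<omega>) x) \<le> H \<omega>"
    using log_plus_nonneg[of "D_inv_sup M X (f \<omega>)"] by (simp add: H_def log_plus_def max_def split: if_splits)
qed

lemma H_measurable: "H \<in> borel_measurable S"
proof -
  have cont: "continuous_on X (D_norm (f \<omega>))" "continuous_on X (D_inv_norm (f \<omega>))" if "\<omega> \<in> space S" for \<omega>
    using op_norms_continuous[OF f_immersion[OF that]] continuous_on_subset by blast+
  have bdd: "bdd_above (D_norm (f \<omega>) ` X)" "bdd_above (D_inv_norm (f \<omega>) ` X)" if "\<omega> \<in> space S" for \<omega>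
    using cont[OF that] by (intro bounded_imp_bdd_above compact_imp_bounded compact_continuous_image X_compact; simp)+
  have "(\<lambda>\<omega>. D_sup M X (f \<omega>)) \<in> borel_measurable S"
    unfolding D_sup_def
    by (rule measurable_SUP_continuous[OF X_nonempty op_norms_measurable(1)[OF f_meas _ f_immersion]]) (auto intro: cont bdd)
  moreover have "(\<lambda>\<omega>. D_inv_sup M X (f \<omega>)) \<in> borel_measurable S"
    unfolding D_inv_sup_def
    by (rule measurable_SUP_continuous[OF X_nonempty op_norms_measurable(2)[OF f_meas _ f_immersion]]) (auto intro: cont bdd)
  ultimately show ?thesis unfolding H_def[abs_def] log_plus_def by measurable
qed

lemma H_integrable: "integrable S H"
  by (rule integrableI_nonneg[OF H_measurable])
    (use log_bound in \<open>simp_all add: H_def log_plus_nonneg\<close>)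

lemma covec_growth_bound:
  assumes \<omega>: "\<omega> \<in> space S" and z: "z \<in> Z"
  shows "\<bar>covec_growth (f \<omega>) z\<bar> \<le> H \<omega>"
proof -
  obtain c where c: "c \<in> charts_at M (fst z)" using ex_chart by blast
  obtain e where e: "e \<noteq> 0" "z = covec_point c (fst z) e" using proj_cotangentE[OF z c] by metis
  have x: "fst z \<in> X" by (rule fst_proj_cotangent[OF z])
  show ?thesis
    using covec_growth_bounds[OF f_immersion[OF \<omega>] c e(1)] op_norm_le_sup[OF \<omega> x] e(2) by simp
qed

lemma lift_in: "immersion h \<Longrightarrow> h ` X \<subseteq> X \<Longrightarrow> z \<in> Z \<Longrightarrow> lift h z \<in> Z"
proof -
  assume h: "immersion h" "h ` X \<subseteq> X" and z: "z \<in> Z"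
  obtain c where c: "c \<in> charts_at M (fst z)" using ex_chart by blast
  obtain c' where c': "c' \<in> charts_at M (h (fst z))" using ex_chart by blast
  obtain e where e: "e \<noteq> 0" "z = covec_point c (fst z) e" using proj_cotangentE[OF z c] by metis
  have x: "h (fst z) \<in> X" using fst_proj_cotangent[OF z] h(2) by blast
  have "lift h z = covec_point c' (h (fst z)) (covec_push c c' h (fst z) e)" by (subst e(2)) (rule lift_covec_point[OF h(1) c c'])
  then show "lift h z \<in> Z" using covec_point_in[OF c' x covec_push_nonzero[OF h(1) c c' e(1)]] by simp
qed

lemma covec_growth_Suc:
  assumes "\<omega> \<in> space S" "z \<in> Z"
  shows "covec_growth (F (Suc n) \<omega>) z = covec_growth (f \<omega>) z + covec_growth (F n (shifted 1 \<omega>)) (lift (f \<omega>) z)"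
  using covec_growth_cocycle[OF f_immersion[OF assms(1)] F_immersion[OF shift_in_space[OF assms(1), of 1]] assms(2), of n]
    random_iterate_add[of f 1 n \<omega>] by simp

lemma covec_growth_id: "z \<in> Z \<Longrightarrow> covec_growth id z = 0"
proof -
  assume z: "z \<in> Z"
  obtain c where c: "c \<in> charts_at M (fst z)" using ex_chart by blast
  obtain e where e: "e \<noteq> 0" "z = covec_point c (fst z) e" using proj_cotangentE[OF z c] by metis
  show "covec_growth id z = 0" using covec_growth_covec_point[OF immersion_id c e(1)] e(2) by simp
qed

lemma covec_growth_le_D_inv_norm: "immersion h \<Longrightarrow> z \<in> Z \<Longrightarrow> covec_growth h z \<le> ln (D_inv_norm h (fst z))"
proof -
  assume h: "immersion h" and z: "z \<in> Z"
  obtain c where c: "c \<in> charts_at M (fst z)" using ex_chart by blast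
  obtain e where e: "e \<noteq> 0" "z = covec_point c (fst z) e" using proj_cotangentE[OF z c] by metis
  show "covec_growth h z \<le> ln (D_inv_norm h (fst z))" using covec_growth_bounds(1)[OF h c e(1)] e(2) by simp
qed

lemma covec_growth_lower: "\<omega> \<in> space S \<Longrightarrow> z \<in> Z \<Longrightarrow> - (\<Sum>j<n. H (shifted j \<omega>)) \<le> covec_growth (F n \<omega>) z"
proof (induction n arbitrary: \<omega> z)
  case 0
  then show ?case by (simp only: random_iterate.simps covec_growth_id) simp
next
  case (Suc n)
  have "- (\<Sum>j<n. H (shifted j (shifted 1 \<omega>))) \<le> covec_growth (F n (shifted 1 \<omega>)) (lift (f \<omega>) z)"
    using Suc.prems f_immersion f_X by (intro Suc.IH shift_in_space lift_in) auto
  moreover have "- H \<omega> \<le> covec_growth (f \<omega>) z" using covec_growth_bound[OF Suc.prems] by (simp add: abs_le_iff)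
  moreover have "(\<Sum>j<Suc n. H (shifted j \<omega>)) = H \<omega> + (\<Sum>j<n. H (shifted j (shifted 1 \<omega>)))"
    unfolding sum.lessThan_Suc_shift by simp
  ultimately show ?case unfolding covec_growth_Suc[OF Suc.prems] by linarith
qed

lemma D_inv_norm_add:
  assumes \<omega>: "\<omega> \<in> space S"
  shows "ln (D_inv_norm (F (m + n) \<omega>) x) \<le> ln (D_inv_norm (F m \<omega>) x) + ln (D_inv_norm (F n (shifted m \<omega>)) (F m \<omega> x))"
proof -
  note g = F_immersion[OF \<omega>, of m] F_immersion[OF shift_in_space[OF \<omega>], of n m]
  note pos = op_norms_pos(2)[OF g(1), of x] op_norms_pos(2)[OF g(2), of "F m \<omega> x"]
  have "D_inv_norm (F (m + n) \<omega>) x \<le> D_inv_norm (F m \<omega>) x * D_inv_norm (F n (shifted m \<omega>)) (F m \<omega> x)"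
    unfolding random_iterate_add using D_inv_norm_comp[OF g, of x] by simp
  then have "ln (D_inv_norm (F (m + n) \<omega>) x) \<le> ln (D_inv_norm (F m \<omega>) x * D_inv_norm (F n (shifted m \<omega>)) (F m \<omega> x))"
    using op_norms_pos(2)[OF F_immersion[OF \<omega>, of "m + n"], of x] by (intro ln_mono) auto
  also have "\<dots> = ln (D_inv_norm (F m \<omega>) x) + ln (D_inv_norm (F n (shifted m \<omega>)) (F m \<omega> x))" by (rule ln_mult_pos[OF pos])
  finally show ?thesis .
qed

lemma D_inv_norm_upper:
  assumes \<omega>: "\<omega> \<in> space S" and x: "x \<in> X"
  shows "ln (D_inv_norm (F n \<omega>) x) \<le> (\<Sum>j<n. H (shifted j \<omega>))"
proof (induction n)
  case 0
  obtain c where c: "c \<in> charts_at M x" using ex_chart by blast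
  have "D_inv_norm id x \<le> 1"
    unfolding op_norm_D_inv[OF immersion_id c]
    by (rule ratio_sup_le[OF push_norm_homogeneous[OF C1_id c] push_norm_homogeneous[OF C1_id c] push_norm_pos[OF immersion_id c]]) simp_all
  then have "ln (D_inv_norm id x) \<le> ln 1" using op_norms_pos(2)[OF immersion_id, of x] by (intro ln_mono) auto
  then show ?case by (simp only: random_iterate.simps ln_one lessThan_0 sum.empty)
next
  case (Suc n)
  have "ln (D_inv_norm (F (n + 1) \<omega>) x) \<le> ln (D_inv_norm (F n \<omega>) x) + ln (D_inv_norm (F 1 (shifted n \<omega>)) (F n \<omega> x))"
    by (rule D_inv_norm_add[OF \<omega>])
  also have "ln (D_inv_norm (F 1 (shifted n \<omega>)) (F n \<omega> x)) \<le> H (shifted n \<omega>)"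
    using op_norm_le_sup(1)[OF shift_in_space[OF \<omega>] F_X[OF \<omega> x], of n n] by simp
  finally show ?case using Suc by (simp only: sum.lessThan_Suc Suc_eq_plus1[symmetric]) linarith
qed

lemma sum_H_integrable: "integrable S (\<lambda>\<omega>. \<Sum>j<n. H (shifted j \<omega>))"
proof -
  have "integrable S (\<lambda>\<omega>. H (shifted j \<omega>))" for j
    using integrable_distr[OF shift_measurable, of j H] H_integrable by (simp add: distr_shift)
  then show ?thesis by (intro Bochner_Integration.integrable_sum)
qed

text \<open>The growth is set to 0 outside the bundle because \<open>s_0\<close> asks for the value
  0 at every \<open>z\<close>, whereas \<open>covec_growth\<close> is arbitrary off the bundle. With
  \<open>b\<close> the logarithm of the norm of the inverse derivative, the abstract exponent
  becomes the smallest Lyapunov exponent.\<close>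

lemma ex_random_cocycle:
  obtains Y :: "(real \<times> 'e \<times> 'e) set" and q where
    "random_cocycle p f X MZ (bundle_continuous X) fst (\<lambda>\<omega>. lift (f \<omega>)) Y q
      (\<lambda>n \<omega> z. if z \<in> Z then covec_growth (F n \<omega>) z else 0) (\<lambda>n \<omega> x. ln (D_inv_norm (F n \<omega>) x)) H"
proof -
  obtain ch :: "real \<Rightarrow> ('a, 'e) chart" and I :: "real set" and Y :: "(real \<times> 'e \<times> 'e) set"
    where I: "finite I" and ch: "\<And>i. i \<in> I \<Longrightarrow> ch i \<in> atlas M" and Y: "compact Y"
    and Yin: "\<And>i w e. (i, w, e) \<in> Y \<Longrightarrow> i \<in> I \<and> w \<in> snd (ch i) ` (fst (ch i) \<inter> X) \<and> e \<noteq> 0"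
    and Yq: "(\<lambda>(i, w, e). covec_point (ch i) (chart_inv (ch i) w) e) ` Y = Z"
    by (rule ex_parametrization[OF X_compact]) (rule that)
  define q where "q = (\<lambda>(i, w, e). covec_point (ch i) (chart_inv (ch i) w) e)"
  have cl: "closed X" by (rule compact_imp_closed[OF X_compact])
  have fRX: "(\<lambda>(\<omega>, x). f \<omega> x) \<in> measurable (S \<Otimes>\<^sub>M restrict_space borel X) (restrict_space borel X)"
  proof (rule measurable_restrict_space2)
    show "(\<lambda>(\<omega>, x). f \<omega> x) \<in> space (S \<Otimes>\<^sub>M restrict_space borel X) \<rightarrow> X"
      using f_X by (auto simp: space_pair_measure space_restrict_space)
    have "(\<lambda>z. (fst z, id (snd z))) \<in> measurable (S \<Otimes>\<^sub>M restrict_space borel X) (S \<Otimes>\<^sub>M borel)"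
      by (intro measurable_Pair measurable_fst
          measurable_compose[OF measurable_snd measurable_restrict_space1[OF measurable_ident]])
    from measurable_compose[OF this f_meas]
    show "(\<lambda>(\<omega>, x). f \<omega> x) \<in> measurable (S \<Otimes>\<^sub>M restrict_space borel X) borel" by (simp add: case_prod_beta')
  qed
  have C_q: "continuous_on Y (\<lambda>y. u (q y))" if u: "u \<in> bundle_continuous X" for u
  proof (rule continuous_on_local)
    fix y assume y: "y \<in> Y"
    obtain i w e where iwe: "y = (i, w, e)" by (cases y)
    have i: "i \<in> I" using Yin y iwe by blast
    \<comment> \<open>Removing the finitely many other indices leaves an open set on which the chart
      is the fixed \<open>ch i\<close>.\<close>
    let ?U = "(- (I - {i})) \<times> (UNIV :: ('e \<times> 'e) set)"
    have Ui: "fst z = i" if "z \<in> ?U \<inter> Y" for z using that Yin by (cases z) auto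
    have "continuous_on (?U \<inter> Y) (\<lambda>y. u (covec_point (ch i) (chart_inv (ch i) (fst (snd y))) (snd (snd y))))"
      by (rule continuous_on_compose2[OF bundle_continuous_D[OF u ch[OF i]]])
        (use Yin Ui in \<open>auto intro!: continuous_intros\<close>)
    then have "continuous_on (?U \<inter> Y) (\<lambda>y. u (q y))"
    proof (rule continuous_on_eq)
      fix z assume "z \<in> ?U \<inter> Y"
      then show "u (covec_point (ch i) (chart_inv (ch i) (fst (snd z))) (snd (snd z))) = u (q z)"
        using Ui[of z] by (simp add: q_def case_prod_beta)
    qed
    then show "\<exists>U. open U \<and> y \<in> U \<and> continuous_on (U \<inter> Y) (\<lambda>y. u (q y))"
      using iwe by (intro exI[of _ ?U] conjI open_Times open_Compl finite_imp_closed finite_Diff I open_UNIV) simp_all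
  qed
  \<comment> \<open>Joint measurability in the noise and the parameter is checked on each of the
    finitely many index pieces, where the coordinates of the covector are measurable functions in
    one fixed chart.\<close>
  have C_joint: "(\<lambda>(\<omega>, y). u (lift (f \<omega>) (q y))) \<in> borel_measurable (S \<Otimes>\<^sub>M restrict_space borel Y)" if u: "u \<in> bundle_continuous X" for u
  proof (rule measurable_piecewise_restrict[where C="(\<lambda>i. {l. fst (snd l) = i}) ` I"])
    let ?R = "S \<Otimes>\<^sub>M restrict_space borel Y"
    have sndY: "(\<lambda>l. snd l) \<in> measurable ?R borel"
    proof -
      have "(\<lambda>l. id (snd l)) \<in> measurable ?R borel"
        by (rule measurable_compose[OF measurable_snd measurable_restrict_space1[OF measurable_ident]])
      then show ?thesis by simp
    qed
    have fstm: "(\<lambda>l. fst (snd l)) \<in> measurable ?R borel"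
      by (rule measurable_compose[OF sndY borel_measurable_continuous_onI[OF continuous_on_fst[OF continuous_on_id]]])
    have wm: "(\<lambda>l. fst (snd (snd l))) \<in> measurable ?R borel"
      by (rule measurable_compose[OF sndY borel_measurable_continuous_onI[OF continuous_on_fst[OF continuous_on_snd[OF continuous_on_id]]]])
    have em: "(\<lambda>l. snd (snd (snd l))) \<in> measurable ?R borel"
      by (rule measurable_compose[OF sndY borel_measurable_continuous_onI[OF continuous_on_snd[OF continuous_on_snd[OF continuous_on_id]]]])
    show "countable ((\<lambda>i. {l. fst (snd l) = i}) ` I)" using I by (intro countable_image countable_finite)
    show "space ?R \<subseteq> \<Union> ((\<lambda>i. {l. fst (snd l) = i}) ` I)"
      using Yin by (auto simp: space_pair_measure space_restrict_space)
    fix \<Omega> :: "((nat \<Rightarrow> 't) \<times> real \<times> 'e \<times> 'e) set" assume "\<Omega> \<in> (\<lambda>i. {l. fst (snd l) = i}) ` I"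
    then obtain i where i: "i \<in> I" and \<Omega>: "\<Omega> = {l. fst (snd l) = i}" by blast
    have "\<Omega> \<inter> space ?R = (\<lambda>l. fst (snd l)) -` {i} \<inter> space ?R" unfolding \<Omega> by auto
    also have "\<dots> \<in> sets ?R" by (rule measurable_sets[OF fstm]) simp
    finally show "\<Omega> \<inter> space ?R \<in> sets ?R" .
    let ?L = "restrict_space ?R \<Omega>"
    let ?ci = "\<lambda>w. if w \<in> snd (ch i) ` fst (ch i) then chart_inv (ch i) w else undefined"
    have ci: "?ci \<in> measurable borel borel"
      using chart_img_open[OF ch[OF i]] chart_inv_cont[OF ch[OF i]] by (intro measurable_If_continuous) auto
    have L: "fst l \<in> space S" "fst (snd l) = i" "fst (snd (snd l)) \<in> snd (ch i) ` (fst (ch i) \<inter> X)" "snd (snd (snd l)) \<noteq> 0"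
      if "l \<in> space ?L" for l
    proof -
      have l: "fst l \<in> space S" "fst (snd l) = i" "snd l \<in> Y"
        using that by (auto simp: space_restrict_space space_pair_measure \<Omega>)
      then show "fst l \<in> space S" "fst (snd l) = i" by simp_all
      have "(i, fst (snd (snd l)), snd (snd (snd l))) \<in> Y" using l by (metis prod.collapse)
      then show "fst (snd (snd l)) \<in> snd (ch i) ` (fst (ch i) \<inter> X)" "snd (snd (snd l)) \<noteq> 0" using Yin by blast+
    qed
    have x: "(\<lambda>l. ?ci (fst (snd (snd l)))) \<in> borel_measurable ?L"
      by (rule measurable_restrict_space1[OF measurable_compose[OF wm ci]])
    have e: "(\<lambda>l. snd (snd (snd l))) \<in> borel_measurable ?L" by (rule measurable_restrict_space1[OF em])
    have h: "(\<lambda>(l, y). f (fst l) y) \<in> measurable (?L \<Otimes>\<^sub>M borel) borel"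
    proof -
      have "(\<lambda>z. (fst (fst z), snd z)) \<in> measurable (?L \<Otimes>\<^sub>M borel) (S \<Otimes>\<^sub>M borel)"
        by (intro measurable_Pair measurable_snd
            measurable_compose[OF measurable_fst measurable_restrict_space1[OF measurable_fst]])
      from measurable_compose[OF this f_meas] show ?thesis by (simp add: case_prod_beta')
    qed
    have ci_in: "?ci (fst (snd (snd l))) = chart_inv (ch i) (fst (snd (snd l)))"
      "chart_inv (ch i) (fst (snd (snd l))) \<in> fst (ch i)" "chart_inv (ch i) (fst (snd (snd l))) \<in> X" if "l \<in> space ?L" for l
      using L(3)[OF that] chart_point[OF ch[OF i] L(3)[OF that]] charts_atD by auto
    have "(\<lambda>l. u (lift (f (fst l)) (covec_point (ch i) (?ci (fst (snd (snd l)))) (snd (snd (snd l)))))) \<in> borel_measurable ?L"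
    proof (rule bundle_continuous_lift_measurable[OF u cl h x e ch[OF i]])
      fix l assume l: "l \<in> space ?L"
      show "immersion (f (fst l))" by (rule f_immersion[OF L(1)[OF l]])
      show "?ci (fst (snd (snd l))) \<in> fst (ch i)" using ci_in[OF l] by simp
      show "f (fst l) (?ci (fst (snd (snd l)))) \<in> X" using ci_in[OF l] f_X[OF L(1)[OF l]] by auto
      show "snd (snd (snd l)) \<noteq> 0" by (rule L(4)[OF l])
    qed
    then show "(\<lambda>(\<omega>, y). u (lift (f \<omega>) (q y))) \<in> borel_measurable ?L"
    proof (rule measurable_cong[THEN iffD1, rotated])
      fix l assume l: "l \<in> space ?L"
      show "u (lift (f (fst l)) (covec_point (ch i) (?ci (fst (snd (snd l)))) (snd (snd (snd l))))) =
          (case l of (\<omega>, y) \<Rightarrow> u (lift (f \<omega>) (q y)))"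
        using L(2)[OF l] ci_in(1)[OF l] by (simp add: q_def case_prod_beta)
    qed
  qed
  have KKm: "(\<lambda>\<omega>. covec_growth (F n \<omega>) z) \<in> borel_measurable S" if "z \<in> Z" for n z
    by (rule covec_growth_measurable[OF F_measurable F_immersion that])
  have INm: "(\<lambda>(\<omega>, x). D_inv_norm (F n \<omega>) x) \<in> borel_measurable (S \<Otimes>\<^sub>M restrict_space borel X)" for n
  proof -
    have h: "(\<lambda>(l, y). F n (fst l) y) \<in> measurable ((S \<Otimes>\<^sub>M restrict_space borel X) \<Otimes>\<^sub>M borel) borel"
    proof -
      have "(\<lambda>z. (fst (fst z), snd z)) \<in> measurable ((S \<Otimes>\<^sub>M restrict_space borel X) \<Otimes>\<^sub>M borel) (S \<Otimes>\<^sub>M borel)"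
        by (intro measurable_Pair measurable_snd measurable_compose[OF measurable_fst measurable_fst])
      from measurable_compose[OF this F_measurable[of n]] show ?thesis by (simp add: case_prod_beta')
    qed
    have x: "(\<lambda>l. id (snd l)) \<in> borel_measurable (S \<Otimes>\<^sub>M restrict_space borel X)"
      by (rule measurable_compose[OF measurable_snd measurable_restrict_space1[OF measurable_ident]])
    have "(\<lambda>l. D_inv_norm (F n (fst l)) (id (snd l))) \<in> borel_measurable (S \<Otimes>\<^sub>M restrict_space borel X)"
      by (rule op_norms_measurable(2)[OF h x]) (auto simp: space_pair_measure intro: F_immersion)
    then show ?thesis by (simp add: case_prod_beta')
  qed
  have bm: "(\<lambda>(\<omega>, x). ln (D_inv_norm (F n \<omega>) x)) \<in> borel_measurable (S \<Otimes>\<^sub>M restrict_space borel X)" for n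
    using measurable_compose[OF INm borel_measurable_ln[OF measurable_ident]] by (simp add: case_prod_beta')
  \<comment> \<open>Any single covector over \<open>x\<close> bounds the norm of the inverse
    derivative from below.\<close>
  have b_lower: "- (\<Sum>j<n. H (shifted j \<omega>)) \<le> ln (D_inv_norm (F n \<omega>) x)" if \<omega>: "\<omega> \<in> space S" and x: "x \<in> X" for \<omega> x n
  proof -
    obtain c where c: "c \<in> charts_at M x" using ex_chart by blast
    obtain d :: 'e where "d \<in> sphere 0 1" using sphere_nonempty by blast
    then have "d \<noteq> 0" by auto
    then have z: "covec_point c x d \<in> Z" by (rule covec_point_in[OF c x])
    show ?thesis using covec_growth_lower[OF \<omega> z, of n] covec_growth_le_D_inv_norm[OF F_immersion[OF \<omega>] z, of n] by simp
  qed
  have b_cont: "continuous_on X (\<lambda>x. \<integral>\<omega>. ln (D_inv_norm (F n \<omega>) x) \<partial>S)" for n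
  proof (rule continuous_on_integral_dominated[OF _ _ sum_H_integrable[of n]])
    show "(\<lambda>\<omega>. ln (D_inv_norm (F n \<omega>) x)) \<in> borel_measurable S" if "x \<in> X" for x
      using op_norms_measurable(2)[OF F_measurable[of n] _ F_immersion, of "\<lambda>_. x"] by measurable
    show "continuous_on X (\<lambda>x. ln (D_inv_norm (F n \<omega>) x))" if "\<omega> \<in> space S" for \<omega>
      using op_norms_continuous(2)[OF F_immersion[OF that]] op_norms_pos(2)[OF F_immersion[OF that]]
      by (intro continuous_on_ln) (auto intro: continuous_on_subset simp: less_le)
    show "\<bar>ln (D_inv_norm (F n \<omega>) x)\<bar> \<le> (\<Sum>j<n. H (shifted j \<omega>))" if "\<omega> \<in> space S" "x \<in> X" for \<omega> x
      using b_lower[OF that, of n] D_inv_norm_upper[OF that, of n] by (simp add: abs_le_iff)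
  qed
  \<comment> \<open>Membership in \<open>bundle_continuous X\<close> depends only on the values on
    \<open>Z\<close>; this absorbs the default value 0 in the potential.\<close>
  have C_congr: "v \<in> bundle_continuous X" if "u \<in> bundle_continuous X" "\<And>z. z \<in> Z \<Longrightarrow> u z = v z" for u v
  proof (rule bundle_continuous_I)
    fix c assume c: "c \<in> atlas M"
    show "continuous_on (snd c ` (fst c \<inter> X) \<times> (- {0 :: 'e})) (\<lambda>z. v (covec_point c (chart_inv c (fst z)) (snd z)))"
    proof (rule continuous_on_eq[OF bundle_continuous_D[OF that(1) c]])
      fix z assume "z \<in> snd c ` (fst c \<inter> X) \<times> (- {0 :: 'e})"
      then have "fst z \<in> snd c ` (fst c \<inter> X)" "snd z \<noteq> 0" by auto
      then show "u (covec_point c (chart_inv c (fst z)) (snd z)) = v (covec_point c (chart_inv c (fst z)) (snd z))"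
        using chart_point[OF c] by (intro that(2) covec_point_in)
    qed
  qed
  have C_bounded: "\<exists>B. \<forall>z\<in>Z. \<bar>u z\<bar> \<le> B" if u: "u \<in> bundle_continuous X" for u
  proof -
    have "bounded ((\<lambda>y. u (q y)) ` Y)" by (rule compact_imp_bounded[OF compact_continuous_image[OF C_q[OF u] Y]])
    then obtain B where "\<And>y. y \<in> Y \<Longrightarrow> \<bar>u (q y)\<bar> \<le> B" by (auto simp: bounded_iff)
    then have "\<forall>z\<in>q ` Y. \<bar>u z\<bar> \<le> B" by blast
    then show ?thesis using Yq unfolding q_def by blast
  qed
  have lm: "(\<lambda>\<omega>. u (lift (f \<omega>) z)) \<in> borel_measurable S" if u: "u \<in> bundle_continuous X" and z: "z \<in> Z" for u z
  proof -
    obtain y where y: "y \<in> Y" "z = q y" using z Yq unfolding q_def by blast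
    have "(\<lambda>\<omega>. case (\<omega>, y) of (\<omega>, y) \<Rightarrow> u (lift (f \<omega>) (q y))) \<in> borel_measurable S"
      by (rule measurable_compose[OF measurable_Pair2' C_joint[OF u]]) (simp add: y space_restrict_space)
    then show ?thesis by (simp add: y)
  qed
  have transfer: "(\<lambda>z. \<integral>\<omega>. u (lift (f \<omega>) z) \<partial>S) \<in> bundle_continuous X" if u: "u \<in> bundle_continuous X" for u
  proof -
    obtain B where B: "\<forall>z\<in>Z. \<bar>u z\<bar> \<le> B" using C_bounded[OF u] by blast
    show ?thesis
    proof (rule bundle_continuous_integral[where H="\<lambda>_. B"])
      show "(\<lambda>\<omega>. u (lift (f \<omega>) z)) \<in> borel_measurable S" if "z \<in> Z" for z by (rule lm[OF u that])
      show "(\<lambda>z. u (lift (f \<omega>) z)) \<in> bundle_continuous X" if "\<omega> \<in> space S" for \<omega> by (rule bundle_continuous_lift[OF u f_immersion[OF that] f_X[OF that]])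
      show "\<bar>u (lift (f \<omega>) z)\<bar> \<le> B" if "\<omega> \<in> space S" "z \<in> Z" for \<omega> z
        using B lift_in[OF f_immersion[OF that(1)] f_X[OF that(1)] that(2)] by blast
    qed simp
  qed
  have F1: "F 1 \<omega> = f \<omega>" for \<omega> by simp
  have pot: "(\<lambda>z. \<integral>\<omega>. (if z \<in> Z then covec_growth (F 1 \<omega>) z else 0) \<partial>S) \<in> bundle_continuous X"
  proof (rule C_congr)
    show "(\<lambda>z. \<integral>\<omega>. covec_growth (F 1 \<omega>) z \<partial>S) \<in> bundle_continuous X"
      by (rule bundle_continuous_integral[OF KKm covec_growth_bundle_continuous[OF F_immersion] H_integrable]) (use covec_growth_bound in \<open>simp_all add: F1\<close>)
  qed simp
  show ?thesis
  proof (rule that[of Y q], unfold_locales)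
    show "sets (restrict_space borel X) = sigma_sets X (positivity_sets X {g. continuous_on X g})"
      by (rule sets_restrict_borel_positivity[OF X_compact])
    show "sets MZ = sigma_sets (space MZ) (positivity_sets (space MZ) (bundle_continuous X))"
      unfolding space_proj_cotangent_borel by (rule sets_proj_cotangent_borel[OF X_compact])
    show "q ` Y = space MZ" unfolding space_proj_cotangent_borel q_def by (rule Yq)
    show "\<exists>z\<in>space MZ. fst z = x" if "x \<in> X" for x
    proof -
      obtain c where c: "c \<in> charts_at M x" using ex_chart by blast
      obtain d :: 'e where "d \<in> sphere 0 1" using sphere_nonempty by blast
      then have "d \<noteq> 0" by auto
      then have z: "covec_point c x d \<in> Z" by (rule covec_point_in[OF c that])
      then show ?thesis unfolding space_proj_cotangent_borel by (intro bexI[of _ "covec_point c x d"]) simp_all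
    qed
    show "fst z \<in> X" if "z \<in> space MZ" for z
      using that fst_proj_cotangent unfolding space_proj_cotangent_borel by blast
    show "lift (f \<omega>) z \<in> space MZ" if "\<omega> \<in> space S" "z \<in> space MZ" for \<omega> z
      using that lift_in[OF f_immersion f_X] unfolding space_proj_cotangent_borel by blast
    show "fst (lift (f \<omega>) z) = f \<omega> (fst z)" for \<omega> z by (rule fst_lift)
    show "lift (f \<omega>) = lift (f \<omega>')" if "\<omega> \<in> space S" "\<omega>' \<in> space S" "\<omega> 0 = \<omega>' 0" for \<omega> \<omega>'
      using f_dep0[OF that] by simp
    show "function_lattice (bundle_continuous X)" by (rule bundle_continuous_lattice)
    show "(\<lambda>z. g (fst z)) \<in> bundle_continuous X" if "continuous_on X g" for g by (rule bundle_continuous_base[OF that])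
    show "(\<lambda>z. u (lift (f \<omega>) z)) \<in> bundle_continuous X" if "u \<in> bundle_continuous X" "\<omega> \<in> space S" for u \<omega>
      by (rule bundle_continuous_lift[OF that(1) f_immersion[OF that(2)] f_X[OF that(2)]])
    show "(if z \<in> Z then covec_growth (F 0 \<omega>) z else 0) = 0" for \<omega> z by (simp add: covec_growth_id)
    show "(if z \<in> Z then covec_growth (F (Suc n) \<omega>) z else 0) = (if z \<in> Z then covec_growth (F 1 \<omega>) z else 0) +
        (if lift (f \<omega>) z \<in> Z then covec_growth (F n (shifted 1 \<omega>)) (lift (f \<omega>) z) else 0)"
      if \<omega>: "\<omega> \<in> space S" and z: "z \<in> space MZ" for n \<omega> z
    proof -
      have z: "z \<in> Z" using z by (simp add: space_proj_cotangent_borel)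
      show ?thesis using covec_growth_Suc[OF \<omega> z, of n] lift_in[OF f_immersion[OF \<omega>] f_X[OF \<omega>] z] z by (simp only: F1 if_True)
    qed
    show "(\<lambda>\<omega>. if z \<in> Z then covec_growth (F n \<omega>) z else 0) \<in> borel_measurable S" for n z
      using KKm by (cases "z \<in> Z") simp_all
    show "\<bar>if z \<in> Z then covec_growth (F 1 \<omega>) z else 0\<bar> \<le> H \<omega>" if "\<omega> \<in> space S" "z \<in> space MZ" for \<omega> z
      using covec_growth_bound[OF that(1)] that(2) by (simp only: F1 space_proj_cotangent_borel if_True)
    show "(if z \<in> Z then covec_growth (F n \<omega>) z else 0) \<le> ln (D_inv_norm (F n \<omega>) (fst z))" if "\<omega> \<in> space S" "z \<in> space MZ" for n \<omega> z
      using covec_growth_le_D_inv_norm[OF F_immersion[OF that(1)]] that(2) by (simp add: space_proj_cotangent_borel)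
    show "ln (D_inv_norm (F (m + n) \<omega>) x) \<le> ln (D_inv_norm (F m \<omega>) x) + ln (D_inv_norm (F n (shifted m \<omega>)) (F m \<omega> x))"
      if "\<omega> \<in> space S" for m n \<omega> x by (rule D_inv_norm_add[OF that])
  qed (use fRX f_dep0 X_compact transfer Y C_q C_joint H_integrable pot bm D_inv_norm_upper b_cont in blast)+
qed

end

section \<open>From almost every to every noise sequence\<close>

lemma integral_completion_AE:
  fixes g g' :: "'a \<Rightarrow> real"
  assumes g': "g' \<in> borel_measurable M" and ae: "AE x in M. g x = g' x"
  shows "(\<integral>x. g x \<partial>completion M) = (\<integral>x. g' x \<partial>M)"
proof -
  have m: "g' \<in> borel_measurable (completion M)" by (rule measurable_completion[OF g'])
  have ae': "AE x in completion M. g' x = g x" by (rule AE_completion) (use ae in auto)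
  \<comment> \<open>\<open>g\<close> may be non-measurable because of its values on a null set; in
    the completion, a function almost everywhere equal to a measurable one is measurable.\<close>
  have "g \<in> borel_measurable (completion M)"
  proof (rule measurableI)
    fix A :: "real set" assume "A \<in> sets borel"
    then have A: "g' -` A \<inter> space (completion M) \<in> sets (completion M)" by (rule measurable_sets[OF m])
    show "g -` A \<inter> space (completion M) \<in> sets (completion M)"
      by (rule completion.in_sets_AE[OF _ A]) (use ae' in \<open>eventually_elim, auto\<close>)
  qed simp
  then have "(\<integral>x. g x \<partial>completion M) = (\<integral>x. g' x \<partial>completion M)"
    using m ae' by (intro integral_cong_AE) auto
  also have "\<dots> = (\<integral>x. g' x \<partial>M)" by (rule integral_completion[OF g'])
  finally show ?thesis .
qed

lemma stationary_measures_cong: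
  assumes "AE \<omega> in seq_space p. F \<omega> = G \<omega>"
  shows "stationary_measures p F Y = stationary_measures p G Y"
proof -
  have "(\<integral>\<^sup>+ \<omega>. emeasure \<mu> (F \<omega> -` B \<inter> space Y) \<partial>seq_space p) =
      (\<integral>\<^sup>+ \<omega>. emeasure \<mu> (G \<omega> -` B \<inter> space Y) \<partial>seq_space p)" for \<mu> B
    by (rule nn_integral_cong_AE) (use assms in eventually_elim, simp)
  then show ?thesis unfolding stationary_measures_def by simp
qed

lemma topcontinuous_at_cong:
  assumes "topcontinuous_at X Y f x" "\<And>y. y \<in> topspace X \<Longrightarrow> f y = g y"
  shows "topcontinuous_at X Y g x"
  unfolding topcontinuous_at_def
proof (intro conjI allI impI)
  show x: "x \<in> topspace X" using assms(1) by (simp add: topcontinuous_at_def)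
  have "f \<in> topspace X \<rightarrow> topspace Y" using assms(1) by (simp add: topcontinuous_at_def)
  then show "g \<in> topspace X \<rightarrow> topspace Y" using assms(2) by (auto simp: Pi_iff)
  fix V assume "openin Y V \<and> g x \<in> V"
  then have "openin Y V \<and> f x \<in> V" using assms(2)[OF x] by simp
  then obtain U where U: "openin X U" "x \<in> U" "\<forall>y\<in>U. f y \<in> V"
    using assms(1) unfolding topcontinuous_at_def by blast
  have "\<forall>y\<in>U. g y \<in> V"
  proof
    fix y assume y: "y \<in> U"
    then have "y \<in> topspace X" using openin_subset[OF U(1)] by blast
    then show "g y \<in> V" using U(3) y assms(2)[of y] by auto
  qed
  then show "\<exists>U. openin X U \<and> x \<in> U \<and> (\<forall>y\<in>U. g y \<in> V)" using U by blast
qed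

context iid_noise
begin

lemma AE_coordinates:
  assumes "AE t in p. Q t"
  shows "AE \<omega> in S. \<forall>i. Q (\<omega> i)"
proof -
  have "AE \<omega> in S. Q (\<omega> i)" for i
    by (rule AE_distrD[OF coordinate_measurable[of i]]) (unfold distr_coordinate, rule assms)
  then show ?thesis by (simp add: AE_all_countable)
qed

text \<open>By \<open>distr_cons\<close> and Fubini, for almost every letter some sequence beginning
  with it satisfies \<open>P\<close>; as \<open>P\<close> depends on the first letter only, all such
  sequences do. The outcome is an exceptional set of letters, not merely of sequences, so that it
  can be avoided at all times simultaneously.\<close>

lemma AE_first_coordinate:
  assumes ae: "AE \<omega> in S. P \<omega>"
    and dep: "\<And>\<omega> \<omega>'. \<omega> \<in> space S \<Longrightarrow> \<omega>' \<in> space S \<Longrightarrow> \<omega> 0 = \<omega>' 0 \<Longrightarrow> P \<omega> \<Longrightarrow> P \<omega>'"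
  shows "\<exists>T0\<in>sets p. (AE t in p. t \<in> T0) \<and> (\<forall>\<omega>\<in>space S. \<omega> 0 \<in> T0 \<longrightarrow> P \<omega>)"
proof -
  interpret P: pair_sigma_finite p S ..
  have "AE x in distr (p \<Otimes>\<^sub>M S) S (\<lambda>(t, \<omega>). case_nat t \<omega>). P x" unfolding distr_cons by (rule ae)
  then have "AE x in p \<Otimes>\<^sub>M S. P (case x of (t, \<omega>) \<Rightarrow> case_nat t \<omega>)" by (rule AE_distrD[OF cons_measurable])
  then have "AE t in p. AE \<omega> in S. P (case_nat t \<omega>)" using P.AE_pair by fastforce
  then obtain A where A: "A \<in> null_sets p" "{t \<in> space p. \<not> (AE \<omega> in S. P (case_nat t \<omega>))} \<subseteq> A"
    unfolding eventually_ae_filter by blast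
  have "P \<omega>" if \<omega>: "\<omega> \<in> space S" "\<omega> 0 \<in> space p - A" for \<omega>
  proof -
    have "AE \<eta> in S. P (case_nat (\<omega> 0) \<eta>)" using \<omega>(2) A(2) by blast
    then have "\<exists>\<eta>\<in>space S. P (case_nat (\<omega> 0) \<eta>)"
    proof (rule contrapos_pp)
      assume "\<not> (\<exists>\<eta>\<in>space S. P (case_nat (\<omega> 0) \<eta>))"
      then have no: "AE \<eta> in S. \<not> P (case_nat (\<omega> 0) \<eta>)" by (intro AE_I2) blast
      show "\<not> (AE \<eta> in S. P (case_nat (\<omega> 0) \<eta>))"
      proof
        assume "AE \<eta> in S. P (case_nat (\<omega> 0) \<eta>)"
        with no have "AE \<eta> in S. False" by eventually_elim simp
        then show False by (simp only: S.AE_False)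
      qed
    qed
    then obtain \<eta> where \<eta>: "\<eta> \<in> space S" "P (case_nat (\<omega> 0) \<eta>)" by blast
    show ?thesis
      by (rule dep[OF cons_in_space \<omega>(1) _ \<eta>(2)]) (use \<omega> \<eta> in auto)
  qed
  moreover have "AE t in p. t \<in> space p - A" using AE_not_in[OF A(1)] AE_space by eventually_elim auto
  moreover have "space p - A \<in> sets p" using A(1) by auto
  ultimately show ?thesis by blast
qed

end

text \<open>Here \<open>g\<close> is the original random map and \<open>f\<close> its modification.
  Stationary measures, their lifts, the potential and the exponent are given by integrals over the
  noise and so agree for both maps; for the exponent this requires the almost sure equality of all
  iterates.\<close>

lemma (in random_immersion) lyap_min_continuous_at:
  assumes ae: "\<And>n. AE \<omega> in S. random_iterate g n \<omega> = F n \<omega>"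
    and \<mu>: "\<mu> \<in> stationary_on p g X" and coq: "coquasi_irreducible_measure M p g X \<mu>"
  shows "topcontinuous_at (weak_star X (stationary_on p g X)) euclideanreal (lyap_min M p g) \<mu>"
proof -
  obtain Y :: "(real \<times> 'e \<times> 'e) set" and q where
    rc: "random_cocycle p f X MZ (bundle_continuous X) fst (\<lambda>\<omega>. lift (f \<omega>)) Y q
      (\<lambda>n \<omega> z. if z \<in> Z then covec_growth (F n \<omega>) z else 0) (\<lambda>n \<omega> x. ln (D_inv_norm (F n \<omega>) x)) H"
    by (rule ex_random_cocycle)
  interpret R: random_cocycle p f X MZ "bundle_continuous X" fst "\<lambda>\<omega>. lift (f \<omega>)" Y q
    "\<lambda>n \<omega> z. if z \<in> Z then covec_growth (F n \<omega>) z else 0" "\<lambda>n \<omega> x. ln (D_inv_norm (F n \<omega>) x)" H by (rule rc)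
  have gf: "AE \<omega> in S. g \<omega> = f \<omega>" using ae[of 1] by simp
  have stat: "stationary_on p g X = stationary_on p f X"
    unfolding stationary_on_def by (rule stationary_measures_cong[OF gf])
  have "AE \<omega> in S. proj_map M g \<omega> = lift (f \<omega>)"
    using gf by eventually_elim (simp add: proj_map_def lift_def)
  then have lstat: "stationary_measures p (proj_map M g) MZ = stationary_measures p (\<lambda>\<omega>. lift (f \<omega>)) MZ"
    by (rule stationary_measures_cong)
  have exp_eq: "R.exponent \<nu> = lyap_min M p g \<nu>" if \<nu>: "\<nu> \<in> stationary_on p f X" for \<nu>
  proof -
    have "sets \<nu> = sets (restrict_space borel X)" using \<nu> by (simp add: stationary_on_def stationary_measures_def)
    then have sp: "space \<nu> = X" using sets_eq_imp_space_eq[of \<nu> "restrict_space borel X"] by (simp add: space_restrict_space)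
    have "(\<integral>\<omega>. ln (D_conorm M (random_iterate g n \<omega>) x) \<partial>completion S) = - R.\<beta> n x" if x: "x \<in> X" for n x
    proof -
      have "(\<integral>\<omega>. ln (D_conorm M (random_iterate g n \<omega>) x) \<partial>completion S) = (\<integral>\<omega>. - ln (D_inv_norm (F n \<omega>) x) \<partial>S)"
      proof (rule integral_completion_AE)
        show "(\<lambda>\<omega>. - ln (D_inv_norm (F n \<omega>) x)) \<in> borel_measurable S"
          using R.b_integrable[OF x, of n] by (intro borel_measurable_uminus borel_measurable_integrable)
        show "AE \<omega> in S. ln (D_conorm M (random_iterate g n \<omega>) x) = - ln (D_inv_norm (F n \<omega>) x)"
          using ae[of n] AE_space
        proof eventually_elim
          case (elim \<omega>)
          show ?case unfolding elim(1) D_conorm_def by (rule ln_inverse)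
        qed
      qed
      then show ?thesis by (simp add: R.\<beta>_def)
    qed
    then have "(\<integral>x. (\<integral>\<omega>. ln (D_conorm M (random_iterate g n \<omega>) x) \<partial>completion S) \<partial>\<nu>) = (\<integral>x. - R.\<beta> n x \<partial>\<nu>)" for n
      by (intro Bochner_Integration.integral_cong) (simp_all add: sp)
    then show ?thesis unfolding R.exponent_def lyap_min_def by (simp only:)
  qed
  have pot: "proj_potential M p g z = R.\<phi> z" if z: "z \<in> Z" for z
  proof -
    have "proj_potential M p g z = (\<integral>\<omega>. covec_growth (g \<omega>) z \<partial>completion S)"
      by (simp add: proj_potential_def covec_growth_def case_prod_beta Let_def)
    also have "\<dots> = (\<integral>\<omega>. (if z \<in> Z then covec_growth (F 1 \<omega>) z else 0) \<partial>S)"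
    proof (rule integral_completion_AE)
      show "(\<lambda>\<omega>. if z \<in> Z then covec_growth (F 1 \<omega>) z else 0) \<in> borel_measurable S"
        by (rule R.s_meas) (simp add: space_proj_cotangent_borel z)
      show "AE \<omega> in S. covec_growth (g \<omega>) z = (if z \<in> Z then covec_growth (F 1 \<omega>) z else 0)"
        using gf by eventually_elim (simp add: z)
    qed
    also have "\<dots> = R.\<phi> z" by (simp only: R.\<phi>_def)
    finally show ?thesis .
  qed
  have "topcontinuous_at (weak_star X (stationary_on p f X)) euclideanreal R.exponent \<mu>"
  proof (rule R.exponent_continuous_at)
    show \<mu>f: "\<mu> \<in> stationary_on p f X" using \<mu> by (simp only: stat)
    fix \<nu> assume \<nu>: "\<nu> \<in> stationary_measures p (\<lambda>\<omega>. lift (f \<omega>)) MZ" "distr \<nu> (restrict_space borel X) fst = \<mu>"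
    then have "\<nu> \<in> proj_stationary M p g X \<mu>" by (simp add: proj_stationary_def lstat)
    then have "(\<integral>z. proj_potential M p g z \<partial>\<nu>) = - lyap_min M p g \<mu>"
      using coq by (simp add: coquasi_irreducible_measure_def)
    moreover have "space \<nu> = Z"
      using \<nu>(1) sets_eq_imp_space_eq[of \<nu> MZ] by (simp add: stationary_measures_def space_proj_cotangent_borel)
    then have "(\<integral>z. proj_potential M p g z \<partial>\<nu>) = (\<integral>z. R.\<phi> z \<partial>\<nu>)"
      by (intro Bochner_Integration.integral_cong) (simp_all add: pot)
    ultimately show "(\<integral>z. R.\<phi> z \<partial>\<nu>) = - R.exponent \<mu>" using exp_eq[OF \<mu>f] by simp
  qed
  then show ?thesis
    unfolding stat by (rule topcontinuous_at_cong) (simp add: topspace_weak_star exp_eq)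
qed

lemma lyap_min_continuous_at_coquasi_irreducible:
  fixes M :: "('a::{t2_space, second_countable_topology}, 'e::euclidean_space) riemannian"
    and p :: "'t measure"
    and f :: "(nat \<Rightarrow> 't) \<Rightarrow> 'a \<Rightarrow> 'a"
  assumes M: "riemannian_manifold M" and p: "prob_space p" and f: "C1_random_map M p f" and X: "compact X"
    and inv: "AE \<omega> in seq_space p. f \<omega> ` X \<subseteq> X"
    and log: "(\<integral>\<^sup>+ \<omega>. ennreal (log_plus (D_sup M X (f \<omega>)) + log_plus (D_inv_sup M X (f \<omega>)))
            \<partial>seq_space p) < \<infinity>"
    and \<mu>: "\<mu> \<in> stationary_on p f X" and coq: "coquasi_irreducible_measure M p f X \<mu>"
  shows "topcontinuous_at (weak_star X (stationary_on p f X)) euclideanreal (lyap_min M p f) \<mu>"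
proof -
  interpret riem M by unfold_locales (rule M)
  interpret iid_noise p by (rule iid_noise.intro[OF p])
  have f_meas: "(\<lambda>(\<omega>, x). f \<omega> x) \<in> measurable (S \<Otimes>\<^sub>M borel) borel"
    and f_dep: "\<And>\<omega> \<omega>'. \<omega> \<in> space S \<Longrightarrow> \<omega>' \<in> space S \<Longrightarrow> \<omega> 0 = \<omega>' 0 \<Longrightarrow> f \<omega> = f \<omega>'"
    and f_diff: "AE \<omega> in S. C1_local_diffeo M (f \<omega>)"
    using f unfolding C1_random_map_def by blast+
  have "AE \<omega> in S. C1_local_diffeo M (f \<omega>) \<and> f \<omega> ` X \<subseteq> X" using f_diff inv by eventually_elim auto
  then have "\<exists>T0\<in>sets p. (AE t in p. t \<in> T0) \<and> (\<forall>\<omega>\<in>space S. \<omega> 0 \<in> T0 \<longrightarrow> C1_local_diffeo M (f \<omega>) \<and> f \<omega> ` X \<subseteq> X)"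
    by (rule AE_first_coordinate) (metis f_dep)
  then obtain T0 where T0: "T0 \<in> sets p" "AE t in p. t \<in> T0"
    "\<forall>\<omega>\<in>space S. \<omega> 0 \<in> T0 \<longrightarrow> C1_local_diffeo M (f \<omega>) \<and> f \<omega> ` X \<subseteq> X" by blast
  \<comment> \<open>The identity is an immersion preserving \<open>X\<close>, hence a suitable value
    at exceptional letters. The dependence on the first letter alone is kept, and almost surely no
    exceptional letter ever occurs, so that all iterates agree.\<close>
  define g where "g = (\<lambda>\<omega>. if \<omega> 0 \<in> T0 then f \<omega> else id)"
  have T0_ae: "AE \<omega> in S. \<forall>i. \<omega> i \<in> T0" by (rule AE_coordinates[OF T0(2)])
  have iter: "AE \<omega> in S. random_iterate f n \<omega> = random_iterate g n \<omega>" for n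
    using T0_ae
  proof eventually_elim
    case (elim \<omega>)
    have "random_iterate f n \<omega> = random_iterate g n \<omega>"
      by (induction n) (simp_all add: g_def elim)
    then show ?case .
  qed
  have gf: "AE \<omega> in S. f \<omega> = g \<omega>" using iter[of 1] by simp
  have g_meas: "(\<lambda>(\<omega>, x). g \<omega> x) \<in> measurable (S \<Otimes>\<^sub>M borel) borel"
  proof -
    have "(\<lambda>z. fst z 0) \<in> measurable (S \<Otimes>\<^sub>M borel) p"
      by (rule measurable_compose[OF measurable_fst coordinate_measurable])
    then have "(\<lambda>z. fst z 0) -` T0 \<inter> space (S \<Otimes>\<^sub>M borel) \<in> sets (S \<Otimes>\<^sub>M (borel :: 'a measure))"
      using T0(1) by (rule measurable_sets)
    then have "{z \<in> space (S \<Otimes>\<^sub>M borel). fst z 0 \<in> T0} \<in> sets (S \<Otimes>\<^sub>M (borel :: 'a measure))"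
      by (simp add: vimage_def Collect_conj_eq Int_commute)
    then have "(\<lambda>z. if fst z 0 \<in> T0 then (\<lambda>(\<omega>, x). f \<omega> x) z else snd z) \<in> measurable (S \<Otimes>\<^sub>M borel) borel"
      by (intro measurable_If f_meas measurable_snd)
    then show ?thesis
      by (rule measurable_cong[THEN iffD1, rotated]) (auto simp: g_def)
  qed
  \<comment> \<open>The stationary measure at hand is a probability measure on \<open>X\<close>,
    which rules out the empty set; the suprema over \<open>X\<close> rely on this.\<close>
  have X_ne: "X \<noteq> {}"
  proof
    assume "X = {}"
    moreover have "prob_space \<mu>" "sets \<mu> = sets (restrict_space borel X)"
      using \<mu> by (simp_all add: stationary_on_def stationary_measures_def)
    ultimately show False
      using prob_space.not_empty[of \<mu>] sets_eq_imp_space_eq[of \<mu> "restrict_space borel X"]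
      by (simp add: space_restrict_space)
  qed
  interpret G: random_immersion M p g X
  proof unfold_locales
    show "(\<lambda>(\<omega>, x). g \<omega> x) \<in> measurable (S \<Otimes>\<^sub>M borel) borel" by (rule g_meas)
    show "g \<omega> = g \<omega>'" if "\<omega> \<in> space S" "\<omega>' \<in> space S" "\<omega> 0 = \<omega>' 0" for \<omega> \<omega>'
      using f_dep[OF that] that(3) by (simp add: g_def)
    show "immersion (g \<omega>)" if "\<omega> \<in> space S" for \<omega>
      using T0(3) that immersion_local_diffeo immersion_id by (auto simp only: g_def split: if_splits)
    show "g \<omega> ` X \<subseteq> X" if "\<omega> \<in> space S" for \<omega>
      using T0(3) that by (cases "\<omega> 0 \<in> T0") (auto simp: g_def)
    show "(\<integral>\<^sup>+ \<omega>. ennreal (log_plus (D_sup M X (g \<omega>)) + log_plus (D_inv_sup M X (g \<omega>))) \<partial>S) < \<infinity>"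
    proof -
      have "(\<integral>\<^sup>+ \<omega>. ennreal (log_plus (D_sup M X (g \<omega>)) + log_plus (D_inv_sup M X (g \<omega>))) \<partial>S) =
          (\<integral>\<^sup>+ \<omega>. ennreal (log_plus (D_sup M X (f \<omega>)) + log_plus (D_inv_sup M X (f \<omega>))) \<partial>S)"
        by (rule nn_integral_cong_AE) (use gf in eventually_elim, simp)
      then show ?thesis using log by simp
    qed
  qed (use X X_ne in auto)
  show ?thesis by (rule G.lyap_min_continuous_at[OF iter \<mu> coq])
qed

theorem theorem4:
  fixes M :: "('a::{t2_space, second_countable_topology}, 'e::euclidean_space) riemannian"
    and p :: "'t measure"
    and f :: "(nat \<Rightarrow> 't) \<Rightarrow> 'a \<Rightarrow> 'a"
    and X :: "'a set"
  assumes "riemannian_manifold M"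
    and "prob_space p"
    and "C1_random_map M p f"
    and "compact X"
    and "AE \<omega> in seq_space p. f \<omega> ` X \<subseteq> X"
    and "(\<integral>\<^sup>+ \<omega>. ennreal (log_plus (D_sup M X (f \<omega>)) + log_plus (D_inv_sup M X (f \<omega>)))
            \<partial>seq_space p) < \<infinity>"
  shows "(\<forall>\<mu>\<^sub>0 \<in> stationary_on p f X. coquasi_irreducible_measure M p f X \<mu>\<^sub>0 \<longrightarrow>
            topcontinuous_at (weak_star X (stationary_on p f X)) euclideanreal (lyap_min M p f) \<mu>\<^sub>0) \<and>
         (coquasi_irreducible_map M p f X \<longrightarrow>
            continuous_map (weak_star X (stationary_on p f X)) euclideanreal (lyap_min M p f))"
  using lyap_min_continuous_at_coquasi_irreducible[OF assms]
  by (auto simp: continuous_map_eq_topcontinuous_at topspace_weak_star coquasi_irreducible_map_def)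

end
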